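(* Let $n\in\mathbb N$, $n\ge1$, let $s\in(0,n)\setminus\mathbb N$, and let $A$ be a Young function such that $$\int_0\left(\frac{t}{A(t)}\right)^{\frac{s}{n-s}}dt<\infty .$$ Then the following statements are equivalent: (i) $\displaystyle\int^\infty\left(\frac{t}{A(t)}\right)^{\frac{s}{n-s}}dt<\infty$; (ii) the continuous embedding $V^{s,A}_d(\mathbb R^n)\to L^\infty(\mathbb R^n)$ holds; (iii) the continuous embedding $V^{s,A}_d(\mathbb R^n)\to C^0(\mathbb R^n)$ holds. Moreover, if the condition in (i) is in force, then there exists a constant $c$ such that $$\|u\|_{L^\infty(\mathbb R^n)}\le c\left(\int_{\mathbb R^n}\int_{\mathbb R^n}A\left(\frac{|\nabla^{[s]}u(x)-\nabla^{[s]}u(y)|}{|x-y|^{\{s\}}}\right)\frac{dx\,dy}{|x-y|^n}\right)^{\frac sn}$$ for every $u\in V^{s,A}_d(\mathbb R^n)$.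
   Context: A Young function is a function $A:[0,\infty)\to[0,\infty]$ which is convex, non-constant, left-continuous, with $A(0)=0$. The notation $\int_0(\cdots)dt<\infty$ means finiteness of the integral over $(0,\delta)$ for some $\delta>0$; $\int^\infty(\cdots)dt<\infty$ means finiteness over $(T,\infty)$ for some $T>0$. Conventions: $t/A(t)=\infty$ if $A(t)=0$, $t>0$, and $t/A(t)=0$ if $A(t)=\infty$. $\mathcal M(\mathbb R^n)$ is the set of measurable functions $u:\mathbb R^n\to\mathbb R$ (identified a.e.); $|E|$ is the Lebesgue measure of $E$. For $\sigma\in(0,1)$ and $v$ measurable on $\mathbb R^n$ (scalar or vector-valued; $|\cdot|$ is the Euclidean norm), $$J_{\sigma,A}(v)=\int_{\mathbb R^n}\int_{\mathbb R^n}A\left(\frac{|v(x)-v(y)|}{|x-y|^{\sigma}}\right)\frac{dx\,dy}{|x-y|^n},\qquad |v|_{\sigma,A,\mathbb R^n}=\inf\{\lambda>0: J_{\sigma,A}(v/\lambda)\le 1\}.$$ For $s\in(0,\infty)\setminus\mathbb N$, $[s]$ is the integer part, $\{s\}=s-[s]$, and $\nabla^k u$ is the vector of all weak derivatives of order $k$ of $u$ ($\nabla^0u=u$). Then $V^{s,A}_d(\mathbb R^n)$ is the space of all $u\in\mathcal M(\mathbb R^n)$ that are $[s]$-times weakly differentiable, with $|\nabla^{[s]}u|_{\{s\},A,\mathbb R^n}<\infty$ and $|\{|\nabla^ku|>t\}|<\infty$ for every $t>0$ and $k=0,1,\dots,[s]$. It is normed by $|\nabla^{[s]}u|_{\{s\},A,\mathbb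 R^n}$. $C^0(\mathbb R^n)$ is the Banach space of (bounded) continuous functions on $\mathbb R^n$ with the supremum norm; membership of $u\in V^{s,A}_d(\mathbb R^n)$ in $C^0(\mathbb R^n)$ means that $u$ agrees a.e. with a continuous function. For $Z=L^\infty(\mathbb R^n)$ or $Z=C^0(\mathbb R^n)$, the continuous embedding $V^{s,A}_d(\mathbb R^n)\to Z$ means that every $u\in V^{s,A}_d(\mathbb R^n)$ belongs to $Z$ and there is a constant $c$ with $\|u\|_Z\le c\,|\nabla^{[s]}u|_{\{s\},A,\mathbb R^n}$ for all such $u$. *)

theory Defs
  imports "HOL-Analysis.Analysis" "HOL-Probability.Essential_Supremum"
begin

section \<open>Young functions\<close>

text \<open>Only the values of \<open>A\<close> on \<open>[0,\<infinity>)\<close> matter.\<close>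

definition young_function :: "(real \<Rightarrow> ennreal) \<Rightarrow> bool" where
  "young_function A \<longleftrightarrow>
     A 0 = 0 \<and>
     (\<exists>t\<ge>0. A t \<noteq> A 0) \<and>
     (\<forall>x\<ge>0. \<forall>y\<ge>0. \<forall>\<theta>\<in>{0..1}.
        A ((1 - \<theta>) * x + \<theta> * y) \<le> ennreal (1 - \<theta>) * A x + ennreal \<theta> * A y) \<and>
     (\<forall>t>0. (A \<longlongrightarrow> A t) (at_left t))"

text \<open>Real powers in \<open>[0,\<infinity>]\<close>, used for exponents \<open>p > 0\<close> only.\<close>

definition epowr :: "ennreal \<Rightarrow> real \<Rightarrow> ennreal" where
  "epowr x p = (if x = \<infinity> then \<infinity> else ennreal (enn2real x powr p))"

text \<open>For \<open>t > 0\<close>, division in \<open>ennreal\<close> gives \<open>t / A t = \<infinity>\<close> if \<open>A t = 0\<close> and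
  \<open>t / A t = 0\<close> if \<open>A t = \<infinity>\<close>, which are the intended conventions.\<close>

definition finite_near_0 :: "(real \<Rightarrow> ennreal) \<Rightarrow> real \<Rightarrow> bool" where
  "finite_near_0 A p \<longleftrightarrow>
     (\<exists>\<delta>>0. (\<integral>\<^sup>+t\<in>{0<..<\<delta>}. epowr (ennreal t / A t) p \<partial>lborel) < \<infinity>)"

definition finite_near_infinity :: "(real \<Rightarrow> ennreal) \<Rightarrow> real \<Rightarrow> bool" where
  "finite_near_infinity A p \<longleftrightarrow>
     (\<exists>T>0. (\<integral>\<^sup>+t\<in>{T<..}. epowr (ennreal t / A t) p \<partial>lborel) < \<infinity>)"


section \<open>Weak derivatives\<close>

text \<open>A multi-index is a function \<open>\<alpha> :: 'n \<Rightarrow> nat\<close>.\<close>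

definition multi_indices :: "nat \<Rightarrow> ('n::finite \<Rightarrow> nat) set" where
  "multi_indices k = {\<alpha>. (\<Sum>i\<in>UNIV. \<alpha> i) = k}"

definition partial :: "'n \<Rightarrow> (real^'n \<Rightarrow> real) \<Rightarrow> real^'n \<Rightarrow> real" where
  "partial i \<phi> x = frechet_derivative \<phi> (at x) (axis i 1)"

text \<open>The partial derivatives are taken in some order compatible with \<open>\<alpha>\<close>; for smooth
  functions, the only ones to which this is applied, the order is irrelevant.\<close>

definition mderiv :: "('n \<Rightarrow> nat) \<Rightarrow> (real^'n \<Rightarrow> real) \<Rightarrow> real^'n \<Rightarrow> real" where
  "mderiv \<alpha> \<phi> = foldr partial (SOME is. \<forall>i. count_list is i = \<alpha> i) \<phi>"

primrec C_k :: "nat \<Rightarrow> (real^'n \<Rightarrow> real) \<Rightarrow> bool" where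
  "C_k 0 \<phi> \<longleftrightarrow> continuous_on UNIV \<phi>"
| "C_k (Suc k) \<phi> \<longleftrightarrow> \<phi> differentiable_on UNIV \<and> (\<forall>i. C_k k (partial i \<phi>))"

definition test_function :: "(real^'n \<Rightarrow> real) \<Rightarrow> bool" where
  "test_function \<phi> \<longleftrightarrow> (\<forall>k. C_k k \<phi>) \<and> compact (closure {x. \<phi> x \<noteq> 0})"

definition locally_integrable :: "(real^'n \<Rightarrow> real) \<Rightarrow> bool" where
  "locally_integrable f \<longleftrightarrow> (\<forall>K. compact K \<longrightarrow> set_integrable lebesgue K f)"

definition has_weak_deriv ::
    "('n \<Rightarrow> nat) \<Rightarrow> (real^'n \<Rightarrow> real) \<Rightarrow> (real^'n \<Rightarrow> real) \<Rightarrow> bool" where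
  "has_weak_deriv \<alpha> u g \<longleftrightarrow>
     locally_integrable u \<and> locally_integrable g \<and>
     (\<forall>\<phi>. test_function \<phi> \<longrightarrow>
        (LINT x|lebesgue. u x * mderiv \<alpha> \<phi> x)
          = (-1) ^ (\<Sum>i\<in>UNIV. \<alpha> i) * (LINT x|lebesgue. g x * \<phi> x))"

text \<open>Order \<open>0\<close> is excluded: being \<open>0\<close>-times weakly differentiable is no condition, not even
  local integrability.\<close>

definition weakly_differentiable :: "nat \<Rightarrow> (real^'n \<Rightarrow> real) \<Rightarrow> bool" where
  "weakly_differentiable m u \<longleftrightarrow>
     (\<forall>k\<in>{1..m}. \<forall>\<alpha>\<in>multi_indices k. \<exists>g. has_weak_deriv \<alpha> u g)"

text \<open>Weak derivatives are unique up to null sets, so a representative can be chosen.\<close>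

definition weak_deriv :: "('n \<Rightarrow> nat) \<Rightarrow> (real^'n \<Rightarrow> real) \<Rightarrow> real^'n \<Rightarrow> real" where
  "weak_deriv \<alpha> u = (if \<alpha> = (\<lambda>_. 0) then u else (SOME g. has_weak_deriv \<alpha> u g))"

text \<open>The vector \<open>\<nabla>\<^sup>k u (x)\<close> is the family of the \<open>weak_deriv \<alpha> u x\<close> for
  \<open>\<alpha> \<in> multi_indices k\<close>. As its length depends on \<open>k\<close>, vectors are functions on an index type,
  considered on a finite index set \<open>I\<close>, with the Euclidean norm \<open>L2_set _ I\<close>.\<close>

definition nabla :: "(real^'n \<Rightarrow> real) \<Rightarrow> real^'n \<Rightarrow> ('n \<Rightarrow> nat) \<Rightarrow> real" where
  "nabla u x \<alpha> = weak_deriv \<alpha> u x"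


section \<open>Fractional Orlicz--Sobolev spaces\<close>

definition J :: "real \<Rightarrow> (real \<Rightarrow> ennreal) \<Rightarrow> 'i set \<Rightarrow> (real^'n \<Rightarrow> 'i \<Rightarrow> real) \<Rightarrow> ennreal" where
  "J \<sigma> A I v =
     (\<integral>\<^sup>+x. \<integral>\<^sup>+y. A (L2_set (\<lambda>i. v x i - v y i) I / norm (x - y) powr \<sigma>)
                 / ennreal (norm (x - y) ^ CARD('n)) \<partial>lebesgue \<partial>lebesgue)"

definition seminorm ::
    "real \<Rightarrow> (real \<Rightarrow> ennreal) \<Rightarrow> 'i set \<Rightarrow> (real^'n \<Rightarrow> 'i \<Rightarrow> real) \<Rightarrow> ennreal" where
  "seminorm \<sigma> A I v = (INF r\<in>{r. 0 < r \<and> J \<sigma> A I (\<lambda>x i. v x i / r) \<le> 1}. ennreal r)"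

abbreviation int_part :: "real \<Rightarrow> nat" where
  "int_part s \<equiv> nat \<lfloor>s\<rfloor>"

definition V_modular :: "real \<Rightarrow> (real \<Rightarrow> ennreal) \<Rightarrow> (real^'n \<Rightarrow> real) \<Rightarrow> ennreal" where
  "V_modular s A u = J (frac s) A (multi_indices (int_part s)) (nabla u)"

definition V_norm :: "real \<Rightarrow> (real \<Rightarrow> ennreal) \<Rightarrow> (real^'n \<Rightarrow> real) \<Rightarrow> ennreal" where
  "V_norm s A u = seminorm (frac s) A (multi_indices (int_part s)) (nabla u)"

definition V_d :: "real \<Rightarrow> (real \<Rightarrow> ennreal) \<Rightarrow> (real^'n \<Rightarrow> real) set" where
  "V_d s A = {u. u \<in> borel_measurable lebesgue \<and>
     weakly_differentiable (int_part s) u \<and>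
     V_norm s A u < \<infinity> \<and>
     (\<forall>t>0. \<forall>k\<le>int_part s. emeasure lebesgue {x. L2_set (nabla u x) (multi_indices k) > t} < \<infinity>)}"


section \<open>Embeddings\<close>

definition Linf_norm :: "(real^'n \<Rightarrow> real) \<Rightarrow> ennreal" where
  "Linf_norm u = esssup lebesgue (\<lambda>x. ennreal \<bar>u x\<bar>)"

definition Linf :: "(real^'n \<Rightarrow> real) set" where
  "Linf = {u. u \<in> borel_measurable lebesgue \<and> Linf_norm u < \<infinity>}"

text \<open>Here \<open>X\<close> is a space of functions and \<open>N\<close> its norm.\<close>

definition embeds_Linf :: "(real^'n \<Rightarrow> real) set \<Rightarrow> ((real^'n \<Rightarrow> real) \<Rightarrow> ennreal) \<Rightarrow> bool" where
  "embeds_Linf X N \<longleftrightarrow>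
     X \<subseteq> Linf \<and> (\<exists>c::real. c > 0 \<and> (\<forall>u\<in>X. Linf_norm u \<le> ennreal c * N u))"

text \<open>The element \<open>w\<close> of \<open>C\<^sup>0\<close> (bounded continuous functions, with the supremum norm)
  represents \<open>u\<close>; it is unique if it exists.\<close>

definition C0_rep :: "(real^'n \<Rightarrow> real) \<Rightarrow> ((real^'n) \<Rightarrow>\<^sub>C real) \<Rightarrow> bool" where
  "C0_rep u w \<longleftrightarrow> (AE x in lebesgue. u x = apply_bcontfun w x)"

definition embeds_C0 :: "(real^'n \<Rightarrow> real) set \<Rightarrow> ((real^'n \<Rightarrow> real) \<Rightarrow> ennreal) \<Rightarrow> bool" where
  "embeds_C0 X N \<longleftrightarrow>
     (\<forall>u\<in>X. \<exists>w. C0_rep u w) \<and>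
     (\<exists>c::real. c > 0 \<and> (\<forall>u\<in>X. \<forall>w. C0_rep u w \<longrightarrow> ennreal (norm w) \<le> ennreal c * N u))"

end

theory Submission
  imports Defs
begin

text \<open>
  Let \<open>m\<close> and \<open>\<sigma>\<close> be the integer and the fractional part of \<open>s\<close>, and let \<open>U \<rho>\<close> be the average of \<open>u\<close>
  against a bump of width \<open>\<rho>\<close>. Along a line in the space of scales and centres, the \<open>m\<close>-th derivative
  of such averages is an average of \<open>m\<close>-th derivatives of \<open>u\<close>, hence constant up to the mean oscillation
  of the \<open>m\<close>-th gradient, and the averages are polynomials of degree \<open>m\<close> up to that error. Extrapolating
  \<open>U\<close> from the scales \<open>R, 2 R, \<dots>, (m + 1) R\<close> to the scale 0 gives a smoothing \<open>S R\<close> for which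
  \<open>S R - S (R / 2)\<close>, as well as the \<open>(m + 1)\<close>-st differences of \<open>S R\<close> with step at most \<open>R\<close>, are bounded
  by this oscillation. Summed over dyadic scales, Young's inequality bounds the oscillations by the
  modular and by a sum that the integral conditions on \<open>A\<close> control. So \<open>S (R / 2 ^ k)\<close> converges
  uniformly to a continuous representative of \<open>u\<close> whose \<open>(m + 1)\<close>-st differences, of any step, are
  bounded; optimizing the slope in Young's inequality produces the power \<open>s / n\<close> of the modular.
  As the level sets of \<open>u\<close> have finite measure, for every \<open>x\<close> there is a step \<open>h\<close> with \<open>u (x + j h)\<close> small for all
  \<open>1 \<le> j \<le> m + 1\<close>, and the bound on the difference becomes a bound on \<open>u x\<close>.

  Conversely, sums of bumps dilated by \<open>2 ^ k\<close> have a modular that is essentially additive in \<open>k\<close>, by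
  Jensen's inequality, and if the integral at infinity diverges, heights can be chosen such that the
  modular stays below 1 while the value at the origin is arbitrarily large.
\<close>

section \<open>Smooth bumps\<close>

text \<open>Along a path of scales and centres the derivative of the averaging kernel is a total
  divergence, so integration by parts moves it onto \<open>g\<close> without losing a power of the
  scale; the price is one factor \<open>h $ i - \<rho>1 * t\<close> per derivative. Kernels and test
  functions are tensor products, so that all of this happens in one coordinate at a time. Plain
  averages at the scales R and R / 2 differ by a polynomial drift of degree m that the oscillation
  of the m-th gradient does not see. Extrapolation to scale 0 is exact on such drifts and cancels
  them. The exponent s / (n - s) has the same origin in both directions. Let b(k) be the length of
  {t > 0. A t <= k t}. Young's inequality with slope l r^(s - n) at scale r leaves the sum of r^s
  b(l r^(s - n)) over dyadic r. Exchanging sum and integral gives for each t a geometric series of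
  size (l t / A t)^(s / (n - s)). In the converse, heights t_k below b(e 2^(k (n - s))) enter a
  lacunary sum: up to constants, its value at 0 is the sum of 2^(-k s) t_k, and its modular is at
  most e times that sum, because A t <= k t on the level set.\<close>

primrec Ck_real :: "nat \<Rightarrow> (real \<Rightarrow> real) \<Rightarrow> bool" where
  "Ck_real 0 f \<longleftrightarrow> continuous_on UNIV f"
| "Ck_real (Suc k) f \<longleftrightarrow> f differentiable_on UNIV \<and> Ck_real k (deriv f)"

definition smooth :: "(real \<Rightarrow> real) \<Rightarrow> bool" where
  "smooth f \<longleftrightarrow> (\<forall>k. Ck_real k f)"

lemma Ck_real_SucI:
  assumes "\<And>x. (f has_real_derivative f' x) (at x)" "Ck_real k f'"
  shows "Ck_real (Suc k) f"
proof -
  have "deriv f = f'" using assms(1) by (auto intro!: DERIV_imp_deriv)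
  moreover have "f differentiable_on UNIV"
    using assms(1) by (auto simp: differentiable_on_def real_differentiable_def)
  ultimately show ?thesis using assms(2) by simp
qed

lemma Ck_real_Suc_DERIV: "Ck_real (Suc k) f \<Longrightarrow> (f has_real_derivative deriv f x) (at x)"
  by (metis Ck_real.simps(2) DERIV_deriv_iff_real_differentiable UNIV_I differentiable_on_def)

lemma Ck_real_mono: "Ck_real (Suc k) f \<Longrightarrow> Ck_real k f"
proof (induction k arbitrary: f)
  case 0
  then show ?case using differentiable_imp_continuous_on by auto
qed auto

lemma Ck_real_const: "Ck_real k (\<lambda>_. c)"
proof (induction k arbitrary: c)
  case (Suc k)
  show ?case by (rule Ck_real_SucI[of _ "\<lambda>_. 0"]) (auto intro: Suc)
qed auto

lemma Ck_real_add: "Ck_real k f \<Longrightarrow> Ck_real k g \<Longrightarrow> Ck_real k (\<lambda>t. f t + g t)"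
proof (induction k arbitrary: f g)
  case (Suc k)
  show ?case
    by (rule Ck_real_SucI[of _ "\<lambda>t. deriv f t + deriv g t"])
      (use Suc Ck_real_Suc_DERIV in \<open>auto intro!: derivative_intros\<close>)
qed (auto intro: continuous_intros)

lemma Ck_real_mult: "Ck_real k f \<Longrightarrow> Ck_real k g \<Longrightarrow> Ck_real k (\<lambda>t. f t * g t)"
proof (induction k arbitrary: f g)
  case (Suc k)
  show ?case
  proof (rule Ck_real_SucI[of _ "\<lambda>t. f t * deriv g t + deriv f t * g t"])
    show "((\<lambda>t. f t * g t) has_real_derivative f x * deriv g x + deriv f x * g x) (at x)" for x
      by (rule DERIV_mult'[OF Ck_real_Suc_DERIV[OF Suc.prems(1)] Ck_real_Suc_DERIV[OF Suc.prems(2)]])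
    show "Ck_real k (\<lambda>t. f t * deriv g t + deriv f t * g t)"
      using Suc Ck_real_mono[OF Suc.prems(1)] Ck_real_mono[OF Suc.prems(2)]
      by (auto intro!: Ck_real_add)
  qed
qed (auto intro: continuous_intros)

lemma Ck_real_affine: "Ck_real k f \<Longrightarrow> Ck_real k (\<lambda>t. f (c * t + d))"
proof (induction k arbitrary: f)
  case 0
  then show ?case
    by (auto intro!: continuous_on_compose2[of UNIV f] continuous_intros)
next
  case (Suc k)
  show ?case
  proof (rule Ck_real_SucI[of _ "\<lambda>t. deriv f (c * t + d) * c"])
    show "((\<lambda>t. f (c * t + d)) has_real_derivative deriv f (c * x + d) * c) (at x)" for x
      by (rule DERIV_chain2[OF Ck_real_Suc_DERIV[OF Suc.prems]]) (auto intro!: derivative_eq_intros)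
    show "Ck_real k (\<lambda>t. deriv f (c * t + d) * c)"
      using Suc by (auto intro!: Ck_real_mult Ck_real_const)
  qed
qed

lemma Ck_real_ident: "Ck_real k (\<lambda>t. t)"
  by (cases k) (auto intro!: Ck_real_SucI[of _ "\<lambda>_. 1"] Ck_real_const simp del: Ck_real.simps(2) intro: continuous_intros)

lemma smooth_const [intro]: "smooth (\<lambda>_. c)"
  and smooth_ident [intro]: "smooth (\<lambda>t. t)"
  and smooth_mult: "smooth f \<Longrightarrow> smooth g \<Longrightarrow> smooth (\<lambda>t. f t * g t)"
  and smooth_affine: "smooth f \<Longrightarrow> smooth (\<lambda>t. f (c * t + d))"
  by (auto simp: smooth_def Ck_real_const Ck_real_ident Ck_real_add Ck_real_mult Ck_real_affine)

lemma smooth_deriv: "smooth f \<Longrightarrow> smooth (deriv f)"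
  by (metis Ck_real.simps(2) smooth_def)

lemma smooth_funpow_deriv: "smooth f \<Longrightarrow> smooth ((deriv ^^ k) f)"
  by (induction k) (auto intro: smooth_deriv)

lemma smooth_DERIV: "smooth f \<Longrightarrow> (f has_real_derivative deriv f x) (at x)"
  using Ck_real_Suc_DERIV smooth_def by blast

lemma smooth_DERIV_chain:
  "smooth f \<Longrightarrow> (g has_real_derivative g') (at x within s) \<Longrightarrow>
    ((\<lambda>x. f (g x)) has_real_derivative deriv f (g x) * g') (at x within s)"
  by (rule DERIV_chain2[OF smooth_DERIV])

lemma smooth_continuous: "smooth f \<Longrightarrow> continuous_on UNIV f"
  using Ck_real.simps(1) smooth_def by blast

lemma smooth_power: "smooth f \<Longrightarrow> smooth (\<lambda>t. f t ^ k)"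
  by (induction k) (auto intro: smooth_mult)

text \<open>The derivative of \<open>flat_exp p\<close> is again of this form.\<close>

definition flat_exp :: "real poly \<Rightarrow> real \<Rightarrow> real" where
  "flat_exp p t = (if t > 0 then poly p (1 / t) * exp (- (1 / t)) else 0)"

lemma poly_exp_minus_tendsto_0: "((\<lambda>x. poly p x * exp (- x)) \<longlongrightarrow> 0) (at_top :: real filter)"
proof -
  have "((\<lambda>x. \<Sum>i\<le>degree p. coeff p i * (x ^ i / exp x)) \<longlongrightarrow> (\<Sum>i\<le>degree p. coeff p i * 0)) at_top"
    by (intro tendsto_intros tendsto_power_div_exp_0)
  moreover have "poly p x * exp (- x) = (\<Sum>i\<le>degree p. coeff p i * (x ^ i / exp x))" for x :: real
    by (simp add: poly_altdef sum_distrib_right exp_minus divide_simps)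
  ultimately show ?thesis by simp
qed

lemma flat_exp_tendsto_0: "(flat_exp p \<longlongrightarrow> 0) (at 0)"
proof -
  have "(flat_exp p \<longlongrightarrow> 0) (at_right 0)"
  proof (rule Lim_transform_eventually)
    show "((\<lambda>t. poly p (inverse t) * exp (- inverse t)) \<longlongrightarrow> 0) (at_right 0)"
      by (rule filterlim_compose[OF poly_exp_minus_tendsto_0 filterlim_inverse_at_top_right])
    show "\<forall>\<^sub>F t in at_right 0. poly p (inverse t) * exp (- inverse t) = flat_exp p t"
      by (auto simp: eventually_at_filter flat_exp_def divide_inverse)
  qed
  moreover have "(flat_exp p \<longlongrightarrow> 0) (at_left 0)"
    by (rule Lim_transform_eventually[OF tendsto_const])
      (auto simp: eventually_at_filter flat_exp_def)
  ultimately show ?thesis using filterlim_split_at by blast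
qed

text \<open>With x = 1 / t the chain rule gives d/dt (p(x) exp(-x)) = x^2 (p(x) - p'(x)) exp(-x);
  the factor x^2 is \<open>[:0,0,1:]\<close>.\<close>

lemma flat_exp_DERIV:
  "(flat_exp p has_real_derivative flat_exp ([:0,0,1:] * (p - pderiv p)) x) (at x)"
proof -
  consider "x > 0" | "x < 0" | "x = 0" by linarith
  then show ?thesis
  proof cases
    case 1
    have "((\<lambda>t. poly p (1 / t) * exp (- (1 / t))) has_real_derivative
        flat_exp ([:0,0,1:] * (p - pderiv p)) x) (at x)"
      using 1 by (auto intro!: derivative_eq_intros simp: flat_exp_def field_simps power2_eq_square)
    then show ?thesis
      by (rule has_field_derivative_transform_within_open[where S="{0<..}"])
        (use 1 in \<open>auto simp: flat_exp_def\<close>)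
  next
    case 2
    have "((\<lambda>t. 0) has_real_derivative flat_exp ([:0,0,1:] * (p - pderiv p)) x) (at x)"
      using 2 by (auto simp: flat_exp_def)
    then show ?thesis
      by (rule has_field_derivative_transform_within_open[where S="{..<0}"])
        (use 2 in \<open>auto simp: flat_exp_def\<close>)
  next
    case 3
    \<comment> \<open>The difference quotient at 0 is again a flat exponential, with p(x) replaced
      by x p(x), so it tends to 0.\<close>
    have "((\<lambda>y. (flat_exp p y - flat_exp p 0) / (y - 0)) \<longlongrightarrow> 0) (at 0)"
      by (rule Lim_transform_eventually[OF flat_exp_tendsto_0[of "[:0,1:] * p"]])
        (auto simp: flat_exp_def eventually_at_filter)
    then show ?thesis
      unfolding 3 has_field_derivative_iff by (simp add: flat_exp_def)
  qed
qed

lemma smooth_flat_exp: "smooth (flat_exp p)"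
proof -
  have "Ck_real k (flat_exp p)" for k p
  proof (induction k arbitrary: p)
    case 0
    show ?case
      using flat_exp_DERIV by (auto intro!: continuous_at_imp_continuous_on DERIV_isCont)
  next
    case (Suc k)
    show ?case by (rule Ck_real_SucI[OF flat_exp_DERIV Suc])
  qed
  then show ?thesis by (simp add: smooth_def)
qed

text \<open>Sign and mass are left free: the class has to be closed under \<open>deriv\<close> and
  under multiplication by polynomials.\<close>

definition bump :: "(real \<Rightarrow> real) \<Rightarrow> bool" where
  "bump b \<longleftrightarrow> smooth b \<and> (\<exists>M. \<forall>t. M < \<bar>t\<bar> \<longrightarrow> b t = 0)"

lemma bump_smooth: "bump b \<Longrightarrow> smooth b"
  by (simp add: bump_def)

lemma bumpI: "smooth b \<Longrightarrow> (\<And>t. M < \<bar>t\<bar> \<Longrightarrow> b t = 0) \<Longrightarrow> bump b"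
  by (auto simp: bump_def)

lemma deriv_outside_support:
  assumes "\<And>t. M < \<bar>t\<bar> \<Longrightarrow> b t = 0" "M < \<bar>t\<bar>"
  shows "deriv b t = (0::real)"
proof -
  have "open {t::real. M < \<bar>t\<bar>}" by (intro open_Collect_less continuous_intros)
  moreover have "((\<lambda>_. 0) has_real_derivative 0) (at t)" by simp
  ultimately have "(b has_real_derivative 0) (at t)"
    using assms has_field_derivative_transform_within_open[of "\<lambda>_. 0" 0 t "{t. M < \<bar>t\<bar>}" b] by auto
  then show ?thesis by (rule DERIV_imp_deriv)
qed

lemma bump_deriv: "bump b \<Longrightarrow> bump (deriv b)"
  unfolding bump_def by (blast intro: deriv_outside_support smooth_deriv)

lemma bump_funpow_deriv: "bump b \<Longrightarrow> bump ((deriv ^^ k) b)"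
  by (induction k) (auto intro: bump_deriv)

lemma bump_mult: "smooth f \<Longrightarrow> bump b \<Longrightarrow> bump (\<lambda>t. f t * b t)"
  by (auto simp: bump_def intro: smooth_mult)

lemma bump_affine:
  assumes "bump b" "c \<noteq> 0"
  shows "bump (\<lambda>t. b (c * t + d))"
proof -
  obtain M where M: "\<And>t. M < \<bar>t\<bar> \<Longrightarrow> b t = 0" using assms by (auto simp: bump_def)
  show ?thesis
  proof (rule bumpI[where M="(M + \<bar>d\<bar>) / \<bar>c\<bar>"])
    show "smooth (\<lambda>t. b (c * t + d))" using assms by (auto simp: bump_def intro: smooth_affine)
    fix t assume "(M + \<bar>d\<bar>) / \<bar>c\<bar> < \<bar>t\<bar>"
    then have "M + \<bar>d\<bar> < \<bar>c * t\<bar>" using assms(2) by (simp add: abs_mult field_simps)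
    then show "b (c * t + d) = 0" by (intro M) linarith
  qed
qed

lemma bump_bounded:
  assumes "bump b"
  obtains B where "B > 0" "\<And>t. \<bar>b t\<bar> \<le> B"
proof -
  obtain M where M: "\<And>t. M < \<bar>t\<bar> \<Longrightarrow> b t = 0" using assms by (auto simp: bump_def)
  have "compact (b ` {-M..M})"
    using smooth_continuous[OF bump_smooth[OF assms]]
    by (intro compact_continuous_image) (auto intro: continuous_on_subset)
  then obtain B where B: "B > 0" "\<And>t. \<bar>t\<bar> \<le> M \<Longrightarrow> \<bar>b t\<bar> \<le> B"
    by (force simp: bounded_pos abs_le_iff dest!: compact_imp_bounded)
  then have "\<bar>b t\<bar> \<le> B" for t
    by (cases "M < \<bar>t\<bar>") (auto simp: M)
  with B(1) show ?thesis using that by blast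
qed

section \<open>Tensor products of one-dimensional bumps\<close>

definition prodf :: "('n::finite \<Rightarrow> real \<Rightarrow> real) \<Rightarrow> real^'n \<Rightarrow> real" where
  "prodf q x = (\<Prod>i\<in>UNIV. q i (x $ i))"

lemma prodf_has_derivative:
  assumes "\<And>i. smooth (q i)"
  shows "(prodf q has_derivative (\<lambda>v. \<Sum>i\<in>UNIV. v $ i * prodf (q(i := deriv (q i))) x)) (at x)"
proof -
  have "((\<lambda>x. q i (x $ i)) has_derivative (\<lambda>v. v $ i * deriv (q i) (x $ i))) (at x)" for i
    using has_derivative_compose[OF bounded_linear_imp_has_derivative[OF bounded_linear_vec_nth[of i]]
        smooth_DERIV[OF assms, unfolded has_field_derivative_def]]
    by (simp add: mult.commute)
  then have "(prodf q has_derivative (\<lambda>v. \<Sum>i\<in>UNIV. v $ i * deriv (q i) (x $ i) * (\<Prod>j\<in>UNIV - {i}. q j (x $ j)))) (at x)"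
    unfolding prodf_def[abs_def] by (intro has_derivative_prod)
  moreover have "v $ i * deriv (q i) (x $ i) * (\<Prod>j\<in>UNIV - {i}. q j (x $ j))
     = v $ i * prodf (q(i := deriv (q i))) x" for v i
    unfolding prodf_def by (subst prod.remove[of UNIV i]) auto
  ultimately show ?thesis by simp
qed

text \<open>The reason for working with tensor products: a partial derivative changes a single
  factor and stays within the class, so smoothness and iterated derivatives reduce to one real
  variable.\<close>

lemma partial_prodf:
  assumes "\<And>i. smooth (q i)"
  shows "partial i (prodf q) = prodf (q(i := deriv (q i)))"
proof
  fix x
  have "frechet_derivative (prodf q) (at x) = (\<lambda>v. \<Sum>i\<in>UNIV. v $ i * prodf (q(i := deriv (q i))) x)"
    using frechet_derivative_at[OF prodf_has_derivative[of q, OF assms]] by simp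
  then show "partial i (prodf q) x = prodf (q(i := deriv (q i))) x"
    by (simp add: partial_def axis_def if_distrib[of "\<lambda>u. u * _"] cong: if_cong)
qed

lemma prodf_continuous:
  assumes "\<And>i. continuous_on UNIV (q i)"
  shows "continuous_on UNIV (prodf q)"
  unfolding prodf_def[abs_def]
  by (intro continuous_intros continuous_on_compose2[OF assms]) auto

lemma C_k_prodf: "(\<And>i. smooth (q i)) \<Longrightarrow> C_k k (prodf q)"
proof (induction k arbitrary: q)
  case 0
  then show ?case by (auto intro!: prodf_continuous smooth_continuous)
next
  case (Suc k)
  have "prodf q differentiable_on UNIV"
    using prodf_has_derivative[of q, OF Suc.prems] by (auto simp: differentiable_on_def differentiable_def)
  moreover have "C_k k (partial i (prodf q))" for i
    unfolding partial_prodf[of q, OF Suc.prems]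
    by (rule Suc.IH) (simp add: Suc.prems smooth_deriv)
  ultimately show ?case by simp
qed

text \<open>The Euclidean norm is at most the l1 norm, so a point far enough out has some coordinate
  beyond the support of its factor.\<close>

lemma prodf_support:
  assumes "\<And>i. bump (q i)"
  obtains M where "M > 0" "\<And>x. M < norm x \<Longrightarrow> prodf q x = 0"
proof -
  have "\<exists>M. \<forall>t. M < \<bar>t\<bar> \<longrightarrow> q i t = 0" for i using assms by (auto simp: bump_def)
  then obtain M where M: "\<And>i t. M i < \<bar>t\<bar> \<Longrightarrow> q i t = 0" by metis
  define K where "K = (\<Sum>i\<in>UNIV. \<bar>M i\<bar>) + 1"
  show ?thesis
  proof
    show "K > 0" unfolding K_def by (simp add: add_nonneg_pos sum_nonneg)
    fix x :: "real^'a" assume K: "K < norm x"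
    have "\<exists>i. M i < \<bar>x $ i\<bar>"
    proof (rule ccontr)
      assume "\<not> ?thesis"
      then have "\<bar>x $ i\<bar> \<le> \<bar>M i\<bar>" for i by (meson abs_ge_self leI order_trans)
      then have "(\<Sum>i\<in>UNIV. \<bar>x $ i\<bar>) \<le> (\<Sum>i\<in>UNIV. \<bar>M i\<bar>)" by (intro sum_mono) auto
      with norm_le_l1_cart[of x] K show False unfolding K_def by linarith
    qed
    then show "prodf q x = 0" unfolding prodf_def using M by (intro prod_zero) auto
  qed
qed

lemma test_function_prodf:
  assumes "\<And>i. bump (q i)"
  shows "test_function (prodf q)"
proof -
  obtain M where M: "\<And>x. M < norm x \<Longrightarrow> prodf q x = 0"
    by (rule prodf_support[of q, OF assms]) blast+
  have "norm x \<le> M" if "prodf q x \<noteq> 0" for x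
    using M[of x] that by linarith
  then have "bounded {x. prodf q x \<noteq> 0}"
    by (intro boundedI[of _ M]) simp
  then show ?thesis
    unfolding test_function_def using assms by (simp add: C_k_prodf[of q] bump_smooth)
qed

text \<open>Gives the choice operator in \<open>mderiv\<close> a witness: each index is repeated as
  often as \<alpha> prescribes.\<close>

lemma ex_count_list: "\<exists>l. \<forall>i. count_list l i = \<alpha> (i::'n::finite)"
proof -
  obtain xs :: "'n list" where xs: "set xs = UNIV" "distinct xs"
    using finite_distinct_list[OF finite_class.finite_UNIV] by metis
  have "count_list (concat (map (\<lambda>i. replicate (\<alpha> i) i) ys)) i = (if i \<in> set ys then \<alpha> i else 0)"
    if "distinct ys" for ys i
    using that
  proof (induction ys)
    case (Cons y ys)
    have "count_list (replicate k y) i = (if y = i then k else 0)" for k by (induction k) auto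
    then show ?case using Cons by auto
  qed auto
  then show ?thesis using xs by (metis UNIV_I)
qed

lemma foldr_partial_prodf:
  assumes "\<And>i. smooth (q i)"
  shows "foldr partial l (prodf q) = prodf (\<lambda>i. (deriv ^^ count_list l i) (q i))"
proof (induction l)
  case (Cons a l)
  have "foldr partial (a # l) (prodf q) = partial a (prodf (\<lambda>i. (deriv ^^ count_list l i) (q i)))"
    using Cons by simp
  also have "\<dots> = prodf (\<lambda>i. (deriv ^^ count_list (a # l) i) (q i))"
    unfolding partial_prodf[of "\<lambda>i. (deriv ^^ count_list l i) (q i)", OF smooth_funpow_deriv[OF assms]]
    by (rule arg_cong[where f=prodf]) auto
  finally show ?case .
qed simp

text \<open>The order of differentiation chosen inside \<open>mderiv\<close> is invisible on tensor
  products, where only the multiplicities enter.\<close>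

lemma mderiv_prodf:
  assumes "\<And>i. smooth (q i)"
  shows "mderiv \<alpha> (prodf q) = prodf (\<lambda>i. (deriv ^^ \<alpha> i) (q i))"
proof -
  have "\<forall>i. count_list (SOME l. \<forall>i. count_list l i = \<alpha> i) i = \<alpha> i"
    using someI_ex[OF ex_count_list] .
  then show ?thesis unfolding mderiv_def by (simp add: foldr_partial_prodf[of q, OF assms])
qed

section \<open>Orthogonality to bumps and integration of derivatives\<close>

lemma nn_integral_lborel_affine:
  fixes f :: "'a::euclidean_space \<Rightarrow> ennreal"
  assumes [measurable]: "f \<in> borel_measurable borel" and c: "c \<noteq> 0"
  shows "(\<integral>\<^sup>+x. f x \<partial>lborel) = ennreal (\<bar>c\<bar> ^ DIM('a)) * (\<integral>\<^sup>+x. f (t + c *\<^sub>R x) \<partial>lborel)"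
  by (subst lborel_affine[OF c, of t])
    (simp add: nn_integral_density nn_integral_distr nn_integral_cmult ennreal_power)

lemma integral_lborel_affine:
  fixes f :: "'a::euclidean_space \<Rightarrow> real"
  assumes [measurable]: "f \<in> borel_measurable borel" and c: "c \<noteq> 0"
  shows "(LINT x|lborel. f x) = \<bar>c\<bar> ^ DIM('a) * (LINT x|lborel. f (t + c *\<^sub>R x))"
proof -
  have "(LINT x|lborel. f x) = integral\<^sup>L (density (distr lborel borel (\<lambda>x. t + c *\<^sub>R x)) (\<lambda>_. \<bar>c\<bar> ^ DIM('a))) f"
    using lborel_affine[OF c, of t] by simp
  also have "\<dots> = \<bar>c\<bar> ^ DIM('a) * (LINT x|lborel. f (t + c *\<^sub>R x))"
    by (subst integral_density) (auto simp: integral_distr)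
  finally show ?thesis .
qed

lemma integrable_lborel_affine:
  fixes f :: "'a::euclidean_space \<Rightarrow> real"
  assumes f: "integrable lborel f" and c: "c \<noteq> 0"
  shows "integrable lborel (\<lambda>x. f (t + c *\<^sub>R x))"
proof -
  have [measurable]: "f \<in> borel_measurable borel" using f by auto
  have "ennreal (\<bar>c\<bar> ^ DIM('a)) * (\<integral>\<^sup>+x. ennreal \<bar>f (t + c *\<^sub>R x)\<bar> \<partial>lborel) < \<infinity>"
    using f nn_integral_lborel_affine[of "\<lambda>x. ennreal \<bar>f x\<bar>" c t] c
    by (simp add: integrable_iff_bounded)
  then show ?thesis
    using c by (auto simp: integrable_iff_bounded ennreal_mult_less_top)
qed

lemma enn2real_eqD: "enn2real x = enn2real y \<Longrightarrow> x < top \<Longrightarrow> y < top \<Longrightarrow> x = y"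
  by (cases x; cases y) auto

text \<open>The Borel counterpart of \<open>locally_integrable\<close>: Borel representatives make
  Fubini and compositions with affine maps available.\<close>

definition loc_int :: "('a::euclidean_space \<Rightarrow> real) \<Rightarrow> bool" where
  "loc_int g \<longleftrightarrow> g \<in> borel_measurable borel \<and> (\<forall>R. set_integrable lborel (cball 0 R) g)"

lemma loc_int_measurable: "loc_int g \<Longrightarrow> g \<in> borel_measurable borel"
  by (simp add: loc_int_def)

lemma loc_int_integrable_mult:
  assumes g: "loc_int g" and [measurable]: "\<phi> \<in> borel_measurable borel"
    and B: "\<And>x. \<bar>\<phi> x\<bar> \<le> B" and R: "\<And>x. \<phi> x \<noteq> 0 \<Longrightarrow> norm x \<le> R"
  shows "integrable lborel (\<lambda>x. g x * \<phi> x)"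
proof (rule Bochner_Integration.integrable_bound)
  show "integrable lborel (\<lambda>x. B * (indicator (cball 0 R) x *\<^sub>R g x))"
    using g by (auto simp: loc_int_def set_integrable_def)
  show "(\<lambda>x. g x * \<phi> x) \<in> borel_measurable lborel"
    using g[THEN loc_int_measurable] by simp
  show "AE x in lborel. norm (g x * \<phi> x) \<le> norm (B * (indicator (cball 0 R) x *\<^sub>R g x))"
  proof (rule AE_I2)
    fix x
    have "B \<ge> 0" using B[of x] by linarith
    then show "norm (g x * \<phi> x) \<le> norm (B * (indicator (cball 0 R) x *\<^sub>R g x))"
      using B[of x] R[of x]
      by (cases "\<phi> x = 0") (auto simp: abs_mult mult.commute[of "\<bar>g x\<bar>"] intro!: mult_right_mono)
  qed
qed

lemma loc_int_diff:
  assumes "loc_int f" "loc_int g"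
  shows "loc_int (\<lambda>x. f x - g x)"
  using assms by (auto simp: loc_int_def set_integral_diff(1))

lemma loc_int_continuous: "continuous_on UNIV f \<Longrightarrow> loc_int f"
  unfolding loc_int_def set_integrable_def
proof (intro conjI allI)
  show "f \<in> borel_measurable borel" if "continuous_on UNIV f"
    using that by (rule borel_measurable_continuous_onI)
  show "integrable lborel (\<lambda>x. indicator (cball 0 R) x *\<^sub>R f x)" if "continuous_on UNIV f" for R
    by (rule borel_integrable_compact[OF compact_cball continuous_on_subset[OF that]]) simp
qed

lemma flat_exp_one_bounds: "0 \<le> flat_exp 1 t" "flat_exp 1 t \<le> 1"
  by (auto simp: flat_exp_def)

text \<open>A flat exponential switched on at \<open>a $ i\<close> times one switched off at
  \<open>b $ i\<close>. As the steepness \<open>k\<close> grows, the tensor product tends to the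
  indicator of the open box and never exceeds it.\<close>

definition box_bump :: "nat \<Rightarrow> real^'n \<Rightarrow> real^'n \<Rightarrow> 'n::finite \<Rightarrow> real \<Rightarrow> real" where
  "box_bump k a b i t = flat_exp 1 (real k * (t - a $ i)) * flat_exp 1 (real k * (b $ i - t))"

lemma bump_box_bump: "bump (box_bump k a b i)"
proof (rule bumpI)
  have "smooth (\<lambda>t. flat_exp 1 (real k * t + (- real k * a $ i)))"
       "smooth (\<lambda>t. flat_exp 1 ((- real k) * t + real k * b $ i))"
    by (intro smooth_affine smooth_flat_exp)+
  from smooth_mult[OF this] show "smooth (box_bump k a b i)"
    by (simp add: box_bump_def[abs_def] algebra_simps)
  show "box_bump k a b i t = 0" if "\<bar>a $ i\<bar> + \<bar>b $ i\<bar> < \<bar>t\<bar>" for t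
  proof -
    have "t - a $ i \<le> 0 \<or> b $ i - t \<le> 0" using that by linarith
    then show ?thesis
      by (auto simp: box_bump_def flat_exp_def zero_less_mult_iff)
  qed
qed

lemma box_bump_bounds: "0 \<le> prodf (box_bump k a b) x" "prodf (box_bump k a b) x \<le> 1"
proof -
  have "0 \<le> box_bump k a b i (x $ i) \<and> box_bump k a b i (x $ i) \<le> 1" for i
    unfolding box_bump_def by (simp add: mult_le_one flat_exp_one_bounds)
  then show "0 \<le> prodf (box_bump k a b) x" "prodf (box_bump k a b) x \<le> 1"
    unfolding prodf_def by (auto intro: prod_nonneg prod_le_1)
qed

lemma flat_exp_scale_tendsto:
  "(\<lambda>k. flat_exp 1 (real k * u)) \<longlonglongrightarrow> (if u > 0 then 1 else 0)"
proof (cases "u > 0")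
  case True
  have "(\<lambda>k. exp (- ((1 / u) * inverse (real k)))) \<longlonglongrightarrow> exp (- ((1 / u) * 0))"
    by (intro tendsto_intros lim_inverse_n)
  moreover have "\<forall>\<^sub>F k in sequentially. exp (- ((1 / u) * inverse (real k))) = flat_exp 1 (real k * u)"
    using eventually_gt_at_top[of 0]
    by eventually_elim (use True in \<open>auto simp: flat_exp_def field_simps\<close>)
  ultimately show ?thesis using True by (auto intro: Lim_transform_eventually)
next
  case False
  then have "\<not> 0 < real k * u" for k by (simp add: zero_less_mult_iff)
  then show ?thesis using False by (simp add: flat_exp_def)
qed

lemma box_bump_tendsto:
  "(\<lambda>k. prodf (box_bump k a b) x) \<longlonglongrightarrow> indicator (box a b) x"
proof -
  have "(\<lambda>k. prodf (box_bump k a b) x) \<longlonglongrightarrow>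
      (\<Prod>i\<in>UNIV. (if x $ i - a $ i > 0 then 1 else 0) * (if b $ i - x $ i > 0 then 1 else 0))"
    unfolding prodf_def box_bump_def
    by (intro tendsto_intros flat_exp_scale_tendsto)
  also have "(\<Prod>i\<in>UNIV. (if x $ i - a $ i > 0 then 1 else 0) * (if b $ i - x $ i > 0 then 1 else 0))
      = (indicator (box a b) x :: real)"
  proof (cases "x \<in> box a b")
    case True
    then show ?thesis by (auto simp: mem_box_cart intro!: prod.neutral)
  next
    case False
    then obtain i where "\<not> (a $ i < x $ i \<and> x $ i < b $ i)" by (auto simp: mem_box_cart)
    then show ?thesis using False by (auto intro!: prod_zero)
  qed
  finally show ?thesis .
qed

lemma prodf_measurable: "(\<And>i. bump (q i)) \<Longrightarrow> prodf q \<in> borel_measurable borel"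
proof (rule borel_measurable_continuous_onI, rule prodf_continuous)
  show "continuous_on UNIV (q i)" if "\<And>i. bump (q i)" for i
    using smooth_continuous[OF bump_smooth[OF that]] .
qed

lemma prodf_bounded:
  assumes "\<And>i. bump (q i)"
  obtains B where "B > 0" "\<And>x. \<bar>prodf q x\<bar> \<le> B"
proof -
  have "\<exists>B>0. \<forall>t. \<bar>q i t\<bar> \<le> B" for i using bump_bounded[OF assms[of i]] by metis
  then obtain B where B: "\<And>i. B i > 0" "\<And>i t. \<bar>q i t\<bar> \<le> B i" by metis
  show ?thesis
  proof
    show "(\<Prod>i\<in>UNIV. B i) > 0" using B(1) by (intro prod_pos) auto
    show "\<bar>prodf q x\<bar> \<le> (\<Prod>i\<in>UNIV. B i)" for x
      unfolding prodf_def abs_prod by (intro prod_mono) (auto simp: B)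
  qed
qed

lemma loc_int_prodf:
  assumes "loc_int g" "\<And>i. bump (q i)"
  shows "integrable lborel (\<lambda>x. g x * prodf q x)"
proof -
  obtain B where "B > 0" and B: "\<And>x. \<bar>prodf q x\<bar> \<le> B" by (rule prodf_bounded[of q, OF assms(2)]) blast
  obtain M where "M > 0" and M: "\<And>x. M < norm x \<Longrightarrow> prodf q x = 0" by (rule prodf_support[of q, OF assms(2)]) blast
  show ?thesis
    by (rule loc_int_integrable_mult[OF assms(1) prodf_measurable[OF assms(2)] B, of M])
      (meson M not_le)
qed

lemma box_subset_cball: "\<exists>R. box a b \<subseteq> cball 0 R"
proof -
  obtain R where "\<forall>x\<in>box a b. norm x \<le> R" using bounded_box[of a b] unfolding bounded_iff by blast
  then have "box a b \<subseteq> cball 0 R" by auto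
  then show ?thesis by blast
qed

text \<open>The fundamental lemma of the calculus of variations, for tensor test functions only.
  They approximate indicators of boxes, so \<open>g\<close> has integral zero over every box, and
  boxes are an intersection-stable generator of the Borel sets.\<close>

lemma AE_zero_if_orthogonal_to_bumps:
  fixes g :: "real^'n::finite \<Rightarrow> real"
  assumes g: "loc_int g"
    and orth: "\<And>q. (\<And>i. bump (q i)) \<Longrightarrow> (LINT x|lborel. g x * prodf q x) = 0"
  shows "AE x in lborel. g x = 0"
proof -
  have gm[measurable]: "g \<in> borel_measurable borel" using g by (rule loc_int_measurable)
  have intb: "integrable lborel (\<lambda>x. g x * indicator (box a b) x)" for a b
  proof -
    obtain R where "box a b \<subseteq> cball 0 R" using box_subset_cball by blast
    then show ?thesis
      by (intro loc_int_integrable_mult[OF g, where B=1 and R=R]) (auto simp: indicator_def split: if_splits)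
  qed
  have zero: "(LINT x|lborel. g x * indicator (box a b) x) = 0" for a b
  proof -
    obtain R where R: "box a b \<subseteq> cball 0 R" using box_subset_cball by blast
    have "(\<lambda>k. LINT x|lborel. g x * prodf (box_bump k a b) x) \<longlonglongrightarrow>
        (LINT x|lborel. g x * indicator (box a b) x)"
    proof (rule integral_dominated_convergence)
      show "integrable lborel (\<lambda>x. \<bar>g x * indicator (box a b) x\<bar>)"
        using intb by (rule integrable_abs)
      show "AE x in lborel. (\<lambda>k. g x * prodf (box_bump k a b) x) \<longlonglongrightarrow> g x * indicator (box a b) x"
        by (intro AE_I2 tendsto_intros box_bump_tendsto)
      show "AE x in lborel. norm (g x * prodf (box_bump k a b) x) \<le> \<bar>g x * indicator (box a b) x\<bar>" for k
      proof (rule AE_I2)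
        fix x
        have "\<bar>prodf (box_bump k a b) x\<bar> \<le> indicator (box a b) x"
        proof (cases "x \<in> box a b")
          case False
          then obtain i where "\<not> (a $ i < x $ i \<and> x $ i < b $ i)" by (auto simp: mem_box_cart)
          then have "x $ i - a $ i \<le> 0 \<or> b $ i - x $ i \<le> 0" by linarith
          then have "box_bump k a b i (x $ i) = 0"
            by (auto simp: box_bump_def flat_exp_def zero_less_mult_iff)
          then have "prodf (box_bump k a b) x = 0" unfolding prodf_def by (intro prod_zero) auto
          then show ?thesis by simp
        qed (use box_bump_bounds[of k a b x] in auto)
        then show "norm (g x * prodf (box_bump k a b) x) \<le> \<bar>g x * indicator (box a b) x\<bar>"
          by (auto simp: abs_mult intro!: mult_left_mono)
      qed
    qed (auto intro!: borel_measurable_times prodf_measurable bump_box_bump)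
    moreover have "(LINT x|lborel. g x * prodf (box_bump k a b) x) = 0" for k
      by (rule orth[of "box_bump k a b"]) (rule bump_box_bump)
    ultimately show ?thesis by (simp add: LIMSEQ_const_iff)
  qed
  \<comment> \<open>As \<open>ennreal\<close> truncates at 0, these are the positive and the
    negative part of \<open>g\<close>; the measures with these densities are shown to
    coincide.\<close>
  let ?P = "\<lambda>x. ennreal (g x)" and ?N = "\<lambda>x. ennreal (- g x)"
  have eq: "emeasure (density lborel ?P) (box a b) = emeasure (density lborel ?N) (box a b)"
     and fin: "emeasure (density lborel ?P) (box a b) \<noteq> \<infinity>" for a b
  proof -
    let ?h = "\<lambda>x. g x * indicator (box a b) x"
    have 1: "emeasure (density lborel ?P) (box a b) = (\<integral>\<^sup>+x. ennreal (?h x) \<partial>lborel)"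
            "emeasure (density lborel ?N) (box a b) = (\<integral>\<^sup>+x. ennreal (- ?h x) \<partial>lborel)"
      by (auto simp: emeasure_density indicator_def intro!: nn_integral_cong)
    have 2: "(\<integral>\<^sup>+x. ennreal (?h x) \<partial>lborel) \<noteq> \<infinity>" "(\<integral>\<^sup>+x. ennreal (- ?h x) \<partial>lborel) \<noteq> \<infinity>"
      using intb[of a b] by (auto simp: real_integrable_def)
    have "enn2real (\<integral>\<^sup>+x. ennreal (?h x) \<partial>lborel) = enn2real (\<integral>\<^sup>+x. ennreal (- ?h x) \<partial>lborel)"
      using zero[of a b] real_lebesgue_integral_def[OF intb[of a b]] by simp
    then show "emeasure (density lborel ?P) (box a b) = emeasure (density lborel ?N) (box a b)"
      unfolding 1 by (rule enn2real_eqD) (use 2 in \<open>simp_all add: less_top\<close>)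
    show "emeasure (density lborel ?P) (box a b) \<noteq> \<infinity>" using 1 2 by simp
  qed
  have "density lborel ?P = density lborel ?N"
  proof (rule measure_eqI_generator_eq)
    let ?E = "range (\<lambda>(a, b). box a b :: (real^'n) set)"
    show "Int_stable ?E" by (auto simp: Int_stable_def box_Int_box)
    show "?E \<subseteq> Pow UNIV" "sets (density lborel ?P) = sigma_sets UNIV ?E"
      "sets (density lborel ?N) = sigma_sets UNIV ?E"
      by (simp_all add: borel_eq_box)
    let ?A = "\<lambda>n::nat. box (- (real n *\<^sub>R One)) (real n *\<^sub>R One) :: (real^'n) set"
    show "range ?A \<subseteq> ?E" "(\<Union>i. ?A i) = UNIV"
      unfolding UN_box_eq_UNIV by auto
    show "emeasure (density lborel ?P) (?A i) \<noteq> \<infinity>" for i by (rule fin)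
    show "emeasure (density lborel ?P) X = emeasure (density lborel ?N) X" if "X \<in> ?E" for X
      using that eq by auto
  qed
  then have "AE x in lborel. ?P x = ?N x"
    by (subst (asm) sigma_finite_measure.density_unique_iff[OF sigma_finite_lborel]) auto
  then show ?thesis
  proof eventually_elim
    case (elim x)
    then show "g x = 0"
      by (cases "g x \<ge> 0") (auto simp: ennreal_neg ennreal_eq_0_iff eq_commute[of 0])
  qed
qed

section \<open>Integrals of partial derivatives\<close>

lemma axis_DERIV:
  fixes w :: "real^'n::finite \<Rightarrow> real"
  assumes "\<And>x. w differentiable (at x)"
  shows "((\<lambda>t. w (x + t *\<^sub>R axis i 1)) has_real_derivative partial i w (x + t *\<^sub>R axis i 1)) (at t)"
proof -
  let ?D = "frechet_derivative w (at (x + t *\<^sub>R axis i 1))"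
  have D: "(w has_derivative ?D) (at (x + t *\<^sub>R axis i 1))"
    using assms frechet_derivative_works by blast
  have "((\<lambda>t. x + t *\<^sub>R axis i 1) has_derivative (\<lambda>h. h *\<^sub>R axis i 1)) (at t)"
    by (auto intro!: derivative_eq_intros)
  from has_derivative_compose[OF this D]
  have "((\<lambda>t. w (x + t *\<^sub>R axis i 1)) has_derivative (\<lambda>h. ?D (h *\<^sub>R axis i 1))) (at t)" .
  moreover have "(\<lambda>h. ?D (h *\<^sub>R axis i 1)) = (\<lambda>h. partial i w (x + t *\<^sub>R axis i 1) * h)"
    using linear_cmul[OF has_derivative_linear[OF D]] by (auto simp: partial_def mult.commute)
  ultimately show ?thesis by (simp add: has_field_derivative_def)
qed

text \<open>Difference quotients have integral zero by translation invariance, and they converge to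
  the partial derivative under a common integrable bound.\<close>

lemma integral_partial_eq_0:
  fixes w :: "real^'n::finite \<Rightarrow> real"
  assumes d: "\<And>x. w differentiable (at x)" and c: "continuous_on UNIV (partial i w)"
    and supp: "\<And>x. M < norm x \<Longrightarrow> w x = 0"
  shows "(LINT x|lborel. partial i w x) = 0"
proof -
  let ?e = "axis i 1 :: real^'n"
  have wc: "continuous_on UNIV w"
    using d by (simp add: continuous_at_imp_continuous_on differentiable_imp_continuous_within)
  have wm[measurable]: "w \<in> borel_measurable borel" using wc by (rule borel_measurable_continuous_onI)
  have pm[measurable]: "partial i w \<in> borel_measurable borel" using c by (rule borel_measurable_continuous_onI)
  have psupp: "partial i w x = 0" if "M < norm x" for x
  proof -
    have "open {x::real^'n. M < norm x}" by (intro open_Collect_less continuous_intros)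
    then have "(w has_derivative (\<lambda>_. 0)) (at x)"
      using that supp has_derivative_transform_within_open[of "\<lambda>_. 0" "\<lambda>_. 0" x UNIV "{x. M < norm x}" w]
      by auto
    from frechet_derivative_at[OF this] show ?thesis by (simp add: partial_def fun_eq_iff)
  qed
  have "compact (partial i w ` cball 0 M)"
    using c by (intro compact_continuous_image) (auto intro: continuous_on_subset)
  then obtain B where B: "B > 0" "\<And>x. norm x \<le> M \<Longrightarrow> \<bar>partial i w x\<bar> \<le> B"
    by (force simp: bounded_pos dest!: compact_imp_bounded)
  have Bx: "\<bar>partial i w x\<bar> \<le> B" for x
    using B psupp[of x] by (cases "norm x \<le> M") auto
  have wint: "integrable lborel w"
  proof -
    have "loc_int w" using wc by (rule loc_int_continuous)
    then have "integrable lborel (\<lambda>x. w x * indicator (cball 0 M) x)"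
      by (rule loc_int_integrable_mult[of _ _ 1 M]) (auto simp: indicator_def)
    moreover have "w x * indicator (cball 0 M) x = w x" for x
      using supp[of x] by (auto simp: indicator_def)
    ultimately show ?thesis by simp
  qed
  define h where "h k = inverse (real (Suc k))" for k
  have h: "0 < h k" "h k \<le> 1" for k by (auto simp: h_def field_simps)
  have lim: "(\<lambda>k. LINT x|lborel. (w (x + h k *\<^sub>R ?e) - w x) / h k) \<longlonglongrightarrow> (LINT x|lborel. partial i w x)"
  proof (rule integral_dominated_convergence)
    \<comment> \<open>The steps \<open>h k\<close> are at most 1, so all quotients vanish outside
      the ball of radius \<open>M + 1\<close>.\<close>
    have "emeasure lborel (cball 0 (M + 1) :: (real^'n) set) < \<infinity>"
      by (intro emeasure_lborel_cball_finite)
    then show "integrable lborel (\<lambda>x::real^'n. B * indicator (cball 0 (M + 1)) x)"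
      by simp
    show "AE x in lborel. (\<lambda>k. (w (x + h k *\<^sub>R ?e) - w x) / h k) \<longlonglongrightarrow> partial i w x"
    proof (rule AE_I2)
      fix x
      have "((\<lambda>t. (w (x + t *\<^sub>R ?e) - w x) / t) \<longlongrightarrow> partial i w x) (at 0)"
        using axis_DERIV[OF d, of x i 0] by (simp add: has_field_derivative_iff)
      moreover have "filterlim h (at 0) sequentially"
        unfolding filterlim_at using h LIMSEQ_inverse_real_of_nat
        by (auto simp: h_def[abs_def] less_imp_neq)
      ultimately show "(\<lambda>k. (w (x + h k *\<^sub>R ?e) - w x) / h k) \<longlonglongrightarrow> partial i w x"
        by (rule filterlim_compose)
    qed
    show "AE x in lborel. norm ((w (x + h k *\<^sub>R ?e) - w x) / h k) \<le> B * indicator (cball 0 (M + 1)) x" for k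
    proof (rule AE_I2)
      fix x
      show "norm ((w (x + h k *\<^sub>R ?e) - w x) / h k) \<le> B * indicator (cball 0 (M + 1)) x"
      proof (cases "norm x \<le> M + 1")
        case True
        obtain z where "w (x + h k *\<^sub>R ?e) - w (x + 0 *\<^sub>R ?e) = (h k - 0) * partial i w (x + z *\<^sub>R ?e)"
          using MVT2[of 0 "h k" "\<lambda>t. w (x + t *\<^sub>R ?e)" "\<lambda>t. partial i w (x + t *\<^sub>R ?e)",
            OF h(1) axis_DERIV[OF d]] by blast
        then have "(w (x + h k *\<^sub>R ?e) - w x) / h k = partial i w (x + z *\<^sub>R ?e)"
          using h[of k] by simp
        then show ?thesis using Bx True by simp
      next
        case False
        have "norm x \<le> norm (x + h k *\<^sub>R ?e) + norm (h k *\<^sub>R ?e)" by (metis add_diff_cancel_right' norm_triangle_ineq4)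
        also have "norm (h k *\<^sub>R ?e) \<le> 1" using h[of k] by simp
        finally have "M < norm (x + h k *\<^sub>R ?e)" using False by linarith
        then show ?thesis using False supp[of x] supp[of "x + h k *\<^sub>R ?e"] by simp
      qed
    qed
  qed auto
  have z: "(LINT x|lborel. (w (x + h k *\<^sub>R ?e) - w x) / h k) = 0" for k
  proof -
    have 1: "(LINT x|lborel. w (x + h k *\<^sub>R ?e)) = (LINT x|lborel. w x)"
      using integral_lborel_affine[OF wm, of 1 "h k *\<^sub>R ?e"] by (simp add: add.commute)
    have "integrable lborel (\<lambda>x. w (h k *\<^sub>R ?e + x))"
      using integrable_lborel_affine[OF wint, of 1] by simp
    then have 2: "integrable lborel (\<lambda>x. w (x + h k *\<^sub>R ?e))" by (simp add: add.commute)
    show ?thesis using 1 2 wint by simp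
  qed
  show ?thesis using lim unfolding z by (simp add: LIMSEQ_const_iff)
qed

section \<open>Averages along paths of scales and centres\<close>

text \<open>Differentiation under the integral sign: by the mean value inequality the bound
  \<open>w\<close> on the derivatives also dominates the difference quotients, provided that the
  points stay in the ball. Hence the sequences below are shifted by \<open>N\<close>.\<close>

lemma has_real_derivative_integral:
  fixes f f' :: "real \<Rightarrow> 'a \<Rightarrow> real"
  assumes w: "integrable M w" and d: "d > 0"
    and int: "\<And>t. t \<in> ball t0 d \<Longrightarrow> integrable M (f t)"
    and D: "\<And>t z. t \<in> ball t0 d \<Longrightarrow> ((\<lambda>t. f t z) has_real_derivative f' t z) (at t)"
    and m: "f' t0 \<in> borel_measurable M"
    and bnd: "\<And>t z. t \<in> ball t0 d \<Longrightarrow> \<bar>f' t z\<bar> \<le> w z"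
  shows "((\<lambda>t. integral\<^sup>L M (f t)) has_real_derivative integral\<^sup>L M (f' t0)) (at t0)"
  unfolding has_field_derivative_iff tendsto_at_iff_sequentially
proof (intro allI impI)
  fix X :: "nat \<Rightarrow> real"
  assume X: "\<forall>i. X i \<in> UNIV - {t0}" and lim: "X \<longlonglongrightarrow> t0"
  from lim d have "\<forall>\<^sub>F i in sequentially. X i \<in> ball t0 d"
    by (auto simp: tendsto_iff dist_commute)
  then obtain N where "\<forall>i\<ge>N. X i \<in> ball t0 d" unfolding eventually_sequentially by blast
  then have N: "X (i + N) \<in> ball t0 d" for i by simp
  have t0: "t0 \<in> ball t0 d" using d by simp
  note [measurable] = borel_measurable_integrable[OF int[OF N]] borel_measurable_integrable[OF int[OF t0]] m
  have "(\<lambda>i. LINT z|M. (f (X (i + N)) z - f t0 z) / (X (i + N) - t0)) \<longlonglongrightarrow> integral\<^sup>L M (f' t0)"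
  proof (rule integral_dominated_convergence[where w=w])
    show "AE z in M. (\<lambda>i. (f (X (i + N)) z - f t0 z) / (X (i + N) - t0)) \<longlonglongrightarrow> f' t0 z"
    proof (rule AE_I2)
      fix z
      have "((\<lambda>y. (f y z - f t0 z) / (y - t0)) \<longlongrightarrow> f' t0 z) (at t0)"
        using D[OF t0, of z] by (simp add: has_field_derivative_iff)
      moreover have "filterlim (\<lambda>i. X (i + N)) (at t0) sequentially"
        unfolding filterlim_at using X LIMSEQ_ignore_initial_segment[OF lim, of N] by auto
      ultimately show "(\<lambda>i. (f (X (i + N)) z - f t0 z) / (X (i + N) - t0)) \<longlonglongrightarrow> f' t0 z"
        by (rule filterlim_compose)
    qed
    show "AE z in M. norm ((f (X (i + N)) z - f t0 z) / (X (i + N) - t0)) \<le> w z" for i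
    proof (rule AE_I2)
      fix z
      have "norm (f (X (i + N)) z - f t0 z) \<le> w z * norm (X (i + N) - t0)"
        by (rule field_differentiable_bound[where S="ball t0 d" and f="\<lambda>t. f t z" and f'="\<lambda>t. f' t z"])
          (use D bnd N t0 in \<open>auto intro: has_field_derivative_at_within\<close>)
      then show "norm ((f (X (i + N)) z - f t0 z) / (X (i + N) - t0)) \<le> w z"
        using X by (simp add: divide_le_eq abs_divide)
    qed
  qed (use w in auto)
  moreover have "(LINT z|M. (f (X (i + N)) z - f t0 z) / (X (i + N) - t0))
      = (integral\<^sup>L M (f (X (i + N))) - integral\<^sup>L M (f t0)) / (X (i + N) - t0)" for i
    using int[OF N] int[OF t0] by simp
  ultimately have "(\<lambda>i. (integral\<^sup>L M (f (X (i + N))) - integral\<^sup>L M (f t0)) / (X (i + N) - t0))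
      \<longlonglongrightarrow> integral\<^sup>L M (f' t0)" by (simp only:)
  then show "((\<lambda>y. (integral\<^sup>L M (f y) - integral\<^sup>L M (f t0)) / (y - t0)) \<circ> X) \<longlonglongrightarrow> integral\<^sup>L M (f' t0)"
    unfolding comp_def by (rule LIMSEQ_offset)
qed

section \<open>Dilated kernels and the averages they define\<close>

definition ker :: "('n::finite \<Rightarrow> real \<Rightarrow> real) \<Rightarrow> real \<Rightarrow> real^'n \<Rightarrow> real^'n \<Rightarrow> real" where
  "ker \<psi> \<rho> x z = prodf \<psi> ((1 / \<rho>) *\<^sub>R (x - z)) / \<rho> ^ CARD('n)"

text \<open>As a function of the integration variable \<open>z\<close> the kernel is itself a tensor
  product, hence a legitimate test function for weak derivatives.\<close>

lemma ker_eq_prodf: "ker \<psi> \<rho> x z = prodf (\<lambda>i t. \<psi> i ((x $ i - t) / \<rho>) / \<rho>) z"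
  by (simp add: ker_def prodf_def prod_dividef)

lemma bump_ker_factor:
  assumes "bump b" "\<rho> > 0"
  shows "bump (\<lambda>t. b ((c - t) / \<rho>) / \<rho>)"
proof -
  have "bump (\<lambda>t. (1 / \<rho>) * b ((- 1 / \<rho>) * t + c / \<rho>))"
    using assms by (intro bump_mult smooth_const bump_affine) auto
  then show ?thesis by (simp add: diff_divide_distrib add.commute)
qed

lemma deriv_ker_factor:
  assumes "bump b" "\<rho> > 0"
  shows "deriv (\<lambda>t. b ((c - t) / \<rho>) / \<rho>) = (\<lambda>t. - (1 / \<rho>) * (deriv b ((c - t) / \<rho>) / \<rho>))"
proof
  fix t
  have "((\<lambda>t. b ((c - t) / \<rho>)) has_real_derivative deriv b ((c - t) / \<rho>) * (- 1 / \<rho>)) (at t)"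
    by (rule smooth_DERIV_chain[OF bump_smooth[OF assms(1)]]) (use assms(2) in \<open>auto intro!: derivative_eq_intros\<close>)
  from DERIV_cdivide[OF this, of \<rho>]
  show "deriv (\<lambda>t. b ((c - t) / \<rho>) / \<rho>) t = - (1 / \<rho>) * (deriv b ((c - t) / \<rho>) / \<rho>)"
    by (intro DERIV_imp_deriv) (simp add: mult.commute)
qed

lemma ker_measurable [measurable]:
  assumes "\<And>i. bump (\<psi> i)"
  shows "ker \<psi> \<rho> x \<in> borel_measurable borel"
proof -
  have [measurable]: "prodf \<psi> \<in> borel_measurable borel" by (rule prodf_measurable[of \<psi>, OF assms])
  show ?thesis unfolding ker_def[abs_def] by measurable
qed

lemma integral_ker:
  assumes "\<And>i. bump (\<psi> i)" "\<rho> > 0"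
  shows "(LINT z|lborel. ker \<psi> \<rho> x z) = (LINT z|lborel. prodf \<psi> z)"
proof -
  have m: "prodf \<psi> \<in> borel_measurable borel" by (rule prodf_measurable[of \<psi>, OF assms(1)])
  have "(LINT z|lborel. prodf \<psi> z)
      = (1 / \<rho>) ^ CARD('a) * (LINT z|lborel. prodf \<psi> ((1 / \<rho>) *\<^sub>R x + (- 1 / \<rho>) *\<^sub>R z))"
    using integral_lborel_affine[OF m, of "- 1 / \<rho>" "(1 / \<rho>) *\<^sub>R x"] assms(2) by simp
  also have "\<dots> = (LINT z|lborel. ker \<psi> \<rho> x z)"
    unfolding ker_def using assms(2) by (simp add: scaleR_diff_right power_divide)
  finally show ?thesis by simp
qed

definition W :: "(real^'n \<Rightarrow> real) \<Rightarrow> ('n::finite \<Rightarrow> real \<Rightarrow> real) \<Rightarrow> real \<Rightarrow> real^'n \<Rightarrow> real" where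
  "W g \<psi> \<rho> x = (LINT z|lborel. g z * ker \<psi> \<rho> x z)"

lemma ker_integrable:
  assumes "loc_int g" "\<And>i. bump (\<psi> i)" "\<rho> > 0"
  shows "integrable lborel (\<lambda>z. g z * ker \<psi> \<rho> x z)"
  unfolding ker_eq_prodf
  by (rule loc_int_prodf[OF assms(1)]) (rule bump_ker_factor[OF assms(2,3)])

text \<open>The factors for the \<open>\<alpha>\<close>-th derivative along the path
  \<open>\<tau> \<mapsto> (\<rho>0 + \<tau> \<rho>1, p + \<tau> h)\<close> of scales and centres.\<close>

definition path_fac :: "real^'n \<Rightarrow> real \<Rightarrow> (real \<Rightarrow> real) \<Rightarrow> ('n::finite \<Rightarrow> nat) \<Rightarrow> 'n \<Rightarrow> real \<Rightarrow> real" where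
  "path_fac h \<rho>1 b \<alpha> i t = (h $ i - \<rho>1 * t) ^ \<alpha> i * b t"

lemma bump_path_fac: "bump b \<Longrightarrow> bump (path_fac h \<rho>1 b \<alpha> i)"
proof -
  have "smooth (\<lambda>t. (- \<rho>1) * t + h $ i)" by (rule smooth_affine[of "\<lambda>t. t"]) auto
  then have "smooth (\<lambda>t. (h $ i - \<rho>1 * t) ^ \<alpha> i)"
    using smooth_power by fastforce
  then show "bump b \<Longrightarrow> bump (path_fac h \<rho>1 b \<alpha> i)"
    unfolding path_fac_def[abs_def] by (rule bump_mult)
qed

text \<open>Put y = (x - z) / \<rho>. The i-th coordinate of y moves with velocity (h_i - \<rho>1
  y_i) / \<rho>, and the factor 1 / \<rho> contributes -\<rho>1 / \<rho>^2. By the product rule both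
  effects merge into the single derivative of t |-> (h_i - \<rho>1 t) \<psi>_i(t). So the path
  derivative is a divergence, ready for integration by parts.\<close>

lemma path_ker_DERIV:
  fixes p h :: "real^'n::finite"
  assumes b: "\<And>i. bump (\<psi> i)" and pos: "\<rho>0 + \<tau> * \<rho>1 > 0"
  shows "((\<lambda>\<tau>. ker \<psi> (\<rho>0 + \<tau> * \<rho>1) (p + \<tau> *\<^sub>R h) z) has_real_derivative
    (\<Sum>i\<in>UNIV. (1 / (\<rho>0 + \<tau> * \<rho>1)) *
       ker (\<psi>(i := deriv (\<lambda>t. (h $ i - \<rho>1 * t) * \<psi> i t))) (\<rho>0 + \<tau> * \<rho>1) (p + \<tau> *\<^sub>R h) z)) (at \<tau>)"
proof -
  let ?\<rho> = "\<rho>0 + \<tau> * \<rho>1"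
  define y where "y i = (p $ i + \<tau> * h $ i - z $ i) / ?\<rho>" for i
  define \<kappa> where "\<kappa> i t = (h $ i - \<rho>1 * t) * \<psi> i t" for i t
  have sm: "smooth (\<psi> i)" for i using b by (rule bump_smooth)
  have dk: "deriv (\<kappa> i) t = (h $ i - \<rho>1 * t) * deriv (\<psi> i) t - \<rho>1 * \<psi> i t" for i t
    unfolding \<kappa>_def
    by (rule DERIV_imp_deriv) (auto intro!: derivative_eq_intros smooth_DERIV[OF sm])
  have 1: "((\<lambda>\<tau>. \<psi> i ((p $ i + \<tau> * h $ i - z $ i) / (\<rho>0 + \<tau> * \<rho>1)) / (\<rho>0 + \<tau> * \<rho>1))
      has_real_derivative (1 / ?\<rho>) * (deriv (\<kappa> i) (y i) / ?\<rho>)) (at \<tau>)" for i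
  proof -
    have "((\<lambda>\<tau>. (p $ i + \<tau> * h $ i - z $ i) / (\<rho>0 + \<tau> * \<rho>1)) has_real_derivative
       (h $ i - \<rho>1 * y i) / ?\<rho>) (at \<tau>)"
      using pos by (auto intro!: derivative_eq_intros simp: y_def field_simps)
    from smooth_DERIV_chain[OF sm this, of i]
    have "((\<lambda>\<tau>. \<psi> i ((p $ i + \<tau> * h $ i - z $ i) / (\<rho>0 + \<tau> * \<rho>1))) has_real_derivative
        deriv (\<psi> i) (y i) * ((h $ i - \<rho>1 * y i) / ?\<rho>)) (at \<tau>)"
      by (simp add: y_def)
    moreover have "((\<lambda>\<tau>. \<rho>0 + \<tau> * \<rho>1) has_real_derivative \<rho>1) (at \<tau>)"
      by (auto intro!: derivative_eq_intros)
    ultimately have "((\<lambda>\<tau>. \<psi> i ((p $ i + \<tau> * h $ i - z $ i) / (\<rho>0 + \<tau> * \<rho>1)) / (\<rho>0 + \<tau> * \<rho>1)) has_real_derivative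
        (deriv (\<psi> i) (y i) * ((h $ i - \<rho>1 * y i) / ?\<rho>) * ?\<rho> - \<psi> i (y i) * \<rho>1) / (?\<rho> * ?\<rho>)) (at \<tau>)"
      using pos unfolding y_def by (intro DERIV_divide) auto
    moreover have "(deriv (\<psi> i) (y i) * ((h $ i - \<rho>1 * y i) / ?\<rho>) * ?\<rho> - \<psi> i (y i) * \<rho>1) / (?\<rho> * ?\<rho>)
        = (1 / ?\<rho>) * (deriv (\<kappa> i) (y i) / ?\<rho>)"
      using pos unfolding dk by (simp add: mult.commute)
    ultimately show ?thesis by (simp only:)
  qed
  have "((\<lambda>\<tau>. \<Prod>i\<in>UNIV. \<psi> i ((p $ i + \<tau> * h $ i - z $ i) / (\<rho>0 + \<tau> * \<rho>1)) / (\<rho>0 + \<tau> * \<rho>1))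
      has_real_derivative (\<Sum>i\<in>UNIV. (1 / ?\<rho>) * (deriv (\<kappa> i) (y i) / ?\<rho>) *
        (\<Prod>j\<in>UNIV - {i}. \<psi> j (y j) / ?\<rho>))) (at \<tau>)"
    unfolding y_def by (rule has_field_derivative_prod) (rule 1[unfolded y_def])
  moreover have "(1 / ?\<rho>) * (deriv (\<kappa> i) (y i) / ?\<rho>) * (\<Prod>j\<in>UNIV - {i}. \<psi> j (y j) / ?\<rho>)
     = (1 / ?\<rho>) * ker (\<psi>(i := deriv (\<kappa> i))) ?\<rho> (p + \<tau> *\<^sub>R h) z" for i
    unfolding ker_eq_prodf prodf_def
    by (subst prod.remove[of UNIV i]) (auto simp: y_def)
  ultimately show ?thesis
    by (simp add: ker_eq_prodf prodf_def \<kappa>_def[abs_def])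
qed

lemma norm_le_card_cart:
  fixes y :: "real^'n::finite"
  assumes "\<And>i. \<bar>y $ i\<bar> \<le> c"
  shows "norm y \<le> real CARD('n) * c"
  using norm_le_l1_cart[of y] sum_bounded_above[of UNIV "\<lambda>i. \<bar>y $ i\<bar>" c] assms by simp

lemma ker_bounds:
  fixes \<psi> :: "'n::finite \<Rightarrow> real \<Rightarrow> real"
  assumes "\<And>i. bump (\<psi> i)"
  obtains B M where "B > 0" "M > 0" "\<And>\<rho> x z. \<rho> > 0 \<Longrightarrow> \<bar>ker \<psi> \<rho> x z\<bar> \<le> B / \<rho> ^ CARD('n)"
    "\<And>\<rho> x z. \<rho> > 0 \<Longrightarrow> ker \<psi> \<rho> x z \<noteq> 0 \<Longrightarrow> norm (x - z) \<le> M * \<rho>"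
proof -
  obtain B where B: "B > 0" "\<And>x. \<bar>prodf \<psi> x\<bar> \<le> B" by (rule prodf_bounded[of \<psi>, OF assms]) blast
  obtain M where M: "M > 0" "\<And>x. M < norm x \<Longrightarrow> prodf \<psi> x = 0" by (rule prodf_support[of \<psi>, OF assms]) blast
  show ?thesis
  proof (rule that[of B M])
    show "B > 0" "M > 0" by fact+
    show "\<bar>ker \<psi> \<rho> x z\<bar> \<le> B / \<rho> ^ CARD('n)" if "\<rho> > 0" for \<rho> x z
      using B(2) that by (simp add: ker_def abs_divide divide_right_mono)
    show "norm (x - z) \<le> M * \<rho>" if "\<rho> > 0" "ker \<psi> \<rho> x z \<noteq> 0" for \<rho> x z
    proof -
      have "prodf \<psi> ((1 / \<rho>) *\<^sub>R (x - z)) \<noteq> 0" using that by (auto simp: ker_def)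
      then have "norm ((1 / \<rho>) *\<^sub>R (x - z)) \<le> M" using M(2) not_le by blast
      then show ?thesis using that by (simp add: divide_le_eq)
    qed
  qed
qed

lemma W_path_DERIV:
  fixes p h :: "real^'n::finite"
  assumes g: "loc_int g" and b: "\<And>i. bump (\<psi> i)" and pos: "\<rho>0 + \<tau> * \<rho>1 > 0"
  shows "((\<lambda>\<tau>. W g \<psi> (\<rho>0 + \<tau> * \<rho>1) (p + \<tau> *\<^sub>R h)) has_real_derivative
    (\<Sum>i\<in>UNIV. (1 / (\<rho>0 + \<tau> * \<rho>1)) *
       W g (\<psi>(i := deriv (\<lambda>t. (h $ i - \<rho>1 * t) * \<psi> i t))) (\<rho>0 + \<tau> * \<rho>1) (p + \<tau> *\<^sub>R h))) (at \<tau>)"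
proof -
  define \<psi>' where "\<psi>' i = \<psi>(i := deriv (\<lambda>t. (h $ i - \<rho>1 * t) * \<psi> i t))" for i
  let ?\<rho> = "\<lambda>\<tau>. \<rho>0 + \<tau> * \<rho>1"
  let ?x = "\<lambda>\<tau>. p + \<tau> *\<^sub>R h"
  have b': "bump (\<psi>' i j)" for i j
  proof -
    have "smooth (\<lambda>t. (- \<rho>1) * t + h $ i)" by (rule smooth_affine[of "\<lambda>t. t"]) auto
    then have "smooth (\<lambda>t. h $ i - \<rho>1 * t)" by simp
    from bump_deriv[OF bump_mult[OF this b, of i]] show ?thesis
      unfolding \<psi>'_def by (simp add: b)
  qed
  have "\<exists>B M. B > 0 \<and> M > 0 \<and> (\<forall>\<rho> x z. \<rho> > 0 \<longrightarrow> \<bar>ker (\<psi>' i) \<rho> x z\<bar> \<le> B / \<rho> ^ CARD('n)) \<and>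
    (\<forall>\<rho> x z. \<rho> > 0 \<longrightarrow> ker (\<psi>' i) \<rho> x z \<noteq> 0 \<longrightarrow> norm (x - z) \<le> M * \<rho>)" for i
    by (rule ker_bounds[of "\<psi>' i", OF b']) blast
  then obtain B M where BM: "\<And>i. B i > 0" "\<And>i. M i > 0"
    "\<And>i \<rho> x z. \<rho> > 0 \<Longrightarrow> \<bar>ker (\<psi>' i) \<rho> x z\<bar> \<le> B i / \<rho> ^ CARD('n)"
    "\<And>i \<rho> x z. \<rho> > 0 \<Longrightarrow> ker (\<psi>' i) \<rho> x z \<noteq> 0 \<Longrightarrow> norm (x - z) \<le> M i * \<rho>"
    by metis
  \<comment> \<open>Within this distance of \<tau> the scale stays between one half and twice its
    value at \<tau>; adding 1 covers the case \<rho>1 = 0.\<close>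
  define d where "d = ?\<rho> \<tau> / (2 * (\<bar>\<rho>1\<bar> + 1))"
  have d: "d > 0" using pos unfolding d_def by (intro divide_pos_pos) auto
  have near: "?\<rho> t \<ge> ?\<rho> \<tau> / 2" "?\<rho> t \<le> 2 * ?\<rho> \<tau>" "\<bar>t\<bar> \<le> \<bar>\<tau>\<bar> + d" if "t \<in> ball \<tau> d" for t
  proof -
    have t: "\<bar>t - \<tau>\<bar> < d" using that by (simp add: dist_real_def abs_minus_commute)
    have "\<bar>(t - \<tau>) * \<rho>1\<bar> \<le> d * (\<bar>\<rho>1\<bar> + 1)"
      using t d unfolding abs_mult by (intro mult_mono) auto
    also have "\<dots> = ?\<rho> \<tau> / 2" unfolding d_def by (simp add: field_simps)
    finally have le: "\<bar>(t - \<tau>) * \<rho>1\<bar> \<le> ?\<rho> \<tau> / 2" .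
    define e where "e = (t - \<tau>) * \<rho>1"
    have "?\<rho> t = ?\<rho> \<tau> + e" by (simp add: e_def algebra_simps)
    then show "?\<rho> t \<ge> ?\<rho> \<tau> / 2" "?\<rho> t \<le> 2 * ?\<rho> \<tau>"
      using abs_le_D1[OF le[folded e_def]] abs_le_D2[OF le[folded e_def]] pos by argo+
    show "\<bar>t\<bar> \<le> \<bar>\<tau>\<bar> + d" using t by linarith
  qed
  \<comment> \<open>A ball about 0 that contains the supports of all kernels with parameter near
    \<tau>: bound on the centre plus bound on the support radius.\<close>
  define R where "R = norm p + (\<bar>\<tau>\<bar> + d) * norm h + (\<Sum>i\<in>UNIV. M i) * (2 * ?\<rho> \<tau>)"
  define r where "r = ?\<rho> \<tau> / 2"
  have r: "r > 0" using pos by (simp add: r_def)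
  define C where "C = (\<Sum>i\<in>UNIV. (1 / r) * (B i / r ^ CARD('n)))"
  let ?f' = "\<lambda>t z. g z * (\<Sum>i\<in>UNIV. (1 / ?\<rho> t) * ker (\<psi>' i) (?\<rho> t) (?x t) z)"
  have "((\<lambda>t. LINT z|lborel. g z * ker \<psi> (?\<rho> t) (?x t) z) has_real_derivative (LINT z|lborel. ?f' \<tau> z)) (at \<tau>)"
  proof (rule has_real_derivative_integral[where d=d and w="\<lambda>z. \<bar>g z * (C * indicator (cball 0 R) z)\<bar>"])
    show "integrable lborel (\<lambda>z. \<bar>g z * (C * indicator (cball 0 R) z)\<bar>)"
      by (intro integrable_abs loc_int_integrable_mult[OF g, where B="\<bar>C\<bar>" and R=R])
        (auto simp: indicator_def abs_mult split: if_splits)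
    show "d > 0" by fact
    show "integrable lborel (\<lambda>z. g z * ker \<psi> (?\<rho> t) (?x t) z)" if "t \<in> ball \<tau> d" for t
      using near(1)[OF that] pos by (intro ker_integrable[of g \<psi>, OF g b]) argo
    show "((\<lambda>t. g z * ker \<psi> (?\<rho> t) (?x t) z) has_real_derivative ?f' t z) (at t)"
      if "t \<in> ball \<tau> d" for t z
    proof (rule DERIV_cmult)
      have "?\<rho> t > 0" using near(1)[OF that] pos by argo
      then show "((\<lambda>t. ker \<psi> (?\<rho> t) (?x t) z) has_real_derivative
          (\<Sum>i\<in>UNIV. (1 / ?\<rho> t) * ker (\<psi>' i) (?\<rho> t) (?x t) z)) (at t)"
        unfolding \<psi>'_def by (rule path_ker_DERIV[of \<psi>, OF b])
    qed
    have [measurable]: "ker (\<psi>' i) \<rho> x \<in> borel_measurable borel" for i \<rho> x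
      by (rule ker_measurable[of "\<psi>' i", OF b'])
    have [measurable]: "g \<in> borel_measurable borel" using g by (rule loc_int_measurable)
    show "?f' \<tau> \<in> borel_measurable lborel" by measurable
    show "\<bar>?f' t z\<bar> \<le> \<bar>g z * (C * indicator (cball 0 R) z)\<bar>" if t: "t \<in> ball \<tau> d" for t z
    proof -
      have \<rho>: "?\<rho> t \<ge> r" using near(1)[OF t] by (simp add: r_def)
      have Cnn: "C \<ge> 0" unfolding C_def using BM(1) r
        by (intro sum_nonneg mult_nonneg_nonneg) (auto intro: less_imp_le)
      have bnd: "\<bar>(1 / ?\<rho> t) * ker (\<psi>' i) (?\<rho> t) (?x t) z\<bar>
          \<le> (1 / r) * (B i / r ^ CARD('n)) * indicator (cball 0 R) z" for i
      proof (cases "ker (\<psi>' i) (?\<rho> t) (?x t) z = 0")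
        case True
        then show ?thesis using BM(1)[of i] r by simp
      next
        case False
        have "norm (?x t - z) \<le> M i * ?\<rho> t" using BM(4)[of "?\<rho> t" i "?x t" z] False \<rho> r by simp
        also have "\<dots> \<le> (\<Sum>i\<in>UNIV. M i) * (2 * ?\<rho> \<tau>)"
          using near(2)[OF t] BM(2) \<rho> r pos
          by (intro mult_mono member_le_sum sum_nonneg) (auto intro: less_imp_le)
        finally have 1: "norm (?x t - z) \<le> (\<Sum>i\<in>UNIV. M i) * (2 * ?\<rho> \<tau>)" .
        have "norm (?x t) \<le> norm p + \<bar>t\<bar> * norm h" using norm_triangle_ineq[of p "t *\<^sub>R h"] by simp
        also have "\<bar>t\<bar> * norm h \<le> (\<bar>\<tau>\<bar> + d) * norm h"
          using near(3)[OF t] by (intro mult_right_mono) auto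
        finally have "norm z \<le> R"
          using 1 norm_triangle_ineq4[of "?x t" "?x t - z"] unfolding R_def by simp
        moreover have "\<bar>(1 / ?\<rho> t) * ker (\<psi>' i) (?\<rho> t) (?x t) z\<bar> \<le> (1 / r) * (B i / r ^ CARD('n))"
        proof -
          have "\<bar>ker (\<psi>' i) (?\<rho> t) (?x t) z\<bar> \<le> B i / (?\<rho> t) ^ CARD('n)"
            using BM(3)[of "?\<rho> t" i] \<rho> r by simp
          also have "\<dots> \<le> B i / r ^ CARD('n)"
            using \<rho> r BM(1)[of i] by (intro divide_left_mono power_mono mult_pos_pos zero_less_power) auto
          finally show ?thesis
            using \<rho> r unfolding abs_mult by (intro mult_mono) (auto intro: divide_left_mono)
        qed
        ultimately show ?thesis by simp
      qed
      have "\<bar>\<Sum>i\<in>UNIV. (1 / ?\<rho> t) * ker (\<psi>' i) (?\<rho> t) (?x t) z\<bar> \<le> C * indicator (cball 0 R) z"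
        unfolding C_def sum_distrib_right by (rule order_trans[OF sum_abs sum_mono[OF bnd]])
      then show ?thesis
        using Cnn unfolding abs_mult by (intro mult_left_mono) auto
    qed
  qed
  moreover have "(LINT z|lborel. ?f' \<tau> z) = (\<Sum>i\<in>UNIV. (1 / ?\<rho> \<tau>) * W g (\<psi>' i) (?\<rho> \<tau>) (?x \<tau>))"
  proof -
    have "(LINT z|lborel. ?f' \<tau> z) = (LINT z|lborel. (\<Sum>i\<in>UNIV. (1 / ?\<rho> \<tau>) * (g z * ker (\<psi>' i) (?\<rho> \<tau>) (?x \<tau>) z)))"
      by (simp add: sum_distrib_left mult.left_commute mult.commute)
    also have "\<dots> = (\<Sum>i\<in>UNIV. (1 / ?\<rho> \<tau>) * W g (\<psi>' i) (?\<rho> \<tau>) (?x \<tau>))"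
      unfolding W_def
      by (subst Bochner_Integration.integral_sum)
        (auto intro!: integrable_mult_right ker_integrable[of g, OF g b' pos])
    finally show ?thesis .
  qed
  ultimately show ?thesis unfolding W_def \<psi>'_def by simp
qed

section \<open>Oscillation, finite differences and extrapolation\<close>

text \<open>Mean oscillation is taken as an unnormalized double integral over pairs, since it is
  compared pair by pair with the double integral \<open>J\<close>.\<close>

definition osc :: "(real^'n::finite \<Rightarrow> real) \<Rightarrow> real^'n \<Rightarrow> real \<Rightarrow> ennreal" where
  "osc g x R = (\<integral>\<^sup>+z\<in>cball x R. (\<integral>\<^sup>+y\<in>cball x R. ennreal \<bar>g z - g y\<bar> \<partial>lborel) \<partial>lborel)"

lemma loc_int_cball:
  assumes "loc_int g"
  shows "integrable lborel (\<lambda>z. indicator (cball x R) z * g z)"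
proof -
  have "integrable lborel (\<lambda>z. g z * indicator (cball x R) z)"
  proof (rule loc_int_integrable_mult[OF assms, where B=1 and R="norm x + R"])
    show "norm z \<le> norm x + R" if "indicat_real (cball x R) z \<noteq> 0" for z
      using that norm_triangle_ineq4[of x "x - z"] by (auto simp: indicator_def dist_norm split: if_splits)
  qed (auto simp: indicator_def)
  then show ?thesis by (simp add: mult.commute)
qed

text \<open>The witness is the mean of \<open>g\<close> over the ball; the absolute value is pulled
  inside the average over \<open>y\<close>.\<close>

lemma osc_average:
  fixes g :: "real^'n::finite \<Rightarrow> real"
  assumes g: "loc_int g" and R: "R > 0"
  shows "\<exists>c. (\<integral>\<^sup>+z\<in>cball x R. ennreal \<bar>g z - c\<bar> \<partial>lborel) \<le> osc g x R / emeasure lborel (cball x R)"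
proof -
  have [measurable]: "g \<in> borel_measurable borel" using g by (rule loc_int_measurable)
  define S where "S = cball x R"
  have [measurable]: "S \<in> sets borel" by (simp add: S_def)
  define v where "v = measure lborel S"
  have ev: "emeasure lborel S = ennreal v" unfolding v_def S_def
    using emeasure_lborel_cball_finite[of x R] by (intro emeasure_eq_ennreal_measure) auto
  have v: "v > 0" unfolding v_def S_def using content_cball_gt_0_iff[of x R] R by simp
  define c where "c = (LINT y|lborel. indicator S y * g y) / v"
  have ind: "integrable lborel (\<lambda>y. indicator S y :: real)"
    using ev by simp
  have gi: "integrable lborel (\<lambda>y. indicator S y * g y)"
    unfolding S_def by (rule loc_int_cball[OF g])
  have "ennreal \<bar>g z - c\<bar> \<le> (\<integral>\<^sup>+y\<in>S. ennreal \<bar>g z - g y\<bar> \<partial>lborel) / ennreal v" for z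
  proof -
    have i: "integrable lborel (\<lambda>y. indicator S y * (g z - g y))"
      using ind gi by (simp add: right_diff_distrib)
    have "g z - c = (LINT y|lborel. indicator S y * (g z - g y)) / v"
      using ind gi v by (simp add: right_diff_distrib c_def v_def diff_divide_distrib)
    then have "ennreal \<bar>g z - c\<bar> = ennreal (norm (LINT y|lborel. indicator S y * (g z - g y))) / ennreal v"
      using v by (simp add: abs_divide divide_ennreal)
    also have "\<dots> \<le> (\<integral>\<^sup>+y. norm (indicator S y * (g z - g y)) \<partial>lborel) / ennreal v"
      by (intro divide_right_mono_ennreal integral_norm_bound_ennreal i)
    also have "(\<integral>\<^sup>+y. norm (indicator S y * (g z - g y)) \<partial>lborel) = (\<integral>\<^sup>+y\<in>S. ennreal \<bar>g z - g y\<bar> \<partial>lborel)"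
      by (intro nn_integral_cong) (auto simp: indicator_def)
    finally show ?thesis .
  qed
  then have "(\<integral>\<^sup>+z\<in>S. ennreal \<bar>g z - c\<bar> \<partial>lborel)
      \<le> (\<integral>\<^sup>+z. ((\<integral>\<^sup>+y\<in>S. ennreal \<bar>g z - g y\<bar> \<partial>lborel) * indicator S z) / ennreal v \<partial>lborel)"
    by (intro nn_integral_mono) (auto simp: indicator_def)
  also have "\<dots> = osc g x R / ennreal v"
    unfolding osc_def S_def[symmetric] by (rule nn_integral_divide) measurable
  finally show ?thesis unfolding S_def[symmetric] ev by blast
qed

text \<open>On the large ball \<open>g\<close> is replaced by a constant \<open>a\<close>. The
  average of a constant is \<open>a\<close> times the mass of the kernel, and this mass depends on
  neither scale nor centre; so one \<open>c\<close> serves all admissible pairs at once.\<close>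

lemma W_near_const:
  fixes g :: "real^'n::finite \<Rightarrow> real"
  assumes g: "loc_int g" and b: "\<And>i. bump (\<psi> i)" and R: "R > 0" and r: "r > 0"
    and B: "\<And>y. \<bar>prodf \<psi> y\<bar> \<le> B" and M: "\<And>y. prodf \<psi> y \<noteq> 0 \<Longrightarrow> norm y \<le> M"
  shows "\<exists>c. \<forall>\<rho>\<ge>r. \<forall>x. cball x (M * \<rho>) \<subseteq> cball X R \<longrightarrow>
     ennreal \<bar>W g \<psi> \<rho> x - c\<bar> \<le> ennreal (B / r ^ CARD('n)) * (osc g X R / emeasure lborel (cball X R))"
proof -
  have [measurable]: "g \<in> borel_measurable borel" using g by (rule loc_int_measurable)
  obtain a where a: "(\<integral>\<^sup>+z\<in>cball X R. ennreal \<bar>g z - a\<bar> \<partial>lborel) \<le> osc g X R / emeasure lborel (cball X R)"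
    using osc_average[OF g R] by blast
  define k where "k = (LINT y|lborel. prodf \<psi> y)"
  show ?thesis
  proof (intro exI[of _ "a * k"] allI impI)
    fix \<rho> x assume \<rho>: "r \<le> \<rho>" and sub: "cball x (M * \<rho>) \<subseteq> cball X R"
    have \<rho>0: "\<rho> > 0" using r \<rho> by simp
    have [measurable]: "ker \<psi> \<rho> x \<in> borel_measurable borel" by (rule ker_measurable[of \<psi>, OF b])
    have i1: "integrable lborel (\<lambda>z. g z * ker \<psi> \<rho> x z)" by (rule ker_integrable[of g \<psi>, OF g b \<rho>0])
    have [measurable]: "cball X R \<in> sets borel" by simp
    have "loc_int (\<lambda>_::real^'n. a)" by (rule loc_int_continuous) simp
    then have i2: "integrable lborel (\<lambda>z. a * ker \<psi> \<rho> x z)" by (rule ker_integrable[of _ \<psi>, OF _ b \<rho>0])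
    have "W g \<psi> \<rho> x - a * k = (LINT z|lborel. g z * ker \<psi> \<rho> x z - a * ker \<psi> \<rho> x z)"
      using i1 i2 integral_ker[of \<psi> \<rho> x, OF b \<rho>0] by (simp add: W_def k_def)
    then have "ennreal \<bar>W g \<psi> \<rho> x - a * k\<bar> \<le> (\<integral>\<^sup>+z. norm (g z * ker \<psi> \<rho> x z - a * ker \<psi> \<rho> x z) \<partial>lborel)"
      using integral_norm_bound_ennreal[OF Bochner_Integration.integrable_diff[OF i1 i2]] by simp
    also have "\<dots> \<le> (\<integral>\<^sup>+z. ennreal (B / r ^ CARD('n)) * (ennreal \<bar>g z - a\<bar> * indicator (cball X R) z) \<partial>lborel)"
    proof (rule nn_integral_mono)
      fix z
      have eq: "norm (g z * ker \<psi> \<rho> x z - a * ker \<psi> \<rho> x z) = \<bar>ker \<psi> \<rho> x z\<bar> * \<bar>g z - a\<bar>"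
        by (simp add: left_diff_distrib[symmetric] abs_mult mult.commute)
      show "ennreal (norm (g z * ker \<psi> \<rho> x z - a * ker \<psi> \<rho> x z))
        \<le> ennreal (B / r ^ CARD('n)) * (ennreal \<bar>g z - a\<bar> * indicator (cball X R) z)"
      proof (cases "ker \<psi> \<rho> x z = 0")
        case False
        then have "prodf \<psi> ((1 / \<rho>) *\<^sub>R (x - z)) \<noteq> 0" by (auto simp: ker_def)
        from M[OF this] have "norm (x - z) \<le> M * \<rho>" using \<rho>0 by (simp add: divide_le_eq)
        then have z: "z \<in> cball X R" using sub by (auto simp: dist_norm)
        have Bn: "B \<ge> 0" using B[of 0] by linarith
        have "\<bar>ker \<psi> \<rho> x z\<bar> \<le> B / \<rho> ^ CARD('n)"
          unfolding ker_def using B \<rho>0 by (simp add: abs_divide divide_right_mono)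
        also have "\<dots> \<le> B / r ^ CARD('n)"
          using \<rho> r Bn by (intro divide_left_mono power_mono mult_pos_pos zero_less_power) auto
        finally have le: "\<bar>ker \<psi> \<rho> x z\<bar> \<le> B / r ^ CARD('n)" .
        have "ennreal (B / r ^ CARD('n)) * (ennreal \<bar>g z - a\<bar> * indicator (cball X R) z)
            = ennreal (B / r ^ CARD('n) * \<bar>g z - a\<bar>)"
          unfolding ennreal_mult''[OF abs_ge_zero] using z by simp
        then show ?thesis
          unfolding eq using le by (simp only:) (intro ennreal_leI mult_right_mono, auto)
      qed simp
    qed
    also have "\<dots> = ennreal (B / r ^ CARD('n)) * (\<integral>\<^sup>+z\<in>cball X R. ennreal \<bar>g z - a\<bar> \<partial>lborel)"
      by (rule nn_integral_cmult) measurable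
    also have "\<dots> \<le> ennreal (B / r ^ CARD('n)) * (osc g X R / emeasure lborel (cball X R))"
      by (intro mult_left_mono a) simp
    finally show "ennreal \<bar>W g \<psi> \<rho> x - a * k\<bar>
      \<le> ennreal (B / r ^ CARD('n)) * (osc g X R / emeasure lborel (cball X R))" .
  qed
qed

section \<open>Approximation by polynomials, finite differences and extrapolation\<close>

definition near_poly :: "nat \<Rightarrow> real \<Rightarrow> (real \<Rightarrow> real) \<Rightarrow> real set \<Rightarrow> bool" where
  "near_poly k e f T \<longleftrightarrow> (\<exists>c. \<forall>\<tau>\<in>T. \<bar>f \<tau> - (\<Sum>i\<le>k. c i * \<tau> ^ i)\<bar> \<le> e)"

text \<open>The antiderivative of the approximating polynomials has degree one more, and the mean
  value inequality multiplies the error by the length of the interval. The factor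
  \<open>CARD('n)\<close> counts the partial derivatives that add up to the derivative of
  \<open>f\<close>.\<close>

lemma near_poly_integrate:
  fixes F :: "'n::finite \<Rightarrow> real \<Rightarrow> real"
  assumes D: "\<And>\<tau>. \<tau> \<in> {a..b} \<Longrightarrow> (f has_real_derivative (\<Sum>i\<in>UNIV. F i \<tau>)) (at \<tau>)"
    and F: "\<And>i. near_poly k e (F i) {a..b}" and ab: "a \<le> b"
  shows "near_poly (Suc k) (real CARD('n) * (b - a) * e) f {a..b}"
proof -
  from F obtain c where c: "\<And>i \<tau>. \<tau> \<in> {a..b} \<Longrightarrow> \<bar>F i \<tau> - (\<Sum>j\<le>k. c i j * \<tau> ^ j)\<bar> \<le> e"
    unfolding near_poly_def by metis
  define Q where "Q \<tau> = (\<Sum>j\<le>k. ((\<Sum>i\<in>UNIV. c i j) / real (Suc j)) * \<tau> ^ Suc j)" for \<tau>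
  have Q: "(Q has_real_derivative (\<Sum>i\<in>UNIV. \<Sum>j\<le>k. c i j * \<tau> ^ j)) (at \<tau>)" for \<tau>
  proof -
    have "((\<lambda>\<tau>. ((\<Sum>i\<in>UNIV. c i j) / real (Suc j)) * \<tau> ^ Suc j) has_real_derivative
        (\<Sum>i\<in>UNIV. c i j) * \<tau> ^ j) (at \<tau>)" for j
      by (rule derivative_eq_intros refl)+ (simp del: of_nat_Suc)
    then have "(Q has_real_derivative (\<Sum>j\<le>k. (\<Sum>i\<in>UNIV. c i j) * \<tau> ^ j)) (at \<tau>)"
      unfolding Q_def[abs_def] by (intro DERIV_sum)
    then show ?thesis by (simp add: sum_distrib_right sum.swap[of _ UNIV])
  qed
  have G: "\<bar>(f \<tau> - Q \<tau>) - (f a - Q a)\<bar> \<le> real CARD('n) * (b - a) * e" if \<tau>: "\<tau> \<in> {a..b}" for \<tau>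
  proof -
    have e: "e \<ge> 0" using c[OF \<tau>] abs_ge_zero order_trans by blast
    have "norm ((f \<tau> - Q \<tau>) - (f a - Q a)) \<le> (real CARD('n) * e) * norm (\<tau> - a)"
    proof (rule field_differentiable_bound[where S="{a..b}" and
          f'="\<lambda>\<tau>. (\<Sum>i\<in>UNIV. F i \<tau>) - (\<Sum>i\<in>UNIV. \<Sum>j\<le>k. c i j * \<tau> ^ j)"])
      fix z assume z: "z \<in> {a..b}"
      show "((\<lambda>\<tau>. f \<tau> - Q \<tau>) has_real_derivative
          (\<Sum>i\<in>UNIV. F i z) - (\<Sum>i\<in>UNIV. \<Sum>j\<le>k. c i j * z ^ j)) (at z within {a..b})"
        using DERIV_diff[OF D[OF z] Q[of z]] by (rule has_field_derivative_at_within)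
      have "norm ((\<Sum>i\<in>UNIV. F i z) - (\<Sum>i\<in>UNIV. \<Sum>j\<le>k. c i j * z ^ j))
          = \<bar>\<Sum>i\<in>UNIV. F i z - (\<Sum>j\<le>k. c i j * z ^ j)\<bar>" by (simp add: sum_subtractf)
      also have "\<dots> \<le> (\<Sum>i\<in>(UNIV::'n set). e)" by (rule order_trans[OF sum_abs sum_mono[OF c[OF z]]])
      finally show "norm ((\<Sum>i\<in>UNIV. F i z) - (\<Sum>i\<in>UNIV. \<Sum>j\<le>k. c i j * z ^ j)) \<le> real CARD('n) * e"
        by simp
    qed (use \<tau> ab in auto)
    also have "\<dots> \<le> (real CARD('n) * e) * (b - a)" using \<tau> e by (intro mult_left_mono) auto
    finally show ?thesis by (simp add: mult_ac)
  qed
  \<comment> \<open>The constant of integration becomes the coefficient of degree 0; the integrated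
    coefficients move up by one.\<close>
  define d where "d j = (case j of 0 \<Rightarrow> f a - Q a | Suc j \<Rightarrow> (\<Sum>i\<in>UNIV. c i j) / real (Suc j))" for j
  have eq: "f \<tau> - (\<Sum>j\<le>Suc k. d j * \<tau> ^ j) = (f \<tau> - Q \<tau>) - (f a - Q a)" for \<tau>
    by (subst sum.atMost_Suc_shift) (simp add: d_def Q_def)
  have "\<forall>\<tau>\<in>{a..b}. \<bar>f \<tau> - (\<Sum>j\<le>Suc k. d j * \<tau> ^ j)\<bar> \<le> real CARD('n) * (b - a) * e"
    unfolding eq using G by blast
  then show ?thesis unfolding near_poly_def by blast
qed

text \<open>The absorption identity j (N + 1 choose j) = (N + 1) (N choose j - 1) trades one power
  of j for a step down in N; expanding (j + 1)^i' leaves only powers covered by the induction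
  hypothesis.\<close>

lemma alternating_binomial_power_sum:
  "i < N \<Longrightarrow> (\<Sum>j\<le>N. (-1) ^ j * real (N choose j) * real j ^ i) = 0"
proof (induction N arbitrary: i)
  case (Suc N)
  show ?case
  proof (cases i)
    case 0
    then show ?thesis using choose_alternating_sum[of "Suc N", where ?'a=real] by simp
  next
    case (Suc i')
    have pow: "(real j + 1) ^ i' = (\<Sum>l\<le>i'. real (i' choose l) * real j ^ l)" for j
      by (simp add: binomial_ring)
    have "(\<Sum>j\<le>Suc N. (-1) ^ j * real (Suc N choose j) * real j ^ i)
        = (\<Sum>j\<le>N. (-1) ^ Suc j * real (Suc N choose Suc j) * real (Suc j) ^ Suc i')"
      unfolding Suc by (subst sum.atMost_Suc_shift) simp
    also have "\<dots> = (\<Sum>j\<le>N. - real (Suc N) * ((-1) ^ j * real (N choose j) * (real j + 1) ^ i'))"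
    proof (rule sum.cong[OF refl])
      fix j
      have A: "real (Suc j) * real (Suc N choose Suc j) = real (Suc N) * real (N choose j)"
        unfolding of_nat_mult[symmetric] Suc_times_binomial ..
      have B: "(-1) ^ Suc j * real (Suc N choose Suc j) * real (Suc j) ^ Suc i'
          = - ((-1) ^ j * (real (Suc j) * real (Suc N choose Suc j)) * (real j + 1) ^ i')"
        by (simp add: mult_ac add.commute del: binomial_Suc_Suc)
      show "(-1) ^ Suc j * real (Suc N choose Suc j) * real (Suc j) ^ Suc i'
          = - real (Suc N) * ((-1) ^ j * real (N choose j) * (real j + 1) ^ i')"
        unfolding B A by (simp add: mult_ac del: of_nat_Suc)
    qed
    also have "\<dots> = - real (Suc N) * (\<Sum>j\<le>N. (-1) ^ j * real (N choose j) * (\<Sum>l\<le>i'. real (i' choose l) * real j ^ l))"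
      by (simp only: pow sum_distrib_left)
    also have "(\<Sum>j\<le>N. (-1) ^ j * real (N choose j) * (\<Sum>l\<le>i'. real (i' choose l) * real j ^ l))
       = (\<Sum>l\<le>i'. real (i' choose l) * (\<Sum>j\<le>N. (-1) ^ j * real (N choose j) * real j ^ l))"
      unfolding sum_distrib_left by (subst sum.swap) (simp add: mult_ac)
    also have "\<dots> = 0"
      using Suc.IH Suc.prems \<open>i = Suc i'\<close> by (intro sum.neutral) auto
    finally show ?thesis by simp
  qed
qed simp

lemma finite_difference_poly:
  "(\<Sum>j\<le>Suc m. (-1) ^ j * real (Suc m choose j) * (\<Sum>i\<le>m. c i * (real j * d) ^ i)) = 0"
proof -
  have "(\<Sum>j\<le>Suc m. (-1) ^ j * real (Suc m choose j) * (\<Sum>i\<le>m. c i * (real j * d) ^ i))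
    = (\<Sum>i\<le>m. c i * d ^ i * (\<Sum>j\<le>Suc m. (-1) ^ j * real (Suc m choose j) * real j ^ i))"
    unfolding sum_distrib_left by (subst sum.swap) (simp add: mult_ac power_mult_distrib)
  also have "\<dots> = 0"
    using alternating_binomial_power_sum[of _ "Suc m"] by (intro sum.neutral) auto
  finally show ?thesis .
qed

lemma sum_abs_binomial: "(\<Sum>j\<le>N. \<bar>(-1) ^ j * real (N choose j)\<bar>) = 2 ^ N"
proof -
  have "(\<Sum>j\<le>N. \<bar>(-1) ^ j * real (N choose j)\<bar>) = real (\<Sum>j\<le>N. N choose j)"
    by (simp add: abs_mult power_abs)
  also have "\<dots> = 2 ^ N" by (subst choose_row_sum) simp
  finally show ?thesis .
qed

lemma finite_difference_near_poly:
  assumes "near_poly m e f T" "\<And>j. j \<le> Suc m \<Longrightarrow> real j \<in> T"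
  shows "\<bar>\<Sum>j\<le>Suc m. (-1) ^ j * real (Suc m choose j) * f (real j)\<bar> \<le> 2 ^ Suc m * e"
proof -
  obtain c where c: "\<And>\<tau>. \<tau> \<in> T \<Longrightarrow> \<bar>f \<tau> - (\<Sum>i\<le>m. c i * \<tau> ^ i)\<bar> \<le> e"
    using assms(1) by (auto simp: near_poly_def)
  let ?w = "\<lambda>j. (-1) ^ j * real (Suc m choose j)"
  let ?P = "\<lambda>j. \<Sum>i\<le>m. c i * real j ^ i"
  have "(\<Sum>j\<le>Suc m. ?w j * f (real j)) = (\<Sum>j\<le>Suc m. ?w j * (f (real j) - ?P j))"
    using finite_difference_poly[of m c 1] by (simp add: right_diff_distrib sum_subtractf)
  also have "\<bar>\<dots>\<bar> \<le> (\<Sum>j\<le>Suc m. \<bar>?w j\<bar> * e)"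
    by (intro order_trans[OF sum_abs sum_mono]) (auto simp: abs_mult intro!: mult_left_mono c assms(2))
  also have "\<dots> = 2 ^ Suc m * e" using sum_abs_binomial[of "Suc m"] by (simp add: sum_distrib_right[symmetric])
  finally show ?thesis .
qed

text \<open>The extrapolation of \<open>f\<close> to \<open>0\<close> from the points \<open>R, 2R, \<dots>, (m+1)R\<close>; it is exact on
  polynomials of degree at most \<open>m\<close>.\<close>

definition extrap :: "nat \<Rightarrow> (real \<Rightarrow> real) \<Rightarrow> real \<Rightarrow> real" where
  "extrap m f R = - (\<Sum>j=1..Suc m. (-1) ^ j * real (Suc m choose j) * f (real j * R))"

text \<open>On the approximating polynomial both extrapolations return its value \<open>c 0\<close>
  at 0. Hence each differs from \<open>c 0\<close> by at most e times the sum of the absolute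
  weights, whatever the step.\<close>

lemma extrap_near_poly:
  assumes "near_poly m e f T" and T: "\<And>j. j \<in> {1..Suc m} \<Longrightarrow> real j * R \<in> T \<and> real j * R' \<in> T" and e: "e \<ge> 0"
  shows "\<bar>extrap m f R - extrap m f R'\<bar> \<le> 2 * 2 ^ Suc m * e"
proof -
  obtain c where c: "\<And>\<tau>. \<tau> \<in> T \<Longrightarrow> \<bar>f \<tau> - (\<Sum>i\<le>m. c i * \<tau> ^ i)\<bar> \<le> e"
    using assms(1) by (auto simp: near_poly_def)
  let ?w = "\<lambda>j. (-1) ^ j * real (Suc m choose j)"
  let ?P = "\<lambda>\<tau>. \<Sum>i\<le>m. c i * \<tau> ^ i"
  have S: "{..Suc m} = insert 0 {1..Suc m}" by auto
  have *: "\<bar>extrap m f R - c 0\<bar> \<le> 2 ^ Suc m * e" if R: "\<And>j. j \<in> {1..Suc m} \<Longrightarrow> real j * R \<in> T" for R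
  proof -
    have "?P 0 = c 0" by (simp add: power_0_left if_distrib[of "\<lambda>t. c _ * t"] cong: if_cong)
    then have "c 0 = - (\<Sum>j=1..Suc m. ?w j * ?P (real j * R))"
      using finite_difference_poly[of m c R] unfolding S by (simp add: power_0_left)
    then have "extrap m f R - c 0 = - (\<Sum>j=1..Suc m. ?w j * (f (real j * R) - ?P (real j * R)))"
      unfolding extrap_def by (simp add: right_diff_distrib sum_subtractf)
    also have "\<bar>\<dots>\<bar> \<le> (\<Sum>j=1..Suc m. \<bar>?w j\<bar> * e)"
      unfolding abs_minus_cancel
      by (intro order_trans[OF sum_abs sum_mono]) (auto simp: abs_mult intro!: mult_left_mono c R)
    also have "\<dots> \<le> (\<Sum>j\<le>Suc m. \<bar>?w j\<bar> * e)"
      using e by (intro sum_mono2) auto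
    also have "\<dots> = 2 ^ Suc m * e" using sum_abs_binomial[of "Suc m"] by (simp add: sum_distrib_right[symmetric])
    finally show ?thesis .
  qed
  have "\<bar>extrap m f R - c 0\<bar> \<le> 2 ^ Suc m * e" "\<bar>extrap m f R' - c 0\<bar> \<le> 2 ^ Suc m * e"
    using * T by blast+
  then show ?thesis by linarith
qed

section \<open>Smoothing by extrapolated averages\<close>

text \<open>Each order of differentiation contributes one factor bounded by \<open>H\<close> on
  [-1, 1]. A point whose coordinates are at most 1 in absolute value has norm at most
  \<open>CARD('n)\<close>, which is the support radius used from here on.\<close>

lemma prodf_path_fac_bound:
  assumes b1: "\<And>t. \<bar>b t\<bar> \<le> 1" and bs: "\<And>t. b t \<noteq> 0 \<Longrightarrow> \<bar>t\<bar> \<le> 1"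
    and H: "\<And>i t. \<bar>t\<bar> \<le> 1 \<Longrightarrow> \<bar>h $ i - \<rho>1 * t\<bar> \<le> H"
  shows "\<bar>prodf (path_fac h \<rho>1 b \<alpha>) y\<bar> \<le> H ^ sum \<alpha> UNIV"
    and "prodf (path_fac h \<rho>1 b \<alpha>) (y::real^'n::finite) \<noteq> 0 \<Longrightarrow> norm y \<le> real CARD('n)"
proof -
  have H0: "H \<ge> 0" by (rule order_trans[OF abs_ge_zero H[of 0]]) simp
  have "\<bar>path_fac h \<rho>1 b \<alpha> i t\<bar> \<le> H ^ \<alpha> i" for i t
  proof (cases "b t = 0")
    case False
    have "\<bar>path_fac h \<rho>1 b \<alpha> i t\<bar> = \<bar>h $ i - \<rho>1 * t\<bar> ^ \<alpha> i * \<bar>b t\<bar>"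
      by (simp add: path_fac_def abs_mult power_abs)
    also have "\<dots> \<le> H ^ \<alpha> i * 1"
      using H[OF bs[OF False], of i] b1[of t] H0 by (intro mult_mono power_mono) auto
    finally show ?thesis by simp
  qed (use H0 in \<open>simp add: path_fac_def\<close>)
  then have "\<bar>prodf (path_fac h \<rho>1 b \<alpha>) y\<bar> \<le> (\<Prod>i\<in>UNIV. H ^ \<alpha> i)"
    unfolding prodf_def abs_prod by (intro prod_mono) auto
  then show "\<bar>prodf (path_fac h \<rho>1 b \<alpha>) y\<bar> \<le> H ^ sum \<alpha> UNIV" by (simp add: power_sum)
  show "norm y \<le> real CARD('n)" if "prodf (path_fac h \<rho>1 b \<alpha>) y \<noteq> 0"
  proof -
    have "path_fac h \<rho>1 b \<alpha> i (y $ i) \<noteq> 0" for i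
      using that unfolding prodf_def by (auto simp: prod_zero_iff)
    then have "\<bar>y $ i\<bar> \<le> 1" for i by (intro bs) (auto simp: path_fac_def)
    then show ?thesis using norm_le_card_cart[of y 1] by simp
  qed
qed

text \<open>Collects the powers of R: R^m from m integrations over a path of length comparable to R,
  one R^n from the size of the kernel and one from the volume of the ball.\<close>

lemma step_const_algebra:
  fixes R :: real
  shows "k * ((c * (a * R)) ^ m * (1 ^ m / (R / 2) ^ n * (E / (v * (l * R) ^ n))))
    = k * ((c * a) ^ m * (2 ^ n / (v * l ^ n))) * (R ^ m / R ^ (2 * n)) * E"
proof -
  have "R ^ (2 * n) = R ^ n * R ^ n" by (simp add: mult_2 power_add)
  then show ?thesis by (simp add: power_mult_distrib power_divide mult_ac)
qed

lemma diff_const_algebra: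
  fixes R :: real
  shows "k * (k * (c ^ m * (R ^ m / R ^ n * (E / (v * (l * R) ^ n)))))
    = k * (k * (c ^ m * (1 / (v * l ^ n)))) * (R ^ m / R ^ (2 * n)) * E"
proof -
  have "R ^ (2 * n) = R ^ n * R ^ n" by (simp add: mult_2 power_add)
  then show ?thesis by (simp add: power_mult_distrib mult_ac)
qed

lemma path_fac_zero: "path_fac h \<rho>1 b (\<lambda>_. 0) = (\<lambda>_. b)"
  by (simp add: path_fac_def fun_eq_iff)

definition std_bump :: "real \<Rightarrow> real" where
  "std_bump t = flat_exp 1 (1 + t) * flat_exp 1 (1 - t)"

lemma std_bump_nonneg: "0 \<le> std_bump t"
  and std_bump_abs_le_1: "\<bar>std_bump t\<bar> \<le> 1"
  and std_bump_support: "std_bump t \<noteq> 0 \<Longrightarrow> \<bar>t\<bar> \<le> 1"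
  by (auto simp: std_bump_def flat_exp_one_bounds abs_mult intro!: mult_le_one)
    (auto simp: flat_exp_def abs_le_iff split: if_splits)

lemma std_bump_0: "std_bump 0 > 0"
  by (simp add: std_bump_def flat_exp_def)

lemma bump_std_bump: "bump std_bump"
proof (rule bumpI[where M=1])
  have "smooth (\<lambda>t. flat_exp 1 (1 * t + 1) * flat_exp 1 ((- 1) * t + 1))"
    by (intro smooth_mult smooth_affine smooth_flat_exp)
  then show "smooth std_bump" by (simp add: std_bump_def[abs_def] add.commute)
  show "std_bump t = 0" if "1 < \<bar>t\<bar>" for t
    using std_bump_support[of t] that by linarith
qed

text \<open>With zero integral the nonnegative continuous bump would vanish everywhere, also at 0.
  The bump is not normalized, so its mass is divided out at the end.\<close>

lemma integral_std_bump_pos: "(LINT y|lborel. prodf (\<lambda>_. std_bump) y) > 0" (is "?I > 0")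
proof -
  have one: "loc_int (\<lambda>_. 1)" by (rule loc_int_continuous) simp
  have i: "integrable lborel (prodf (\<lambda>_::'a. std_bump))"
    using loc_int_prodf[OF one, of "\<lambda>_. std_bump", OF bump_std_bump] by simp
  have nn: "0 \<le> prodf (\<lambda>_. std_bump) y" for y :: "real^'a"
    unfolding prodf_def by (intro prod_nonneg) (simp add: std_bump_nonneg)
  have "?I \<noteq> 0"
  proof
    assume "?I = 0"
    then have "AE y in lborel. prodf (\<lambda>_. std_bump) (y::real^'a) = 0"
      using integral_nonneg_eq_0_iff_AE[OF i] nn by simp
    from AE_completion[OF this]
    have "AE y in lebesgue. (y::real^'a) \<in> {y. prodf (\<lambda>_. std_bump) y = 0}" by simp
    moreover have "continuous_on UNIV (prodf (\<lambda>_::'a. std_bump))"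
      by (rule prodf_continuous) (rule smooth_continuous[OF bump_smooth[OF bump_std_bump]])
    then have "closed {y::real^'a. prodf (\<lambda>_. std_bump) y = 0}"
      by (intro closed_Collect_eq) auto
    ultimately have "(0::real^'a) \<in> {y. prodf (\<lambda>_. std_bump) y = 0}"
      by (intro mem_closed_if_AE_lebesgue)
    then show False using std_bump_0 by (simp add: prodf_def)
  qed
  moreover have "?I \<ge> 0" by (rule Bochner_Integration.integral_nonneg) (rule nn)
  ultimately show ?thesis by simp
qed

lemma finite_multi_indices: "finite (multi_indices k :: ('n::finite \<Rightarrow> nat) set)"
proof (rule finite_subset)
  show "(multi_indices k :: ('n \<Rightarrow> nat) set) \<subseteq> PiE UNIV (\<lambda>_. {..k})"
  proof
    fix \<alpha> :: "'n \<Rightarrow> nat" assume "\<alpha> \<in> multi_indices k"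
    then have "\<alpha> i \<le> k" for i using member_le_sum[of i UNIV \<alpha>] by (auto simp: multi_indices_def)
    then show "\<alpha> \<in> PiE UNIV (\<lambda>_. {..k})" by auto
  qed
  show "finite (PiE (UNIV::'n set) (\<lambda>_. {..k}))" by (intro finite_PiE) auto
qed

text \<open>The leading factor comes from comparing two extrapolations, (n (m + 1))^m from m
  integrations along the path, 2^n from the smallest scale R / 2, and the denominator from the
  volume of the ball of radius (n + 1) (m + 1) R.\<close>

definition step_const :: "nat \<Rightarrow> nat \<Rightarrow> real" where
  "step_const m n = 2 * 2 ^ Suc m * ((real n * (real m + 1)) ^ m *
     (2 ^ n / (unit_ball_vol (real n) * ((real n + 1) * (real m + 1)) ^ n)))"

definition diff_const :: "nat \<Rightarrow> nat \<Rightarrow> real" where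
  "diff_const m n = 2 ^ Suc m * (2 ^ Suc m * ((real n * (real m + 1)) ^ m *
     (1 / (unit_ball_vol (real n) * ((real n + 1) * (real m + 1)) ^ n))))"

lemma step_const_pos: "n > 0 \<Longrightarrow> step_const m n > 0"
  and diff_const_pos: "n > 0 \<Longrightarrow> diff_const m n > 0"
  unfolding step_const_def diff_const_def
  by (intro mult_pos_pos divide_pos_pos zero_less_power; simp add: add_nonneg_pos)+

text \<open>The function \<open>g \<alpha>\<close> is the \<open>\<alpha>\<close>-th weak derivative of \<open>g 0\<close>; products of one-dimensional
  bumps suffice as test functions.\<close>

locale weak_system =
  fixes m :: nat and g :: "('n::finite \<Rightarrow> nat) \<Rightarrow> real^'n \<Rightarrow> real"
  assumes loc_int_g: "sum \<alpha> UNIV \<le> m \<Longrightarrow> loc_int (g \<alpha>)"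
    and by_parts: "sum \<alpha> UNIV < m \<Longrightarrow> (\<And>j. bump (q j)) \<Longrightarrow>
      (LINT z|lborel. g \<alpha> z * prodf (q(i := deriv (q i))) z)
        = - (LINT z|lborel. g (\<alpha>(i := Suc (\<alpha> i))) z * prodf q z)"
begin

lemma sum_fun_upd_Suc: "sum (\<alpha>(i := Suc (\<alpha> i))) UNIV = Suc (sum \<alpha> (UNIV :: 'n set))"
proof -
  have "sum (\<alpha>(i := Suc (\<alpha> i))) UNIV = Suc (\<alpha> i) + sum (\<alpha>(i := Suc (\<alpha> i))) (UNIV - {i})"
    by (subst sum.remove[of UNIV i]) auto
  also have "sum (\<alpha>(i := Suc (\<alpha> i))) (UNIV - {i}) = sum \<alpha> (UNIV - {i})" by (rule sum.cong) auto
  finally show ?thesis by (subst sum.remove[of UNIV i]) auto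
qed

text \<open>The kernel is differentiated as in \<open>path_ker_DERIV\<close> and the derivative is
  moved onto \<open>g \<alpha>\<close>. The inner derivative -1 / \<rho> and the sign of integration
  by parts cancel the prefactor 1 / \<rho> exactly, and the new factor
  \<open>h $ i - \<rho>1 * t\<close> raises the exponent in \<open>path_fac\<close>. So the family
  of averages is closed under path derivatives.\<close>

lemma path_DERIV:
  assumes \<alpha>: "sum \<alpha> UNIV < m" and b: "bump b" and pos: "\<rho>0 + \<tau> * \<rho>1 > 0"
  shows "((\<lambda>\<tau>. W (g \<alpha>) (path_fac h \<rho>1 b \<alpha>) (\<rho>0 + \<tau> * \<rho>1) (p + \<tau> *\<^sub>R h)) has_real_derivative
    (\<Sum>i\<in>UNIV. W (g (\<alpha>(i := Suc (\<alpha> i)))) (path_fac h \<rho>1 b (\<alpha>(i := Suc (\<alpha> i)))) (\<rho>0 + \<tau> * \<rho>1) (p + \<tau> *\<^sub>R h))) (at \<tau>)"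
proof -
  define \<rho> where "\<rho> = \<rho>0 + \<tau> * \<rho>1"
  define x where "x = p + \<tau> *\<^sub>R h"
  have \<rho>: "\<rho> > 0" using pos by (simp add: \<rho>_def)
  let ?P = "path_fac h \<rho>1 b"
  have bP: "bump (?P \<alpha> i)" for \<alpha> i by (rule bump_path_fac[OF b])
  have "(1 / \<rho>) * W (g \<alpha>) ((?P \<alpha>)(i := deriv (\<lambda>t. (h $ i - \<rho>1 * t) * ?P \<alpha> i t))) \<rho> x
     = W (g (\<alpha>(i := Suc (\<alpha> i)))) (?P (\<alpha>(i := Suc (\<alpha> i)))) \<rho> x" for i
  proof -
    define \<beta> where "\<beta> = \<alpha>(i := Suc (\<alpha> i))"
    define q where "q j t = ?P \<beta> j ((x $ j - t) / \<rho>) / \<rho>" for j t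
    have bq: "bump (q j)" for j unfolding q_def[abs_def] by (rule bump_ker_factor[OF bP \<rho>])
    have k: "(\<lambda>t. (h $ i - \<rho>1 * t) * ?P \<alpha> i t) = ?P \<beta> i" by (auto simp: path_fac_def \<beta>_def)
    have o: "?P \<alpha> j = ?P \<beta> j" if "j \<noteq> i" for j using that by (auto simp: path_fac_def \<beta>_def)
    have dq: "deriv (q i) = (\<lambda>t. - (1 / \<rho>) * (deriv (?P \<beta> i) ((x $ i - t) / \<rho>) / \<rho>))"
      unfolding q_def[abs_def] by (rule deriv_ker_factor[OF bP \<rho>])
    have 1: "prodf (q(i := deriv (q i))) z = - (1 / \<rho>) * ker ((?P \<alpha>)(i := deriv (?P \<beta> i))) \<rho> x z" for z
    proof -
      have "prodf (q(i := deriv (q i))) z = deriv (q i) (z $ i) * (\<Prod>j\<in>UNIV-{i}. q j (z $ j))"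
        unfolding prodf_def by (subst prod.remove[of UNIV i]) auto
      also have "(\<Prod>j\<in>UNIV-{i}. q j (z $ j)) = (\<Prod>j\<in>UNIV-{i}. ?P \<alpha> j ((x $ j - z $ j) / \<rho>) / \<rho>)"
        by (rule prod.cong) (auto simp: q_def o)
      also have "deriv (q i) (z $ i) * \<dots> = - (1 / \<rho>) * ker ((?P \<alpha>)(i := deriv (?P \<beta> i))) \<rho> x z"
        unfolding ker_eq_prodf prodf_def dq by (subst prod.remove[of UNIV i]) auto
      finally show ?thesis .
    qed
    have "(LINT z|lborel. g \<alpha> z * prodf (q(i := deriv (q i))) z)
        = - (1 / \<rho>) * W (g \<alpha>) ((?P \<alpha>)(i := deriv (?P \<beta> i))) \<rho> x"
      unfolding 1 W_def by (simp add: mult.left_commute)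
    moreover have "(LINT z|lborel. g \<beta> z * prodf q z) = W (g \<beta>) (?P \<beta>) \<rho> x"
      unfolding W_def ker_eq_prodf q_def[abs_def] ..
    ultimately show ?thesis
      using by_parts[of \<alpha> q i, OF \<alpha> bq] unfolding k \<beta>_def[symmetric] by simp
  qed
  then show ?thesis
    using W_path_DERIV[of "g \<alpha>" "?P \<alpha>" \<rho>0 \<tau> \<rho>1 p h, OF loc_int_g bP pos] \<alpha>
    unfolding \<rho>_def x_def by simp
qed

text \<open>Descending induction on the order: averages of derivatives of order m are constant up to
  the oscillation, and each integration along the path lowers the order by one and raises the degree
  by one.\<close>

lemma path_near_poly:
  assumes b: "bump b" "\<And>t. \<bar>b t\<bar> \<le> 1" "\<And>t. b t \<noteq> 0 \<Longrightarrow> \<bar>t\<bar> \<le> 1"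
    and r: "r > 0" and R: "R > 0" and le: "a \<le> a'"
    and path: "\<And>\<tau>. \<tau> \<in> {a..a'} \<Longrightarrow> r \<le> \<rho>0 + \<tau> * \<rho>1 \<and> cball (p + \<tau> *\<^sub>R h) (real CARD('n) * (\<rho>0 + \<tau> * \<rho>1)) \<subseteq> cball X R"
    and H: "\<And>i t. \<bar>t\<bar> \<le> 1 \<Longrightarrow> \<bar>h $ i - \<rho>1 * t\<bar> \<le> H"
    and e: "e \<ge> 0" "\<And>\<alpha>. sum \<alpha> UNIV = m \<Longrightarrow>
      ennreal (H ^ m / r ^ CARD('n)) * (osc (g \<alpha>) X R / emeasure lborel (cball X R)) \<le> ennreal e"
  shows "sum \<alpha> UNIV + k = m \<Longrightarrow> near_poly k ((real CARD('n) * (a' - a)) ^ k * e)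
    (\<lambda>\<tau>. W (g \<alpha>) (path_fac h \<rho>1 b \<alpha>) (\<rho>0 + \<tau> * \<rho>1) (p + \<tau> *\<^sub>R h)) {a..a'}"
proof (induction k arbitrary: \<alpha>)
  case 0
  then have \<alpha>: "sum \<alpha> UNIV = m" by simp
  have "\<exists>c. \<forall>\<rho>\<ge>r. \<forall>x. cball x (real CARD('n) * \<rho>) \<subseteq> cball X R \<longrightarrow>
     ennreal \<bar>W (g \<alpha>) (path_fac h \<rho>1 b \<alpha>) \<rho> x - c\<bar>
       \<le> ennreal (H ^ sum \<alpha> UNIV / r ^ CARD('n)) * (osc (g \<alpha>) X R / emeasure lborel (cball X R))"
    by (rule W_near_const[OF loc_int_g bump_path_fac[OF b(1)] R r prodf_path_fac_bound(1)[of b, OF b(2,3) H]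
          prodf_path_fac_bound(2)[of b, OF b(2,3) H]]) (use \<alpha> in auto)
  then obtain c where c: "\<And>\<rho> x. \<rho> \<ge> r \<Longrightarrow> cball x (real CARD('n) * \<rho>) \<subseteq> cball X R \<Longrightarrow>
     ennreal \<bar>W (g \<alpha>) (path_fac h \<rho>1 b \<alpha>) \<rho> x - c\<bar>
       \<le> ennreal (H ^ m / r ^ CARD('n)) * (osc (g \<alpha>) X R / emeasure lborel (cball X R))"
    unfolding \<alpha> by blast
  note c = order_trans[OF c e(2)[OF \<alpha>]]
  show ?case
    unfolding near_poly_def
  proof (intro exI[of _ "\<lambda>_. c"] ballI)
    fix \<tau> assume "\<tau> \<in> {a..a'}"
    then have "ennreal \<bar>W (g \<alpha>) (path_fac h \<rho>1 b \<alpha>) (\<rho>0 + \<tau> * \<rho>1) (p + \<tau> *\<^sub>R h) - c\<bar> \<le> ennreal e"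
      using c path by blast
    then show "\<bar>W (g \<alpha>) (path_fac h \<rho>1 b \<alpha>) (\<rho>0 + \<tau> * \<rho>1) (p + \<tau> *\<^sub>R h) - (\<Sum>i\<le>0. c * \<tau> ^ i)\<bar>
      \<le> (real CARD('n) * (a' - a)) ^ 0 * e"
      using e(1) by (simp add: ennreal_le_iff)
  qed
next
  case (Suc k)
  let ?F = "\<lambda>\<alpha> \<tau>. W (g \<alpha>) (path_fac h \<rho>1 b \<alpha>) (\<rho>0 + \<tau> * \<rho>1) (p + \<tau> *\<^sub>R h)"
  have "near_poly (Suc k) (real CARD('n) * (a' - a) * ((real CARD('n) * (a' - a)) ^ k * e)) (?F \<alpha>) {a..a'}"
  proof (rule near_poly_integrate[OF _ _ le])
    show "(?F \<alpha> has_real_derivative (\<Sum>i\<in>UNIV. ?F (\<alpha>(i := Suc (\<alpha> i))) \<tau>)) (at \<tau>)" if "\<tau> \<in> {a..a'}" for \<tau>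
      by (rule path_DERIV[OF _ b(1)]) (use Suc.prems path[OF that] r in auto)
    show "near_poly k ((real CARD('n) * (a' - a)) ^ k * e) (?F (\<alpha>(i := Suc (\<alpha> i)))) {a..a'}" for i
      by (rule Suc.IH) (use Suc.prems in \<open>simp only: sum_fun_upd_Suc\<close>)
  qed
  then show ?case by (simp add: mult_ac)
qed

definition U :: "real \<Rightarrow> real^'n \<Rightarrow> real" where
  "U \<rho> x = W (g (\<lambda>_. 0)) (\<lambda>_. std_bump) \<rho> x"

definition smoothing :: "real \<Rightarrow> real^'n \<Rightarrow> real" where
  "smoothing R x = extrap m (\<lambda>\<rho>. U \<rho> x) R"

definition vosc :: "real^'n \<Rightarrow> real \<Rightarrow> ennreal" where
  "vosc x R = (\<integral>\<^sup>+z\<in>cball x R. (\<integral>\<^sup>+y\<in>cball x R.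
      ennreal (L2_set (\<lambda>\<alpha>. g \<alpha> z - g \<alpha> y) (multi_indices m)) \<partial>lborel) \<partial>lborel)"

text \<open>In units of R: scales go up to m + 1 and the kernel has support radius n, while centres
  move by at most m + 1. Together this gives n (m + 1) + (m + 1).\<close>

definition reach :: real where
  "reach = (real CARD('n) + 1) * (real m + 1)"

lemma reach_pos: "reach > 0" by (simp add: reach_def add_nonneg_pos)

lemma osc_le_vosc:
  assumes "sum \<alpha> UNIV = m"
  shows "osc (g \<alpha>) x R \<le> vosc x R"
proof -
  have "\<bar>g \<alpha> z - g \<alpha> y\<bar> \<le> L2_set (\<lambda>\<alpha>. g \<alpha> z - g \<alpha> y) (multi_indices m)" for z y
  proof -
    have "\<bar>g \<alpha> z - g \<alpha> y\<bar> = L2_set (\<lambda>\<alpha>. g \<alpha> z - g \<alpha> y) {\<alpha>}" by (simp add: L2_set_def)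
    also have "\<dots> \<le> L2_set (\<lambda>\<alpha>. g \<alpha> z - g \<alpha> y) (multi_indices m)"
      unfolding L2_set_def using assms finite_multi_indices
      by (intro real_sqrt_le_mono sum_mono2) (auto simp: multi_indices_def)
    finally show ?thesis .
  qed
  then show ?thesis unfolding osc_def vosc_def
    by (intro nn_integral_mono mult_right_mono ennreal_leI) auto
qed

lemma path_near_poly_scale:
  assumes R: "R > 0" and r: "r > 0" and le: "a \<le> a'" and H: "\<And>i t. \<bar>t\<bar> \<le> 1 \<Longrightarrow> \<bar>h $ i - \<rho>1 * t\<bar> \<le> H"
    and path: "\<And>\<tau>. \<tau> \<in> {a..a'} \<Longrightarrow> r \<le> \<rho>0 + \<tau> * \<rho>1 \<and>
        norm (p + \<tau> *\<^sub>R h - x) + real CARD('n) * (\<rho>0 + \<tau> * \<rho>1) \<le> reach * R"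
    and E: "vosc x (reach * R) = ennreal E" "E \<ge> 0"
  shows "near_poly m ((real CARD('n) * (a' - a)) ^ m *
      (H ^ m / r ^ CARD('n) * (E / (unit_ball_vol (real CARD('n)) * (reach * R) ^ CARD('n)))))
    (\<lambda>\<tau>. U (\<rho>0 + \<tau> * \<rho>1) (p + \<tau> *\<^sub>R h)) {a..a'}"
proof -
  let ?V = "unit_ball_vol (real CARD('n)) * (reach * R) ^ CARD('n)"
  have V: "emeasure lborel (cball x (reach * R)) = ennreal ?V" "?V > 0"
    using emeasure_cball[of "reach * R" x] reach_pos R by auto
  have H0: "H \<ge> 0" by (rule order_trans[OF abs_ge_zero H[of 0]]) simp
  show ?thesis
    unfolding U_def
  proof (rule path_near_poly[where \<alpha>="\<lambda>_. 0" and k=m and b=std_bump and X=x and R="reach * R" and r=r and H=H,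
        unfolded path_fac_zero])
    show "0 < reach * R" using reach_pos R by simp
    show "r \<le> \<rho>0 + \<tau> * \<rho>1 \<and> cball (p + \<tau> *\<^sub>R h) (real CARD('n) * (\<rho>0 + \<tau> * \<rho>1)) \<subseteq> cball x (reach * R)"
      if "\<tau> \<in> {a..a'}" for \<tau>
    proof (intro conjI subsetI)
      show "r \<le> \<rho>0 + \<tau> * \<rho>1" using path[OF that] by blast
      fix y assume "y \<in> cball (p + \<tau> *\<^sub>R h) (real CARD('n) * (\<rho>0 + \<tau> * \<rho>1))"
      then have "norm (p + \<tau> *\<^sub>R h - y) \<le> real CARD('n) * (\<rho>0 + \<tau> * \<rho>1)" by (simp add: dist_norm)
      moreover have "norm (x - y) \<le> norm (p + \<tau> *\<^sub>R h - x) + norm (p + \<tau> *\<^sub>R h - y)"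
        using norm_triangle_ineq4[of "p + \<tau> *\<^sub>R h - y" "p + \<tau> *\<^sub>R h - x"] by simp
      ultimately show "y \<in> cball x (reach * R)" using path[OF that] by (auto simp: dist_norm)
    qed
    show "0 \<le> H ^ m / r ^ CARD('n) * (E / ?V)"
      using mult_nonneg_nonneg[OF divide_nonneg_pos[OF zero_le_power[OF H0] zero_less_power[OF r]]
          divide_nonneg_pos[OF E(2) V(2)]] .
    show "ennreal (H ^ m / r ^ CARD('n)) * (osc (g \<alpha>) x (reach * R) / emeasure lborel (cball x (reach * R)))
       \<le> ennreal (H ^ m / r ^ CARD('n) * (E / ?V))" if "sum \<alpha> UNIV = m" for \<alpha>
    proof -
      have "osc (g \<alpha>) x (reach * R) / emeasure lborel (cball x (reach * R)) \<le> ennreal E / ennreal ?V"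
        unfolding V E(1)[symmetric] by (intro divide_right_mono_ennreal osc_le_vosc that)
      also have "\<dots> = ennreal (E / ?V)" using E(2) V(2) by (rule divide_ennreal)
      finally show ?thesis
        using H0 r E(2) V(2) by (subst ennreal_mult') (auto intro!: mult_left_mono)
    qed
  qed (use r le H bump_std_bump std_bump_abs_le_1 std_bump_support in auto)
qed

text \<open>The path keeps the centre fixed and lets the scale itself be the parameter, over an
  interval containing all nodes j R and j R / 2 of both extrapolations. Here \<open>H\<close> is
  1.\<close>

lemma smoothing_scale_step:
  assumes R: "R > 0"
  shows "ennreal \<bar>smoothing R x - smoothing (R / 2) x\<bar>
     \<le> ennreal (step_const m CARD('n) * (R ^ m / R ^ (2 * CARD('n)))) * vosc x (reach * R)"
proof -
  let ?N = "real CARD('n)"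
  define C where "C = 2 * 2 ^ Suc m * ((?N * (real m + 1)) ^ m * (2 ^ CARD('n) / (unit_ball_vol ?N * reach ^ CARD('n))))"
  have C: "C > 0" unfolding C_def using reach_pos
    by (intro mult_pos_pos divide_pos_pos zero_less_power) (auto simp: add_nonneg_pos)
  have CC: "step_const m CARD('n) = C" by (simp add: step_const_def C_def reach_def)
  show ?thesis
    unfolding CC
  proof -
    show "ennreal \<bar>smoothing R x - smoothing (R / 2) x\<bar>
       \<le> ennreal (C * (R ^ m / R ^ (2 * CARD('n)))) * vosc x (reach * R)"
    proof (cases "vosc x (reach * R)" rule: ennreal_cases)
      case (real E)
      let ?e = "(1 ^ m / (R / 2) ^ CARD('n) * (E / (unit_ball_vol ?N * (reach * R) ^ CARD('n))))"
      let ?f = "\<lambda>\<tau>. U \<tau> x"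
      have e: "?e \<ge> 0" using R real reach_pos by simp
      have "near_poly m ((?N * ((real m + 1) * R - R / 2)) ^ m * ?e) (\<lambda>\<tau>. U (0 + \<tau> * 1) (x + \<tau> *\<^sub>R 0)) {R / 2..(real m + 1) * R}"
      proof (rule path_near_poly_scale[OF R])
        show "0 < R / 2" using R by simp
        have "0 \<le> real m * R" using R by simp
        then show "R / 2 \<le> (real m + 1) * R" using R by (simp add: algebra_simps)
        show "R / 2 \<le> 0 + \<tau> * 1 \<and> norm (x + \<tau> *\<^sub>R 0 - x) + ?N * (0 + \<tau> * 1) \<le> reach * R"
          if "\<tau> \<in> {R / 2..(real m + 1) * R}" for \<tau>
        proof -
          have "?N * \<tau> \<le> (?N + 1) * ((real m + 1) * R)" using that R by (intro mult_mono) auto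
          then show ?thesis using that by (simp add: reach_def mult.assoc)
        qed
      qed (use real in auto)
      then have np: "near_poly m ((?N * ((real m + 1) * R - R / 2)) ^ m * ?e) ?f {R / 2..(real m + 1) * R}" by simp
      have "\<bar>extrap m ?f R - extrap m ?f (R / 2)\<bar> \<le> 2 * 2 ^ Suc m * ((?N * ((real m + 1) * R - R / 2)) ^ m * ?e)"
      proof (rule extrap_near_poly[OF np])
        fix j assume "j \<in> {1..Suc m}"
        then have j: "1 \<le> real j" "real j \<le> real m + 1" by auto
        have a: "R \<le> real j * R" "real j * R \<le> (real m + 1) * R"
          using j R mult_right_mono[of 1 "real j" R] mult_right_mono[of "real j" "real m + 1" R] by auto
        have b: "real j * (R / 2) = real j * R / 2" by simp
        have c: "R / 2 \<le> real j * R" using a(1) R by linarith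
        have d: "real j * R / 2 \<le> (real m + 1) * R" using a R by linarith
        show "real j * R \<in> {R / 2..(real m + 1) * R} \<and> real j * (R / 2) \<in> {R / 2..(real m + 1) * R}"
          unfolding b using a c d by auto
      next
        have "0 \<le> real m * R" using R by simp
        then have "R / 2 \<le> (real m + 1) * R" using R by (simp add: algebra_simps)
        then show "0 \<le> (?N * ((real m + 1) * R - R / 2)) ^ m * ?e"
          by (intro mult_nonneg_nonneg[OF zero_le_power e]) simp
      qed
      also have "\<dots> \<le> 2 * 2 ^ Suc m * ((?N * ((real m + 1) * R)) ^ m * ?e)"
      proof -
        have "0 \<le> real m * R" using R by simp
        then have "R / 2 \<le> (real m + 1) * R" using R by (simp add: algebra_simps)
        then have "(?N * ((real m + 1) * R - R / 2)) ^ m \<le> (?N * ((real m + 1) * R)) ^ m"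
          using R by (intro power_mono mult_left_mono) auto
        from mult_left_mono[OF mult_right_mono[OF this e], of "2 * 2 ^ Suc m"] show ?thesis by simp
      qed
      also have "\<dots> = C * (R ^ m / R ^ (2 * CARD('n))) * E"
        unfolding C_def by (rule step_const_algebra)
      finally have "\<bar>smoothing R x - smoothing (R / 2) x\<bar> \<le> C * (R ^ m / R ^ (2 * CARD('n))) * E"
        by (simp add: smoothing_def)
      then show ?thesis using real R C by (simp add: ennreal_mult'[symmetric] ennreal_leI)
    next
      case top
      then show ?thesis using C R by (simp add: ennreal_mult_top)
    qed
  qed
qed

text \<open>The path keeps the scale at l R and moves the centre with velocity \<open>h\<close>, so
  \<open>H\<close> is R. The nodes of the difference are the integer parameters 0, ..., m +
  1.\<close>

lemma smoothing_difference:
  assumes R: "R > 0" and h: "norm h \<le> R"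
  shows "ennreal \<bar>\<Sum>j\<le>Suc m. (-1) ^ j * real (Suc m choose j) * smoothing R (x + real j *\<^sub>R h)\<bar>
     \<le> ennreal (diff_const m CARD('n) * (R ^ m / R ^ (2 * CARD('n)))) * vosc x (reach * R)"
proof -
  let ?N = "real CARD('n)"
  define C where "C = 2 ^ Suc m * (2 ^ Suc m * ((?N * (real m + 1)) ^ m * (1 / (unit_ball_vol ?N * reach ^ CARD('n)))))"
  have C: "C > 0" unfolding C_def using reach_pos
    by (intro mult_pos_pos divide_pos_pos zero_less_power) (auto simp: add_nonneg_pos)
  let ?w = "\<lambda>j. (-1) ^ j * real (Suc m choose j)"
  have CC: "diff_const m CARD('n) = C" by (simp add: diff_const_def C_def reach_def)
  show ?thesis
    unfolding CC
  proof -
    show "ennreal \<bar>\<Sum>j\<le>Suc m. ?w j * smoothing R (x + real j *\<^sub>R h)\<bar>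
       \<le> ennreal (C * (R ^ m / R ^ (2 * CARD('n)))) * vosc x (reach * R)"
    proof (cases "vosc x (reach * R)" rule: ennreal_cases)
      case (real E)
      let ?e = "(R ^ m / R ^ CARD('n) * (E / (unit_ball_vol ?N * (reach * R) ^ CARD('n))))"
      let ?B = "2 ^ Suc m * ((?N * (real m + 1)) ^ m * ?e)"
      have e: "?e \<ge> 0" using R real reach_pos by simp
      have *: "\<bar>\<Sum>j\<le>Suc m. ?w j * U (real l * R) (x + real j *\<^sub>R h)\<bar> \<le> ?B" if l: "l \<in> {1..Suc m}" for l
      proof -
        have l': "1 \<le> real l" "real l \<le> real m + 1" using l by auto
        have lR: "R \<le> real l * R" "real l * R \<le> (real m + 1) * R"
          using l' R mult_right_mono[of 1 "real l" R] mult_right_mono[of "real l" "real m + 1" R] by auto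
        have "near_poly m ((?N * ((real m + 1) - 0)) ^ m * ?e)
           (\<lambda>\<tau>. U (real l * R + \<tau> * 0) (x + \<tau> *\<^sub>R h)) {0..real m + 1}"
        proof (rule path_near_poly_scale[OF R R])
          show "R \<le> real l * R + \<tau> * 0 \<and> norm (x + \<tau> *\<^sub>R h - x) + ?N * (real l * R + \<tau> * 0) \<le> reach * R"
            if "\<tau> \<in> {0..real m + 1}" for \<tau>
          proof -
            have "norm (x + \<tau> *\<^sub>R h - x) \<le> (real m + 1) * R"
              using that h R by (auto intro!: mult_mono)
            moreover have "?N * (real l * R) \<le> ?N * ((real m + 1) * R)"
              using lR by (intro mult_left_mono) auto
            moreover have "reach * R = ?N * ((real m + 1) * R) + (real m + 1) * R"
              by (simp add: reach_def algebra_simps)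
            ultimately have "norm (x + \<tau> *\<^sub>R h - x) + ?N * (real l * R) \<le> reach * R" by linarith
            then show ?thesis using lR(1) by simp
          qed
          show "\<bar>h $ i - 0 * t\<bar> \<le> R" for i t
            using component_le_norm_cart[of h i] h by simp
        qed (use real in auto)
        then have "near_poly m ((?N * (real m + 1)) ^ m * ?e) (\<lambda>\<tau>. U (real l * R) (x + \<tau> *\<^sub>R h)) {0..real m + 1}"
          by simp
        from finite_difference_near_poly[OF this] show ?thesis by auto
      qed
      \<comment> \<open>Spatial differences commute with extrapolation in the scale, so the bound at
        each fixed scale l R can be summed with the extrapolation weights.\<close>
      have eq: "(\<Sum>j\<le>Suc m. ?w j * smoothing R (x + real j *\<^sub>R h))
          = - (\<Sum>l=1..Suc m. ?w l * (\<Sum>j\<le>Suc m. ?w j * U (real l * R) (x + real j *\<^sub>R h)))"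
        unfolding smoothing_def extrap_def sum_distrib_left mult_minus_right sum_negf
        by (subst sum.swap) (simp only: mult_ac)
      have "\<bar>\<Sum>j\<le>Suc m. ?w j * smoothing R (x + real j *\<^sub>R h)\<bar>
          = \<bar>\<Sum>l=1..Suc m. ?w l * (\<Sum>j\<le>Suc m. ?w j * U (real l * R) (x + real j *\<^sub>R h))\<bar>"
        unfolding eq by (rule abs_minus_cancel)
      also have "\<dots> \<le> (\<Sum>l=1..Suc m. \<bar>?w l\<bar> * ?B)"
        by (intro order_trans[OF sum_abs sum_mono]) (simp only: abs_mult, intro mult_left_mono *, auto)
      also have "\<dots> \<le> (\<Sum>l\<le>Suc m. \<bar>?w l\<bar> * ?B)"
      proof (rule sum_mono2)
        have "0 \<le> (?N * (real m + 1)) ^ m * ?e" using e by (rule mult_nonneg_nonneg[rotated]) simp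
        then have "0 \<le> ?B" by (rule mult_nonneg_nonneg[rotated]) simp
        then show "0 \<le> \<bar>?w l\<bar> * ?B" for l by (rule mult_nonneg_nonneg[OF abs_ge_zero])
      qed auto
      also have "\<dots> = 2 ^ Suc m * ?B" using sum_abs_binomial[of "Suc m"] by (simp only: sum_distrib_right[symmetric])
      also have "\<dots> = C * (R ^ m / R ^ (2 * CARD('n))) * E"
        unfolding C_def by (rule diff_const_algebra)
      finally show ?thesis using real R C by (simp add: ennreal_mult'[symmetric] ennreal_leI)
    next
      case top
      then show ?thesis using C R by (simp add: ennreal_mult_top)
    qed
  qed
qed

end

section \<open>Young functions and sums over dyadic scales\<close>

text \<open>The largest admissible term is at most X^q and the following ones decay by the factor
  2^(-q); the bound depends on neither R nor the number of terms.\<close>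

lemma geometric_sum_below:
  fixes R X q :: real
  assumes q: "q > 0" and R: "R > 0" and X: "X > 0"
  shows "(\<Sum>i<k. if R / 2 ^ i \<le> X then (R / 2 ^ i) powr q else 0) \<le> X powr q / (1 - 2 powr - q)"
proof -
  define c where "c = 1 - 2 powr - q"
  have c: "c > 0" unfolding c_def using q by (simp add: powr_less_one)
  \<comment> \<open>Strengthened for the induction: when R is below X the bound must shrink with R,
    because the hypothesis is applied to R / 2.\<close>
  have "(\<Sum>i<k. if R / 2 ^ i \<le> X then (R / 2 ^ i) powr q else 0) \<le> (min R X) powr q / c"
    using R
  proof (induction k arbitrary: R)
    case 0
    then show ?case using c by simp
  next
    case (Suc k)
    have "(\<Sum>i<Suc k. if R / 2 ^ i \<le> X then (R / 2 ^ i) powr q else 0)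
      = (if R \<le> X then R powr q else 0) + (\<Sum>i<k. if (R / 2) / 2 ^ i \<le> X then ((R / 2) / 2 ^ i) powr q else 0)"
    proof -
      have "R / 2 ^ Suc i = (R / 2) / 2 ^ i" for i by simp
      then show ?thesis by (subst sum.lessThan_Suc_shift) (simp only: power_0 div_by_1)
    qed
    also have "\<dots> \<le> (if R \<le> X then R powr q else 0) + (min (R / 2) X) powr q / c"
      using Suc.IH[of "R / 2"] Suc.prems by simp
    also have "\<dots> \<le> (min R X) powr q / c"
    proof (cases "R \<le> X")
      case True
      then have "min (R / 2) X = R / 2" "min R X = R" using Suc.prems by auto
      moreover have "(R / 2) powr q = R powr q * (1 - c)"
        using Suc.prems powr_divide[of R 2 q] powr_minus_divide[of 2 q] by (simp add: c_def)
      moreover have "R powr q + R powr q * (1 - c) / c = R powr q / c"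
        using c by (simp add: field_simps)
      ultimately show ?thesis using True by simp
    next
      case False
      then have "(min (R / 2) X) powr q \<le> (min R X) powr q"
        using Suc.prems X q by (intro powr_mono2) auto
      then show ?thesis using False c by (simp add: divide_right_mono)
    qed
    finally show ?case .
  qed
  also have "\<dots> \<le> X powr q / c"
    using c R X q by (intro divide_right_mono powr_mono2) auto
  finally show ?thesis by (simp add: c_def)
qed

lemma geometric_sum_below_increasing:
  fixes u X q :: real
  assumes q: "q > 0" and u: "u > 0" and X: "X > 0"
  shows "(\<Sum>i<k. if u * 2 ^ i \<le> X then (u * 2 ^ i) powr q else 0) \<le> X powr q / (1 - 2 powr - q)"
proof (cases k)
  case 0
  have "1 - 2 powr - q > 0" using q by (simp add: powr_less_one)
  then show ?thesis using 0 by simp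
next
  case (Suc l)
  have "(\<Sum>i<k. if u * 2 ^ i \<le> X then (u * 2 ^ i) powr q else 0)
     = (\<Sum>i<k. if u * 2 ^ (k - Suc i) \<le> X then (u * 2 ^ (k - Suc i)) powr q else 0)"
    by (rule sum.nat_diff_reindex[symmetric])
  also have "\<dots> = (\<Sum>i<k. if (u * 2 ^ l) / 2 ^ i \<le> X then ((u * 2 ^ l) / 2 ^ i) powr q else 0)"
    by (intro sum.cong refl) (simp add: Suc power_diff)
  also have "\<dots> \<le> X powr q / (1 - 2 powr - q)"
    using u by (intro geometric_sum_below q X) simp
  finally show ?thesis .
qed

section \<open>Convexity and slope levels of Young functions\<close>

lemma young_zero: "young_function A \<Longrightarrow> A 0 = 0"
  and young_convex: "young_function A \<Longrightarrow> x \<ge> 0 \<Longrightarrow> y \<ge> 0 \<Longrightarrow> 0 \<le> \<theta> \<Longrightarrow> \<theta> \<le> 1 \<Longrightarrow>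
    A ((1 - \<theta>) * x + \<theta> * y) \<le> ennreal (1 - \<theta>) * A x + ennreal \<theta> * A y"
  by (auto simp: young_function_def)

text \<open>Convexity against the point 0. This says that A(t) / t is nondecreasing, the form in
  which convexity is mostly used.\<close>

lemma young_scale:
  assumes "young_function A" "0 \<le> \<theta>" "\<theta> \<le> 1" "t \<ge> 0"
  shows "A (\<theta> * t) \<le> ennreal \<theta> * A t"
  using young_convex[OF assms(1) order.refl assms(4,2,3)] young_zero[OF assms(1)] by simp

lemma young_mono:
  assumes A: "young_function A" and "0 \<le> x" "x \<le> y"
  shows "A x \<le> A y"
proof (cases "y = 0")
  case False
  then have y: "y > 0" using assms by simp
  have "A ((x / y) * y) \<le> ennreal (x / y) * A y"
    using assms y by (intro young_scale[OF A]) auto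
  also have "\<dots> \<le> 1 * A y" using assms y by (intro mult_right_mono) (auto simp: ennreal_le_1)
  finally show ?thesis using y by simp
qed (use assms in auto)

lemma borel_measurable_mono_ennreal:
  fixes f :: "real \<Rightarrow> ennreal"
  assumes "mono f"
  shows "f \<in> borel_measurable borel"
proof (rule borel_measurableI_greater)
  fix y
  have "is_interval {x. y < f x}"
    unfolding is_interval_1 using monoD[OF assms] by (auto intro: less_le_trans)
  from real_interval_borel_measurable[OF this]
  show "{x \<in> space borel. y < f x} \<in> sets borel" by simp
qed

text \<open>Only values on [0, \<infinity>) are constrained, so monotonicity is available for A(max
  0 t) and the absolute value enforces a legitimate argument.\<close>

lemma young_measurable:
  assumes "young_function A"
  shows "(\<lambda>t. A \<bar>t\<bar>) \<in> borel_measurable borel"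
proof -
  have "mono (\<lambda>t. A (max 0 t))" by (intro monoI young_mono[OF assms]) auto
  then have [measurable]: "(\<lambda>t. A (max 0 t)) \<in> borel_measurable borel"
    by (rule borel_measurable_mono_ennreal)
  have "(\<lambda>t. A (max 0 \<bar>t\<bar>)) \<in> borel_measurable borel" by measurable
  then show ?thesis by simp
qed

text \<open>By \<open>young_scale\<close> the set is an interval starting at 0, so its length is a
  generalized inverse of A(t) / t at \<open>k\<close>. Written as a measure, it lets sums over
  slopes be exchanged with integration in t.\<close>

definition slope_level :: "(real \<Rightarrow> ennreal) \<Rightarrow> real \<Rightarrow> ennreal" where
  "slope_level A k = emeasure lborel {t. 0 < t \<and> A t \<le> ennreal (k * t)}"

lemma slope_level_set_measurable:
  assumes "young_function A"
  shows "{t. 0 < t \<and> A t \<le> ennreal (k * t)} \<in> sets borel"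
proof -
  note [measurable] = young_measurable[OF assms]
  have "{t. 0 < t \<and> A t \<le> ennreal (k * t)} = {t \<in> space borel. 0 < t \<and> A \<bar>t\<bar> \<le> ennreal (k * t)}"
    by auto
  also have "\<dots> \<in> sets borel" by measurable
  finally show ?thesis .
qed

text \<open>A substitute for Young's inequality: \<open>k * slope_level A k\<close> plays the role of the
  conjugate function.\<close>

lemma young_inequality:
  assumes A: "young_function A" and D: "D \<ge> 0" and k: "k \<ge> 0"
  shows "ennreal (k * D) \<le> A D + ennreal k * slope_level A k"
proof (cases "A D \<le> ennreal (k * D)")
  case True
  \<comment> \<open>The inequality at \<open>D\<close> is inherited by all smaller t, so the slope
    level is at least \<open>D\<close>. In the other case \<open>A D\<close> alone exceeds the
    left-hand side.\<close>
  have "{0<..D} \<subseteq> {t. 0 < t \<and> A t \<le> ennreal (k * t)}"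
  proof safe
    fix t assume t: "t \<in> {0<..D}"
    then have "A ((t / D) * D) \<le> ennreal (t / D) * A D" by (intro young_scale[OF A]) auto
    also have "\<dots> \<le> ennreal (t / D) * ennreal (k * D)" by (intro mult_left_mono True) simp
    also have "\<dots> = ennreal (k * t)" using t k by (simp add: ennreal_mult'[symmetric])
    finally show "A t \<le> ennreal (k * t)" using t by simp
  qed simp
  from emeasure_mono[OF this, of lborel] slope_level_set_measurable[OF A]
  have "ennreal D \<le> slope_level A k" using D by (simp add: slope_level_def)
  then have "ennreal k * ennreal D \<le> ennreal k * slope_level A k" by (intro mult_left_mono) auto
  then show ?thesis using k by (simp add: ennreal_mult' add_increasing)
next
  case False
  then show ?thesis by (simp add: add_increasing2 less_imp_le not_le)
qed

text \<open>What Young's inequality leaves over when the oscillations of all scales \<open>R / 2 ^ i\<close> are added up.\<close>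

definition conj_sum :: "real \<Rightarrow> nat \<Rightarrow> (real \<Rightarrow> ennreal) \<Rightarrow> real \<Rightarrow> real \<Rightarrow> nat \<Rightarrow> ennreal" where
  "conj_sum s n A l R k = (\<Sum>i<k. ennreal ((R / 2 ^ i) ^ n) *
     (ennreal (l * (R / 2 ^ i) powr (s - n)) * slope_level A (l * (R / 2 ^ i) powr (s - n))))"

section \<open>From dyadic sums of slope levels to the integral condition\<close>

lemma epowr_measurable [measurable]: "(\<lambda>x. epowr x p) \<in> borel_measurable borel"
  unfolding epowr_def[abs_def] by measurable

lemma young_ratio_measurable:
  assumes "young_function A"
  shows "(\<lambda>t. epowr (ennreal t / A t) p * indicator {0<..} t) \<in> borel_measurable borel"
proof -
  note [measurable] = young_measurable[OF assms]
  have "(\<lambda>t. epowr (ennreal t / A \<bar>t\<bar>) p * indicator {0<..} t) \<in> borel_measurable borel" by measurable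
  moreover have "(\<lambda>t. epowr (ennreal t / A \<bar>t\<bar>) p * indicator {0<..} t)
      = (\<lambda>t. epowr (ennreal t / A t) p * indicator {0<..} t)"
    by (auto simp: indicator_def fun_eq_iff)
  ultimately show ?thesis by simp
qed

text \<open>Each slope level is an integral of an indicator over t. For fixed t, the condition A(t)
  <= l r^(s - n) t means r <= X with X^(n - s) = l t / A(t), and the admissible r^s sum to a
  multiple of X^s. This produces the power s / (n - s), and the powers of l add up to 1 + s / (n -
  s) = n / (n - s).\<close>

lemma conj_sum_le:
  fixes s :: real and n :: nat
  assumes A: "young_function A" and s: "0 < s" "s < n" and l: "l > 0" and R: "R > 0"
  shows "conj_sum s n A l R k \<le> ennreal (l powr (n / (n - s)) / (1 - 2 powr - s)) *
     (\<integral>\<^sup>+t\<in>{0<..}. epowr (ennreal t / A t) (s / (n - s)) \<partial>lborel)"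
proof -
  let ?r = "\<lambda>i. R / 2 ^ i"
  let ?k = "\<lambda>i. l * ?r i powr (s - n)"
  define S where "S i = {t. 0 < t \<and> A t \<le> ennreal (?k i * t)}" for i
  have mem_S: "t \<in> S i \<longleftrightarrow> 0 < t \<and> A t \<le> ennreal (?k i * t)" for t i by (simp add: S_def)
  let ?p = "s / (n - s)"
  define c where "c = 1 - 2 powr - s"
  have c: "c > 0" unfolding c_def using s by (simp add: powr_less_one)
  have r: "?r i > 0" for i using R by simp
  have [measurable]: "S i \<in> sets borel" for i unfolding S_def by (rule slope_level_set_measurable[OF A])
  note [measurable] = young_ratio_measurable[OF A]
  have "conj_sum s n A l R k = (\<Sum>i<k. \<integral>\<^sup>+t. ennreal (l * ?r i powr s) * indicator (S i) t \<partial>lborel)"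
    unfolding conj_sum_def
  proof (rule sum.cong[OF refl])
    fix i
    have "ennreal (?r i ^ n) * (ennreal (?k i) * slope_level A (?k i))
        = ennreal (?r i ^ n * ?k i) * slope_level A (?k i)"
      using r[of i] l by (simp add: ennreal_mult' mult.assoc)
    also have "?r i ^ n * ?k i = l * ?r i powr s"
      using r[of i] by (simp add: powr_realpow[symmetric] powr_add[symmetric])
    also have "ennreal (l * ?r i powr s) * slope_level A (?k i)
       = (\<integral>\<^sup>+t. ennreal (l * ?r i powr s) * indicator (S i) t \<partial>lborel)"
      unfolding slope_level_def S_def[symmetric] by (rule nn_integral_cmult_indicator[symmetric]) simp
    finally show "ennreal (?r i ^ n) * (ennreal (?k i) * slope_level A (?k i))
       = (\<integral>\<^sup>+t. ennreal (l * ?r i powr s) * indicator (S i) t \<partial>lborel)" .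
  qed
  also have "\<dots> = (\<integral>\<^sup>+t. (\<Sum>i<k. ennreal (l * ?r i powr s) * indicator (S i) t) \<partial>lborel)"
    by (rule nn_integral_sum[symmetric]) measurable
  also have "\<dots> \<le> (\<integral>\<^sup>+t. ennreal (l powr (n / (n - s)) / c) * (epowr (ennreal t / A t) ?p * indicator {0<..} t) \<partial>lborel)"
  proof (rule nn_integral_mono)
    fix t :: real
    show "(\<Sum>i<k. ennreal (l * ?r i powr s) * indicator (S i) t)
       \<le> ennreal (l powr (n / (n - s)) / c) * (epowr (ennreal t / A t) ?p * indicator {0<..} t)"
    proof (cases "t > 0")
      case False
      then show ?thesis by (simp add: indicator_def mem_S)
    next
      case t: True
      show ?thesis
      proof (cases "A t" rule: ennreal_cases)
        case top
        then have "indicator (S i) t = (0::ennreal)" for i by (simp add: indicator_def mem_S top_unique)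
        then show ?thesis by simp
      next
        case (real a)
        show ?thesis
        proof (cases "a = 0")
          case True
          have "ennreal t / A t = top" using real t True by (simp add: ennreal_divide_zero)
          then show ?thesis using t l c by (simp add: epowr_def ennreal_mult_top)
        next
          case False
          then have a: "a > 0" using real by simp
          define X where "X = (l * t / a) powr (1 / (n - s))"
          have X: "X > 0" unfolding X_def using l t a by simp
          have mem: "t \<in> S i \<longleftrightarrow> ?r i \<le> X" for i
          proof -
            have "t \<in> S i \<longleftrightarrow> a \<le> ?k i * t"
              unfolding mem_S using t real l by (simp add: ennreal_le_iff)
            also have "\<dots> \<longleftrightarrow> a * ?r i powr (n - s) \<le> l * t"
              using r[of i] by (simp add: powr_diff field_simps)
            also have "\<dots> \<longleftrightarrow> ?r i powr (n - s) \<le> l * t / a"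
              using a by (simp add: field_simps)
            also have "\<dots> \<longleftrightarrow> ?r i \<le> X"
            proof
              assume "?r i powr (n - s) \<le> l * t / a"
              then have "(?r i powr (n - s)) powr (1 / (n - s)) \<le> X"
                unfolding X_def using s by (intro powr_mono2) auto
              then show "?r i \<le> X" using s r[of i] R by (simp add: powr_powr)
            next
              assume "?r i \<le> X"
              then have "?r i powr (n - s) \<le> X powr (n - s)"
                using s r[of i] by (intro powr_mono2) auto
              also have "X powr (n - s) = l * t / a"
                unfolding X_def using s l t a by (simp add: powr_powr)
              finally show "?r i powr (n - s) \<le> l * t / a" .
            qed
            finally show ?thesis .
          qed
          have "(\<Sum>i<k. ennreal (l * ?r i powr s) * indicator (S i) t)
              = (\<Sum>i<k. ennreal (l * (if ?r i \<le> X then ?r i powr s else 0)))"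
            by (intro sum.cong refl) (auto simp: mem indicator_def)
          also have "\<dots> = ennreal (l * (\<Sum>i<k. if ?r i \<le> X then ?r i powr s else 0))"
            using l by (subst sum_ennreal) (auto simp: sum_distrib_left)
          also have "\<dots> \<le> ennreal (l * (X powr s / c))"
            unfolding c_def using l by (intro ennreal_leI mult_left_mono geometric_sum_below s R X) auto
          also have "l * (X powr s / c) = (l powr (n / (n - s)) / c) * (t / a) powr ?p"
          proof -
            have "X powr s = (l * (t / a)) powr ?p" unfolding X_def by (simp add: powr_powr)
            also have "\<dots> = l powr ?p * (t / a) powr ?p" using powr_mult[of l "t / a" ?p] l t a by simp
            finally have "l * X powr s = (l powr 1 * l powr ?p) * (t / a) powr ?p" using l by simp
            also have "l powr 1 * l powr ?p = l powr (n / (n - s))"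
            proof -
              have "1 + ?p = n / (n - s)" using s by (simp add: field_simps)
              then show ?thesis by (simp only: powr_add[symmetric])
            qed
            finally show ?thesis by simp
          qed
          also have "ennreal \<dots> = ennreal (l powr (n / (n - s)) / c) * (epowr (ennreal t / A t) ?p * indicator {0<..} t)"
            using t a real c by (simp add: divide_ennreal epowr_def ennreal_mult'[symmetric])
          finally show ?thesis .
        qed
      qed
    qed
  qed
  also have "\<dots> = ennreal (l powr (n / (n - s)) / c) * (\<integral>\<^sup>+t\<in>{0<..}. epowr (ennreal t / A t) ?p \<partial>lborel)"
    by (rule nn_integral_cmult) measurable
  finally show ?thesis unfolding c_def .
qed

lemma epowr_mono: "x \<le> y \<Longrightarrow> p > 0 \<Longrightarrow> epowr x p \<le> epowr y p"
  by (cases x; cases y)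
    (auto simp: epowr_def ennreal_le_iff top_unique intro!: ennreal_leI powr_mono2)

lemma young_ratio_antimono:
  assumes A: "young_function A" and "0 < a" "a \<le> t"
  shows "ennreal t / A t \<le> ennreal a / A a"
proof -
  have "A ((a / t) * t) \<le> ennreal (a / t) * A t"
    using assms by (intro young_scale[OF A]) auto
  then have le: "A a \<le> ennreal (a / t) * A t" using assms by simp
  show ?thesis
  proof (cases "A t" rule: ennreal_cases)
    case top
    then show ?thesis by simp
  next
    case (real b)
    show ?thesis
    proof (cases "A a" rule: ennreal_cases)
      case top
      then show ?thesis using le real assms by (simp add: ennreal_mult'[symmetric] top_unique)
    next
      case r2: (real b')
      have b': "b' \<le> a / t * b" using le real r2 assms by (simp add: ennreal_mult'[symmetric] ennreal_le_iff)
      show ?thesis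
      proof (cases "b' = 0")
        case True
        then show ?thesis using r2 assms by (simp add: ennreal_divide_zero)
      next
        case False
        then have "b' > 0" using r2 by simp
        then have "0 < a / t * b" using b' by linarith
        then have "b > 0" using assms by (simp add: zero_less_mult_iff zero_less_divide_iff)
        have "t / b \<le> a / b'" using b' \<open>b > 0\<close> \<open>b' > 0\<close> assms by (simp add: field_simps)
        then show ?thesis using real r2 \<open>b > 0\<close> \<open>b' > 0\<close> assms by (simp add: divide_ennreal ennreal_leI)
      qed
    qed
  qed
qed

text \<open>The ratio t / A(t) is nonincreasing, so between the two ranges of integrability it is
  bounded by its value at a point a of the first range. That value is finite, as otherwise the ratio
  would be infinite on all of (0, a].\<close>

lemma young_ratio_integral_finite:
  assumes A: "young_function A" and p: "p > 0" and f0: "finite_near_0 A p" and fi: "finite_near_infinity A p"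
  shows "(\<integral>\<^sup>+t\<in>{0<..}. epowr (ennreal t / A t) p \<partial>lborel) < \<infinity>"
proof -
  let ?f = "\<lambda>t. epowr (ennreal t / A t) p"
  note [measurable] = young_ratio_measurable[OF A]
  obtain d where d: "d > 0" "(\<integral>\<^sup>+t\<in>{0<..<d}. ?f t \<partial>lborel) < \<infinity>" using f0 by (auto simp: finite_near_0_def)
  obtain T where T: "T > 0" "(\<integral>\<^sup>+t\<in>{T<..}. ?f t \<partial>lborel) < \<infinity>" using fi by (auto simp: finite_near_infinity_def)
  define a where "a = d / 2"
  have a: "0 < a" "a < d" using d by (auto simp: a_def)
  have fa: "?f a < \<infinity>"
  proof (rule ccontr)
    assume "\<not> ?f a < \<infinity>"
    then have "?f a = top" unfolding infinity_ennreal_def less_top[symmetric] by simp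
    then have top: "?f t = top" if "0 < t" "t \<le> a" for t
      using epowr_mono[OF young_ratio_antimono[OF A that] p] by (simp add: top_unique)
    have "(\<integral>\<^sup>+t. top * indicator {0<..<a} t \<partial>lborel) \<le> (\<integral>\<^sup>+t\<in>{0<..<d}. ?f t \<partial>lborel)"
      using top a by (intro nn_integral_mono) (auto simp: indicator_def)
    moreover have "(\<integral>\<^sup>+t. top * indicator {0<..<a} t \<partial>lborel) = top"
      using a by (subst nn_integral_cmult_indicator) (auto simp: ennreal_top_mult)
    ultimately show False using d by (simp add: top_unique)
  qed
  have m1: "(\<lambda>t. ?f t * indicator {0<..<d} t) \<in> borel_measurable lborel"
  proof -
    have "(\<lambda>t. (?f t * indicator {0<..} t) * indicator {0<..<d} t) \<in> borel_measurable lborel" by measurable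
    moreover have "(\<lambda>t. (?f t * indicator {0<..} t) * indicator {0<..<d} t) = (\<lambda>t. ?f t * indicator {0<..<d} t)"
      by (auto simp: indicator_def fun_eq_iff)
    ultimately show ?thesis by simp
  qed
  have m2: "(\<lambda>t. ?f t * indicator {T<..} t) \<in> borel_measurable lborel"
  proof -
    have "(\<lambda>t. (?f t * indicator {0<..} t) * indicator {T<..} t) \<in> borel_measurable lborel" by measurable
    moreover have "(\<lambda>t. (?f t * indicator {0<..} t) * indicator {T<..} t) = (\<lambda>t. ?f t * indicator {T<..} t)"
      using T by (auto simp: indicator_def fun_eq_iff)
    ultimately show ?thesis by simp
  qed
  have "(\<integral>\<^sup>+t\<in>{0<..}. ?f t \<partial>lborel) \<le> (\<integral>\<^sup>+t. ?f t * indicator {0<..<d} t + (?f a * indicator {a..T} t + ?f t * indicator {T<..} t) \<partial>lborel)"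
  proof (rule nn_integral_mono)
    fix t :: real
    consider "t \<le> 0" | "0 < t" "t < d" | "d \<le> t" "t \<le> T" | "t > T" by linarith
    then show "?f t * indicator {0<..} t \<le> ?f t * indicator {0<..<d} t + (?f a * indicator {a..T} t + ?f t * indicator {T<..} t)"
    proof cases
      case 3
      then have "?f t \<le> ?f a" using a by (intro epowr_mono[OF young_ratio_antimono[OF A] p]) auto
      then show ?thesis using 3 a by (auto simp: indicator_def)
    next
      case 4
      then show ?thesis by (auto simp: indicator_def add_increasing add_increasing2)
    qed (auto simp: indicator_def add_increasing2)
  qed
  also have "\<dots> = (\<integral>\<^sup>+t\<in>{0<..<d}. ?f t \<partial>lborel) + (?f a * emeasure lborel {a..T} + (\<integral>\<^sup>+t\<in>{T<..}. ?f t \<partial>lborel))"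
    using m1 m2 by (simp add: nn_integral_add nn_integral_cmult_indicator)
  also have "\<dots> < \<infinity>"
  proof -
    have "emeasure lborel {a..T} < \<infinity>" by (simp add: emeasure_lborel_Icc_eq)
    then show ?thesis using d(2) T(2) fa by (simp add: ennreal_mult_less_top ennreal_add_less_top)
  qed
  finally show ?thesis .
qed

text \<open>Nonnegative integrals agree with those over the completion for every integrand, so the
  nested integral can be transferred for arbitrary \<open>v\<close>.\<close>

lemma J_lborel: "J \<sigma> A I v = (\<integral>\<^sup>+x. \<integral>\<^sup>+y. A (L2_set (\<lambda>i. v x i - v y i) I / norm (x - y) powr \<sigma>)
    / ennreal (norm (x - y) ^ CARD('n)) \<partial>lborel \<partial>lborel)"
  for v :: "real^'n::finite \<Rightarrow> 'i \<Rightarrow> real"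
  by (simp add: J_def nn_integral_completion)

text \<open>The first summand is the geometric series in front of the modular. The second is the
  coefficient of \<open>conj_sum\<close>; the squared ball volume arises by integrating a constant
  over pairs.\<close>

definition sum_const :: "real \<Rightarrow> nat \<Rightarrow> real \<Rightarrow> real" where
  "sum_const \<sigma> n L = (2 * L) powr (n + \<sigma>) / (1 - 2 powr - (n + \<sigma>)) +
     (2 * L) powr \<sigma> * (unit_ball_vol n * L ^ n) ^ 2"

lemma sum_const_pos: "\<sigma> > 0 \<Longrightarrow> L > 0 \<Longrightarrow> sum_const \<sigma> n L > 0"
  unfolding sum_const_def
  by (intro add_pos_nonneg divide_pos_pos) (auto simp: powr_less_one)

text \<open>The left-hand side factors as q k (d / t^\<sigma>) with slope k = l r^(m + \<sigma> - n)
  and q = (t / r)^(n + \<sigma>) / t^n, and Young's inequality is applied to k (d / t^\<sigma>). The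
  factor (t / r)^(n + \<sigma>) stays with the modular term, where it makes the sum over scales
  converge; in the other term it is absorbed by t <= 2 L r.\<close>

lemma scale_term_bound:
  fixes A :: "real \<Rightarrow> ennreal" and n m :: nat and \<sigma> :: real
  assumes A: "young_function A" and sg: "0 < \<sigma>" and L: "L > 0" and l: "l > 0" and r: "r > 0"
    and t: "t > 0" and d: "d \<ge> 0" and near: "t \<le> 2 * L * r"
  shows "ennreal (l * (r ^ m / r ^ (2 * n))) * ennreal d
     \<le> ennreal ((t / r) powr (n + \<sigma>)) * (A (d / t powr \<sigma>) / ennreal (t ^ n))
       + ennreal ((2 * L) powr \<sigma> / r ^ n) *
         (ennreal (l * r powr (m + \<sigma> - n)) * slope_level A (l * r powr (m + \<sigma> - n)))"
proof -
  let ?k = "l * r powr (m + \<sigma> - n)"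
  let ?q = "(t / r) powr (n + \<sigma>) / t ^ n"
  have eq: "l * (r ^ m / r ^ (2 * n)) * d = ?q * (?k * (d / t powr \<sigma>))"
  proof -
    have "?q * (?k * (d / t powr \<sigma>)) = l * d * ((t powr (n + \<sigma>) / (t powr n * t powr \<sigma>)) * (r powr (m + \<sigma> - n) / r powr (n + \<sigma>)))"
      using t r by (simp add: powr_divide powr_realpow mult_ac)
    also have "t powr (n + \<sigma>) / (t powr n * t powr \<sigma>) = 1"
      using t by (simp add: powr_add[symmetric])
    also have "r powr (m + \<sigma> - n) / r powr (n + \<sigma>) = r powr (real m - real (2 * n))"
      using r by (simp add: powr_diff[symmetric] algebra_simps)
    also have "\<dots> = r ^ m / r ^ (2 * n)" using r by (simp only: powr_diff powr_realpow)
    finally show ?thesis by (simp add: mult_ac)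
  qed
  have q: "?q \<ge> 0" using t by simp
  have "ennreal (l * (r ^ m / r ^ (2 * n))) * ennreal d = ennreal ?q * ennreal (?k * (d / t powr \<sigma>))"
    unfolding ennreal_mult'[OF q, symmetric] eq[symmetric] by (rule ennreal_mult''[OF d, symmetric])
  also have "\<dots> \<le> ennreal ?q * (A (d / t powr \<sigma>) + ennreal ?k * slope_level A ?k)"
    using l d by (intro mult_left_mono young_inequality[OF A]) auto
  also have "\<dots> = ennreal ?q * A (d / t powr \<sigma>) + ennreal ?q * (ennreal ?k * slope_level A ?k)"
    by (rule distrib_left)
  also have "ennreal ?q * A (d / t powr \<sigma>) = ennreal ((t / r) powr (n + \<sigma>)) * (A (d / t powr \<sigma>) / ennreal (t ^ n))"
    using t by (simp add: divide_ennreal[symmetric] ennreal_times_divide mult.commute)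
  also have "ennreal ?q * (ennreal ?k * slope_level A ?k) \<le> ennreal ((2 * L) powr \<sigma> / r ^ n) * (ennreal ?k * slope_level A ?k)"
  proof (intro mult_right_mono ennreal_leI)
    have "?q = t powr \<sigma> / (r powr n * r powr \<sigma>)"
      using t r by (simp add: powr_divide powr_add powr_realpow)
    also have "\<dots> = (t / r) powr \<sigma> / r ^ n" using t r by (simp add: powr_divide powr_realpow)
    also have "\<dots> \<le> (2 * L) powr \<sigma> / r ^ n"
      using near t r sg L by (intro divide_right_mono powr_mono2) (auto simp: divide_le_eq)
    finally show "?q \<le> (2 * L) powr \<sigma> / r ^ n" .
  qed simp
  finally show ?thesis by simp
qed

text \<open>The estimate is made for each pair (z, y) before integrating: the pair is seen only by
  scales with |z - y| / r <= 2 L, and over these (|z - y| / r)^(n + \<sigma>) is a geometric series.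
  Hence the modular is paid for once and not once per scale.\<close>

lemma scale_sum_le:
  fixes v :: "real^'n::finite \<Rightarrow> 'i \<Rightarrow> real" and m :: nat and \<sigma> :: real
  assumes A: "young_function A" and sg: "0 < \<sigma>" and L: "L > 0" and l: "l > 0" and R: "R > 0"
    and I: "finite I" and v[measurable]: "\<And>i. i \<in> I \<Longrightarrow> (\<lambda>x. v x i) \<in> borel_measurable borel"
  shows "(\<Sum>i<k. ennreal (l * ((R / 2 ^ i) ^ m / (R / 2 ^ i) ^ (2 * CARD('n)))) *
      (\<integral>\<^sup>+z\<in>cball x (L * (R / 2 ^ i)). (\<integral>\<^sup>+y\<in>cball x (L * (R / 2 ^ i)).
         ennreal (L2_set (\<lambda>j. v z j - v y j) I) \<partial>lborel) \<partial>lborel))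
    \<le> ennreal (sum_const \<sigma> CARD('n) L) * (J \<sigma> A I v + conj_sum (m + \<sigma>) CARD('n) A l R k)"
proof -
  let ?n = "CARD('n)"
  define r where "r i = R / 2 ^ i" for i
  define B where "B i = cball x (L * r i)" for i
  define d where "d z y = L2_set (\<lambda>j. v z j - v y j) I" for z y
  define a where "a z y = A (d z y / norm (z - y) powr \<sigma>) / ennreal (norm (z - y) ^ ?n)" for z y
  define \<Phi> where "\<Phi> i = ennreal (l * r i powr (m + \<sigma> - ?n)) * slope_level A (l * r i powr (m + \<sigma> - ?n))" for i
  define c1 where "c1 = (2 * L) powr (?n + \<sigma>) / (1 - 2 powr - (?n + \<sigma>))"
  define c2 where "c2 i = ennreal ((2 * L) powr \<sigma> / r i ^ ?n) * \<Phi> i" for i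
  define w where "w i = l * (r i ^ m / r i ^ (2 * ?n))" for i
  have r: "r i > 0" for i using R by (simp add: r_def)
  have c1: "c1 \<ge> 0" unfolding c1_def using sg by (simp add: powr_less_one less_imp_le)
  have [measurable]: "B i \<in> sets borel" for i by (simp add: B_def)
  have d0: "d z y \<ge> 0" for z y by (simp add: d_def)
  have dm[measurable]: "(\<lambda>p. d (fst p) (snd p)) \<in> borel_measurable (borel \<Otimes>\<^sub>M borel)"
  proof -
    have "(\<lambda>p. \<Sum>j\<in>I. (v (fst p) j - v (snd p) j)\<^sup>2) \<in> borel_measurable (borel \<Otimes>\<^sub>M borel)"
    proof (rule borel_measurable_sum)
      fix j assume j: "j \<in> I"
      note [measurable] = v[OF j]
      show "(\<lambda>p. (v (fst p) j - v (snd p) j)\<^sup>2) \<in> borel_measurable (borel \<Otimes>\<^sub>M borel)" by measurable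
    qed
    then show ?thesis unfolding d_def L2_set_def by measurable
  qed
  have am[measurable]: "(\<lambda>p. a (fst p) (snd p)) \<in> borel_measurable (borel \<Otimes>\<^sub>M borel)"
  proof -
    note [measurable] = young_measurable[OF A]
    have "(\<lambda>p. A \<bar>d (fst p) (snd p) / norm (fst p - snd p) powr \<sigma>\<bar> / ennreal (norm (fst p - snd p) ^ ?n))
        \<in> borel_measurable (borel \<Otimes>\<^sub>M borel)" by measurable
    then show ?thesis unfolding a_def using d0 by (simp add: abs_of_nonneg)
  qed
  have amz[measurable]: "a z \<in> borel_measurable borel" for z
    using measurable_compose[OF measurable_Pair1'[of z borel borel] am] by simp
  have dmz[measurable]: "d z \<in> borel_measurable borel" for z
    using measurable_compose[OF measurable_Pair1'[of z borel borel] dm] by simp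
  have aint[measurable]: "(\<lambda>z. \<integral>\<^sup>+y. a z y \<partial>lborel) \<in> borel_measurable borel"
    by (rule lborel.borel_measurable_nn_integral) (simp add: case_prod_unfold)
  have dint[measurable]: "(\<lambda>z. \<integral>\<^sup>+y. ennreal (d z y) * indicator (B i) y \<partial>lborel) \<in> borel_measurable borel" for i
    by (rule lborel.borel_measurable_nn_integral) (simp add: case_prod_unfold)
  have vol: "emeasure lborel (B i) = ennreal (unit_ball_vol ?n * (L * r i) ^ ?n)" for i
    unfolding B_def using L r[of i] by (subst emeasure_cball) auto
  have pt: "(\<Sum>i<k. ennreal (w i) * (ennreal (d z y) * indicator (B i) y * indicator (B i) z))
     \<le> ennreal c1 * a z y + (\<Sum>i<k. c2 i * indicator (B i) y * indicator (B i) z)" for z y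
  proof (cases "z = y")
    case True
    then have "d z y = 0" by (simp add: d_def L2_set_def)
    then show ?thesis by simp
  next
    case False
    define t where "t = norm (z - y)"
    have t: "t > 0" using False by (simp add: t_def)
    let ?g = "\<lambda>i. if t / r i \<le> 2 * L then (t / r i) powr (?n + \<sigma>) else 0"
    have "(\<Sum>i<k. ennreal (w i) * (ennreal (d z y) * indicator (B i) y * indicator (B i) z))
      \<le> (\<Sum>i<k. ennreal (?g i) * a z y + c2 i * indicator (B i) y * indicator (B i) z)"
    proof (rule sum_mono)
      fix i
      show "ennreal (w i) * (ennreal (d z y) * indicator (B i) y * indicator (B i) z)
         \<le> ennreal (?g i) * a z y + c2 i * indicator (B i) y * indicator (B i) z"
      proof (cases "y \<in> B i \<and> z \<in> B i")
        case True
        then have "dist z y \<le> L * r i + L * r i"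
          unfolding B_def using dist_triangle_le[of x z y] dist_triangle3[of z y x] by (simp add: dist_commute)
        then have near: "t \<le> 2 * L * r i" by (simp add: t_def dist_norm)
        then have "t / r i \<le> 2 * L" using r[of i] by (simp add: divide_le_eq)
        then show ?thesis
          using scale_term_bound[OF A sg L l r t d0 near, of m ?n] True
          by (simp add: w_def a_def t_def c2_def \<Phi>_def)
      qed auto
    qed
    also have "\<dots> = ennreal (\<Sum>i<k. ?g i) * a z y + (\<Sum>i<k. c2 i * indicator (B i) y * indicator (B i) z)"
      by (simp add: sum.distrib sum_distrib_right[symmetric] sum_ennreal)
    also have "\<dots> \<le> ennreal c1 * a z y + (\<Sum>i<k. c2 i * indicator (B i) y * indicator (B i) z)"
    proof (intro add_right_mono mult_right_mono ennreal_leI)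
      have eq: "t / r i = (t / R) * 2 ^ i" for i using R by (simp add: r_def)
      show "(\<Sum>i<k. ?g i) \<le> c1"
        unfolding c1_def eq by (rule geometric_sum_below_increasing) (use t R L sg in auto)
    qed simp
    finally show ?thesis .
  qed
  have "(\<Sum>i<k. ennreal (w i) * (\<integral>\<^sup>+z\<in>B i. (\<integral>\<^sup>+y\<in>B i. ennreal (d z y) \<partial>lborel) \<partial>lborel))
     = (\<integral>\<^sup>+z. \<integral>\<^sup>+y. (\<Sum>i<k. ennreal (w i) * (ennreal (d z y) * indicator (B i) y * indicator (B i) z)) \<partial>lborel \<partial>lborel)"
  proof -
    have 1: "(\<integral>\<^sup>+y. (\<Sum>i<k. ennreal (w i) * (ennreal (d z y) * indicator (B i) y * indicator (B i) z)) \<partial>lborel)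
       = (\<Sum>i<k. ennreal (w i) * ((\<integral>\<^sup>+y\<in>B i. ennreal (d z y) \<partial>lborel) * indicator (B i) z))" for z
      by (subst nn_integral_sum) (auto simp: nn_integral_cmult nn_integral_multc)
    show ?thesis unfolding 1
      by (subst nn_integral_sum) (auto simp: nn_integral_cmult)
  qed
  also have "\<dots> \<le> (\<integral>\<^sup>+z. \<integral>\<^sup>+y. ennreal c1 * a z y + (\<Sum>i<k. c2 i * indicator (B i) y * indicator (B i) z) \<partial>lborel \<partial>lborel)"
    by (intro nn_integral_mono pt)
  also have "\<dots> = (\<integral>\<^sup>+z. ennreal c1 * (\<integral>\<^sup>+y. a z y \<partial>lborel) + (\<Sum>i<k. c2 i * emeasure lborel (B i) * indicator (B i) z) \<partial>lborel)"
  proof (rule nn_integral_cong)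
    fix z
    have "(\<integral>\<^sup>+y. ennreal c1 * a z y + (\<Sum>i<k. c2 i * indicator (B i) y * indicator (B i) z) \<partial>lborel)
      = (\<integral>\<^sup>+y. ennreal c1 * a z y \<partial>lborel) + (\<integral>\<^sup>+y. (\<Sum>i<k. c2 i * indicator (B i) y * indicator (B i) z) \<partial>lborel)"
      by (rule nn_integral_add) measurable
    also have "(\<integral>\<^sup>+y. ennreal c1 * a z y \<partial>lborel) = ennreal c1 * (\<integral>\<^sup>+y. a z y \<partial>lborel)"
      by (rule nn_integral_cmult) measurable
    also have "(\<integral>\<^sup>+y. (\<Sum>i<k. c2 i * indicator (B i) y * indicator (B i) z) \<partial>lborel)
      = (\<Sum>i<k. \<integral>\<^sup>+y. c2 i * indicator (B i) y * indicator (B i) z \<partial>lborel)"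
      by (rule nn_integral_sum) measurable
    also have "\<dots> = (\<Sum>i<k. c2 i * emeasure lborel (B i) * indicator (B i) z)"
      by (intro sum.cong refl, subst nn_integral_multc) (auto simp: nn_integral_cmult_indicator)
    finally show "(\<integral>\<^sup>+y. ennreal c1 * a z y + (\<Sum>i<k. c2 i * indicator (B i) y * indicator (B i) z) \<partial>lborel)
      = ennreal c1 * (\<integral>\<^sup>+y. a z y \<partial>lborel) + (\<Sum>i<k. c2 i * emeasure lborel (B i) * indicator (B i) z)" .
  qed
  also have "\<dots> = ennreal c1 * J \<sigma> A I v + (\<Sum>i<k. c2 i * emeasure lborel (B i) * emeasure lborel (B i))"
  proof -
    have "(\<integral>\<^sup>+z. ennreal c1 * (\<integral>\<^sup>+y. a z y \<partial>lborel) + (\<Sum>i<k. c2 i * emeasure lborel (B i) * indicator (B i) z) \<partial>lborel)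
      = (\<integral>\<^sup>+z. ennreal c1 * (\<integral>\<^sup>+y. a z y \<partial>lborel) \<partial>lborel)
        + (\<integral>\<^sup>+z. (\<Sum>i<k. c2 i * emeasure lborel (B i) * indicator (B i) z) \<partial>lborel)"
      by (rule nn_integral_add) measurable
    also have "(\<integral>\<^sup>+z. ennreal c1 * (\<integral>\<^sup>+y. a z y \<partial>lborel) \<partial>lborel) = ennreal c1 * J \<sigma> A I v"
      unfolding J_lborel d_def[symmetric] a_def[symmetric] by (rule nn_integral_cmult) measurable
    also have "(\<integral>\<^sup>+z. (\<Sum>i<k. c2 i * emeasure lborel (B i) * indicator (B i) z) \<partial>lborel)
      = (\<Sum>i<k. \<integral>\<^sup>+z. c2 i * emeasure lborel (B i) * indicator (B i) z \<partial>lborel)"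
      by (rule nn_integral_sum) measurable
    also have "\<dots> = (\<Sum>i<k. c2 i * emeasure lborel (B i) * emeasure lborel (B i))"
      by (intro sum.cong refl nn_integral_cmult_indicator) simp
    finally show ?thesis .
  qed
  also have "(\<Sum>i<k. c2 i * emeasure lborel (B i) * emeasure lborel (B i))
     = ennreal ((2 * L) powr \<sigma> * (unit_ball_vol ?n * L ^ ?n) ^ 2) * conj_sum (m + \<sigma>) ?n A l R k"
    unfolding conj_sum_def sum_distrib_left
  proof (rule sum.cong[OF refl])
    fix i
    let ?V = "unit_ball_vol ?n * (L * r i) ^ ?n"
    have V: "?V \<ge> 0" using L r[of i] by simp
    have "(2 * L) powr \<sigma> / r i ^ ?n * (?V * ?V) = (2 * L) powr \<sigma> * (unit_ball_vol ?n * L ^ ?n) ^ 2 * r i ^ ?n"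
      using r[of i] by (simp add: power_mult_distrib power2_eq_square mult_ac)
    then have "ennreal ((2 * L) powr \<sigma> / r i ^ ?n) * (ennreal ?V * ennreal ?V)
      = ennreal ((2 * L) powr \<sigma> * (unit_ball_vol ?n * L ^ ?n) ^ 2) * ennreal (r i ^ ?n)"
      using V r[of i] by (simp add: ennreal_mult'[symmetric] ennreal_mult''[symmetric])
    then have "c2 i * emeasure lborel (B i) * emeasure lborel (B i)
      = ennreal ((2 * L) powr \<sigma> * (unit_ball_vol ?n * L ^ ?n) ^ 2) * ennreal (r i ^ ?n) * \<Phi> i"
      unfolding vol c2_def by (simp only: mult_ac)
    then show "c2 i * emeasure lborel (B i) * emeasure lborel (B i) =
      ennreal ((2 * L) powr \<sigma> * (unit_ball_vol ?n * L ^ ?n) ^ 2) *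
        (ennreal ((R / 2 ^ i) ^ ?n) * (ennreal (l * (R / 2 ^ i) powr (m + \<sigma> - ?n)) * slope_level A (l * (R / 2 ^ i) powr (m + \<sigma> - ?n))))"
      unfolding \<Phi>_def r_def by (simp only: mult_ac)
  qed
  also have "ennreal c1 * J \<sigma> A I v + ennreal ((2 * L) powr \<sigma> * (unit_ball_vol ?n * L ^ ?n) ^ 2) * conj_sum (m + \<sigma>) ?n A l R k
     \<le> ennreal (sum_const \<sigma> ?n L) * J \<sigma> A I v + ennreal (sum_const \<sigma> ?n L) * conj_sum (m + \<sigma>) ?n A l R k"
    using c1 L by (intro add_mono mult_right_mono ennreal_leI) (auto simp: sum_const_def c1_def)
  finally show ?thesis unfolding w_def B_def r_def d_def by (simp add: distrib_left)
qed

section \<open>Continuous representatives\<close>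

lemma W_continuous:
  fixes g :: "real^'n::finite \<Rightarrow> real"
  assumes g: "loc_int g" and b: "\<And>i. bump (\<psi> i)" and \<rho>: "\<rho> > 0"
  shows "continuous_on UNIV (W g \<psi> \<rho>)"
  unfolding continuous_on_sequentially
proof (intro allI impI ballI, elim conjE)
  fix X :: "nat \<Rightarrow> real^'n" and a assume lim: "X \<longlonglongrightarrow> a"
  obtain B M where BM: "B > 0" "M > 0" "\<And>\<rho> x z. \<rho> > 0 \<Longrightarrow> \<bar>ker \<psi> \<rho> x z\<bar> \<le> B / \<rho> ^ CARD('n)"
    "\<And>\<rho> x z. \<rho> > 0 \<Longrightarrow> ker \<psi> \<rho> x z \<noteq> 0 \<Longrightarrow> norm (x - z) \<le> M * \<rho>"
    by (rule ker_bounds[of \<psi>, OF b]) blast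
  obtain K where K: "\<And>k. norm (X k) \<le> K"
    using convergent_imp_bounded[OF lim] unfolding bounded_iff by auto
  have [measurable]: "ker \<psi> \<rho> x \<in> borel_measurable borel" for x by (rule ker_measurable[of \<psi>, OF b])
  have [measurable]: "g \<in> borel_measurable borel" using g by (rule loc_int_measurable)
  have "(\<lambda>k. LINT z|lborel. g z * ker \<psi> \<rho> (X k) z) \<longlonglongrightarrow> (LINT z|lborel. g z * ker \<psi> \<rho> a z)"
  proof (rule integral_dominated_convergence[where w="\<lambda>z. \<bar>g z * (B / \<rho> ^ CARD('n) * indicator (cball 0 (K + M * \<rho>)) z)\<bar>"])
    show "integrable lborel (\<lambda>z. \<bar>g z * (B / \<rho> ^ CARD('n) * indicator (cball 0 (K + M * \<rho>)) z)\<bar>)"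
      by (intro integrable_abs loc_int_integrable_mult[OF g, where B="B / \<rho> ^ CARD('n)" and R="K + M * \<rho>"])
        (use BM(1) \<rho> in \<open>auto simp: indicator_def abs_mult split: if_splits\<close>)
    have cont: "continuous_on UNIV (prodf \<psi>)"
      by (rule prodf_continuous) (rule smooth_continuous[OF bump_smooth[OF b]])
    show "AE z in lborel. (\<lambda>k. g z * ker \<psi> \<rho> (X k) z) \<longlonglongrightarrow> g z * ker \<psi> \<rho> a z"
    proof (rule AE_I2)
      fix z
      have "(\<lambda>k. prodf \<psi> ((1 / \<rho>) *\<^sub>R (X k - z))) \<longlonglongrightarrow> prodf \<psi> ((1 / \<rho>) *\<^sub>R (a - z))"
        by (rule continuous_on_tendsto_compose[OF cont]) (auto intro!: tendsto_intros lim)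
      then show "(\<lambda>k. g z * ker \<psi> \<rho> (X k) z) \<longlonglongrightarrow> g z * ker \<psi> \<rho> a z"
        unfolding ker_def using \<rho> by (intro tendsto_intros) auto
    qed
    show "AE z in lborel. norm (g z * ker \<psi> \<rho> (X k) z)
        \<le> \<bar>g z * (B / \<rho> ^ CARD('n) * indicator (cball 0 (K + M * \<rho>)) z)\<bar>" for k
    proof (rule AE_I2)
      fix z
      have "\<bar>ker \<psi> \<rho> (X k) z\<bar> \<le> \<bar>B / \<rho> ^ CARD('n) * indicator (cball 0 (K + M * \<rho>)) z\<bar>"
      proof (cases "ker \<psi> \<rho> (X k) z = 0")
        case False
        have "norm z \<le> norm (X k) + norm (X k - z)" using norm_triangle_ineq4[of "X k" "X k - z"] by simp
        then have "norm z \<le> K + M * \<rho>" using K[of k] BM(4)[OF \<rho> False] by linarith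
        then show ?thesis using BM(3)[OF \<rho>, of "X k" z] BM(1) \<rho> by simp
      qed simp
      then show "norm (g z * ker \<psi> \<rho> (X k) z)
        \<le> \<bar>g z * (B / \<rho> ^ CARD('n) * indicator (cball 0 (K + M * \<rho>)) z)\<bar>"
        unfolding real_norm_def abs_mult[of "g z"] by (rule mult_left_mono) simp
    qed
  qed auto
  then show "(W g \<psi> \<rho> \<circ> X) \<longlonglongrightarrow> W g \<psi> \<rho> a" unfolding W_def comp_def .
qed

text \<open>Fubini and the substitution x = z + \<rho> y pass the averaging from \<open>g\<close> to
  \<phi>.\<close>

lemma integral_W_mult:
  fixes g :: "real^'n::finite \<Rightarrow> real"
  assumes g: "loc_int g" and b: "\<And>i. bump (\<psi> i)" and \<rho>: "\<rho> > 0"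
    and \<phi>[measurable]: "\<phi> \<in> borel_measurable borel" and B: "\<And>x. \<bar>\<phi> x\<bar> \<le> B" and R: "\<And>x. \<phi> x \<noteq> 0 \<Longrightarrow> norm x \<le> R"
  shows "(LINT x|lborel. W g \<psi> \<rho> x * \<phi> x)
    = (LINT z|lborel. g z * (LINT y|lborel. prodf \<psi> y * \<phi> (z + \<rho> *\<^sub>R y)))"
proof -
  obtain C M where CM: "C > 0" "M > 0" "\<And>\<rho> x z. \<rho> > 0 \<Longrightarrow> \<bar>ker \<psi> \<rho> x z\<bar> \<le> C / \<rho> ^ CARD('n)"
    "\<And>\<rho> x z. \<rho> > 0 \<Longrightarrow> ker \<psi> \<rho> x z \<noteq> 0 \<Longrightarrow> norm (x - z) \<le> M * \<rho>"
    by (rule ker_bounds[of \<psi>, OF b]) blast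
  have [measurable]: "prodf \<psi> \<in> borel_measurable borel" by (rule prodf_measurable[of \<psi>, OF b])
  have [measurable]: "g \<in> borel_measurable borel" using g by (rule loc_int_measurable)
  have [measurable]: "cball 0 (R + M * \<rho>) \<in> sets (borel :: (real^'n) measure)" by simp
  let ?F = "\<lambda>x z. g z * ker \<psi> \<rho> x z * \<phi> x"
  let ?c = "C / \<rho> ^ CARD('n)"
  have c: "?c \<ge> 0" using CM(1) \<rho> by simp
  have "integrable (lborel \<Otimes>\<^sub>M lborel) (case_prod ?F)"
  proof (rule integrableI_bounded)
    have mF: "case_prod ?F \<in> borel_measurable (lborel \<Otimes>\<^sub>M lborel)"
      unfolding ker_def by measurable
    then show "case_prod ?F \<in> borel_measurable (lborel \<Otimes>\<^sub>M lborel)" .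
    define G where "G = (\<integral>\<^sup>+z. ennreal \<bar>g z * (?c * indicator (cball 0 (R + M * \<rho>)) z)\<bar> \<partial>lborel)"
    have "integrable lborel (\<lambda>z. g z * (?c * indicator (cball 0 (R + M * \<rho>)) z))"
      by (intro loc_int_integrable_mult[OF g, where B="?c" and R="R + M * \<rho>"])
        (use c in \<open>auto simp: indicator_def abs_mult split: if_splits\<close>)
    then have G: "G < \<infinity>" unfolding G_def by (simp add: integrable_iff_bounded)
    have one: "loc_int (\<lambda>_::real^'n. 1)" by (rule loc_int_continuous) simp
    have "integrable lborel (\<lambda>x. 1 * \<phi> x)"
      by (rule loc_int_integrable_mult[OF one \<phi> B R])
    then have P: "(\<integral>\<^sup>+x. ennreal \<bar>\<phi> x\<bar> \<partial>lborel) < \<infinity>" by (simp add: integrable_iff_bounded)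
    have "(\<integral>\<^sup>+p. norm (case_prod ?F p) \<partial>(lborel \<Otimes>\<^sub>M lborel)) = (\<integral>\<^sup>+x. \<integral>\<^sup>+z. ennreal (norm (?F x z)) \<partial>lborel \<partial>lborel)"
      using mF by (subst lborel.nn_integral_fst[symmetric]) auto
    also have "\<dots> \<le> (\<integral>\<^sup>+x. ennreal \<bar>\<phi> x\<bar> * G \<partial>lborel)"
    proof (rule nn_integral_mono)
      fix x
      have "(\<integral>\<^sup>+z. ennreal (norm (?F x z)) \<partial>lborel)
          \<le> (\<integral>\<^sup>+z. ennreal \<bar>\<phi> x\<bar> * ennreal \<bar>g z * (?c * indicator (cball 0 (R + M * \<rho>)) z)\<bar> \<partial>lborel)"
      proof (rule nn_integral_mono)
        fix z
        have "norm (?F x z) \<le> \<bar>\<phi> x\<bar> * \<bar>g z * (?c * indicator (cball 0 (R + M * \<rho>)) z)\<bar>"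
        proof (cases "\<phi> x = 0 \<or> ker \<psi> \<rho> x z = 0")
          case False
          then have "norm x \<le> R" "norm (x - z) \<le> M * \<rho>" using R CM(4)[OF \<rho>] by blast+
          then have "z \<in> cball 0 (R + M * \<rho>)" using norm_triangle_ineq4[of x "x - z"] by simp
          then have "\<bar>ker \<psi> \<rho> x z\<bar> \<le> \<bar>?c * indicator (cball 0 (R + M * \<rho>)) z\<bar>"
            using CM(3)[OF \<rho>, of x z] CM(1) \<rho> by simp
          then have "\<bar>\<phi> x\<bar> * (\<bar>g z\<bar> * \<bar>ker \<psi> \<rho> x z\<bar>) \<le> \<bar>\<phi> x\<bar> * (\<bar>g z\<bar> * \<bar>?c * indicator (cball 0 (R + M * \<rho>)) z\<bar>)"
            by (intro mult_left_mono) auto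
          then show ?thesis by (simp only: real_norm_def abs_mult mult_ac)
        qed auto
        then show "ennreal (norm (?F x z)) \<le> ennreal \<bar>\<phi> x\<bar> * ennreal \<bar>g z * (?c * indicator (cball 0 (R + M * \<rho>)) z)\<bar>"
          unfolding ennreal_mult'[OF abs_ge_zero, symmetric] by (rule ennreal_leI)
      qed
      also have "\<dots> = ennreal \<bar>\<phi> x\<bar> * G"
        unfolding G_def by (rule nn_integral_cmult) measurable
      finally show "(\<integral>\<^sup>+z. ennreal (norm (?F x z)) \<partial>lborel) \<le> ennreal \<bar>\<phi> x\<bar> * G" .
    qed
    also have "\<dots> = (\<integral>\<^sup>+x. ennreal \<bar>\<phi> x\<bar> \<partial>lborel) * G" by (rule nn_integral_multc) measurable
    also have "\<dots> < \<infinity>" using G P by (simp add: ennreal_mult_less_top)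
    finally show "(\<integral>\<^sup>+p. norm (case_prod ?F p) \<partial>(lborel \<Otimes>\<^sub>M lborel)) < \<infinity>" .
  qed
  from lborel_pair.Fubini_integral[OF this]
  have swap: "(LINT x|lborel. LINT z|lborel. ?F x z) = (LINT z|lborel. LINT x|lborel. ?F x z)" by simp
  have inner1: "(LINT z|lborel. ?F x z) = W g \<psi> \<rho> x * \<phi> x" for x by (simp add: W_def)
  have inner2: "(LINT x|lborel. ?F x z) = g z * (LINT y|lborel. prodf \<psi> y * \<phi> (z + \<rho> *\<^sub>R y))" for z
  proof -
    have m: "(\<lambda>x. ker \<psi> \<rho> x z * \<phi> x) \<in> borel_measurable borel" unfolding ker_def by measurable
    have "(LINT x|lborel. ?F x z) = g z * (LINT x|lborel. ker \<psi> \<rho> x z * \<phi> x)"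
      by (simp add: mult.assoc)
    also have "(LINT x|lborel. ker \<psi> \<rho> x z * \<phi> x)
      = \<rho> ^ CARD('n) * (LINT y|lborel. ker \<psi> \<rho> (z + \<rho> *\<^sub>R y) z * \<phi> (z + \<rho> *\<^sub>R y))"
      using integral_lborel_affine[OF m, of \<rho> z] \<rho> by simp
    also have "\<dots> = (LINT y|lborel. \<rho> ^ CARD('n) * (ker \<psi> \<rho> (z + \<rho> *\<^sub>R y) z * \<phi> (z + \<rho> *\<^sub>R y)))" by simp
    also have "\<dots> = (LINT y|lborel. prodf \<psi> y * \<phi> (z + \<rho> *\<^sub>R y))"
      using \<rho> by (intro Bochner_Integration.integral_cong refl) (simp add: ker_def)
    finally show ?thesis .
  qed
  show ?thesis using swap unfolding inner1 inner2 .
qed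

text \<open>As the averaging acts on the continuous \<phi>, local integrability of \<open>g\<close>
  suffices. The mass of the kernel remains as a factor. The upper bound \<open>K\<close> on the
  scales provides one bounded set outside which all averaged test functions vanish.\<close>

lemma W_weak_limit:
  fixes g :: "real^'n::finite \<Rightarrow> real"
  assumes g: "loc_int g" and b: "\<And>i. bump (\<psi> i)" and \<rho>: "\<And>k. \<rho> k > 0" "\<And>k. \<rho> k \<le> K" "\<rho> \<longlonglongrightarrow> 0"
    and \<phi>: "continuous_on UNIV \<phi>" and B: "\<And>x. \<bar>\<phi> x\<bar> \<le> B" and R: "\<And>x. \<phi> x \<noteq> 0 \<Longrightarrow> norm x \<le> R"
  shows "(\<lambda>k. LINT x|lborel. W g \<psi> (\<rho> k) x * \<phi> x) \<longlonglongrightarrow> (LINT y|lborel. prodf \<psi> y) * (LINT z|lborel. g z * \<phi> z)"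
proof -
  have [measurable]: "\<phi> \<in> borel_measurable borel" using \<phi> by (rule borel_measurable_continuous_onI)
  have pm[measurable]: "prodf \<psi> \<in> borel_measurable borel" by (rule prodf_measurable[of \<psi>, OF b])
  have [measurable]: "g \<in> borel_measurable borel" using g by (rule loc_int_measurable)
  obtain M where M: "M > 0" "\<And>x. M < norm x \<Longrightarrow> prodf \<psi> x = 0" by (rule prodf_support[of \<psi>, OF b]) blast
  have B0: "B \<ge> 0" using B[of 0] by linarith
  have one: "loc_int (\<lambda>_::real^'n. 1)" by (rule loc_int_continuous) simp
  have i\<psi>: "integrable lborel (prodf \<psi>)" using loc_int_prodf[of _ \<psi>, OF one b] by simp
  define P where "P = (LINT y|lborel. B * \<bar>prodf \<psi> y\<bar>)"
  have P0: "P \<ge> 0" unfolding P_def using B0 by (intro Bochner_Integration.integral_nonneg) auto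
  define H where "H k z = (LINT y|lborel. prodf \<psi> y * \<phi> (z + \<rho> k *\<^sub>R y))" for k z
  have bnd: "norm (prodf \<psi> y * \<phi> (z + \<rho> k *\<^sub>R y)) \<le> B * \<bar>prodf \<psi> y\<bar>" for y z k
    using B[of "z + \<rho> k *\<^sub>R y"] by (simp add: abs_mult mult.commute[of B] mult_left_mono)
  have H_lim: "(\<lambda>k. H k z) \<longlonglongrightarrow> (LINT y|lborel. prodf \<psi> y) * \<phi> z" for z
  proof -
    have "(\<lambda>k. H k z) \<longlonglongrightarrow> (LINT y|lborel. prodf \<psi> y * \<phi> z)"
      unfolding H_def
    proof (rule integral_dominated_convergence[where w="\<lambda>y. B * \<bar>prodf \<psi> y\<bar>"])
      show "integrable lborel (\<lambda>y. B * \<bar>prodf \<psi> y\<bar>)" using i\<psi> by simp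
      show "AE y in lborel. (\<lambda>k. prodf \<psi> y * \<phi> (z + \<rho> k *\<^sub>R y)) \<longlonglongrightarrow> prodf \<psi> y * \<phi> z"
      proof (rule AE_I2)
        fix y
        have "(\<lambda>k. z + \<rho> k *\<^sub>R y) \<longlonglongrightarrow> z + 0 *\<^sub>R y" by (intro tendsto_intros \<rho>)
        then have "(\<lambda>k. \<phi> (z + \<rho> k *\<^sub>R y)) \<longlonglongrightarrow> \<phi> z"
          by (intro continuous_on_tendsto_compose[OF \<phi>]) auto
        then show "(\<lambda>k. prodf \<psi> y * \<phi> (z + \<rho> k *\<^sub>R y)) \<longlonglongrightarrow> prodf \<psi> y * \<phi> z" by (intro tendsto_intros)
      qed
      show "AE y in lborel. norm (prodf \<psi> y * \<phi> (z + \<rho> k *\<^sub>R y)) \<le> B * \<bar>prodf \<psi> y\<bar>" for k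
        using bnd by simp
    qed auto
    then show ?thesis by simp
  qed
  have HP: "\<bar>H k z\<bar> \<le> P * indicator (cball 0 (R + K * M)) z" for k z
  proof (cases "norm z \<le> R + K * M")
    case True
    have "norm (H k z) \<le> (LINT y|lborel. norm (prodf \<psi> y * \<phi> (z + \<rho> k *\<^sub>R y)))"
      unfolding H_def by (rule integral_norm_bound)
    also have "\<dots> \<le> P"
      unfolding P_def using i\<psi> bnd B0
      by (intro integral_mono' ) auto
    finally show ?thesis using True by simp
  next
    case False
    have "prodf \<psi> y * \<phi> (z + \<rho> k *\<^sub>R y) = 0" for y
    proof (rule ccontr)
      assume "\<not> ?thesis"
      then have "norm y \<le> M" "norm (z + \<rho> k *\<^sub>R y) \<le> R" using M(2)[of y] R by (auto simp: not_less[symmetric])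
      moreover have "norm (\<rho> k *\<^sub>R y) \<le> K * M"
        using \<open>norm y \<le> M\<close> \<rho>(1,2)[of k] by (auto intro!: mult_mono)
      ultimately show False using False norm_triangle_ineq4[of "z + \<rho> k *\<^sub>R y" "\<rho> k *\<^sub>R y"] by simp
    qed
    then have "H k z = 0" unfolding H_def by (simp only: Bochner_Integration.integral_zero)
    then show ?thesis using False by simp
  qed
  have Hm[measurable]: "H k \<in> borel_measurable borel" for k
  proof -
    have "(\<lambda>(z, y). prodf \<psi> y * \<phi> (z + \<rho> k *\<^sub>R y)) \<in> borel_measurable (borel \<Otimes>\<^sub>M lborel)" by measurable
    then show ?thesis unfolding H_def[abs_def] by (rule lborel.borel_measurable_lebesgue_integral)
  qed
  have "(\<lambda>k. LINT z|lborel. g z * H k z) \<longlonglongrightarrow> (LINT z|lborel. g z * ((LINT y|lborel. prodf \<psi> y) * \<phi> z))"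
  proof (rule integral_dominated_convergence[where w="\<lambda>z. \<bar>g z * (P * indicator (cball 0 (R + K * M)) z)\<bar>"])
    show "integrable lborel (\<lambda>z. \<bar>g z * (P * indicator (cball 0 (R + K * M)) z)\<bar>)"
      by (intro integrable_abs loc_int_integrable_mult[OF g, where B=P and R="R + K * M"])
        (use P0 in \<open>auto simp: indicator_def abs_mult split: if_splits\<close>)
    show "AE z in lborel. (\<lambda>k. g z * H k z) \<longlonglongrightarrow> g z * ((LINT y|lborel. prodf \<psi> y) * \<phi> z)"
      by (intro AE_I2 tendsto_intros H_lim)
    show "AE z in lborel. norm (g z * H k z) \<le> \<bar>g z * (P * indicator (cball 0 (R + K * M)) z)\<bar>" for k
    proof (rule AE_I2)
      fix z
      have "\<bar>H k z\<bar> \<le> \<bar>P * indicator (cball 0 (R + K * M)) z\<bar>" using HP[of k z] by linarith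
      then show "norm (g z * H k z) \<le> \<bar>g z * (P * indicator (cball 0 (R + K * M)) z)\<bar>"
        unfolding real_norm_def abs_mult[of "g z"] by (rule mult_left_mono) simp
    qed
  qed auto
  moreover have "(LINT z|lborel. g z * ((LINT y|lborel. prodf \<psi> y) * \<phi> z)) = (LINT y|lborel. prodf \<psi> y) * (LINT z|lborel. g z * \<phi> z)"
    by (simp add: mult.left_commute[of _ "LINT y|lborel. prodf \<psi> y"])
  moreover have "(LINT x|lborel. W g \<psi> (\<rho> k) x * \<phi> x) = (LINT z|lborel. g z * H k z)" for k
    unfolding H_def by (rule integral_W_mult[of g \<psi>, OF g b \<rho>(1) _ B R]) simp
  ultimately show ?thesis by simp
qed

section \<open>Telescoping and convergence of the smoothings\<close>

lemma ennreal_mult_le_lift: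
  assumes "ennreal a \<le> ennreal b * X" "l \<ge> 0" "a \<ge> 0"
  shows "ennreal (l * a) \<le> ennreal b * (ennreal l * X)"
  using mult_left_mono[OF assms(1), of "ennreal l"] assms(2) by (simp add: ennreal_mult' mult.left_commute)

locale young_system = weak_system m g for m and g :: "('n::finite \<Rightarrow> nat) \<Rightarrow> real^'n \<Rightarrow> real" +
  fixes A :: "real \<Rightarrow> ennreal" and \<sigma> :: real
  assumes young: "young_function A" and sg: "0 < \<sigma>"
begin

abbreviation "modular \<equiv> J \<sigma> A (multi_indices m) (\<lambda>x \<alpha>. g \<alpha> x)"

lemma sum_const_reach_pos: "(sum_const \<sigma> CARD('n) reach) > 0" by (rule sum_const_pos[OF sg reach_pos])
lemma bump_mass_pos: "(LINT y|lborel. prodf (\<lambda>_::'n. std_bump) y) > 0" by (rule integral_std_bump_pos)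

lemma vosc_sum_le:
  assumes l: "l > 0" and R: "R > 0"
  shows "(\<Sum>i<k. ennreal (l * ((R / 2 ^ i) ^ m / (R / 2 ^ i) ^ (2 * CARD('n)))) * vosc x (reach * (R / 2 ^ i)))
    \<le> ennreal (sum_const \<sigma> CARD('n) reach) * (modular + conj_sum (m + \<sigma>) CARD('n) A l R k)"
  unfolding vosc_def
  by (rule scale_sum_le[OF young sg reach_pos l R finite_multi_indices])
    (use loc_int_g in \<open>auto simp: multi_indices_def intro!: loc_int_measurable\<close>)

text \<open>The parameter \<open>l\<close> is the free slope in Young's inequality: the modular
  enters without \<open>l\<close>, the left-hand side with it, and \<open>conj_sum\<close> grows
  with it. It is chosen later, differently for convergence and for the final bound.\<close>

lemma smoothing_telescope:
  assumes l: "l > 0" and R: "R > 0"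
  shows "ennreal (l * \<bar>smoothing R x - smoothing (R / 2 ^ k) x\<bar>)
    \<le> ennreal (step_const m CARD('n) * (sum_const \<sigma> CARD('n) reach)) * (modular + conj_sum (m + \<sigma>) CARD('n) A l R k)"
proof -
  have K: "step_const m CARD('n) > 0" by (rule step_const_pos) simp
  let ?s = "\<lambda>i. smoothing (R / 2 ^ i) x"
  let ?w = "\<lambda>i. (R / 2 ^ i) ^ m / (R / 2 ^ i) ^ (2 * CARD('n))"
  have "?s 0 - ?s k = (\<Sum>i<k. ?s i - ?s (Suc i))" by (rule sum_lessThan_telescope'[symmetric])
  then have "\<bar>?s 0 - ?s k\<bar> \<le> (\<Sum>i<k. \<bar>?s i - ?s (Suc i)\<bar>)" by (simp add: sum_abs)
  then have "ennreal (l * \<bar>?s 0 - ?s k\<bar>) \<le> ennreal (\<Sum>i<k. l * \<bar>?s i - ?s (Suc i)\<bar>)"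
    using l by (intro ennreal_leI) (simp add: sum_distrib_left[symmetric] mult_left_mono)
  also have "\<dots> = (\<Sum>i<k. ennreal (l * \<bar>?s i - ?s (Suc i)\<bar>))" using l by (subst sum_ennreal) auto
  also have "\<dots> \<le> (\<Sum>i<k. ennreal (step_const m CARD('n)) * (ennreal (l * ?w i) * vosc x (reach * (R / 2 ^ i))))"
  proof (rule sum_mono)
    fix i
    have "ennreal \<bar>?s i - ?s (Suc i)\<bar> \<le> ennreal (step_const m CARD('n) * ?w i) * vosc x (reach * (R / 2 ^ i))"
      using smoothing_scale_step[of "R / 2 ^ i" x] R by (simp add: mult.commute)
    also have "\<dots> = ennreal (step_const m CARD('n)) * (ennreal (?w i) * vosc x (reach * (R / 2 ^ i)))"
      unfolding ennreal_mult'[OF less_imp_le[OF K]] by (rule mult.assoc)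
    finally have "ennreal (l * \<bar>?s i - ?s (Suc i)\<bar>) \<le>
       ennreal (step_const m CARD('n)) * (ennreal l * (ennreal (?w i) * vosc x (reach * (R / 2 ^ i))))"
      using l by (intro ennreal_mult_le_lift) auto
    also have "ennreal l * (ennreal (?w i) * vosc x (reach * (R / 2 ^ i))) = ennreal (l * ?w i) * vosc x (reach * (R / 2 ^ i))"
      unfolding ennreal_mult'[OF less_imp_le[OF l]] by (rule mult.assoc[symmetric])
    finally show "ennreal (l * \<bar>?s i - ?s (Suc i)\<bar>) \<le> ennreal (step_const m CARD('n)) * (ennreal (l * ?w i) * vosc x (reach * (R / 2 ^ i)))" .
  qed
  also have "\<dots> = ennreal (step_const m CARD('n)) * (\<Sum>i<k. ennreal (l * ?w i) * vosc x (reach * (R / 2 ^ i)))"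
    by (rule sum_distrib_left[symmetric])
  also have "\<dots> \<le> ennreal (step_const m CARD('n)) * (ennreal (sum_const \<sigma> CARD('n) reach) * (modular + conj_sum (m + \<sigma>) CARD('n) A l R k))"
    by (intro mult_left_mono vosc_sum_le l R) simp
  also have "\<dots> = ennreal (step_const m CARD('n) * (sum_const \<sigma> CARD('n) reach)) * (modular + conj_sum (m + \<sigma>) CARD('n) A l R k)"
    unfolding ennreal_mult'[OF less_imp_le[OF K]] by (rule mult.assoc[symmetric])
  finally show ?thesis by simp
qed

text \<open>Only one scale is involved, so this uses the sum over scales with k = 1.\<close>

lemma smoothing_difference_le:
  assumes l: "l > 0" and R: "R > 0" and h: "norm h \<le> R"
  shows "ennreal (l * \<bar>\<Sum>j\<le>Suc m. (-1) ^ j * real (Suc m choose j) * smoothing R (x + real j *\<^sub>R h)\<bar>)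
    \<le> ennreal (diff_const m CARD('n) * (sum_const \<sigma> CARD('n) reach)) * (modular + conj_sum (m + \<sigma>) CARD('n) A l R 1)"
proof -
  have K: "diff_const m CARD('n) > 0" by (rule diff_const_pos) simp
  let ?d = "\<bar>\<Sum>j\<le>Suc m. (-1) ^ j * real (Suc m choose j) * smoothing R (x + real j *\<^sub>R h)\<bar>"
  let ?w = "R ^ m / R ^ (2 * CARD('n))"
  have "ennreal ?d \<le> ennreal (diff_const m CARD('n) * ?w) * vosc x (reach * R)"
    by (rule smoothing_difference[OF R h])
  also have "\<dots> = ennreal (diff_const m CARD('n)) * (ennreal ?w * vosc x (reach * R))"
    unfolding ennreal_mult'[OF less_imp_le[OF K]] by (rule mult.assoc)
  finally have "ennreal (l * ?d) \<le> ennreal (diff_const m CARD('n)) * (ennreal l * (ennreal ?w * vosc x (reach * R)))"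
    using l by (intro ennreal_mult_le_lift) auto
  also have "ennreal l * (ennreal ?w * vosc x (reach * R)) = ennreal (l * ?w) * vosc x (reach * R)"
    unfolding ennreal_mult'[OF less_imp_le[OF l]] by (rule mult.assoc[symmetric])
  also have "\<dots> \<le> ennreal (sum_const \<sigma> CARD('n) reach) * (modular + conj_sum (m + \<sigma>) CARD('n) A l R 1)"
    using vosc_sum_le[OF l R, where k=1 and x=x] by simp
  finally have "ennreal (l * ?d) \<le> ennreal (diff_const m CARD('n)) * (ennreal (sum_const \<sigma> CARD('n) reach) * (modular + conj_sum (m + \<sigma>) CARD('n) A l R 1))"
    by (simp add: mult_left_mono)
  then show ?thesis unfolding ennreal_mult'[OF less_imp_le[OF K]] mult.assoc .
qed

lemma smoothing_continuous: "R > 0 \<Longrightarrow> continuous_on UNIV (smoothing R)"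
proof -
  assume R: "R > 0"
  have "continuous_on UNIV (U (real j * R))" if "j \<in> {1..Suc m}" for j
    unfolding U_def using that R
    by (intro W_continuous[where \<psi>="\<lambda>_. std_bump"] loc_int_g bump_std_bump) auto
  then show ?thesis
    unfolding smoothing_def extrap_def by (intro continuous_intros) auto
qed

lemma U_weak_limit:
  assumes q: "\<And>i. bump (q i)" and \<rho>: "\<And>k. \<rho> k > 0" "\<And>k. \<rho> k \<le> K" "\<rho> \<longlonglongrightarrow> 0"
  shows "(\<lambda>k. LINT x|lborel. U (\<rho> k) x * prodf q x) \<longlonglongrightarrow> (LINT y|lborel. prodf (\<lambda>_::'n. std_bump) y) * (LINT z|lborel. g (\<lambda>_. 0) z * prodf q z)"
proof -
  obtain B where B: "B > 0" "\<And>x. \<bar>prodf q x\<bar> \<le> B" by (rule prodf_bounded[of q, OF q]) blast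
  obtain M where M: "M > 0" "\<And>x. M < norm x \<Longrightarrow> prodf q x = 0" by (rule prodf_support[of q, OF q]) blast
  show ?thesis
    unfolding U_def
  proof (rule W_weak_limit[where \<psi>="\<lambda>_. std_bump"])
    show "continuous_on UNIV (prodf q)"
      by (rule prodf_continuous) (rule smooth_continuous[OF bump_smooth[OF q]])
    show "\<bar>prodf q x\<bar> \<le> B" for x by (rule B(2))
    show "norm x \<le> M" if "prodf q x \<noteq> 0" for x using M(2)[of x] that by linarith
  qed (use \<rho> loc_int_g bump_std_bump in auto)
qed

lemma smoothing_weak_limit:
  assumes q: "\<And>i. bump (q i)"
  shows "(\<lambda>k. LINT x|lborel. smoothing (1 / 2 ^ k) x * prodf q x) \<longlonglongrightarrow> (LINT y|lborel. prodf (\<lambda>_::'n. std_bump) y) * (LINT z|lborel. g (\<lambda>_. 0) z * prodf q z)"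
proof -
  let ?w = "\<lambda>j. (-1) ^ j * real (Suc m choose j)"
  let ?I = "(LINT y|lborel. prodf (\<lambda>_::'n. std_bump) y) * (LINT z|lborel. g (\<lambda>_. 0) z * prodf q z)"
  have int: "integrable lborel (\<lambda>x. U \<rho> x * prodf q x)" if "\<rho> > 0" for \<rho>
    unfolding U_def
    by (rule loc_int_prodf[OF loc_int_continuous[OF W_continuous[where \<psi>="\<lambda>_. std_bump"]] q])
      (use that loc_int_g bump_std_bump in auto)
  have "(\<lambda>k. - (\<Sum>j=1..Suc m. ?w j * (LINT x|lborel. U (real j * (1 / 2 ^ k)) x * prodf q x)))
      \<longlonglongrightarrow> - (\<Sum>j=1..Suc m. ?w j * ?I)"
  proof (intro tendsto_intros U_weak_limit q)
    fix j assume j: "j \<in> {1..Suc m}"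
    show "0 < real j * (1 / 2 ^ k)" for k using j by simp
    show "real j * (1 / 2 ^ k) \<le> real j" for k
      using mult_left_mono[of 1 "2 ^ k :: real" "real j"] by (simp add: divide_le_eq)
    have "(\<lambda>k. real j * (1 / 2) ^ k) \<longlonglongrightarrow> real j * 0"
      by (intro tendsto_intros LIMSEQ_realpow_zero) auto
    then show "(\<lambda>k. real j * (1 / 2 ^ k)) \<longlonglongrightarrow> 0" by (simp add: power_divide)
  qed
  \<comment> \<open>Extrapolation preserves constants: the full alternating sum of the weights is 0
    and its term at j = 0 is 1.\<close>
  moreover have "- (\<Sum>j=1..Suc m. ?w j * ?I) = ?I"
  proof -
    have S: "{..Suc m} = insert 0 {1..Suc m}" by auto
    have "(\<Sum>j\<le>Suc m. ?w j) = 0" using alternating_binomial_power_sum[of 0 "Suc m"] by simp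
    then have "(\<Sum>j=1..Suc m. ?w j) = -1" unfolding S by simp
    then show ?thesis by (simp only: sum_distrib_right[symmetric])
  qed
  moreover have "(LINT x|lborel. smoothing (1 / 2 ^ k) x * prodf q x)
     = - (\<Sum>j=1..Suc m. ?w j * (LINT x|lborel. U (real j * (1 / 2 ^ k)) x * prodf q x))" for k
  proof -
    have "(LINT x|lborel. smoothing (1 / 2 ^ k) x * prodf q x)
      = (LINT x|lborel. - (\<Sum>j=1..Suc m. ?w j * (U (real j * (1 / 2 ^ k)) x * prodf q x)))"
      unfolding smoothing_def extrap_def by (simp only: mult_minus_left sum_distrib_right mult.assoc)
    also have "\<dots> = - (LINT x|lborel. (\<Sum>j=1..Suc m. ?w j * (U (real j * (1 / 2 ^ k)) x * prodf q x)))"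
      by (rule Bochner_Integration.integral_minus)
    also have "(LINT x|lborel. (\<Sum>j=1..Suc m. ?w j * (U (real j * (1 / 2 ^ k)) x * prodf q x)))
      = (\<Sum>j=1..Suc m. LINT x|lborel. ?w j * (U (real j * (1 / 2 ^ k)) x * prodf q x))"
      by (rule Bochner_Integration.integral_sum) (intro integrable_mult_right int, simp)
    finally show ?thesis by (simp only: integral_mult_right_zero)
  qed
  ultimately show ?thesis by (simp only:)
qed

text \<open>The modular does not become small at fine scales in this estimate; it is beaten by a
  large slope \<open>l\<close>. For that fixed \<open>l\<close> the bounded sums form a convergent
  series, whose tail is at most 1 from some scale on.\<close>

lemma smoothing_uniform_Cauchy:
  assumes J: "modular < \<infinity>" and c: "\<And>l k. l > 0 \<Longrightarrow> conj_sum (m + \<sigma>) CARD('n) A l 1 k \<le> ennreal (c l)" and e: "e > 0"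
  shows "\<exists>N. \<forall>x k. \<bar>smoothing (1 / 2 ^ N) x - smoothing (1 / 2 ^ (N + k)) x\<bar> \<le> e"
proof -
  obtain Jr where Jr: "modular = ennreal Jr" "Jr \<ge> 0" using J by (cases modular) auto
  let ?KC = "step_const m CARD('n) * (sum_const \<sigma> CARD('n) reach)"
  have KC: "?KC > 0" by (intro mult_pos_pos sum_const_reach_pos step_const_pos) simp
  define l where "l = ?KC * (Jr + 1) / e"
  have l: "l > 0" unfolding l_def using Jr(2) by (intro divide_pos_pos[OF mult_pos_pos[OF KC] e]) simp
  define a where "a i = ennreal ((1 / 2 ^ i) ^ CARD('n)) *
     (ennreal (l * (1 / 2 ^ i) powr (m + \<sigma> - CARD('n))) * slope_level A (l * (1 / 2 ^ i) powr (m + \<sigma> - CARD('n))))" for i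
  have sa: "(\<Sum>i<k. a i) \<le> ennreal (c l)" for k
    using c[OF l, of k] by (simp add: conj_sum_def a_def)
  have fin: "a i < top" for i
  proof -
    have "a i \<le> (\<Sum>j<Suc i. a j)" by (intro member_le_sum) auto
    also have "\<dots> < top" using sa[of "Suc i"] ennreal_less_top le_less_trans by blast
    finally show ?thesis .
  qed
  define b where "b i = enn2real (a i)" for i
  have b: "b i \<ge> 0" "a i = ennreal (b i)" for i using fin[of i] by (auto simp: b_def)
  have sb: "(\<Sum>i\<in>S. a i) = ennreal (\<Sum>i\<in>S. b i)" for S using b by simp
  have "summable b"
  proof (rule summableI_nonneg_bounded[where x="max 0 (c l)"])
    fix k
    have "ennreal (\<Sum>i<k. b i) \<le> ennreal (max 0 (c l))"
      by (rule order_trans[OF sa[of k, unfolded sb] ennreal_leI]) simp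
    then show "(\<Sum>i<k. b i) \<le> max 0 (c l)" by (rule ennreal_le_iff[THEN iffD1, rotated]) simp
  qed (rule b(1))
  then obtain N where N: "\<And>k. norm (sum b {N..<k}) < 1"
    unfolding summable_Cauchy by (metis order_refl zero_less_one)
  show ?thesis
  proof (intro exI[of _ N] allI)
    fix x k
    \<comment> \<open>Starting at scale 2^(-N) means dropping the first \<open>N\<close> terms of
      the series started at scale 1.\<close>
    have "conj_sum (m + \<sigma>) CARD('n) A l (1 / 2 ^ N) k = (\<Sum>i<k. a (i + N))"
      unfolding conj_sum_def a_def by (intro sum.cong refl) (simp add: power_add mult.commute)
    also have "\<dots> = (\<Sum>i\<in>{N..<N + k}. a i)"
      using sum.shift_bounds_nat_ivl[of a 0 N k] by (simp add: atLeast0LessThan add.commute)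
    also have "\<dots> \<le> 1"
      unfolding sb using N[of "N + k"] by (simp add: ennreal_le_1)
    finally have cs: "conj_sum (m + \<sigma>) CARD('n) A l (1 / 2 ^ N) k \<le> 1" .
    have "ennreal (l * \<bar>smoothing (1 / 2 ^ N) x - smoothing (1 / 2 ^ N / 2 ^ k) x\<bar>)
      \<le> ennreal ?KC * (modular + conj_sum (m + \<sigma>) CARD('n) A l (1 / 2 ^ N) k)"
      by (rule smoothing_telescope[OF l]) simp
    also have "\<dots> \<le> ennreal ?KC * (ennreal Jr + 1)"
      unfolding Jr(1) by (intro mult_left_mono add_left_mono cs) simp
    also have "\<dots> = ennreal (?KC * (Jr + 1))"
      using KC Jr(2) by (simp add: ennreal_mult' ennreal_plus[symmetric] del: ennreal_plus flip: ennreal_1)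
    finally have "l * \<bar>smoothing (1 / 2 ^ N) x - smoothing (1 / 2 ^ N / 2 ^ k) x\<bar> \<le> ?KC * (Jr + 1)"
      using KC Jr(2) by (subst (asm) ennreal_le_iff) auto
    also have "?KC * (Jr + 1) = l * e" using e by (simp add: l_def)
    finally have "\<bar>smoothing (1 / 2 ^ N) x - smoothing (1 / 2 ^ N / 2 ^ k) x\<bar> \<le> e"
      using l by (simp add: mult_le_cancel_left_pos)
    then show "\<bar>smoothing (1 / 2 ^ N) x - smoothing (1 / 2 ^ (N + k)) x\<bar> \<le> e" by (simp add: power_add)
  qed
qed

end

text \<open>Here \<open>r\<close> stands for the integral of (t / A(t))^(s / (n - s)) over (0,
  \<infinity>). In the last factor 1 is the share of the modular at the optimal slope and the
  fraction that of \<open>conj_sum\<close>; \<open>reach\<close> is written out.\<close>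

definition bound_const :: "nat \<Rightarrow> real \<Rightarrow> nat \<Rightarrow> real \<Rightarrow> real" where
  "bound_const m \<sigma> n r = (diff_const m n + 2 ^ Suc m * step_const m n)
     * sum_const \<sigma> n ((real n + 1) * (real m + 1)) * (1 + r / (1 - 2 powr - (m + \<sigma>)))"

lemma le_0_if_le_multiples:
  fixes a K :: real
  assumes "\<And>d. d > 0 \<Longrightarrow> a \<le> K * d" "K \<ge> 0"
  shows "a \<le> 0"
proof (rule field_le_epsilon)
  fix e :: real assume e: "e > 0"
  have "a \<le> K * (e / (K + 1))" using assms(2) e by (intro assms(1)) simp
  also have "\<dots> \<le> e" using assms(2) e by (simp add: divide_le_eq distrib_left)
  finally show "a \<le> 0 + e" by simp
qed

text \<open>The steps that are bad for one j form the preimage of the level set under h |-> x + j h,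
  so they have finite measure since j is positive. Finitely many such sets cannot fill the
  space.\<close>

lemma exists_all_small:
  fixes w :: "real^'n::finite \<Rightarrow> real"
  assumes w: "continuous_on UNIV w" and fin: "emeasure lborel {x. t < \<bar>w x\<bar>} < \<infinity>"
  shows "\<exists>h. \<forall>j\<in>{1..N}. \<bar>w (x + real j *\<^sub>R h)\<bar> \<le> t"
proof -
  have [measurable]: "w \<in> borel_measurable borel" using w by (rule borel_measurable_continuous_onI)
  define E where "E j = {h. t < \<bar>w (x + real j *\<^sub>R h)\<bar>}" for j
  have mE: "E j \<in> sets borel" for j
  proof -
    have "E j = {h \<in> space borel. t < \<bar>w (x + real j *\<^sub>R h)\<bar>}" by (simp add: E_def)
    also have "\<dots> \<in> sets borel" by measurable
    finally show ?thesis .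
  qed
  have m0: "{x. t < \<bar>w x\<bar>} \<in> sets borel"
  proof -
    have "{x. t < \<bar>w x\<bar>} = {x \<in> space borel. t < \<bar>w x\<bar>}" by simp
    also have "\<dots> \<in> sets borel" by measurable
    finally show ?thesis .
  qed
  have "emeasure lborel (E j) < \<infinity>" if j: "j \<in> {1..N}" for j
  proof -
    have "emeasure lborel {x. t < \<bar>w x\<bar>} = (\<integral>\<^sup>+x. indicator {x. t < \<bar>w x\<bar>} x \<partial>lborel)" using m0 by simp
    also have "\<dots> = ennreal (\<bar>real j\<bar> ^ DIM(real^'n)) * (\<integral>\<^sup>+h. indicator {x. t < \<bar>w x\<bar>} (x + real j *\<^sub>R h) \<partial>lborel)"
      using j m0 by (intro nn_integral_lborel_affine) auto
    also have "(\<integral>\<^sup>+h. indicator {x. t < \<bar>w x\<bar>} (x + real j *\<^sub>R h) \<partial>lborel) = (\<integral>\<^sup>+h. indicator (E j) h \<partial>lborel)"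
      by (intro nn_integral_cong) (simp add: indicator_def E_def)
    also have "\<dots> = emeasure lborel (E j)" using mE[of j] by simp
    finally have "ennreal (\<bar>real j\<bar> ^ DIM(real^'n)) * emeasure lborel (E j) < \<infinity>" using fin by simp
    then show ?thesis using j by (auto simp: ennreal_mult_less_top)
  qed
  then have "(\<Sum>j\<in>{1..N}. emeasure lborel (E j)) < \<infinity>" by (simp add: less_top)
  moreover have "emeasure lborel (\<Union>j\<in>{1..N}. E j) \<le> (\<Sum>j\<in>{1..N}. emeasure lborel (E j))"
    using mE by (intro emeasure_subadditive_finite) auto
  ultimately have "emeasure lborel (\<Union>j\<in>{1..N}. E j) < \<infinity>" by (rule le_less_trans[rotated])
  then have "(\<Union>j\<in>{1..N}. E j) \<noteq> UNIV"
    using emeasure_lborel_UNIV[where ?'a="real^'n"] by (metis infinity_ennreal_def less_irrefl)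
  then obtain h where "h \<notin> (\<Union>j\<in>{1..N}. E j)" by blast
  then show ?thesis by (auto simp: E_def not_less)
qed

context young_system
begin

text \<open>Uniform convergence makes the limit continuous; the weak limit, tested against tensor
  bumps, identifies it with \<open>g (\<lambda>_. 0)\<close> times the mass of the bump.\<close>

lemma smoothing_limit:
  assumes J: "modular < \<infinity>" and c: "\<And>l k. l > 0 \<Longrightarrow> conj_sum (m + \<sigma>) CARD('n) A l 1 k \<le> ennreal (c l)"
  shows "\<exists>v. continuous_on UNIV v \<and> (\<forall>x. (\<lambda>k. smoothing (1 / 2 ^ k) x) \<longlonglongrightarrow> v x)
    \<and> (AE x in lborel. g (\<lambda>_. 0) x = v x / (LINT y|lborel. prodf (\<lambda>_::'n. std_bump) y))"
proof -
  let ?S = "\<lambda>k. smoothing (1 / 2 ^ k)"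
  let ?c0 = "(LINT y|lborel. prodf (\<lambda>_::'n. std_bump) y)"
  have "uniformly_Cauchy_on UNIV ?S"
  proof (rule uniformly_Cauchy_onI')
    fix e :: real assume e: "e > 0"
    obtain N where N: "\<And>x k. \<bar>?S N x - ?S (N + k) x\<bar> \<le> e / 3"
      using smoothing_uniform_Cauchy[OF J c, of "e / 3"] e by auto
    have "dist (?S a x) (?S b x) < e" if "a \<ge> N" "b > a" for x a b
    proof -
      have "\<bar>?S N x - ?S a x\<bar> \<le> e / 3" "\<bar>?S N x - ?S b x\<bar> \<le> e / 3"
        using N[of x "a - N"] N[of x "b - N"] that by auto
      then show ?thesis unfolding dist_real_def using e by linarith
    qed
    then show "\<exists>M. \<forall>x\<in>UNIV. \<forall>m\<ge>M. \<forall>n>m. dist (?S m x) (?S n x) < e" by blast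
  qed
  then have "uniformly_convergent_on UNIV ?S" by (rule Cauchy_uniformly_convergent)
  then obtain v where v: "uniform_limit UNIV ?S v sequentially" by (auto simp: uniformly_convergent_on_def)
  have vc: "continuous_on UNIV v"
    by (rule uniform_limit_theorem[OF _ v]) (simp_all add: smoothing_continuous)
  have vlim: "(\<lambda>k. ?S k x) \<longlonglongrightarrow> v x" for x by (rule tendsto_uniform_limitI[OF v]) simp
  have "\<forall>\<^sub>F k in sequentially. \<forall>x\<in>UNIV. dist (?S k x) (v x) < 1"
    using v unfolding uniform_limit_iff by simp
  then obtain N where N: "\<And>k x. k \<ge> N \<Longrightarrow> \<bar>?S k x - v x\<bar> < 1"
    by (auto simp: eventually_sequentially dist_real_def)
  have liv: "loc_int v" using vc by (rule loc_int_continuous)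
  have one: "loc_int (\<lambda>_::real^'n. 1)" by (rule loc_int_continuous) simp
  have orth: "(LINT x|lborel. v x * prodf q x) = ?c0 * (LINT x|lborel. g (\<lambda>_. 0) x * prodf q x)"
    if q: "\<And>i. bump (q i)" for q
  proof (rule LIMSEQ_unique)
    have [measurable]: "prodf q \<in> borel_measurable borel" by (rule prodf_measurable[of q, OF q])
    have [measurable]: "v \<in> borel_measurable borel" using vc by (rule borel_measurable_continuous_onI)
    have [measurable]: "?S k \<in> borel_measurable borel" for k
      by (rule borel_measurable_continuous_onI) (simp add: smoothing_continuous)
    have "(\<lambda>k. LINT x|lborel. ?S (k + N) x * prodf q x) \<longlonglongrightarrow> (LINT x|lborel. v x * prodf q x)"
    proof (rule integral_dominated_convergence[where w="\<lambda>x. \<bar>v x * prodf q x\<bar> + \<bar>1 * prodf q x\<bar>"])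
      show "integrable lborel (\<lambda>x. \<bar>v x * prodf q x\<bar> + \<bar>1 * prodf q x\<bar>)"
        by (intro Bochner_Integration.integrable_add integrable_abs loc_int_prodf[of _ q] liv one q)
      show "AE x in lborel. (\<lambda>k. ?S (k + N) x * prodf q x) \<longlonglongrightarrow> v x * prodf q x"
        by (intro AE_I2 tendsto_intros LIMSEQ_ignore_initial_segment vlim)
      show "AE x in lborel. norm (?S (k + N) x * prodf q x) \<le> \<bar>v x * prodf q x\<bar> + \<bar>1 * prodf q x\<bar>" for k
      proof (rule AE_I2)
        fix x
        have "\<bar>?S (k + N) x\<bar> \<le> \<bar>v x\<bar> + 1" using N[of "k + N" x] by linarith
        then have "\<bar>?S (k + N) x\<bar> * \<bar>prodf q x\<bar> \<le> (\<bar>v x\<bar> + 1) * \<bar>prodf q x\<bar>" by (rule mult_right_mono) simp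
        then show "norm (?S (k + N) x * prodf q x) \<le> \<bar>v x * prodf q x\<bar> + \<bar>1 * prodf q x\<bar>"
          by (simp add: abs_mult distrib_right)
      qed
    qed auto
    then show "(\<lambda>k. LINT x|lborel. ?S k x * prodf q x) \<longlonglongrightarrow> (LINT x|lborel. v x * prodf q x)"
      by (rule LIMSEQ_offset)
    show "(\<lambda>k. LINT x|lborel. ?S k x * prodf q x) \<longlonglongrightarrow> ?c0 * (LINT x|lborel. g (\<lambda>_. 0) x * prodf q x)"
      by (rule smoothing_weak_limit[of q, OF q])
  qed
  have lig: "loc_int (g (\<lambda>_. 0))" by (rule loc_int_g) simp
  have liw: "loc_int (\<lambda>x. v x / ?c0)" using vc bump_mass_pos by (intro loc_int_continuous continuous_intros) auto
  have "AE x in lborel. g (\<lambda>_. 0) x - v x / ?c0 = 0"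
  proof (rule AE_zero_if_orthogonal_to_bumps[OF loc_int_diff[OF lig liw]])
    fix q :: "'n \<Rightarrow> real \<Rightarrow> real" assume q: "\<And>i. bump (q i)"
    have "(LINT x|lborel. (g (\<lambda>_. 0) x - v x / ?c0) * prodf q x)
      = (LINT x|lborel. g (\<lambda>_. 0) x * prodf q x - (v x / ?c0) * prodf q x)" by (simp only: left_diff_distrib)
    also have "\<dots> = (LINT x|lborel. g (\<lambda>_. 0) x * prodf q x) - (LINT x|lborel. (v x / ?c0) * prodf q x)"
      by (intro Bochner_Integration.integral_diff loc_int_prodf[of _ q] lig liw q)
    also have "(LINT x|lborel. (v x / ?c0) * prodf q x) = (LINT x|lborel. v x * prodf q x) / ?c0" by simp
    also have "\<dots> = (LINT x|lborel. g (\<lambda>_. 0) x * prodf q x)" using bump_mass_pos orth[of q, OF q] by simp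
    finally show "(LINT x|lborel. (g (\<lambda>_. 0) x - v x / ?c0) * prodf q x) = 0" by simp
  qed
  then show ?thesis using vc vlim by (intro exI[of _ v]) auto
qed

text \<open>Steps of any length are allowed because the bound on \<open>conj_sum\<close> is uniform
  in the starting scale. A scale exceeding |h| is chosen, the difference is estimated there, and
  passing from that scale to the limit costs the same for every starting scale.\<close>

lemma limit_difference_bound:
  assumes J: "modular = ennreal Jr" "Jr \<ge> 0"
    and c: "\<And>R k. R > 0 \<Longrightarrow> conj_sum (m + \<sigma>) CARD('n) A l R k \<le> ennreal cl" "cl \<ge> 0" and l: "l > 0"
    and v: "\<And>x. (\<lambda>k. smoothing (1 / 2 ^ k) x) \<longlonglongrightarrow> v x"
  shows "\<bar>\<Sum>j\<le>Suc m. (-1) ^ j * real (Suc m choose j) * v (x + real j *\<^sub>R h)\<bar>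
    \<le> (diff_const m CARD('n) + 2 ^ Suc m * step_const m CARD('n)) * sum_const \<sigma> CARD('n) reach * ((Jr + cl) / l)"
proof -
  let ?C = "sum_const \<sigma> CARD('n) reach"
  let ?Q = "(Jr + cl) / l"
  let ?w = "\<lambda>j. (-1) ^ j * real (Suc m choose j)"
  have K: "step_const m CARD('n) * ?C > 0" "diff_const m CARD('n) * ?C > 0"
    by (intro mult_pos_pos sum_const_reach_pos step_const_pos diff_const_pos; simp)+
  have conv: "a \<le> b * ?Q" if "ennreal (l * a) \<le> ennreal b * (modular + conj_sum (m + \<sigma>) CARD('n) A l R k)"
    "R > 0" "b > 0" for a b R k
  proof -
    note that(1)
    also have "ennreal b * (modular + conj_sum (m + \<sigma>) CARD('n) A l R k) \<le> ennreal b * (ennreal Jr + ennreal cl)"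
      unfolding J(1) by (intro mult_left_mono add_left_mono c(1) that(2)) simp
    also have "\<dots> = ennreal (b * (Jr + cl))" using J(2) c(2) that(3) by (simp add: ennreal_mult')
    finally have "ennreal (l * a) \<le> ennreal (b * (Jr + cl))" .
    then have "l * a \<le> b * (Jr + cl)"
      by (rule ennreal_le_iff[THEN iffD1, rotated]) (use J(2) c(2) that(3) in simp)
    then show ?thesis using l by (simp add: pos_le_divide_eq mult.commute)
  qed
  \<comment> \<open>A power of 2, so that halving it runs through the scales 1 / 2^k along which
    \<open>v\<close> is the limit.\<close>
  obtain M :: nat where M: "norm h \<le> 2 ^ M"
    using real_arch_pow[of 2 "norm h"] by (auto intro: less_imp_le)
  let ?R = "2 ^ M :: real"
  have near: "\<bar>v y - smoothing ?R y\<bar> \<le> step_const m CARD('n) * ?C * ?Q" for y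
  proof -
    have "(\<lambda>k. smoothing (?R / 2 ^ (k + M)) y) \<longlonglongrightarrow> v y" using v[of y] by (simp add: power_add)
    then have lim: "(\<lambda>k. smoothing (?R / 2 ^ k) y) \<longlonglongrightarrow> v y"
      by (rule LIMSEQ_offset[where f="\<lambda>k. smoothing (?R / 2 ^ k) y"])
    have "(\<lambda>k. \<bar>smoothing ?R y - smoothing (?R / 2 ^ k) y\<bar>) \<longlonglongrightarrow> \<bar>smoothing ?R y - v y\<bar>"
      by (intro tendsto_intros lim)
    moreover have "\<bar>smoothing ?R y - smoothing (?R / 2 ^ k) y\<bar> \<le> step_const m CARD('n) * ?C * ?Q" for k
      by (rule conv[OF smoothing_telescope[OF l, of ?R]]) (use K in auto)
    ultimately have "\<bar>smoothing ?R y - v y\<bar> \<le> step_const m CARD('n) * ?C * ?Q"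
      by (intro LIMSEQ_le_const2) auto
    then show ?thesis by (simp add: abs_minus_commute)
  qed
  have d: "\<bar>\<Sum>j\<le>Suc m. ?w j * smoothing ?R (x + real j *\<^sub>R h)\<bar> \<le> diff_const m CARD('n) * ?C * ?Q"
    by (rule conv[OF smoothing_difference_le[OF l _ M]]) (use K in auto)
  have "(\<Sum>j\<le>Suc m. ?w j * v (x + real j *\<^sub>R h))
    = (\<Sum>j\<le>Suc m. ?w j * smoothing ?R (x + real j *\<^sub>R h))
      + (\<Sum>j\<le>Suc m. ?w j * (v (x + real j *\<^sub>R h) - smoothing ?R (x + real j *\<^sub>R h)))"
    by (simp only: right_diff_distrib sum_subtractf add_diff_cancel_left' diff_add_eq)
  moreover have "\<bar>\<Sum>j\<le>Suc m. ?w j * (v (x + real j *\<^sub>R h) - smoothing ?R (x + real j *\<^sub>R h))\<bar>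
     \<le> 2 ^ Suc m * (step_const m CARD('n) * ?C * ?Q)"
  proof -
    have "\<bar>\<Sum>j\<le>Suc m. ?w j * (v (x + real j *\<^sub>R h) - smoothing ?R (x + real j *\<^sub>R h))\<bar>
      \<le> (\<Sum>j\<le>Suc m. \<bar>?w j\<bar> * (step_const m CARD('n) * ?C * ?Q))"
      by (intro order_trans[OF sum_abs sum_mono]) (simp only: abs_mult, intro mult_left_mono near, simp)
    also have "\<dots> = 2 ^ Suc m * (step_const m CARD('n) * ?C * ?Q)"
      using sum_abs_binomial[of "Suc m"] by (simp only: sum_distrib_right[symmetric])
    finally show ?thesis .
  qed
  ultimately have "\<bar>\<Sum>j\<le>Suc m. ?w j * v (x + real j *\<^sub>R h)\<bar>
    \<le> diff_const m CARD('n) * ?C * ?Q + 2 ^ Suc m * (step_const m CARD('n) * ?C * ?Q)"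
    using d by linarith
  then show ?thesis by (simp only: distrib_right mult.assoc)
qed

text \<open>The difference bound holds for every slope l > 0 and reads (Jr + I' l^(n / (n - s))) / l
  up to a constant. Minimizing over l, up to constants, gives Jr^(s / n). The finite level sets turn
  the difference bound into a pointwise one.\<close>

theorem bounded_continuous_representative:
  assumes J: "modular = ennreal Jr" "Jr \<ge> 0" and sn: "m + \<sigma> < CARD('n)"
    and I: "(\<integral>\<^sup>+t\<in>{0<..}. epowr (ennreal t / A t) ((m + \<sigma>) / (CARD('n) - (m + \<sigma>))) \<partial>lborel) = ennreal Ir" "Ir \<ge> 0"
    and lev: "\<And>t. t > 0 \<Longrightarrow> emeasure lborel {x. t < \<bar>g (\<lambda>_. 0) x\<bar>} < \<infinity>"
  shows "\<exists>w. continuous_on UNIV w \<and> (AE x in lborel. g (\<lambda>_. 0) x = w x) \<and>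
    (\<forall>x. \<bar>w x\<bar> \<le> bound_const m \<sigma> CARD('n) Ir / (LINT y|lborel. prodf (\<lambda>_::'n. std_bump) y) * Jr powr ((m + \<sigma>) / CARD('n)))"
proof -
  let ?n = "real CARD('n)"
  let ?c0 = "(LINT y|lborel. prodf (\<lambda>_::'n. std_bump) y)"
  define s where "s = m + \<sigma>"
  have s: "s > 0" "s < ?n" using sg sn by (auto simp: s_def)
  define I' where "I' = Ir / (1 - 2 powr - s)"
  have I': "I' \<ge> 0" unfolding I'_def using I(2) s by (simp add: powr_less_one less_imp_le)
  define c where "c l = l powr (?n / (?n - s)) * I'" for l
  have c0: "c l \<ge> 0" for l using I' by (simp add: c_def)
  have cb: "conj_sum (m + \<sigma>) CARD('n) A l R k \<le> ennreal (c l)" if "l > 0" "R > 0" for l R k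
  proof -
    have "conj_sum (m + \<sigma>) CARD('n) A l R k \<le> ennreal (l powr (?n / (?n - s)) / (1 - 2 powr - s)) * ennreal Ir"
      using conj_sum_le[OF young, of "m + \<sigma>" "CARD('n)" l R k] s that unfolding I(1)[symmetric] s_def by simp
    also have "\<dots> = ennreal (c l)" unfolding c_def I'_def using I(2) s
      by (subst ennreal_mult'[symmetric]) (auto simp: powr_less_one less_imp_le)
    finally show ?thesis .
  qed
  have "\<exists>v. continuous_on UNIV v \<and> (\<forall>x. (\<lambda>k. smoothing (1 / 2 ^ k) x) \<longlonglongrightarrow> v x)
    \<and> (AE x in lborel. g (\<lambda>_. 0) x = v x / ?c0)"
    by (rule smoothing_limit[where c=c]) (use J(1) cb in auto)
  then obtain v where v: "continuous_on UNIV v" "\<And>x. (\<lambda>k. smoothing (1 / 2 ^ k) x) \<longlonglongrightarrow> v x"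
    "AE x in lborel. g (\<lambda>_. 0) x = v x / ?c0" by blast
  define w where "w x = v x / ?c0" for x
  have wc: "continuous_on UNIV w" unfolding w_def using v(1) bump_mass_pos by (intro continuous_intros) auto
  have wg: "AE x in lborel. g (\<lambda>_. 0) x = w x" using v(3) by (simp add: w_def)
  have [measurable]: "w \<in> borel_measurable borel" using wc by (rule borel_measurable_continuous_onI)
  have [measurable]: "g (\<lambda>_. 0) \<in> borel_measurable borel" by (intro loc_int_measurable loc_int_g) simp
  have wlev: "emeasure lborel {x. t < \<bar>w x\<bar>} < \<infinity>" if "t > 0" for t
  proof -
    have "emeasure lborel {x \<in> space lborel. t < \<bar>w x\<bar>} = emeasure lborel {x \<in> space lborel. t < \<bar>g (\<lambda>_. 0) x\<bar>}"
      by (rule emeasure_eq_AE) (use wg in auto)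
    then show ?thesis using lev[OF that] by simp
  qed
  define B where "B = (diff_const m CARD('n) + 2 ^ Suc m * step_const m CARD('n)) * sum_const \<sigma> CARD('n) reach"
  have B: "B > 0" unfolding B_def
    by (intro mult_pos_pos add_pos_pos sum_const_reach_pos step_const_pos diff_const_pos) auto
  let ?w = "\<lambda>j. (-1) ^ j * real (Suc m choose j)"
  have bnd: "\<bar>w x\<bar> \<le> B / ?c0 * ((Jr + c l) / l)" if l: "l > 0" for x l
  proof (rule field_le_epsilon)
    fix e :: real assume e: "e > 0"
    \<comment> \<open>The weights with j >= 1 have total absolute value at most 2^(m + 1), so these
      terms contribute at most e.\<close>
    define t where "t = e / 2 ^ Suc m"
    have t: "t > 0" using e by (simp add: t_def)
    obtain h where h: "\<And>j. j \<in> {1..Suc m} \<Longrightarrow> \<bar>w (x + real j *\<^sub>R h)\<bar> \<le> t"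
      using exists_all_small[OF wc wlev[OF t], of "Suc m" x] by blast
    have "\<bar>\<Sum>j\<le>Suc m. ?w j * v (x + real j *\<^sub>R h)\<bar> \<le> B * ((Jr + c l) / l)"
      unfolding B_def by (rule limit_difference_bound[OF J _ c0 l v(2)]) (use cb[OF l] in auto)
    then have "\<bar>\<Sum>j\<le>Suc m. ?w j * v (x + real j *\<^sub>R h)\<bar> / ?c0 \<le> B * ((Jr + c l) / l) / ?c0"
      using bump_mass_pos by (intro divide_right_mono) auto
    moreover have "(\<Sum>j\<le>Suc m. ?w j * v (x + real j *\<^sub>R h)) / ?c0 = (\<Sum>j\<le>Suc m. ?w j * w (x + real j *\<^sub>R h))"
      unfolding w_def by (simp only: sum_divide_distrib times_divide_eq_right)
    moreover have "\<bar>y\<bar> / ?c0 = \<bar>y / ?c0\<bar>" for y using bump_mass_pos by (simp add: abs_divide)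
    ultimately have D: "\<bar>\<Sum>j\<le>Suc m. ?w j * w (x + real j *\<^sub>R h)\<bar> \<le> B / ?c0 * ((Jr + c l) / l)"
      by (simp only: times_divide_eq_left)
    have S: "{..Suc m} = insert 0 {1..Suc m}" by auto
    have "(\<Sum>j\<le>Suc m. ?w j * w (x + real j *\<^sub>R h)) = w x + (\<Sum>j=1..Suc m. ?w j * w (x + real j *\<^sub>R h))"
      unfolding S by (subst sum.insert) auto
    moreover have "\<bar>\<Sum>j=1..Suc m. ?w j * w (x + real j *\<^sub>R h)\<bar> \<le> e"
    proof -
      have "\<bar>\<Sum>j=1..Suc m. ?w j * w (x + real j *\<^sub>R h)\<bar> \<le> (\<Sum>j=1..Suc m. \<bar>?w j\<bar> * t)"
        by (intro order_trans[OF sum_abs sum_mono]) (simp only: abs_mult, intro mult_left_mono h, auto)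
      also have "\<dots> \<le> (\<Sum>j\<le>Suc m. \<bar>?w j\<bar> * t)"
      proof (rule sum_mono2)
        show "0 \<le> \<bar>?w l\<bar> * t" for l using t by (intro mult_nonneg_nonneg) auto
      qed auto
      also have "\<dots> = 2 ^ Suc m * t" using sum_abs_binomial[of "Suc m"] by (simp only: sum_distrib_right[symmetric])
      finally show ?thesis by (simp add: t_def)
    qed
    ultimately show "\<bar>w x\<bar> \<le> B / ?c0 * ((Jr + c l) / l) + e" using D by linarith
  qed
  have BC: "bound_const m \<sigma> CARD('n) Ir / ?c0 = B / ?c0 * (1 + I')"
    by (simp add: bound_const_def B_def I'_def s_def reach_def)
  have cl: "c l / l = I' * l powr (s / (?n - s))" if "l > 0" for l
  proof -
    have "?n / (?n - s) = 1 + s / (?n - s)" using s by (simp add: field_simps)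
    then have "l powr (?n / (?n - s)) = l * l powr (s / (?n - s))" using that by (simp add: powr_add)
    then show ?thesis using that by (simp add: c_def)
  qed
  have "\<bar>w x\<bar> \<le> B / ?c0 * (1 + I') * Jr powr (s / ?n)" for x
  proof (cases "Jr = 0")
    case True
    have "\<bar>w x\<bar> \<le> B / ?c0 * I' * d" if d: "d > 0" for d
    proof -
      \<comment> \<open>With zero modular there is nothing to balance: this slope leaves I' d, and d
        is arbitrary.\<close>
      have l: "d powr ((?n - s) / s) > 0" using d by simp
      have "(Jr + c (d powr ((?n - s) / s))) / d powr ((?n - s) / s) = I' * d"
        using True cl[OF l] s d by (simp add: powr_powr)
      then show ?thesis using bnd[OF l, of x] by simp
    qed
    then have "\<bar>w x\<bar> \<le> 0" by (rule le_0_if_le_multiples) (use B bump_mass_pos I' in auto)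
    then show ?thesis using True by simp
  next
    case False
    then have Jp: "Jr > 0" using J(2) by simp
    \<comment> \<open>The slope at which Jr / l equals l^(s / (n - s)); both are then Jr^(s /
      n).\<close>
    define l where "l = Jr powr ((?n - s) / ?n)"
    have l: "l > 0" using Jp by (simp add: l_def)
    have 1: "Jr / l = Jr powr (s / ?n)"
    proof -
      have "Jr / l = Jr powr (1 - (?n - s) / ?n)" unfolding l_def using Jp by (simp add: powr_diff)
      also have "1 - (?n - s) / ?n = s / ?n" by (simp add: diff_divide_distrib)
      finally show ?thesis .
    qed
    have "l powr (s / (?n - s)) = Jr powr (s / ?n)" unfolding l_def using s by (simp add: powr_powr)
    then have "(Jr + c l) / l = (1 + I') * Jr powr (s / ?n)"
      using cl[OF l] 1 by (simp add: add_divide_distrib distrib_right)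
    then show ?thesis using bnd[OF l, of x] by (simp only: mult.assoc)
  qed
  then show ?thesis unfolding BC using wc wg unfolding s_def by blast
qed

end

section \<open>The embedding\<close>

lemma J_cong_AE:
  fixes v v' :: "real^'n::finite \<Rightarrow> 'i \<Rightarrow> real"
  assumes I: "finite I" and eq: "\<And>i. i \<in> I \<Longrightarrow> AE x in lborel. v x i = v' x i"
  shows "J \<sigma> A I v = J \<sigma> A I v'"
proof -
  have ae: "AE x in lborel. \<forall>i\<in>I. v x i = v' x i"
    using eq I by (simp add: AE_finite_all)
  show ?thesis
    unfolding J_lborel
  proof (rule nn_integral_cong_AE)
    show "AE x in lborel. (\<integral>\<^sup>+y. A (L2_set (\<lambda>i. v x i - v y i) I / norm (x - y) powr \<sigma>) / ennreal (norm (x - y) ^ CARD('n)) \<partial>lborel)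
      = (\<integral>\<^sup>+y. A (L2_set (\<lambda>i. v' x i - v' y i) I / norm (x - y) powr \<sigma>) / ennreal (norm (x - y) ^ CARD('n)) \<partial>lborel)"
      using ae
    proof eventually_elim
      case (elim x)
      show ?case
      proof (rule nn_integral_cong_AE)
        show "AE y in lborel. A (L2_set (\<lambda>i. v x i - v y i) I / norm (x - y) powr \<sigma>) / ennreal (norm (x - y) ^ CARD('n))
          = A (L2_set (\<lambda>i. v' x i - v' y i) I / norm (x - y) powr \<sigma>) / ennreal (norm (x - y) ^ CARD('n))"
          using ae
        proof eventually_elim
          case (elim y)
          have "L2_set (\<lambda>i. v x i - v y i) I = L2_set (\<lambda>i. v' x i - v' y i) I"
            using \<open>\<forall>i\<in>I. v x i = v' x i\<close> elim by (intro L2_set_cong) auto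
          then show ?case by simp
        qed
      qed
    qed
  qed
qed

text \<open>A is positive at some t0, and beyond t0 it stays above the line through 0 and (t0, c).
  As A(t0) may be infinite, \<open>c\<close> is a finite positive number below it.\<close>

lemma young_linear_lower_bound:
  assumes A: "young_function A"
  obtains a b where "a > 0" "b \<ge> 0" "\<And>t. t \<ge> 0 \<Longrightarrow> ennreal (a * t) \<le> A t + ennreal b"
proof -
  obtain t0 where t0: "t0 \<ge> 0" "A t0 \<noteq> A 0" using A by (auto simp: young_function_def)
  have z: "A 0 = 0" by (rule young_zero[OF A])
  then have t0p: "t0 > 0" using t0 by (cases "t0 = 0") auto
  have "A t0 > 0" using t0 z by (simp add: zero_less_iff_neq_zero)
  then obtain c where c: "c > 0" "ennreal c \<le> A t0"
    by (cases "A t0") (auto intro: that[of 1] simp: ennreal_zero_less_top)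
  have "ennreal (c / t0 * t) \<le> A t + ennreal c" if t: "t \<ge> 0" for t
  proof (cases "t \<le> t0")
    case True
    then have "ennreal (c / t0 * t) \<le> ennreal c"
      using c t0p t by (intro ennreal_leI) (simp add: divide_le_eq mult_left_mono)
    then show ?thesis by (simp add: add_increasing)
  next
    case False
    then have tt: "t > 0" "t0 \<le> t" using t0p by auto
    have "A ((t0 / t) * t) \<le> ennreal (t0 / t) * A t" using tt t0p by (intro young_scale[OF A]) auto
    then have "ennreal c \<le> ennreal (t0 / t) * A t" using c(2) tt by (simp add: order_trans)
    then have "ennreal (t / t0) * ennreal c \<le> ennreal (t / t0) * (ennreal (t0 / t) * A t)" by (intro mult_left_mono) auto
    also have "\<dots> = ennreal (t / t0 * (t0 / t)) * A t" using tt t0p by (simp only: ennreal_mult' mult.assoc divide_nonneg_nonneg less_imp_le)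
    also have "t / t0 * (t0 / t) = 1" using tt t0p by simp
    also have "ennreal (t / t0) * ennreal c = ennreal (c / t0 * t)"
      using c tt t0p by (simp add: ennreal_mult'[symmetric] mult.commute)
    finally show ?thesis by (simp add: add_increasing2)
  qed
  then show ?thesis using c t0p by (intro that[of "c / t0" c]) auto
qed

text \<open>Needed for s < 1, where membership in \<open>V_d\<close> does not mention local
  integrability. One point x with finite inner integral is fixed; since A grows at least linearly,
  f(y) - f(x) is integrable in y over balls.\<close>

lemma loc_int_of_J_finite:
  fixes f :: "real^'n::finite \<Rightarrow> real"
  assumes A: "young_function A" and sg: "\<sigma> > 0" and fm[measurable]: "f \<in> borel_measurable borel"
    and J: "J \<sigma> A {i} (\<lambda>x _. f x) < \<infinity>"
  shows "loc_int f"
proof -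
  let ?n = "CARD('n)"
  let ?a = "\<lambda>x y. A (\<bar>f x - f y\<bar> / norm (x - y) powr \<sigma>) / ennreal (norm (x - y) ^ ?n)"
  note [measurable] = young_measurable[OF A]
  have "(\<lambda>p. A \<bar>\<bar>f (fst p) - f (snd p)\<bar> / norm (fst p - snd p) powr \<sigma>\<bar> / ennreal (norm (fst p - snd p) ^ ?n))
      \<in> borel_measurable (borel \<Otimes>\<^sub>M borel)" by measurable
  then have am: "(\<lambda>p. ?a (fst p) (snd p)) \<in> borel_measurable (borel \<Otimes>\<^sub>M borel)" by simp
  have "(\<integral>\<^sup>+x. \<integral>\<^sup>+y. ?a x y \<partial>lborel \<partial>lborel) < \<infinity>"
    using J unfolding J_lborel by (simp add: L2_set_def)
  moreover have "(\<lambda>x. \<integral>\<^sup>+y. ?a x y \<partial>lborel) \<in> borel_measurable lborel"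
    using am by (intro lborel.borel_measurable_nn_integral) (simp add: case_prod_unfold)
  ultimately have "AE x in lborel. (\<integral>\<^sup>+y. ?a x y \<partial>lborel) \<noteq> \<infinity>"
    by (intro nn_integral_PInf_AE) auto
  moreover have "ae_filter (lborel :: (real^'n) measure) \<noteq> bot"
    by (simp add: ae_filter_eq_bot_iff emeasure_lborel_UNIV)
  ultimately obtain x where x: "(\<integral>\<^sup>+y. ?a x y \<partial>lborel) \<noteq> \<infinity>"
    using eventually_happens'[of "ae_filter lborel"] by blast
  have ax: "?a x \<in> borel_measurable borel"
    using measurable_compose[OF measurable_Pair1'[of x borel borel] am] by simp
  obtain a b where ab: "a > 0" "b \<ge> 0" "\<And>t. t \<ge> 0 \<Longrightarrow> ennreal (a * t) \<le> A t + ennreal b"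
    by (rule young_linear_lower_bound[OF A]) blast
  have "set_integrable lborel (cball 0 R) f" for R
    unfolding set_integrable_def
  proof (rule integrableI_bounded)
    have [measurable]: "cball 0 R \<in> sets (borel :: (real^'n) measure)" by simp
    show "(\<lambda>y. indicator (cball 0 R) y *\<^sub>R f y) \<in> borel_measurable lborel" by measurable
    \<comment> \<open>Bounds |x - y| on the ball, so the singular weights can be replaced by
      constants; the last summand only ensures positivity.\<close>
    define \<rho> where "\<rho> = norm x + \<bar>R\<bar> + 1"
    have \<rho>: "\<rho> > 0" unfolding \<rho>_def by (simp add: add_nonneg_pos)
    define k where "k = \<rho> powr \<sigma> / a"
    have k: "k > 0" using \<rho> ab by (simp add: k_def)
    have "ennreal (norm (indicator (cball 0 R) y *\<^sub>R f y))
      \<le> ennreal k * (ennreal (\<rho> ^ ?n) * ?a x y) + ennreal (\<bar>f x\<bar> + k * b) * indicator (cball 0 R) y" for y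
    proof (cases "y \<in> cball 0 R")
      case True
      then have yR: "norm y \<le> \<bar>R\<bar>" by simp
      have d: "norm (x - y) \<le> \<rho>" using norm_triangle_ineq4[of x y] yR by (simp add: \<rho>_def)
      have "ennreal \<bar>f y\<bar> \<le> ennreal \<bar>f x - f y\<bar> + ennreal \<bar>f x\<bar>"
        by (simp add: ennreal_plus[symmetric] del: ennreal_plus)
      also have "ennreal \<bar>f x - f y\<bar> \<le> ennreal k * (ennreal (\<rho> ^ ?n) * ?a x y) + ennreal (k * b)"
      proof (cases "x = y")
        case False
        then have t: "norm (x - y) > 0" by simp
        let ?D = "\<bar>f x - f y\<bar> / norm (x - y) powr \<sigma>"
        have "\<bar>f x - f y\<bar> = norm (x - y) powr \<sigma> * ?D" using t by simp
        also have "\<dots> \<le> \<rho> powr \<sigma> * ?D" using d t sg by (intro mult_right_mono powr_mono2) auto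
        also have "\<dots> = k * (a * ?D)" using ab by (simp add: k_def)
        finally have "ennreal \<bar>f x - f y\<bar> \<le> ennreal k * ennreal (a * ?D)"
          using k by (simp add: ennreal_mult'[symmetric] ennreal_leI)
        also have "\<dots> \<le> ennreal k * (A ?D + ennreal b)" by (intro mult_left_mono ab) auto
        also have "A ?D \<le> ennreal (\<rho> ^ ?n) * ?a x y"
        proof -
          have "A ?D = ennreal (norm (x - y) ^ ?n) * ?a x y"
          proof -
            have "ennreal p * (X / ennreal p) = X" if "p > 0" for p X
              using mult_divide_eq_ennreal[of "ennreal p" X] that
              by (simp add: ennreal_times_divide mult.commute)
            then show ?thesis using t by simp
          qed
          also have "\<dots> \<le> ennreal (\<rho> ^ ?n) * ?a x y"
            using d by (intro mult_right_mono ennreal_leI power_mono) auto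
          finally show ?thesis .
        qed
        finally show ?thesis using k ab by (simp add: distrib_left ennreal_mult' mult_left_mono add_right_mono)
      qed simp
      finally show ?thesis using True k ab
        by (simp add: ennreal_plus add.assoc add.commute[of "\<bar>f x\<bar>"] del: ennreal_plus flip: ennreal_plus)
    qed simp
    then have "(\<integral>\<^sup>+y. ennreal (norm (indicator (cball 0 R) y *\<^sub>R f y)) \<partial>lborel)
      \<le> (\<integral>\<^sup>+y. ennreal k * (ennreal (\<rho> ^ ?n) * ?a x y) + ennreal (\<bar>f x\<bar> + k * b) * indicator (cball 0 R) y \<partial>lborel)"
      by (intro nn_integral_mono)
    also have "\<dots> = ennreal k * (ennreal (\<rho> ^ ?n) * (\<integral>\<^sup>+y. ?a x y \<partial>lborel)) + ennreal (\<bar>f x\<bar> + k * b) * emeasure lborel (cball (0::real^'n) R)"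
      using ax by (simp add: nn_integral_add nn_integral_cmult nn_integral_cmult_indicator)
    also have "\<dots> < \<infinity>"
      using x emeasure_lborel_cball_finite[of "0::real^'n" R] by (simp add: ennreal_mult_less_top less_top)
    finally show "(\<integral>\<^sup>+y. ennreal (norm (indicator (cball 0 R) y *\<^sub>R f y)) \<partial>lborel) < \<infinity>" .
  qed
  then show ?thesis using fm by (simp add: loc_int_def)
qed

section \<open>From functions in \<open>V_d\<close> to Borel representatives\<close>

lemma locally_integrable_measurable:
  assumes "locally_integrable f"
  shows "f \<in> borel_measurable lebesgue"
proof (rule borel_measurable_LIMSEQ_real)
  show "(\<lambda>x. indicator (cball 0 (real k)) x *\<^sub>R f x) \<in> borel_measurable lebesgue" for k
    using assms compact_cball by (blast intro: borel_measurable_integrable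
        dest: locally_integrable_def[THEN iffD1, unfolded set_integrable_def])
  show "(\<lambda>k. indicator (cball 0 (real k)) x *\<^sub>R f x) \<longlonglongrightarrow> f x" for x
  proof (rule tendsto_eventually)
    show "\<forall>\<^sub>F k in sequentially. indicator (cball 0 (real k)) x *\<^sub>R f x = f x"
      using eventually_ge_at_top[of "nat \<lceil>norm x\<rceil>"]
      by eventually_elim (auto simp: indicator_def nat_ceiling_le_eq)
  qed
qed

lemma locally_integrable_loc_int:
  fixes f g :: "real^'n::finite \<Rightarrow> real"
  assumes f: "locally_integrable f" and g: "g \<in> borel_measurable borel" and eq: "AE x in lborel. f x = g x"
  shows "loc_int g"
  unfolding loc_int_def
proof (intro conjI allI g)
  fix R
  have "set_integrable lebesgue (cball 0 R) f" using f by (auto simp: locally_integrable_def)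
  then have i: "integrable lebesgue (\<lambda>x. indicator (cball 0 R) x *\<^sub>R f x)" by (simp add: set_integrable_def)
  have [measurable]: "cball 0 R \<in> sets (borel :: (real^'n) measure)" by simp
  have m: "(\<lambda>x. indicator (cball 0 R) x *\<^sub>R g x) \<in> borel_measurable lborel" using g by measurable
  have "integrable lebesgue (\<lambda>x. indicator (cball 0 R) x *\<^sub>R g x)"
    by (rule integrable_cong_AE_imp[OF i]) (use m AE_completion[OF eq] in \<open>auto intro: measurable_completion elim: eventually_mono\<close>)
  then show "set_integrable lborel (cball 0 R) g"
    using integrable_completion[OF m] by (simp add: set_integrable_def)
qed

lemma integral_lebesgue_AE_eq:
  fixes f g \<phi> :: "real^'n::finite \<Rightarrow> real"
  assumes f: "f \<in> borel_measurable lebesgue" and g[measurable]: "g \<in> borel_measurable borel"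
    and eq: "AE x in lborel. f x = g x" and \<phi>[measurable]: "\<phi> \<in> borel_measurable borel"
  shows "(LINT x|lebesgue. f x * \<phi> x) = (LINT x|lborel. g x * \<phi> x)"
proof -
  have m: "(\<lambda>x. g x * \<phi> x) \<in> borel_measurable lborel" by simp
  have \<phi>': "\<phi> \<in> borel_measurable lebesgue" by (rule measurable_completion) simp
  have "(LINT x|lebesgue. f x * \<phi> x) = (LINT x|lebesgue. g x * \<phi> x)"
  proof (rule integral_cong_AE)
    show "(\<lambda>x. f x * \<phi> x) \<in> borel_measurable lebesgue" using f \<phi>' by (rule borel_measurable_times)
    show "(\<lambda>x. g x * \<phi> x) \<in> borel_measurable lebesgue" using m by (rule measurable_completion)
    show "AE x in lebesgue. f x * \<phi> x = g x * \<phi> x" using AE_completion[OF eq] by eventually_elim simp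
  qed
  also have "\<dots> = (LINT x|lborel. g x * \<phi> x)" by (rule integral_completion[OF m])
  finally show ?thesis .
qed

lemma V_d_weak_deriv:
  assumes u: "weakly_differentiable m u" and \<alpha>: "sum \<alpha> UNIV \<le> m" "\<alpha> \<noteq> (\<lambda>_. 0)"
  shows "has_weak_deriv \<alpha> u (weak_deriv \<alpha> u)"
proof -
  have "sum \<alpha> UNIV \<noteq> 0" using \<alpha>(2) by (auto simp: fun_eq_iff)
  then have "1 \<le> sum \<alpha> UNIV" by linarith
  then have "sum \<alpha> UNIV \<in> {1..m}" using \<alpha>(1) by (simp only: atLeastAtMost_iff)
  moreover have "\<alpha> \<in> multi_indices (sum \<alpha> UNIV)" by (simp add: multi_indices_def)
  ultimately have "\<exists>g. has_weak_deriv \<alpha> u g"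
    using u unfolding weakly_differentiable_def by blast
  then show ?thesis unfolding weak_deriv_def using \<alpha>(2) by (simp add: someI_ex)
qed

lemma multi_indices_0: "multi_indices 0 = {\<lambda>_. 0}"
  by (auto simp: multi_indices_def fun_eq_iff)

lemma L2_set_singleton: "L2_set f {i} = \<bar>f i\<bar>"
  by (simp add: L2_set_def)

lemma emeasure_lborel_eq_lebesgue:
  assumes "S \<in> sets borel"
  shows "emeasure lborel S = emeasure lebesgue S"
proof -
  have "emeasure lborel S = (\<integral>\<^sup>+x. indicator S x \<partial>lborel)" using assms by simp
  also have "\<dots> = (\<integral>\<^sup>+x. indicator S x \<partial>lebesgue)" by (simp only: nn_integral_completion)
  also have "\<dots> = emeasure lebesgue S" using assms by (intro nn_integral_indicator) (simp add: sets_completionI_sets)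
  finally show ?thesis .
qed

lemma borel_representatives:
  fixes u :: "real^'n::finite \<Rightarrow> real"
  assumes u: "u \<in> borel_measurable lebesgue" and wd: "weakly_differentiable m u"
  obtains G :: "('n \<Rightarrow> nat) \<Rightarrow> real^'n \<Rightarrow> real"
  where "\<And>\<alpha>. sum \<alpha> UNIV \<le> m \<Longrightarrow> G \<alpha> \<in> borel_measurable borel"
    "\<And>\<alpha>. sum \<alpha> UNIV \<le> m \<Longrightarrow> AE x in lborel. weak_deriv \<alpha> u x = G \<alpha> x"
proof -
  have "\<exists>g'. g' \<in> borel_measurable borel \<and> (AE x in lborel. weak_deriv \<alpha> u x = g' x)" if "sum \<alpha> UNIV \<le> m" for \<alpha>
  proof -
    have "weak_deriv \<alpha> u \<in> borel_measurable lebesgue"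
    proof (cases "\<alpha> = (\<lambda>_. 0)")
      case True
      then show ?thesis using u by (simp add: weak_deriv_def)
    next
      case False
      then show ?thesis using V_d_weak_deriv[OF wd that] by (simp add: has_weak_deriv_def locally_integrable_measurable)
    qed
    from completion_ex_borel_measurable_real[OF this] show ?thesis by auto
  qed
  then have "\<exists>G. \<forall>\<alpha>. sum \<alpha> UNIV \<le> m \<longrightarrow> G \<alpha> \<in> borel_measurable borel \<and> (AE x in lborel. weak_deriv \<alpha> u x = G \<alpha> x)"
    by (intro choice) blast
  then show ?thesis using that by blast
qed

text \<open>Weak derivatives are defined from \<open>u\<close> only, whereas
  \<open>weak_system\<close> relates consecutive orders. The gap is closed by testing
  \<open>u\<close> with the derivative of order one higher of the same product of bumps, read once
  through \<alpha> and once through its successor. Division by \<open>r\<close> serves the Luxemburg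
  norm.\<close>

lemma young_system_of_V_d:
  fixes u :: "real^'n::finite \<Rightarrow> real"
  assumes A: "young_function A" and sg: "\<sigma> > 0" and r: "r > 0"
    and u: "u \<in> borel_measurable lebesgue" and wd: "weakly_differentiable m u"
    and G: "\<And>\<alpha>. sum \<alpha> UNIV \<le> m \<Longrightarrow> G \<alpha> \<in> borel_measurable borel"
      "\<And>\<alpha>. sum \<alpha> UNIV \<le> m \<Longrightarrow> AE x in lborel. weak_deriv \<alpha> u x = G \<alpha> x"
    and J: "J \<sigma> A (multi_indices m) (\<lambda>x \<alpha>. nabla u x \<alpha> / r) < \<infinity>"
  shows "young_system m (\<lambda>\<alpha> x. G \<alpha> x / r) A \<sigma>"
    and "J \<sigma> A (multi_indices m) (\<lambda>x \<alpha>. G \<alpha> x / r) = J \<sigma> A (multi_indices m) (\<lambda>x \<alpha>. nabla u x \<alpha> / r)"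
proof -
  show JG: "J \<sigma> A (multi_indices m) (\<lambda>x \<alpha>. G \<alpha> x / r) = J \<sigma> A (multi_indices m) (\<lambda>x \<alpha>. nabla u x \<alpha> / r)"
  proof (rule J_cong_AE[OF finite_multi_indices])
    fix \<alpha> :: "'n \<Rightarrow> nat" assume "\<alpha> \<in> multi_indices m"
    then have "AE x in lborel. weak_deriv \<alpha> u x = G \<alpha> x" by (intro G(2)) (simp add: multi_indices_def)
    then show "AE x in lborel. G \<alpha> x / r = nabla u x \<alpha> / r" by eventually_elim (simp add: nabla_def)
  qed
  have li: "loc_int (G \<alpha>)" if \<alpha>: "sum \<alpha> UNIV \<le> m" for \<alpha>
  proof (cases "\<alpha> = (\<lambda>_. 0)")
    case False
    have "locally_integrable (weak_deriv \<alpha> u)" using V_d_weak_deriv[OF wd \<alpha> False] by (simp add: has_weak_deriv_def)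
    then show ?thesis by (rule locally_integrable_loc_int[OF _ G(1,2)[OF \<alpha>]])
  next
    case True
    show ?thesis
    proof (cases "m = 0")
      case False
      \<comment> \<open>Any coordinate will do: the existence of a weak derivative of order 1
        includes local integrability of \<open>u\<close>.\<close>
      define i :: 'n where "i = undefined"
      define \<beta> where "\<beta> j = (if j = i then 1 else 0 :: nat)" for j
      have "sum \<beta> UNIV \<le> m" "\<beta> \<noteq> (\<lambda>_. 0)" using False by (auto simp: \<beta>_def fun_eq_iff)
      from V_d_weak_deriv[OF wd this] have "locally_integrable u" by (simp add: has_weak_deriv_def)
      then show ?thesis using locally_integrable_loc_int[OF _ G(1,2)[OF \<alpha>]] True by (simp add: weak_deriv_def)
    next
      case m0: True
      have "J \<sigma> A {\<lambda>_. 0} (\<lambda>x \<alpha>. G \<alpha> x / r) < \<infinity>" using J JG m0 by (simp add: multi_indices_0)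
      then have "J \<sigma> A {\<lambda>_. 0} (\<lambda>x _. G (\<lambda>_. 0) x / r) < \<infinity>" by (simp add: J_def L2_set_singleton)
      then have "loc_int (\<lambda>x. G (\<lambda>_. 0) x / r)"
        using G(1)[OF \<alpha>] True by (intro loc_int_of_J_finite[OF A sg]) auto
      then have "loc_int (\<lambda>x. r * (G (\<lambda>_. 0) x / r))"
        unfolding loc_int_def set_integrable_def using r by (auto simp: mult.left_commute[of _ r] simp del: times_divide_eq_right)
      then show ?thesis using r True by simp
    qed
  qed
  show "young_system m (\<lambda>\<alpha> x. G \<alpha> x / r) A \<sigma>"
  proof
    show "loc_int (\<lambda>x. G \<alpha> x / r)" if "sum \<alpha> UNIV \<le> m" for \<alpha>
      using li[OF that] by (auto simp: loc_int_def set_integrable_def)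
    show "young_function A" "0 < \<sigma>" by fact+
    fix \<alpha> :: "'n \<Rightarrow> nat" and q :: "'n \<Rightarrow> real \<Rightarrow> real" and i :: 'n
    assume \<alpha>: "sum \<alpha> UNIV < m" and q: "\<And>j. bump (q j)"
    define \<beta> where "\<beta> = \<alpha>(i := Suc (\<alpha> i))"
    have s\<beta>: "sum \<beta> UNIV = Suc (sum \<alpha> UNIV)"
    proof -
      have "sum \<beta> UNIV = Suc (\<alpha> i) + sum \<beta> (UNIV - {i})" by (subst sum.remove[of UNIV i]) (auto simp: \<beta>_def)
      also have "sum \<beta> (UNIV - {i}) = sum \<alpha> (UNIV - {i})" by (rule sum.cong) (auto simp: \<beta>_def)
      finally show ?thesis by (subst (2) sum.remove[of UNIV i]) auto
    qed
    have \<beta>: "sum \<beta> UNIV \<le> m" "\<beta> \<noteq> (\<lambda>_. 0)" using \<alpha> s\<beta> by (auto simp: \<beta>_def fun_eq_iff)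
    define q' where "q' = q(i := deriv (q i))"
    have q': "bump (q' j)" for j using q by (simp add: q'_def bump_deriv)
    have wdq: "(LINT x|lebesgue. u x * mderiv \<gamma> (prodf f) x) = (-1) ^ sum \<gamma> UNIV * (LINT x|lborel. G \<gamma> x * prodf f x)"
      if \<gamma>: "sum \<gamma> UNIV \<le> m" and f: "\<And>j. bump (f j)" for \<gamma> f
    proof -
      have m1: "weak_deriv \<gamma> u \<in> borel_measurable lebesgue"
      proof (cases "\<gamma> = (\<lambda>_. 0)")
        case True
        then show ?thesis using u by (simp add: weak_deriv_def)
      next
        case False
        then show ?thesis using V_d_weak_deriv[OF wd \<gamma>] by (simp add: has_weak_deriv_def locally_integrable_measurable)
      qed
      have "(LINT x|lebesgue. u x * mderiv \<gamma> (prodf f) x) = (-1) ^ sum \<gamma> UNIV * (LINT x|lebesgue. weak_deriv \<gamma> u x * prodf f x)"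
      proof (cases "\<gamma> = (\<lambda>_. 0)")
        case True
        have "mderiv (\<lambda>_. 0) (prodf f) = prodf f" using mderiv_prodf[of f "\<lambda>_. 0", OF bump_smooth[OF f]] by simp
        then show ?thesis using True by (simp add: weak_deriv_def)
      next
        case False
        then show ?thesis using V_d_weak_deriv[OF wd \<gamma>] test_function_prodf[of f, OF f] by (simp add: has_weak_deriv_def)
      qed
      also have "(LINT x|lebesgue. weak_deriv \<gamma> u x * prodf f x) = (LINT x|lborel. G \<gamma> x * prodf f x)"
        by (rule integral_lebesgue_AE_eq[OF m1 G(1,2)[OF \<gamma>] prodf_measurable[of f, OF f]])
      finally show ?thesis .
    qed
    \<comment> \<open>One derivative is already built into \<open>q'\<close>, so both sides
      differentiate the factor i equally often.\<close>
    have "mderiv \<alpha> (prodf q') = mderiv \<beta> (prodf q)"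
    proof -
      have "(deriv ^^ \<alpha> j) (q' j) = (deriv ^^ \<beta> j) (q j)" for j
        by (simp add: q'_def \<beta>_def funpow_Suc_right del: funpow.simps)
      then show ?thesis
        using mderiv_prodf[of q' \<alpha>, OF bump_smooth[OF q']] mderiv_prodf[of q \<beta>, OF bump_smooth[OF q]] by simp
    qed
    then have "(-1) ^ sum \<alpha> UNIV * (LINT x|lborel. G \<alpha> x * prodf q' x) = (-1) ^ sum \<beta> UNIV * (LINT x|lborel. G \<beta> x * prodf q x)"
      using wdq[of \<alpha> q', OF less_imp_le[OF \<alpha>] q'] wdq[of \<beta> q, OF \<beta>(1) q] by simp
    then have "(LINT x|lborel. G \<alpha> x * prodf q' x) = - (LINT x|lborel. G \<beta> x * prodf q x)"
      unfolding s\<beta> by (cases "even (sum \<alpha> UNIV)") auto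
    then show "(LINT z|lborel. G \<alpha> z / r * prodf (q(i := deriv (q i))) z)
      = - (LINT z|lborel. G (\<alpha>(i := Suc (\<alpha> i))) z / r * prodf q z)"
      unfolding q'_def[symmetric] \<beta>_def[symmetric] by simp
  qed
qed

text \<open>The free divisor \<open>r\<close> lets one estimate serve twice: admissible values of
  \<open>r\<close> in the infimum give the norm bound, and r = 1 gives the modular bound.\<close>

lemma V_d_bound:
  fixes s :: real and A :: "real \<Rightarrow> ennreal"
  assumes s: "0 < s" "s < real CARD('n::finite)" "s \<notin> \<nat>" and A: "young_function A"
    and f0: "finite_near_0 A (s / (real CARD('n) - s))"
    and fi: "finite_near_infinity A (s / (real CARD('n) - s))"
  shows "\<exists>c>0. \<forall>u\<in>(V_d s A :: (real^'n \<Rightarrow> real) set). \<forall>r>0. \<forall>Jr\<ge>0.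
    J (frac s) A (multi_indices (int_part s)) (\<lambda>x \<alpha>. nabla u x \<alpha> / r) = ennreal Jr \<longrightarrow>
    (\<exists>w. continuous_on UNIV w \<and> (AE x in lebesgue. u x = w x) \<and>
      (\<forall>x. \<bar>w x\<bar> \<le> c * r * Jr powr (s / real CARD('n))))"
proof -
  let ?n = "real CARD('n)"
  define m where "m = int_part s"
  define \<sigma> where "\<sigma> = frac s"
  have ms: "real m + \<sigma> = s" using s(1) by (simp add: m_def \<sigma>_def frac_def)
  have sg: "\<sigma> > 0"
  proof -
    have "\<sigma> \<noteq> 0" using ms s(3) by (metis add.right_neutral of_nat_in_Nats)
    then show ?thesis unfolding \<sigma>_def using frac_ge_0[of s] by simp
  qed
  have "(\<integral>\<^sup>+t\<in>{0<..}. epowr (ennreal t / A t) (s / (?n - s)) \<partial>lborel) < \<infinity>"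
    using s by (intro young_ratio_integral_finite[OF A _ f0 fi]) auto
  then obtain Ir where Ir: "(\<integral>\<^sup>+t\<in>{0<..}. epowr (ennreal t / A t) (s / (?n - s)) \<partial>lborel) = ennreal Ir" "Ir \<ge> 0"
    by (cases "\<integral>\<^sup>+t\<in>{0<..}. epowr (ennreal t / A t) (s / (?n - s)) \<partial>lborel") auto
  define c where "c = bound_const m \<sigma> CARD('n) Ir / (LINT y|lborel. prodf (\<lambda>_::'n. std_bump) y)"
  define c' where "c' = \<bar>c\<bar> + 1"
  show ?thesis
    unfolding m_def[symmetric] \<sigma>_def[symmetric]
  proof (intro exI[of _ c'] conjI ballI allI impI)
    show "c' > 0" by (simp add: c'_def)
    fix u :: "real^'n \<Rightarrow> real" and r Jr :: real
    assume u: "u \<in> V_d s A" and r: "r > 0" and Jr: "Jr \<ge> 0" "J \<sigma> A (multi_indices m) (\<lambda>x \<alpha>. nabla u x \<alpha> / r) = ennreal Jr"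
    have um: "u \<in> borel_measurable lebesgue" and wd: "weakly_differentiable m u"
      and lev: "\<And>t. t > 0 \<Longrightarrow> emeasure lebesgue {x. L2_set (nabla u x) (multi_indices 0) > t} < \<infinity>"
      using u by (auto simp: V_d_def m_def)
    obtain G :: "('n \<Rightarrow> nat) \<Rightarrow> real^'n \<Rightarrow> real"
      where G: "\<And>\<alpha>. sum \<alpha> UNIV \<le> m \<Longrightarrow> G \<alpha> \<in> borel_measurable borel"
      "\<And>\<alpha>. sum \<alpha> UNIV \<le> m \<Longrightarrow> AE x in lborel. weak_deriv \<alpha> u x = G \<alpha> x"
      by (rule borel_representatives[OF um wd]) blast
    have Jfin: "J \<sigma> A (multi_indices m) (\<lambda>x \<alpha>. nabla u x \<alpha> / r) < \<infinity>" using Jr by simp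
    interpret young_system m "\<lambda>\<alpha> x. G \<alpha> x / r" A \<sigma>
      by (rule young_system_of_V_d(1)[OF A sg r um wd G Jfin])
    have modular: "modular = ennreal Jr"
      using young_system_of_V_d(2)[OF A sg r um wd G Jfin] Jr(2) by simp
    have G0: "AE x in lborel. u x = G (\<lambda>_. 0) x" using G(2)[of "\<lambda>_. 0"] by (simp add: weak_deriv_def)
    have [measurable]: "G (\<lambda>_. 0) \<in> borel_measurable borel" by (rule G(1)) simp
    have lev': "emeasure lborel {x. t < \<bar>G (\<lambda>_. 0) x / r\<bar>} < \<infinity>" if t: "t > 0" for t
    proof -
      have S: "{x. t < \<bar>G (\<lambda>_. 0) x / r\<bar>} \<in> sets borel"
      proof -
        have "{x. t < \<bar>G (\<lambda>_. 0) x / r\<bar>} = {x \<in> space borel. t < \<bar>G (\<lambda>_. 0) x / r\<bar>}" by simp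
        also have "\<dots> \<in> sets borel" by measurable
        finally show ?thesis .
      qed
      have L: "{x. L2_set (nabla u x) (multi_indices 0) > t * r} = {x \<in> space lebesgue. t * r < \<bar>u x\<bar>}"
        by (auto simp: multi_indices_0 L2_set_singleton nabla_def weak_deriv_def)
      have "emeasure lborel {x. t < \<bar>G (\<lambda>_. 0) x / r\<bar>} = emeasure lebesgue {x. t < \<bar>G (\<lambda>_. 0) x / r\<bar>}"
        by (rule emeasure_lborel_eq_lebesgue[OF S])
      also have "\<dots> = emeasure lebesgue {x \<in> space lebesgue. t * r < \<bar>u x\<bar>}"
      proof (rule emeasure_eq_AE)
        show "AE x in lebesgue. (x \<in> {x. t < \<bar>G (\<lambda>_. 0) x / r\<bar>}) = (x \<in> {x \<in> space lebesgue. t * r < \<bar>u x\<bar>})"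
          using AE_completion[OF G0] by eventually_elim (use r in \<open>simp add: abs_divide pos_less_divide_eq\<close>)
        show "{x. t < \<bar>G (\<lambda>_. 0) x / r\<bar>} \<in> sets lebesgue" using S by (simp add: sets_completionI_sets)
        show "{x \<in> space lebesgue. t * r < \<bar>u x\<bar>} \<in> sets lebesgue" using um by measurable
      qed
      also have "\<dots> < \<infinity>" using lev[of "t * r"] t r unfolding L by simp
      finally show ?thesis .
    qed
    have "\<exists>w. continuous_on UNIV w \<and> (AE x in lborel. G (\<lambda>_. 0) x / r = w x) \<and>
      (\<forall>x. \<bar>w x\<bar> \<le> bound_const m \<sigma> CARD('n) Ir / (LINT y|lborel. prodf (\<lambda>_::'n. std_bump) y) * Jr powr ((m + \<sigma>) / CARD('n)))"
      by (rule bounded_continuous_representative[OF modular Jr(1) _ _ Ir(2) lev']) (use ms s Ir(1) in auto)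
    then obtain w where w: "continuous_on UNIV w" "AE x in lborel. G (\<lambda>_. 0) x / r = w x"
      "\<And>x. \<bar>w x\<bar> \<le> c * Jr powr (s / ?n)"
      unfolding c_def[symmetric] ms by blast
    show "\<exists>w. continuous_on UNIV w \<and> (AE x in lebesgue. u x = w x) \<and> (\<forall>x. \<bar>w x\<bar> \<le> c' * r * Jr powr (s / ?n))"
    proof (intro exI[of _ "\<lambda>x. r * w x"] conjI allI)
      show "continuous_on UNIV (\<lambda>x. r * w x)" using w(1) by (intro continuous_intros)
      have "AE x in lborel. u x = r * w x" using w(2) G0 by eventually_elim (use r in \<open>auto simp: field_simps\<close>)
      then show "AE x in lebesgue. u x = r * w x" by (rule AE_completion)
      fix x
      have "\<bar>r * w x\<bar> = r * \<bar>w x\<bar>" using r by (simp add: abs_mult)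
      also have "\<dots> \<le> r * (c' * Jr powr (s / ?n))"
      proof (intro mult_left_mono order_trans[OF w(3)] mult_right_mono)
        show "c \<le> c'" by (simp add: c'_def)
      qed (use r in auto)
      finally show "\<bar>r * w x\<bar> \<le> c' * r * Jr powr (s / ?n)" by (simp add: mult_ac)
    qed
  qed
qed

lemma continuous_eq_if_AE_eq:
  fixes f g :: "real^'n::finite \<Rightarrow> real"
  assumes "continuous_on UNIV f" "continuous_on UNIV g" "AE x in lebesgue. f x = g x"
  shows "f x = g x"
proof -
  have "closed {x. f x = g x}" using assms(1,2) by (intro closed_Collect_eq)
  from mem_closed_if_AE_lebesgue[OF this, of x] assms(3) show ?thesis by simp
qed

text \<open>Every \<open>r\<close> admissible in the Luxemburg infimum has modular at most 1, so the
  representative is bounded by c r. As it does not depend on \<open>r\<close>, the infimum can be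
  taken.\<close>

lemma embeds_C0_V_d:
  fixes s :: real and A :: "real \<Rightarrow> ennreal"
  assumes s: "0 < s" "s < real CARD('n::finite)" "s \<notin> \<nat>" and A: "young_function A"
    and f0: "finite_near_0 A (s / (real CARD('n) - s))"
    and fi: "finite_near_infinity A (s / (real CARD('n) - s))"
  shows "embeds_C0 (V_d s A :: (real^'n \<Rightarrow> real) set) (V_norm s A)"
proof -
  obtain c where c: "c > 0" and bnd: "\<And>u r Jr. u \<in> (V_d s A :: (real^'n \<Rightarrow> real) set) \<Longrightarrow> r > 0 \<Longrightarrow> Jr \<ge> 0 \<Longrightarrow>
    J (frac s) A (multi_indices (int_part s)) (\<lambda>x \<alpha>. nabla u x \<alpha> / r) = ennreal Jr \<Longrightarrow>
    (\<exists>w. continuous_on UNIV w \<and> (AE x in lebesgue. u x = w x) \<and> (\<forall>x. \<bar>w x\<bar> \<le> c * r * Jr powr (s / real CARD('n))))"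
    using V_d_bound[OF assms] by blast
  let ?T = "\<lambda>u :: real^'n \<Rightarrow> real. {r. 0 < r \<and> J (frac s) A (multi_indices (int_part s)) (\<lambda>x \<alpha>. nabla u x \<alpha> / r) \<le> 1}"
  have norm: "V_norm s A u = (INF r\<in>?T u. ennreal r)" for u :: "real^'n \<Rightarrow> real" by (simp add: V_norm_def seminorm_def)
  have b1: "\<exists>w. continuous_on UNIV w \<and> (AE x in lebesgue. u x = w x) \<and> (\<forall>x. \<bar>w x\<bar> \<le> c * r)"
    if u: "u \<in> V_d s A" and r: "r \<in> ?T u" for u r
  proof -
    let ?J = "J (frac s) A (multi_indices (int_part s)) (\<lambda>x \<alpha>. nabla u x \<alpha> / r)"
    have J1: "?J \<le> 1" and r0: "r > 0" using r by auto
    then obtain Jr where Jr: "?J = ennreal Jr" "Jr \<ge> 0" by (cases ?J) (auto simp: top_unique)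
    have "Jr \<le> 1" using J1 Jr by (simp add: ennreal_le_1)
    then have "Jr powr (s / real CARD('n)) \<le> 1 powr (s / real CARD('n))" using Jr s by (intro powr_mono2) auto
    then have "c * r * Jr powr (s / real CARD('n)) \<le> c * r * 1" using c r0 by (intro mult_left_mono) auto
    then show ?thesis using bnd[OF u r0 Jr(2,1)] by (metis mult.right_neutral order_trans)
  qed
  show ?thesis
    unfolding embeds_C0_def
  proof (intro conjI ballI exI[of _ c] c allI impI)
    fix u :: "real^'n \<Rightarrow> real" assume u: "u \<in> V_d s A"
    have fin: "V_norm s A u < \<infinity>" using u by (simp add: V_d_def)
    \<comment> \<open>The infimum over the empty set is infinite, so a finite norm supplies an
      admissible \<open>r\<close>.\<close>
    have "?T u \<noteq> {}"
    proof
      assume "?T u = {}"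
      then have "V_norm s A u = top" unfolding norm by (simp only: image_empty Inf_empty)
      then show False using fin by simp
    qed
    then obtain r where r: "r \<in> ?T u" by blast
    obtain w where w: "continuous_on UNIV w" "AE x in lebesgue. u x = w x" "\<And>x. \<bar>w x\<bar> \<le> c * r"
      using b1[OF u r] by blast
    have "w \<in> bcontfun" unfolding bcontfun_def using w(1,3) by (auto simp: bounded_iff)
    then have "C0_rep u (Bcontfun w)" unfolding C0_rep_def using w(2) by (simp add: Bcontfun_inverse)
    then show "\<exists>w. C0_rep u w" by blast
  next
    fix u :: "real^'n \<Rightarrow> real" and w' assume u: "u \<in> V_d s A" and w': "C0_rep u w'"
    have "ennreal (norm w' / c) \<le> ennreal r" if r: "r \<in> ?T u" for r
    proof -
      obtain w where w: "continuous_on UNIV w" "AE x in lebesgue. u x = w x" "\<And>x. \<bar>w x\<bar> \<le> c * r"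
        using b1[OF u r] by blast
      have "AE x in lebesgue. w x = apply_bcontfun w' x"
        using w(2) w'[unfolded C0_rep_def] by eventually_elim simp
      from continuous_eq_if_AE_eq[OF w(1) _ this] have "w x = apply_bcontfun w' x" for x by simp
      then have "norm (apply_bcontfun w' x) \<le> c * r" for x using w(3)[of x] by simp
      then have "norm w' \<le> c * r" by (rule norm_bound)
      then show ?thesis using c by (intro ennreal_leI) (simp add: divide_le_eq mult.commute)
    qed
    then have "ennreal (norm w' / c) \<le> V_norm s A u" unfolding norm by (intro INF_greatest)
    then have "ennreal c * ennreal (norm w' / c) \<le> ennreal c * V_norm s A u" by (intro mult_left_mono) auto
    then show "ennreal (norm w') \<le> ennreal c * V_norm s A u" using c by (simp add: ennreal_mult'[symmetric])
  qed
qed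

lemma Linf_norm_le:
  assumes "u \<in> borel_measurable lebesgue" "AE x in lebesgue. \<bar>u x\<bar> \<le> c"
  shows "Linf_norm u \<le> ennreal c"
  unfolding Linf_norm_def
  by (rule esssup_I) (use assms in \<open>auto elim: eventually_mono intro: ennreal_leI\<close>)

lemma embeds_Linf_of_embeds_C0:
  fixes X :: "(real^'n::finite \<Rightarrow> real) set"
  assumes X: "X \<subseteq> borel_measurable lebesgue" and C: "embeds_C0 X N"
  shows "embeds_Linf X N"
proof -
  obtain c where c: "c > 0" "\<And>u w. u \<in> X \<Longrightarrow> C0_rep u w \<Longrightarrow> ennreal (norm w) \<le> ennreal c * N u"
    and ex: "\<And>u. u \<in> X \<Longrightarrow> \<exists>w. C0_rep u w" using C unfolding embeds_C0_def by blast
  have le: "Linf_norm u \<le> ennreal (norm w)" if "u \<in> X" "C0_rep u w" for u w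
  proof (rule Linf_norm_le)
    show "u \<in> borel_measurable lebesgue" using X that by blast
    show "AE x in lebesgue. \<bar>u x\<bar> \<le> norm w"
      using that(2) unfolding C0_rep_def
    proof eventually_elim
      case (elim x)
      then show ?case using norm_bounded[of w x] by simp
    qed
  qed
  show ?thesis
    unfolding embeds_Linf_def
  proof (intro conjI exI[of _ c] c(1) ballI subsetI)
    fix u assume u: "u \<in> X"
    obtain w where w: "C0_rep u w" using ex[OF u] by blast
    show "u \<in> Linf" using le[OF u w] X u by (auto simp: Linf_def intro: le_less_trans)
    show "Linf_norm u \<le> ennreal c * N u" using le[OF u w] c(2)[OF u w] by (rule order_trans)
  qed
qed

lemma modular_bound_V_d:
  fixes s :: real and A :: "real \<Rightarrow> ennreal"
  assumes s: "0 < s" "s < real CARD('n::finite)" "s \<notin> \<nat>" and A: "young_function A"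
    and f0: "finite_near_0 A (s / (real CARD('n) - s))"
    and fi: "finite_near_infinity A (s / (real CARD('n) - s))"
  shows "\<exists>c::real. c > 0 \<and> (\<forall>u\<in>(V_d s A :: (real^'n \<Rightarrow> real) set).
    Linf_norm u \<le> ennreal c * epowr (V_modular s A u) (s / real CARD('n)))"
proof -
  obtain c where c: "c > 0" and bnd: "\<And>u r Jr. u \<in> (V_d s A :: (real^'n \<Rightarrow> real) set) \<Longrightarrow> r > 0 \<Longrightarrow> Jr \<ge> 0 \<Longrightarrow>
    J (frac s) A (multi_indices (int_part s)) (\<lambda>x \<alpha>. nabla u x \<alpha> / r) = ennreal Jr \<Longrightarrow>
    (\<exists>w. continuous_on UNIV w \<and> (AE x in lebesgue. u x = w x) \<and> (\<forall>x. \<bar>w x\<bar> \<le> c * r * Jr powr (s / real CARD('n))))"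
    using V_d_bound[OF assms] by blast
  show ?thesis
  proof (intro exI[of _ c] conjI c ballI)
    fix u :: "real^'n \<Rightarrow> real" assume u: "u \<in> V_d s A"
    show "Linf_norm u \<le> ennreal c * epowr (V_modular s A u) (s / real CARD('n))"
    proof (cases "V_modular s A u" rule: ennreal_cases)
      case (real Jr)
      then have J: "J (frac s) A (multi_indices (int_part s)) (\<lambda>x \<alpha>. nabla u x \<alpha> / 1) = ennreal Jr"
        by (simp add: V_modular_def)
      obtain w where w: "AE x in lebesgue. u x = w x" "\<And>x. \<bar>w x\<bar> \<le> c * 1 * Jr powr (s / real CARD('n))"
        using bnd[OF u _ real(1) J] by auto
      have "Linf_norm u \<le> ennreal (c * Jr powr (s / real CARD('n)))"
      proof (rule Linf_norm_le)
        show "u \<in> borel_measurable lebesgue" using u by (simp add: V_d_def)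
        show "AE x in lebesgue. \<bar>u x\<bar> \<le> c * Jr powr (s / real CARD('n))"
          using w(1) by eventually_elim (use w(2) in simp)
      qed
      then show ?thesis using real c by (simp add: epowr_def ennreal_mult')
    next
      case top
      then show ?thesis using c by (simp add: epowr_def ennreal_mult_top)
    qed
  qed
qed

section \<open>Lacunary sums of bumps\<close>

lemma C_k_continuous: "C_k k \<psi> \<Longrightarrow> continuous_on UNIV \<psi>"
  by (cases k) (auto intro: differentiable_imp_continuous_on)

lemma smooth_foldr_partial: "(\<And>k. C_k k \<psi>) \<Longrightarrow> C_k k (foldr partial l \<psi>)"
proof (induction l arbitrary: k)
  case (Cons a l)
  have "C_k (Suc k) (foldr partial l \<psi>)" by (rule Cons.IH) (rule Cons.prems)
  then show ?case by simp
qed simp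

text \<open>The product of the two functions has compact support because of \<open>prodf q\<close>,
  so its partial derivative integrates to zero; \<psi> is only required to be C^1.\<close>

lemma prodf_by_parts:
  fixes q :: "'n::finite \<Rightarrow> real \<Rightarrow> real"
  assumes q: "\<And>i. bump (q i)" and \<psi>: "C_k 1 \<psi>"
  shows "(LINT x|lborel. prodf q x * partial a \<psi> x) = - (LINT x|lborel. prodf (q(a := deriv (q a))) x * \<psi> x)"
proof -
  define q' where "q' = q(a := deriv (q a))"
  have q': "bump (q' i)" for i using q by (simp add: q'_def bump_deriv)
  have \<psi>d: "\<psi> differentiable (at x)" and pc: "continuous_on UNIV (partial a \<psi>)" for x
    using \<psi> by (auto simp: differentiable_on_def)
  have \<psi>c: "continuous_on UNIV \<psi>" using \<psi> by (rule C_k_continuous)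
  have D: "((\<lambda>x. prodf q x * \<psi> x) has_derivative
      (\<lambda>v. prodf q x * frechet_derivative \<psi> (at x) v + (\<Sum>i\<in>UNIV. v $ i * prodf (q(i := deriv (q i))) x) * \<psi> x)) (at x)" for x
    by (rule has_derivative_mult[OF prodf_has_derivative[of q, OF bump_smooth[OF q]] frechet_derivative_works[THEN iffD1, OF \<psi>d]])
  have par: "partial a (\<lambda>x. prodf q x * \<psi> x) = (\<lambda>x. prodf q x * partial a \<psi> x + prodf q' x * \<psi> x)"
  proof
    fix x
    have "frechet_derivative (\<lambda>x. prodf q x * \<psi> x) (at x) =
      (\<lambda>v. prodf q x * frechet_derivative \<psi> (at x) v + (\<Sum>i\<in>UNIV. v $ i * prodf (q(i := deriv (q i))) x) * \<psi> x)"
      using frechet_derivative_at[OF D] by simp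
    then show "partial a (\<lambda>x. prodf q x * \<psi> x) x = prodf q x * partial a \<psi> x + prodf q' x * \<psi> x"
      by (simp add: partial_def axis_def q'_def if_distrib[of "\<lambda>u. u * _"] cong: if_cong)
  qed
  have cq: "continuous_on UNIV (prodf q)"
    by (rule prodf_continuous) (rule smooth_continuous[OF bump_smooth[OF q]])
  have cq': "continuous_on UNIV (prodf q')"
    by (rule prodf_continuous) (rule smooth_continuous[OF bump_smooth[OF q']])
  obtain M where M: "M > 0" "\<And>x. M < norm x \<Longrightarrow> prodf q x = 0" by (rule prodf_support[of q, OF q]) blast
  have "(LINT x|lborel. partial a (\<lambda>x. prodf q x * \<psi> x) x) = 0"
  proof (rule integral_partial_eq_0[where M=M])
    show "(\<lambda>x. prodf q x * \<psi> x) differentiable (at x)" for x using D[of x] by (auto simp: differentiable_def)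
    show "continuous_on UNIV (partial a (\<lambda>x. prodf q x * \<psi> x))"
      unfolding par by (intro continuous_intros cq cq' \<psi>c pc)
    show "prodf q x * \<psi> x = 0" if "M < norm x" for x using M(2)[OF that] by simp
  qed
  moreover have "integrable lborel (\<lambda>x. partial a \<psi> x * prodf q x)" "integrable lborel (\<lambda>x. \<psi> x * prodf q' x)"
    by (rule loc_int_prodf[of _ q, OF loc_int_continuous[OF pc] q], rule loc_int_prodf[of _ q', OF loc_int_continuous[OF \<psi>c] q'])
  ultimately show ?thesis unfolding par q'_def[symmetric] by (simp add: mult.commute)
qed

lemma prodf_by_parts_list:
  fixes q :: "'n::finite \<Rightarrow> real \<Rightarrow> real"
  assumes \<psi>: "\<And>k. C_k k \<psi>" and q: "\<And>i. bump (q i)"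
  shows "(LINT x|lborel. prodf q x * foldr partial l \<psi> x)
    = (-1) ^ length l * (LINT x|lborel. prodf (\<lambda>i. (deriv ^^ count_list l i) (q i)) x * \<psi> x)"
  using q
proof (induction l arbitrary: q)
  case (Cons a l)
  define q' where "q' = q(a := deriv (q a))"
  have q': "bump (q' i)" for i using Cons.prems by (simp add: q'_def bump_deriv)
  have "(LINT x|lborel. prodf q x * foldr partial (a # l) \<psi> x) = - (LINT x|lborel. prodf q' x * foldr partial l \<psi> x)"
    unfolding q'_def using prodf_by_parts[of q "foldr partial l \<psi>" a, OF Cons.prems smooth_foldr_partial[OF \<psi>]] by simp
  also have "(LINT x|lborel. prodf q' x * foldr partial l \<psi> x)
      = (-1) ^ length l * (LINT x|lborel. prodf (\<lambda>i. (deriv ^^ count_list l i) (q' i)) x * \<psi> x)"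
    by (rule Cons.IH[OF q'])
  also have "(\<lambda>i. (deriv ^^ count_list l i) (q' i)) = (\<lambda>i. (deriv ^^ count_list (a # l) i) (q i))"
    by (auto simp: q'_def fun_eq_iff funpow_Suc_right simp del: funpow.simps)
  finally show ?case by simp
qed simp

lemma prodf_by_parts_mderiv:
  fixes q :: "'n::finite \<Rightarrow> real \<Rightarrow> real"
  assumes \<psi>: "test_function \<psi>" and q: "\<And>i. bump (q i)"
  shows "(LINT x|lborel. prodf q x * mderiv \<alpha> \<psi> x)
    = (-1) ^ sum \<alpha> UNIV * (LINT x|lborel. prodf (\<lambda>i. (deriv ^^ \<alpha> i) (q i)) x * \<psi> x)"
proof -
  define l where "l = (SOME l. \<forall>i. count_list l i = \<alpha> i)"
  have l: "count_list l i = \<alpha> i" for i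
    using someI_ex[OF ex_count_list[of \<alpha>]] unfolding l_def by blast
  have "length l = sum (count_list l) UNIV" by (rule sum_count_set[symmetric]) auto
  then have "length l = sum \<alpha> UNIV" by (simp add: l)
  moreover have "C_k k \<psi>" for k using \<psi> by (simp add: test_function_def)
  ultimately show ?thesis
    using prodf_by_parts_list[of \<psi> q l, OF _ q] unfolding mderiv_def l_def[symmetric] by (simp add: l)
qed

text \<open>\<open>weak_deriv\<close> is obtained by choice, so for explicit functions it has to be
  identified with the classical derivative almost everywhere. Both satisfy the same identity against
  tensor bumps.\<close>

lemma weak_deriv_AE_eq:
  fixes u g :: "real^'n::finite \<Rightarrow> real"
  assumes D: "has_weak_deriv \<alpha> u D" "continuous_on UNIV D" and g: "has_weak_deriv \<alpha> u g"
  shows "AE x in lborel. g x = D x"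
proof -
  have gl: "locally_integrable g" using g by (simp add: has_weak_deriv_def)
  have gm: "g \<in> borel_measurable lebesgue" using gl by (rule locally_integrable_measurable)
  obtain g' where g': "g' \<in> borel_measurable borel" "AE x in lborel. g x = g' x"
    using completion_ex_borel_measurable_real[OF gm] by auto
  have li: "loc_int g'" by (rule locally_integrable_loc_int[OF gl g'])
  have lD: "loc_int D" using D(2) by (rule loc_int_continuous)
  have Dm: "D \<in> borel_measurable borel" using D(2) by (rule borel_measurable_continuous_onI)
  have Dl: "D \<in> borel_measurable lebesgue" using Dm by (intro measurable_completion) simp
  have "AE x in lborel. g' x - D x = 0"
  proof (rule AE_zero_if_orthogonal_to_bumps[OF loc_int_diff[OF li lD]])
    fix q :: "'n \<Rightarrow> real \<Rightarrow> real" assume q: "\<And>i. bump (q i)"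
    have pm: "prodf q \<in> borel_measurable borel" by (rule prodf_measurable[of q, OF q])
    have "(LINT x|lebesgue. u x * mderiv \<alpha> (prodf q) x) = (-1) ^ sum \<alpha> UNIV * (LINT x|lebesgue. f x * prodf q x)"
      if "has_weak_deriv \<alpha> u f" for f
      using that test_function_prodf[of q, OF q] by (simp add: has_weak_deriv_def)
    from this[OF D(1)] this[OF g] have "(LINT x|lebesgue. g x * prodf q x) = (LINT x|lebesgue. D x * prodf q x)" by simp
    moreover have "(LINT x|lebesgue. g x * prodf q x) = (LINT x|lborel. g' x * prodf q x)"
      by (rule integral_lebesgue_AE_eq[OF gm g' pm])
    moreover have "(LINT x|lebesgue. D x * prodf q x) = (LINT x|lborel. D x * prodf q x)"
      by (rule integral_lebesgue_AE_eq[OF Dl Dm _ pm]) simp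
    moreover have "integrable lborel (\<lambda>x. g' x * prodf q x)" "integrable lborel (\<lambda>x. D x * prodf q x)"
      using loc_int_prodf[of g' q, OF li q] loc_int_prodf[of D q, OF lD q] .
    ultimately show "(LINT x|lborel. (g' x - D x) * prodf q x) = 0"
      by (simp add: left_diff_distrib)
  qed
  then show ?thesis using g'(2) by eventually_elim simp
qed

text \<open>This is the \<open>\<alpha>\<close>-th derivative of \<open>\<Sum>k<N. c k * \<phi> (2 ^ k x)\<close>, with \<open>\<phi>\<close> the standard bump on \<open>real^'n\<close>.\<close>

definition lacunary :: "(nat \<Rightarrow> real) \<Rightarrow> nat \<Rightarrow> ('n::finite \<Rightarrow> nat) \<Rightarrow> real^'n \<Rightarrow> real" where
  "lacunary c N \<alpha> x = (\<Sum>k<N. c k * (2 ^ k) ^ sum \<alpha> UNIV *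
     prodf (\<lambda>i. (deriv ^^ \<alpha> i) std_bump) (2 ^ k *\<^sub>R x))"

lemma funpow_deriv_scale:
  assumes "smooth b"
  shows "(deriv ^^ a) (\<lambda>t. b (l * t)) = (\<lambda>t. l ^ a * (deriv ^^ a) b (l * t))"
proof (induction a)
  case (Suc a)
  have "((\<lambda>t. l ^ a * (deriv ^^ a) b (l * t)) has_real_derivative l ^ a * (deriv ((deriv ^^ a) b) (l * t) * l)) (at t)" for t
    by (intro DERIV_cmult smooth_DERIV_chain smooth_funpow_deriv assms) (auto intro!: derivative_eq_intros)
  then have "deriv (\<lambda>t. l ^ a * (deriv ^^ a) b (l * t)) t = l ^ a * (deriv ((deriv ^^ a) b) (l * t) * l)" for t
    by (rule DERIV_imp_deriv)
  moreover have "(deriv ^^ Suc a) (\<lambda>t. b (l * t)) = deriv (\<lambda>t. l ^ a * (deriv ^^ a) b (l * t))"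
    using Suc by simp
  ultimately show ?case by (simp add: fun_eq_iff mult_ac)
qed simp

lemma bump_scaled: "bump (\<lambda>t. std_bump (2 ^ k * t))"
  using bump_affine[OF bump_std_bump, of "2 ^ k" 0] by simp

lemma lacunary_eq_prodf:
  "lacunary c N \<alpha> x = (\<Sum>k<N. c k * prodf (\<lambda>i. (deriv ^^ \<alpha> i) (\<lambda>t. std_bump (2 ^ k * t))) x)"
  unfolding lacunary_def funpow_deriv_scale[OF bump_smooth[OF bump_std_bump]] prodf_def
  by (simp add: prod.distrib power_sum mult.assoc)

lemma lacunary_continuous: "continuous_on UNIV (lacunary c N \<alpha>)"
proof -
  have "continuous_on UNIV (prodf (\<lambda>i. (deriv ^^ \<alpha> i) (\<lambda>t. std_bump (2 ^ k * t))))" for k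
    by (rule prodf_continuous) (rule smooth_continuous[OF smooth_funpow_deriv[OF bump_smooth[OF bump_scaled]]])
  then show ?thesis unfolding lacunary_eq_prodf[abs_def] by (intro continuous_intros)
qed

lemma continuous_locally_integrable:
  fixes f :: "real^'n::finite \<Rightarrow> real"
  assumes "continuous_on UNIV f"
  shows "locally_integrable f"
  unfolding locally_integrable_def set_integrable_def
proof (intro allI impI)
  fix K :: "(real^'n) set" assume K: "compact K"
  have i: "integrable lborel (\<lambda>x. indicator K x *\<^sub>R f x)"
    by (rule borel_integrable_compact[OF K continuous_on_subset[OF assms]]) simp
  then show "integrable lebesgue (\<lambda>x. indicator K x *\<^sub>R f x)"
    using integrable_completion[of "\<lambda>x. indicator K x *\<^sub>R f x" lborel] borel_measurable_integrable[OF i] by blast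
qed

text \<open>The roles are reversed compared with \<open>weak_system\<close>: the test function is
  arbitrary and the tensor structure sits in the function to be differentiated, which is what
  \<open>prodf_by_parts_mderiv\<close> provides for.\<close>

lemma lacunary_has_weak_deriv:
  "has_weak_deriv \<alpha> (lacunary c N (\<lambda>_. 0)) (lacunary c N \<alpha> :: real^'n::finite \<Rightarrow> real)"
  unfolding has_weak_deriv_def
proof (intro conjI allI impI)
  show "locally_integrable (lacunary c N (\<lambda>_. 0) :: real^'n \<Rightarrow> real)" "locally_integrable (lacunary c N \<alpha>)"
    by (intro continuous_locally_integrable lacunary_continuous)+
  fix \<psi> :: "real^'n \<Rightarrow> real" assume \<psi>: "test_function \<psi>"
  have \<psi>k: "C_k k \<psi>" for k using \<psi> by (simp add: test_function_def)
  have \<psi>c: "continuous_on UNIV \<psi>" using C_k_continuous[OF \<psi>k] .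
  have mc: "continuous_on UNIV (mderiv \<alpha> \<psi>)" unfolding mderiv_def by (rule C_k_continuous[OF smooth_foldr_partial[OF \<psi>k]])
  let ?q = "\<lambda>k (i::'n) t. std_bump (2 ^ k * t)"
  let ?q' = "\<lambda>k i. (deriv ^^ \<alpha> i) (?q k i)"
  have leb: "(LINT x|lebesgue. f x * h x) = (LINT x|lborel. f x * h x)"
    if "continuous_on UNIV f" "continuous_on UNIV h" for f h :: "real^'n \<Rightarrow> real"
    using borel_measurable_continuous_onI[OF continuous_on_mult[OF that]] by (intro integral_completion) simp
  have lin: "(LINT x|lborel. (\<Sum>k<N. c k * prodf (f k) x) * h x) = (\<Sum>k<N. c k * (LINT x|lborel. prodf (f k) x * h x))"
    if f: "\<And>k i. bump (f k i)" and h: "continuous_on UNIV h" for f :: "nat \<Rightarrow> 'n \<Rightarrow> real \<Rightarrow> real" and h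
  proof -
    have i: "integrable lborel (\<lambda>x. prodf (f k) x * h x)" for k
      using loc_int_prodf[of h "f k", OF loc_int_continuous[OF h] f] by (simp add: mult.commute)
    have "(LINT x|lborel. (\<Sum>k<N. c k * prodf (f k) x) * h x) = (LINT x|lborel. (\<Sum>k<N. c k * (prodf (f k) x * h x)))"
      by (simp add: sum_distrib_right mult.assoc)
    also have "\<dots> = (\<Sum>k<N. LINT x|lborel. c k * (prodf (f k) x * h x))"
      by (rule Bochner_Integration.integral_sum) (intro integrable_mult_right i)
    finally show ?thesis by simp
  qed
  have u: "lacunary c N (\<lambda>_. 0) = (\<lambda>x. \<Sum>k<N. c k * prodf (?q k) x)"
    unfolding lacunary_eq_prodf[abs_def] by simp
  have pb: "(LINT x|lborel. prodf (?q k) x * mderiv \<alpha> \<psi> x) = (-1) ^ sum \<alpha> UNIV * (LINT x|lborel. prodf (?q' k) x * \<psi> x)" for k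
    by (rule prodf_by_parts_mderiv[of \<psi> "?q k", OF \<psi> bump_scaled])
  have "(LINT x|lebesgue. lacunary c N (\<lambda>_. 0) x * mderiv \<alpha> \<psi> x) = (LINT x|lborel. lacunary c N (\<lambda>_. 0) x * mderiv \<alpha> \<psi> x)"
    by (rule leb[OF lacunary_continuous mc])
  also have "\<dots> = (\<Sum>k<N. c k * (LINT x|lborel. prodf (?q k) x * mderiv \<alpha> \<psi> x))"
    unfolding u by (rule lin[of ?q, OF bump_scaled mc])
  also have "\<dots> = (\<Sum>k<N. c k * ((-1) ^ sum \<alpha> UNIV * (LINT x|lborel. prodf (?q' k) x * \<psi> x)))"
    unfolding pb ..
  also have "\<dots> = (-1) ^ sum \<alpha> UNIV * (\<Sum>k<N. c k * (LINT x|lborel. prodf (?q' k) x * \<psi> x))"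
    by (simp add: sum_distrib_left mult.left_commute)
  also have "(\<Sum>k<N. c k * (LINT x|lborel. prodf (?q' k) x * \<psi> x)) = (LINT x|lborel. lacunary c N \<alpha> x * \<psi> x)"
    unfolding lacunary_eq_prodf by (rule lin[of ?q', OF bump_funpow_deriv[OF bump_scaled] \<psi>c, symmetric])
  also have "\<dots> = (LINT x|lebesgue. lacunary c N \<alpha> x * \<psi> x)"
    by (rule leb[OF lacunary_continuous \<psi>c, symmetric])
  finally show "(LINT x|lebesgue. lacunary c N (\<lambda>_. 0) x * mderiv \<alpha> \<psi> x)
    = (-1) ^ sum \<alpha> UNIV * (LINT x|lebesgue. lacunary c N \<alpha> x * \<psi> x)" .
qed

lemma lacunary_weak_deriv_AE:
  "AE x in lborel. weak_deriv \<alpha> (lacunary c N (\<lambda>_. 0)) x = lacunary c N \<alpha> (x::real^'n::finite)"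
proof (cases "\<alpha> = (\<lambda>_. 0)")
  case False
  have "has_weak_deriv \<alpha> (lacunary c N (\<lambda>_. 0) :: real^'n \<Rightarrow> real) (weak_deriv \<alpha> (lacunary c N (\<lambda>_. 0)))"
    unfolding weak_deriv_def using False lacunary_has_weak_deriv someI_ex by (metis (mono_tags, lifting))
  then show ?thesis by (rule weak_deriv_AE_eq[OF lacunary_has_weak_deriv lacunary_continuous])
qed (simp add: weak_deriv_def)

section \<open>The modular of a lacunary sum\<close>

lemma prodf_lipschitz:
  fixes q :: "'n::finite \<Rightarrow> real \<Rightarrow> real"
  assumes q: "\<And>i. bump (q i)"
  obtains L where "L \<ge> 0" "\<And>x y. \<bar>prodf q x - prodf q y\<bar> \<le> L * norm (x - y)"
proof -
  have q': "bump ((q(i := deriv (q i))) j)" for i j using q by (simp add: bump_deriv)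
  have "\<exists>B>0. \<forall>x. \<bar>prodf (q(i := deriv (q i))) x\<bar> \<le> B" for i
    by (rule prodf_bounded[of "q(i := deriv (q i))", OF q']) blast
  then obtain B where B: "\<And>i. B i > 0" "\<And>i x. \<bar>prodf (q(i := deriv (q i))) x\<bar> \<le> B i" by metis
  define L where "L = (\<Sum>i\<in>UNIV. B i)"
  have "norm (prodf q x - prodf q y) \<le> L * norm (x - y)" for x y
  proof (rule differentiable_bound[where S=UNIV and f'="\<lambda>x v. \<Sum>i\<in>UNIV. v $ i * prodf (q(i := deriv (q i))) x"])
    show "(prodf q has_derivative (\<lambda>v. \<Sum>i\<in>UNIV. v $ i * prodf (q(i := deriv (q i))) z)) (at z within UNIV)" for z
      using prodf_has_derivative[of q, OF bump_smooth[OF q]] by simp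
    show "onorm (\<lambda>v. \<Sum>i\<in>UNIV. v $ i * prodf (q(i := deriv (q i))) z) \<le> L" for z
    proof (rule onorm_le)
      fix v :: "real^'n"
      have "norm (\<Sum>i\<in>UNIV. v $ i * prodf (q(i := deriv (q i))) z) \<le> (\<Sum>i\<in>UNIV. norm v * B i)"
        unfolding real_norm_def
        by (intro order_trans[OF sum_abs sum_mono]) (simp only: abs_mult, intro mult_mono component_le_norm_cart B, auto)
      then show "norm (\<Sum>i\<in>UNIV. v $ i * prodf (q(i := deriv (q i))) z) \<le> L * norm v"
        unfolding L_def sum_distrib_right by (simp add: mult.commute)
    qed
  qed auto
  moreover have "L \<ge> 0" unfolding L_def using B(1) by (intro sum_nonneg) (simp add: less_imp_le)
  ultimately show ?thesis using that by simp
qed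

abbreviation bump_deriv_prod :: "('n::finite \<Rightarrow> nat) \<Rightarrow> real^'n \<Rightarrow> real" where
  "bump_deriv_prod \<alpha> \<equiv> prodf (\<lambda>i. (deriv ^^ \<alpha> i) std_bump)"

text \<open>Nearby points are handled by the Lipschitz bound, distant ones by boundedness;
  \<open>min 1\<close> combines the two. The constants are sums over all multi-indices of order m,
  so they serve every derivative at once.\<close>

lemma bump_deriv_prod_variation:
  obtains L M where "L > 0" "M > 0"
    "\<And>x y :: real^'n::finite. (\<Sum>\<alpha>\<in>multi_indices m. \<bar>bump_deriv_prod \<alpha> x - bump_deriv_prod \<alpha> y\<bar>) \<le> L * min 1 (norm (x - y))"
    "\<And>(\<alpha> :: 'n \<Rightarrow> nat) x. \<alpha> \<in> multi_indices m \<Longrightarrow> M < norm x \<Longrightarrow> bump_deriv_prod \<alpha> x = 0"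
proof -
  have b: "bump ((deriv ^^ a) std_bump)" for a by (rule bump_funpow_deriv[OF bump_std_bump])
  have "\<exists>B>0. \<forall>x. \<bar>bump_deriv_prod \<alpha> x\<bar> \<le> B" for \<alpha> :: "'n \<Rightarrow> nat"
    by (rule prodf_bounded[of "\<lambda>i. (deriv ^^ \<alpha> i) std_bump", OF b]) blast
  then obtain B where B: "\<And>\<alpha>::'n \<Rightarrow> nat. B \<alpha> > 0" "\<And>\<alpha> (x::real^'n). \<bar>bump_deriv_prod \<alpha> x\<bar> \<le> B \<alpha>" by metis
  have "\<exists>L\<ge>0. \<forall>x y. \<bar>bump_deriv_prod \<alpha> x - bump_deriv_prod \<alpha> y\<bar> \<le> L * norm (x - y)" for \<alpha> :: "'n \<Rightarrow> nat"
    by (rule prodf_lipschitz[of "\<lambda>i. (deriv ^^ \<alpha> i) std_bump", OF b]) blast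
  then obtain L where L: "\<And>\<alpha>::'n \<Rightarrow> nat. L \<alpha> \<ge> 0"
    "\<And>\<alpha> (x::real^'n) y. \<bar>bump_deriv_prod \<alpha> x - bump_deriv_prod \<alpha> y\<bar> \<le> L \<alpha> * norm (x - y)" by metis
  have "\<exists>M>0. \<forall>x. M < norm x \<longrightarrow> bump_deriv_prod \<alpha> x = 0" for \<alpha> :: "'n \<Rightarrow> nat"
    by (rule prodf_support[of "\<lambda>i. (deriv ^^ \<alpha> i) std_bump", OF b]) blast
  then obtain M where M: "\<And>\<alpha>::'n \<Rightarrow> nat. M \<alpha> > 0" "\<And>\<alpha> (x::real^'n). M \<alpha> < norm x \<Longrightarrow> bump_deriv_prod \<alpha> x = 0" by metis
  define L' where "L' = (\<Sum>\<alpha>\<in>multi_indices m. 2 * B \<alpha> + L \<alpha>) + 1"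
  define M' where "M' = (\<Sum>\<alpha>\<in>multi_indices m. M \<alpha>) + 1"
  have nn: "0 \<le> 2 * B \<alpha> + L \<alpha>" "0 \<le> M \<alpha>" for \<alpha> using B(1)[of \<alpha>] L(1)[of \<alpha>] M(1)[of \<alpha>] by auto
  show ?thesis
  proof (rule that[of L' M'])
    show "L' > 0" "M' > 0" unfolding L'_def M'_def by (intro add_nonneg_pos sum_nonneg nn; simp)+
    fix x y :: "real^'n"
    have "\<bar>bump_deriv_prod \<alpha> x - bump_deriv_prod \<alpha> y\<bar> \<le> (2 * B \<alpha> + L \<alpha>) * min 1 (norm (x - y))" for \<alpha>
    proof (cases "norm (x - y) \<le> 1")
      case True
      have "L \<alpha> * norm (x - y) \<le> (2 * B \<alpha> + L \<alpha>) * norm (x - y)" using B(1)[of \<alpha>] by (intro mult_right_mono) auto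
      then show ?thesis using L(2)[of \<alpha> x y] True by simp
    next
      case False
      then show ?thesis using B(2)[of \<alpha> x] B(2)[of \<alpha> y] L(1)[of \<alpha>] by (simp add: min_def)
    qed
    then have "(\<Sum>\<alpha>\<in>multi_indices m. \<bar>bump_deriv_prod \<alpha> x - bump_deriv_prod \<alpha> y\<bar>)
      \<le> (\<Sum>\<alpha>\<in>multi_indices m. (2 * B \<alpha> + L \<alpha>) * min 1 (norm (x - y)))" by (rule sum_mono)
    also have "\<dots> \<le> L' * min 1 (norm (x - y))"
      unfolding sum_distrib_right[symmetric] L'_def by (intro mult_right_mono) auto
    finally show "(\<Sum>\<alpha>\<in>multi_indices m. \<bar>bump_deriv_prod \<alpha> x - bump_deriv_prod \<alpha> y\<bar>) \<le> L' * min 1 (norm (x - y))" .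
  next
    fix \<alpha> :: "'n \<Rightarrow> nat" and x :: "real^'n" assume \<alpha>: "\<alpha> \<in> multi_indices m" "M' < norm x"
    have "M \<alpha> \<le> (\<Sum>\<alpha>\<in>multi_indices m. M \<alpha>)" using \<alpha>(1) nn by (intro member_le_sum finite_multi_indices) auto
    then show "bump_deriv_prod \<alpha> x = 0" using \<alpha>(2) by (intro M(2)) (simp add: M'_def)
  qed
qed

text \<open>Jensen's inequality with weights of total at most 1 instead of exactly 1, thanks to A(0)
  = 0. The induction splits off one point and renormalizes the remaining weights by 1 -
  p(a).\<close>

lemma young_jensen:
  assumes A: "young_function A"
  shows "finite K \<Longrightarrow> (\<And>k. k \<in> K \<Longrightarrow> p k \<ge> 0) \<Longrightarrow> (\<And>k. k \<in> K \<Longrightarrow> x k \<ge> 0) \<Longrightarrow> (\<Sum>k\<in>K. p k) \<le> 1 \<Longrightarrow>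
    A (\<Sum>k\<in>K. p k * x k) \<le> (\<Sum>k\<in>K. ennreal (p k) * A (x k))"
proof (induction K arbitrary: p rule: finite_induct)
  case empty
  then show ?case using young_zero[OF A] by simp
next
  case (insert a K)
  have pK: "(\<Sum>k\<in>K. p k) \<ge> 0" using insert.prems by (intro sum_nonneg) auto
  have pa: "0 \<le> p a" "p a \<le> 1" using insert.prems insert.hyps pK by auto
  show ?case
  proof (cases "p a = 1")
    case True
    then have "(\<Sum>k\<in>K. p k) = 0" using insert.prems(3) insert.hyps pK by simp
    then have "p k = 0" if "k \<in> K" for k
      using that insert.prems(1) insert.hyps(1) by (subst (asm) sum_nonneg_eq_0_iff) auto
    then show ?thesis using True insert.hyps by simp
  next
    case False
    define q where "q = 1 - p a"
    have q: "0 < q" "q \<le> 1" using False pa by (auto simp: q_def)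
    define y where "y = (\<Sum>k\<in>K. (p k / q) * x k)"
    have y0: "y \<ge> 0" unfolding y_def using insert.prems q by (intro sum_nonneg mult_nonneg_nonneg) auto
    have Ay: "A y \<le> (\<Sum>k\<in>K. ennreal (p k / q) * A (x k))"
      unfolding y_def
    proof (rule insert.IH)
      show "(\<Sum>k\<in>K. p k / q) \<le> 1"
        using insert.prems(3) insert.hyps q by (simp add: sum_divide_distrib[symmetric] divide_le_eq q_def)
    qed (use insert.prems q in auto)
    have "(\<Sum>k\<in>insert a K. p k * x k) = (1 - q) * x a + q * y"
      using insert.hyps q by (simp add: y_def sum_distrib_left q_def)
    then have "A (\<Sum>k\<in>insert a K. p k * x k) \<le> ennreal (1 - q) * A (x a) + ennreal q * A y"
      using young_convex[OF A, of "x a" y q] insert.prems y0 q by simp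
    also have "\<dots> \<le> ennreal (1 - q) * A (x a) + ennreal q * (\<Sum>k\<in>K. ennreal (p k / q) * A (x k))"
      by (intro add_left_mono mult_left_mono Ay) simp
    also have "ennreal q * (\<Sum>k\<in>K. ennreal (p k / q) * A (x k)) = (\<Sum>k\<in>K. ennreal (p k) * A (x k))"
      unfolding sum_distrib_left using q insert.prems
      by (intro sum.cong refl) (simp add: mult.assoc[symmetric] ennreal_mult'[symmetric])
    finally show ?thesis using insert.hyps by (simp add: q_def)
  qed
qed

text \<open>Up to a constant, this bounds the Hoelder quotient of exponent \<sigma> of a fixed bump
  at two points of distance t.\<close>

definition wt :: "real \<Rightarrow> real \<Rightarrow> real" where
  "wt \<sigma> t = t powr - \<sigma> * min 1 t"

lemma wt_nonneg: "t \<ge> 0 \<Longrightarrow> wt \<sigma> t \<ge> 0"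
  by (simp add: wt_def)

definition wt_const :: "real \<Rightarrow> real" where
  "wt_const \<sigma> = 1 / (1 - 2 powr - (1 - \<sigma>)) + 1 / (1 - 2 powr - \<sigma>)"

lemma wt_const_pos: "0 < \<sigma> \<Longrightarrow> \<sigma> < 1 \<Longrightarrow> wt_const \<sigma> > 0"
  unfolding wt_const_def by (intro add_pos_pos divide_pos_pos) (auto simp: powr_less_one)

text \<open>Geometric in both directions: the weight is t^(1 - \<sigma>) below 1 and t^(-\<sigma>)
  above 1. The bound is uniform in \<open>d\<close>, so after division by it the weights of all
  scales are fit for Jensen.\<close>

lemma wt_sum_le:
  assumes sg: "0 < \<sigma>" "\<sigma> < 1" and d: "d > 0"
  shows "(\<Sum>k<N. wt \<sigma> (2 ^ k * d)) \<le> wt_const \<sigma>"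
proof -
  have "wt \<sigma> (2 ^ k * d) \<le> (if d * 2 ^ k \<le> 1 then (d * 2 ^ k) powr (1 - \<sigma>) else 0)
      + (if (1 / d) / 2 ^ k \<le> 1 then ((1 / d) / 2 ^ k) powr \<sigma> else 0)" for k
  proof (cases "d * 2 ^ k \<le> 1")
    case True
    then have "wt \<sigma> (2 ^ k * d) = (d * 2 ^ k) powr (1 - \<sigma>)"
      using d by (simp add: wt_def mult.commute powr_diff powr_minus divide_inverse)
    then show ?thesis using True by simp
  next
    case False
    then have "wt \<sigma> (2 ^ k * d) = ((1 / d) / 2 ^ k) powr \<sigma>"
      using d by (simp add: wt_def mult.commute powr_minus powr_divide powr_mult field_simps)
    moreover have "(1 / d) / 2 ^ k \<le> 1" using False d by (simp add: field_simps)
    ultimately show ?thesis using False by simp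
  qed
  then have "(\<Sum>k<N. wt \<sigma> (2 ^ k * d)) \<le> (\<Sum>k<N. if d * 2 ^ k \<le> 1 then (d * 2 ^ k) powr (1 - \<sigma>) else 0)
     + (\<Sum>k<N. if (1 / d) / 2 ^ k \<le> 1 then ((1 / d) / 2 ^ k) powr \<sigma> else 0)"
    unfolding sum.distrib[symmetric] by (rule sum_mono)
  also have "\<dots> \<le> 1 powr (1 - \<sigma>) / (1 - 2 powr - (1 - \<sigma>)) + 1 powr \<sigma> / (1 - 2 powr - \<sigma>)"
    using sg d by (intro add_mono geometric_sum_below_increasing geometric_sum_below) auto
  finally show ?thesis by (simp add: wt_const_def)
qed

lemma dyadic_scale:
  assumes "(t::real) \<ge> 1"
  shows "\<exists>j. 2 ^ j \<le> t \<and> t < 2 ^ Suc j"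
proof -
  have ex: "\<exists>N. t < 2 ^ N" by (rule real_arch_pow) simp
  define N where "N = (LEAST N. t < 2 ^ N)"
  have N: "t < 2 ^ N" unfolding N_def by (rule LeastI_ex[OF ex])
  have "N \<noteq> 0" using N assms by (cases N) auto
  then obtain j where j: "N = Suc j" by (cases N) auto
  have "\<not> t < 2 ^ j" using not_less_Least[of j "\<lambda>N. t < 2 ^ N"] j by (simp add: N_def)
  then show ?thesis using N j by (intro exI[of _ j]) auto
qed

lemma ennreal_le_suminf: "f j \<le> (\<Sum>j. f j :: ennreal)"
  using sum_le_suminf[of f "{j}"] by simp

text \<open>Dyadic shells are enclosed in balls, on which the integrand is at most a constant. The
  contributions decay with ratio 2^(-(1 - \<sigma>)) towards 0 and 2^(-\<sigma>) towards
  infinity.\<close>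

lemma wt_kernel_integral_finite:
  assumes sg: "0 < \<sigma>" "\<sigma> < 1"
  shows "(\<integral>\<^sup>+(z::real^'n::finite). ennreal (wt \<sigma> (norm z) / norm z ^ CARD('n)) \<partial>lborel) < \<infinity>"
    (is "(\<integral>\<^sup>+z. ?h z \<partial>lborel) < \<infinity>")
proof -
  let ?n = "CARD('n)"
  let ?v = "unit_ball_vol (real ?n)"
  let ?a = "\<lambda>j. (1 / 2 ^ j) powr (1 - \<sigma>) * (2 ^ Suc j) ^ ?n"
  let ?b = "\<lambda>j. (2 ^ j) powr - \<sigma> * (1 / 2 ^ j) ^ ?n"
  let ?A = "\<lambda>j. cball 0 (1 / 2 ^ j) :: (real^'n) set" and ?B = "\<lambda>j. cball 0 (2 ^ Suc j) :: (real^'n) set"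
  have sumA: "summable (\<lambda>j. ?v * 2 ^ ?n * (2 powr - (1 - \<sigma>)) ^ j)" and sumB: "summable (\<lambda>j. ?v * 2 ^ ?n * (2 powr - \<sigma>) ^ j)"
    using sg by (auto intro!: summable_mult summable_geometric simp: powr_less_one)
  have pt: "?h z \<le> (\<Sum>j. ennreal (?a j) * indicator (?A j) z) + (\<Sum>j. ennreal (?b j) * indicator (?B j) z)" for z
  proof (cases "z = 0")
    case True
    then show ?thesis by (simp add: wt_def)
  next
    case False
    define t where "t = norm z"
    have t: "t > 0" using False by (simp add: t_def)
    show ?thesis
    proof (cases "t \<le> 1")
      case True
      then have "1 / t \<ge> 1" using t by (simp add: field_simps)
      then obtain j where j: "2 ^ j \<le> 1 / t" "1 / t < 2 ^ Suc j" using dyadic_scale by blast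
      have tj: "t \<le> 1 / 2 ^ j" using j(1) t by (simp add: field_simps)
      have "wt \<sigma> t / t ^ ?n = t powr (1 - \<sigma>) * (1 / t) ^ ?n"
        using True t by (simp add: wt_def powr_diff powr_minus divide_inverse power_inverse)
      also have "\<dots> \<le> ?a j" using tj j t sg by (intro mult_mono powr_mono2 power_mono) auto
      finally have "?h z \<le> ennreal (?a j) * indicator (?A j) z" using tj by (simp add: t_def ennreal_leI)
      also have "\<dots> \<le> (\<Sum>j. ennreal (?a j) * indicator (?A j) z)"
        by (rule ennreal_le_suminf)
      finally show ?thesis by (simp add: add_increasing2)
    next
      case False
      then obtain j where j: "2 ^ j \<le> t" "t < 2 ^ Suc j" using dyadic_scale[of t] by auto
      have "wt \<sigma> t / t ^ ?n = t powr - \<sigma> * (1 / t) ^ ?n"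
        using False t by (simp add: wt_def divide_inverse power_inverse)
      also have "\<dots> \<le> ?b j"
      proof (intro mult_mono power_mono)
        show "t powr - \<sigma> \<le> (2 ^ j) powr - \<sigma>" using j(1) sg by (intro powr_mono2') auto
        show "1 / t \<le> 1 / 2 ^ j" using j(1) t by (intro divide_left_mono) auto
      qed (use t in auto)
      finally have "?h z \<le> ennreal (?b j) * indicator (?B j) z" using j by (simp add: t_def ennreal_leI)
      also have "\<dots> \<le> (\<Sum>j. ennreal (?b j) * indicator (?B j) z)"
        by (rule ennreal_le_suminf)
      finally show ?thesis by (simp add: add_increasing)
    qed
  qed
  have [measurable]: "?A j \<in> sets borel" "?B j \<in> sets borel" for j by auto
  have "(\<integral>\<^sup>+z. ?h z \<partial>lborel) \<le> (\<integral>\<^sup>+z. (\<Sum>j. ennreal (?a j) * indicator (?A j) z) + (\<Sum>j. ennreal (?b j) * indicator (?B j) z) \<partial>lborel)"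
    by (intro nn_integral_mono pt)
  also have "\<dots> = (\<integral>\<^sup>+z. (\<Sum>j. ennreal (?a j) * indicator (?A j) z) \<partial>lborel) + (\<integral>\<^sup>+z. (\<Sum>j. ennreal (?b j) * indicator (?B j) z) \<partial>lborel)"
    by (rule nn_integral_add) measurable
  also have "(\<integral>\<^sup>+z. (\<Sum>j. ennreal (?a j) * indicator (?A j) z) \<partial>lborel) = (\<Sum>j. \<integral>\<^sup>+z. ennreal (?a j) * indicator (?A j) z \<partial>lborel)"
    by (rule nn_integral_suminf) measurable
  also have "(\<integral>\<^sup>+z. (\<Sum>j. ennreal (?b j) * indicator (?B j) z) \<partial>lborel) = (\<Sum>j. \<integral>\<^sup>+z. ennreal (?b j) * indicator (?B j) z \<partial>lborel)"
    by (rule nn_integral_suminf) measurable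
  also have "(\<lambda>j. \<integral>\<^sup>+z. ennreal (?a j) * indicator (?A j) z \<partial>lborel) = (\<lambda>j. ennreal (?v * 2 ^ ?n * (2 powr - (1 - \<sigma>)) ^ j))"
  proof
    fix j
    have "?a j * (?v * (1 / 2 ^ j) ^ ?n) = ?v * 2 ^ ?n * (2 powr - (1 - \<sigma>)) ^ j"
    proof -
      have "(1 / 2 ^ j :: real) powr (1 - \<sigma>) = (2 powr - (1 - \<sigma>)) ^ j"
      proof -
        have "1 / 2 ^ j = (2::real) powr - real j" by (simp add: powr_minus powr_realpow divide_inverse)
        then show ?thesis by (simp add: powr_powr powr_realpow[symmetric] algebra_simps)
      qed
      moreover have "((2::real) ^ Suc j) ^ ?n * (1 / 2 ^ j) ^ ?n = 2 ^ ?n"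
        unfolding power_mult_distrib[symmetric] by simp
      ultimately show ?thesis by (simp add: mult_ac)
    qed
    moreover have "(\<integral>\<^sup>+z. ennreal (?a j) * indicator (?A j) z \<partial>lborel) = ennreal (?a j) * ennreal (?v * (1 / 2 ^ j) ^ ?n)"
      by (subst nn_integral_cmult_indicator) (auto simp: emeasure_cball)
    ultimately show "(\<integral>\<^sup>+z. ennreal (?a j) * indicator (?A j) z \<partial>lborel) = ennreal (?v * 2 ^ ?n * (2 powr - (1 - \<sigma>)) ^ j)"
      by (simp add: ennreal_mult'[symmetric] del: power_Suc)
  qed
  also have "(\<lambda>j. \<integral>\<^sup>+z. ennreal (?b j) * indicator (?B j) z \<partial>lborel) = (\<lambda>j. ennreal (?v * 2 ^ ?n * (2 powr - \<sigma>) ^ j))"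
  proof
    fix j
    have "?b j * (?v * (2 ^ Suc j) ^ ?n) = ?v * 2 ^ ?n * (2 powr - \<sigma>) ^ j"
    proof -
      have "(2 ^ j :: real) powr - \<sigma> = (2 powr - \<sigma>) ^ j"
        by (simp add: powr_realpow[symmetric] powr_powr mult.commute)
      moreover have "(1 / 2 ^ j) ^ ?n * ((2::real) ^ Suc j) ^ ?n = 2 ^ ?n"
        unfolding power_mult_distrib[symmetric] by simp
      ultimately show ?thesis by (simp add: mult_ac)
    qed
    moreover have "(\<integral>\<^sup>+z. ennreal (?b j) * indicator (?B j) z \<partial>lborel) = ennreal (?b j) * ennreal (?v * (2 ^ Suc j) ^ ?n)"
      by (subst nn_integral_cmult_indicator) (auto simp: emeasure_cball)
    ultimately show "(\<integral>\<^sup>+z. ennreal (?b j) * indicator (?B j) z \<partial>lborel) = ennreal (?v * 2 ^ ?n * (2 powr - \<sigma>) ^ j)"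
      by (simp add: ennreal_mult'[symmetric] del: power_Suc)
  qed
  also have "(\<Sum>j. ennreal (?v * 2 ^ ?n * (2 powr - (1 - \<sigma>)) ^ j)) + (\<Sum>j. ennreal (?v * 2 ^ ?n * (2 powr - \<sigma>) ^ j)) < \<infinity>"
  proof -
    have e1: "(\<Sum>j. ennreal (?v * 2 ^ ?n * (2 powr - (1 - \<sigma>)) ^ j)) = ennreal (\<Sum>j. ?v * 2 ^ ?n * (2 powr - (1 - \<sigma>)) ^ j)"
      by (rule suminf_ennreal2[OF _ sumA]) (intro mult_nonneg_nonneg zero_le_power, auto)
    have e2: "(\<Sum>j. ennreal (?v * 2 ^ ?n * (2 powr - \<sigma>) ^ j)) = ennreal (\<Sum>j. ?v * 2 ^ ?n * (2 powr - \<sigma>) ^ j)"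
      by (rule suminf_ennreal2[OF _ sumB]) (intro mult_nonneg_nonneg zero_le_power, auto)
    show ?thesis unfolding e1 e2 infinity_ennreal_def less_top[symmetric] ennreal_add_eq_top by (intro notI, elim disjE) (auto intro: ennreal_neq_top[THEN notE])
  qed
  finally show ?thesis .
qed

abbreviation wt_integral :: "'n::finite itself \<Rightarrow> real \<Rightarrow> ennreal" where
  "wt_integral _ \<sigma> \<equiv> (\<integral>\<^sup>+(z::real^'n). ennreal (wt \<sigma> (norm z) / norm z ^ CARD('n)) \<partial>lborel)"

lemma wt_measurable [measurable]: "wt \<sigma> \<in> borel_measurable borel"
  unfolding wt_def[abs_def] by measurable

text \<open>The measure |z|^(-n) dz is invariant under dilations, so the integral is the same at all
  scales.\<close>

lemma wt_scaled_integral: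
  "(\<integral>\<^sup>+(z::real^'n::finite). ennreal (wt \<sigma> (2 ^ k * norm z) / norm z ^ CARD('n)) \<partial>lborel) = wt_integral TYPE('n) \<sigma>"
proof -
  let ?n = "CARD('n)"
  let ?f = "\<lambda>z::real^'n. ennreal (wt \<sigma> (2 ^ k * norm z) / norm z ^ ?n)"
  have "(\<integral>\<^sup>+z. ?f z \<partial>lborel) = ennreal (\<bar>1 / 2 ^ k\<bar> ^ DIM(real^'n)) * (\<integral>\<^sup>+z. ?f (0 + (1 / 2 ^ k) *\<^sub>R z) \<partial>lborel)"
    by (rule nn_integral_lborel_affine) auto
  also have "\<dots> = (\<integral>\<^sup>+z. ennreal (\<bar>1 / 2 ^ k\<bar> ^ DIM(real^'n)) * ?f (0 + (1 / 2 ^ k) *\<^sub>R z) \<partial>lborel)"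
    by (rule nn_integral_cmult[symmetric]) measurable
  also have "\<dots> = wt_integral TYPE('n) \<sigma>"
    by (intro nn_integral_cong) (simp add: ennreal_mult'[symmetric] power_divide)
  finally show ?thesis .
qed

lemma nn_integral_pair_difference:
  fixes f :: "real \<Rightarrow> ennreal" and B :: "(real^'n::finite) set"
  assumes f[measurable]: "f \<in> borel_measurable borel" and B[measurable]: "B \<in> sets borel"
  shows "(\<integral>\<^sup>+x. \<integral>\<^sup>+y. f (norm (x - y)) * (indicator B x + indicator B y) \<partial>lborel \<partial>lborel)
    = 2 * (emeasure lborel B * (\<integral>\<^sup>+(z::real^'n). f (norm z) \<partial>lborel))"
proof -
  let ?F = "\<integral>\<^sup>+(z::real^'n). f (norm z) \<partial>lborel"
  have F: "(\<integral>\<^sup>+y. f (norm (x - y)) \<partial>lborel) = ?F" for x :: "real^'n"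
    using nn_integral_lborel_affine[of "\<lambda>z::real^'n. f (norm z)" "-1" x] by simp
  have F': "(\<integral>\<^sup>+x. f (norm (x - y)) \<partial>lborel) = ?F" for y :: "real^'n"
    using F[of y] by (simp add: norm_minus_commute)
  have "(\<integral>\<^sup>+x. \<integral>\<^sup>+y. f (norm (x - y)) * (indicator B x + indicator B y) \<partial>lborel \<partial>lborel)
    = (\<integral>\<^sup>+x. (\<integral>\<^sup>+y. f (norm (x - y)) * indicator B x \<partial>lborel) + (\<integral>\<^sup>+y. f (norm (x - y)) * indicator B y \<partial>lborel) \<partial>lborel)"
    unfolding distrib_left by (intro nn_integral_cong nn_integral_add) measurable
  also have "\<dots> = (\<integral>\<^sup>+x. \<integral>\<^sup>+y. f (norm (x - y)) * indicator B x \<partial>lborel \<partial>lborel)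
      + (\<integral>\<^sup>+x. \<integral>\<^sup>+y. f (norm (x - y)) * indicator B y \<partial>lborel \<partial>lborel)"
    by (rule nn_integral_add) measurable
  also have "(\<integral>\<^sup>+x. \<integral>\<^sup>+y. f (norm (x - y)) * indicator B y \<partial>lborel \<partial>lborel)
      = (\<integral>\<^sup>+y. \<integral>\<^sup>+x. f (norm (x - y)) * indicator B y \<partial>lborel \<partial>lborel)"
    by (rule lborel_pair.Fubini'[symmetric]) measurable
  also have "\<dots> = (\<integral>\<^sup>+y. ?F * indicator B y \<partial>lborel)"
    by (intro nn_integral_cong) (simp add: nn_integral_multc F')
  also have "(\<integral>\<^sup>+x. \<integral>\<^sup>+y. f (norm (x - y)) * indicator B x \<partial>lborel \<partial>lborel) = (\<integral>\<^sup>+y. ?F * indicator B y \<partial>lborel)"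
    by (intro nn_integral_cong) (simp add: nn_integral_multc F)
  also have "(\<integral>\<^sup>+y. ?F * indicator B y \<partial>lborel) = ?F * emeasure lborel B"
    by (rule nn_integral_cmult_indicator) simp
  finally show ?thesis by (simp add: mult_2 mult.commute)
qed

text \<open>For each pair of points the quotient is a combination of the numbers L c_k 2^(k (m +
  \<sigma>)) with weights of total at most 1, so Jensen moves A onto the single scales. Scale k is
  seen only by pairs with a point in a ball of radius comparable to 2^(-k), whence the factor 2^(-k
  n).\<close>

lemma lacunary_J_le:
  assumes A: "young_function A" and sg: "0 < \<sigma>" "\<sigma> < 1"
  obtains K L :: real where "K > 0" "L > 0"
    "\<And>c N. (\<And>k. c k \<ge> 0) \<Longrightarrow> J \<sigma> A (multi_indices m) (\<lambda>(x::real^'n::finite) \<alpha>. lacunary c N \<alpha> x)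
      \<le> (\<Sum>k<N. ennreal (K / (2 ^ k) ^ CARD('n)) * A (L * (c k * (2 ^ k) powr (m + \<sigma>))))"
proof -
  let ?n = "CARD('n)"
  let ?I = "multi_indices m :: ('n \<Rightarrow> nat) set"
  obtain \<Lambda> M where \<Lambda>: "\<Lambda> > 0" and M: "M > 0"
    and var: "\<And>x y :: real^'n. (\<Sum>\<alpha>\<in>?I. \<bar>bump_deriv_prod \<alpha> x - bump_deriv_prod \<alpha> y\<bar>) \<le> \<Lambda> * min 1 (norm (x - y))"
    and supp: "\<And>\<alpha> x. \<alpha> \<in> ?I \<Longrightarrow> M < norm x \<Longrightarrow> bump_deriv_prod \<alpha> x = 0"
    by (rule bump_deriv_prod_variation[of m]) blast
  define Wc where "Wc = wt_const \<sigma>"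
  have Wc: "Wc > 0" unfolding Wc_def by (rule wt_const_pos[OF sg])
  define L where "L = \<Lambda> * Wc"
  have L: "L > 0" using \<Lambda> Wc by (simp add: L_def)
  obtain H where H: "wt_integral TYPE('n) \<sigma> = ennreal H" "H \<ge> 0"
    using wt_kernel_integral_finite[OF sg, where ?'n='n] by (cases "wt_integral TYPE('n) \<sigma>") auto
  \<comment> \<open>Ball volume times kernel integral, with 2 for the two points of a pair; adding 1
    makes positivity immediate.\<close>
  define K where "K = 2 * unit_ball_vol (real ?n) * M ^ ?n * H / Wc + 1"
  have K: "K > 0" unfolding K_def using M H(2) Wc by (intro add_nonneg_pos divide_nonneg_pos mult_nonneg_nonneg) auto
  have main: "J \<sigma> A ?I (\<lambda>x \<alpha>. lacunary c N \<alpha> x)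
      \<le> (\<Sum>k<N. ennreal (K / (2 ^ k) ^ ?n) * A (L * (c k * (2 ^ k) powr (m + \<sigma>))))" if c: "\<And>k. c k \<ge> 0" for c N
  proof -
    define B where "B k = (cball 0 (M / 2 ^ k) :: (real^'n) set)" for k
    have [measurable]: "B k \<in> sets borel" for k by (simp add: B_def)
    define X where "X k = L * (c k * (2 ^ k) powr (m + \<sigma>))" for k
    have X0: "X k \<ge> 0" for k using L c[of k] by (simp add: X_def)
    define f where "f k d = ennreal (wt \<sigma> (2 ^ k * d) / d ^ ?n)" for k :: nat and d :: real
    have [measurable]: "f k \<in> borel_measurable borel" for k unfolding f_def[abs_def] by measurable
    have pt: "A (L2_set (\<lambda>\<alpha>. lacunary c N \<alpha> x - lacunary c N \<alpha> y) ?I / norm (x - y) powr \<sigma>) / ennreal (norm (x - y) ^ ?n)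
        \<le> (\<Sum>k<N. (ennreal (1 / Wc) * A (X k)) * (f k (norm (x - y)) * (indicator (B k) x + indicator (B k) y)))" for x y :: "real^'n"
    proof (cases "x = y")
      case True
      then show ?thesis using young_zero[OF A] by (simp add: L2_set_def)
    next
      case False
      define d where "d = norm (x - y)"
      have d: "d > 0" using False by (simp add: d_def)
      let ?P = "\<lambda>k. x \<in> B k \<or> y \<in> B k"
      \<comment> \<open>Dropping scales at which both points lie off the support keeps the total
        weight below \<open>Wc\<close> and localizes the later integral of scale k to
        \<open>B k\<close>.\<close>
      define w where "w k = (if ?P k then wt \<sigma> (2 ^ k * d) else 0)" for k
      have w0: "w k \<ge> 0" for k using d wt_nonneg[of "2 ^ k * d" \<sigma>] by (simp add: w_def)
      have term_le: "(\<Sum>\<alpha>\<in>?I. \<bar>bump_deriv_prod \<alpha> (2 ^ k *\<^sub>R x) - bump_deriv_prod \<alpha> (2 ^ k *\<^sub>R y)\<bar>)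
          \<le> \<Lambda> * ((2 ^ k * d) powr \<sigma> * w k)" for k
      proof (cases "?P k")
        case True
        have "(\<Sum>\<alpha>\<in>?I. \<bar>bump_deriv_prod \<alpha> (2 ^ k *\<^sub>R x) - bump_deriv_prod \<alpha> (2 ^ k *\<^sub>R y)\<bar>)
          \<le> \<Lambda> * min 1 (norm (2 ^ k *\<^sub>R x - 2 ^ k *\<^sub>R y))" by (rule var)
        also have "norm (2 ^ k *\<^sub>R x - 2 ^ k *\<^sub>R y) = 2 ^ k * d"
          unfolding scaleR_diff_right[symmetric] by (simp add: d_def)
        also have "min 1 (2 ^ k * d) = (2 ^ k * d) powr \<sigma> * wt \<sigma> (2 ^ k * d)"
          using d by (simp add: wt_def powr_minus)
        finally show ?thesis using True by (simp add: w_def)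
      next
        case False
        then have "M < norm (2 ^ k *\<^sub>R x)" "M < norm (2 ^ k *\<^sub>R y)" by (auto simp: B_def divide_less_eq not_le mult.commute)
        then show ?thesis using False by (simp add: w_def supp)
      qed
      have "L2_set (\<lambda>\<alpha>. lacunary c N \<alpha> x - lacunary c N \<alpha> y) ?I \<le> (\<Sum>\<alpha>\<in>?I. \<bar>lacunary c N \<alpha> x - lacunary c N \<alpha> y\<bar>)"
        by (rule L2_set_le_sum_abs)
      also have "\<dots> \<le> (\<Sum>\<alpha>\<in>?I. \<Sum>k<N. c k * (2 ^ k) ^ m * \<bar>bump_deriv_prod \<alpha> (2 ^ k *\<^sub>R x) - bump_deriv_prod \<alpha> (2 ^ k *\<^sub>R y)\<bar>)"
      proof (rule sum_mono)
        fix \<alpha> assume "\<alpha> \<in> ?I"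
        then have "lacunary c N \<alpha> x - lacunary c N \<alpha> y
            = (\<Sum>k<N. c k * (2 ^ k) ^ m * (bump_deriv_prod \<alpha> (2 ^ k *\<^sub>R x) - bump_deriv_prod \<alpha> (2 ^ k *\<^sub>R y)))"
          by (simp add: lacunary_def multi_indices_def sum_subtractf right_diff_distrib)
        then have "\<bar>lacunary c N \<alpha> x - lacunary c N \<alpha> y\<bar>
            \<le> (\<Sum>k<N. \<bar>c k * (2 ^ k) ^ m * (bump_deriv_prod \<alpha> (2 ^ k *\<^sub>R x) - bump_deriv_prod \<alpha> (2 ^ k *\<^sub>R y))\<bar>)"
          by (simp add: sum_abs)
        then show "\<bar>lacunary c N \<alpha> x - lacunary c N \<alpha> y\<bar>
            \<le> (\<Sum>k<N. c k * (2 ^ k) ^ m * \<bar>bump_deriv_prod \<alpha> (2 ^ k *\<^sub>R x) - bump_deriv_prod \<alpha> (2 ^ k *\<^sub>R y)\<bar>)"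
          using c by (simp add: abs_mult)
      qed
      also have "\<dots> = (\<Sum>k<N. c k * (2 ^ k) ^ m * (\<Sum>\<alpha>\<in>?I. \<bar>bump_deriv_prod \<alpha> (2 ^ k *\<^sub>R x) - bump_deriv_prod \<alpha> (2 ^ k *\<^sub>R y)\<bar>))"
        unfolding sum_distrib_left by (rule sum.swap)
      also have "\<dots> \<le> (\<Sum>k<N. c k * (2 ^ k) ^ m * (\<Lambda> * ((2 ^ k * d) powr \<sigma> * w k)))"
        using c by (intro sum_mono mult_left_mono term_le mult_nonneg_nonneg) auto
      also have "\<dots> = d powr \<sigma> * (\<Sum>k<N. (w k / Wc) * X k)"
        unfolding sum_distrib_left
      proof (rule sum.cong[OF refl])
        fix k
        have "(2 ^ k * d) powr \<sigma> = (2 ^ k) powr \<sigma> * d powr \<sigma>" using d by (simp add: powr_mult)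
        moreover have "(2 ^ k :: real) powr (m + \<sigma>) = (2 ^ k) ^ m * (2 ^ k) powr \<sigma>" by (simp add: powr_add powr_realpow)
        ultimately show "c k * (2 ^ k) ^ m * (\<Lambda> * ((2 ^ k * d) powr \<sigma> * w k)) = d powr \<sigma> * (w k / Wc * X k)"
          using Wc by (simp add: X_def L_def)
      qed
      finally have "L2_set (\<lambda>\<alpha>. lacunary c N \<alpha> x - lacunary c N \<alpha> y) ?I / d powr \<sigma> \<le> (\<Sum>k<N. (w k / Wc) * X k)"
        using d by (simp add: divide_le_eq mult.commute)
      then have "A (L2_set (\<lambda>\<alpha>. lacunary c N \<alpha> x - lacunary c N \<alpha> y) ?I / d powr \<sigma>) \<le> A (\<Sum>k<N. (w k / Wc) * X k)"
        by (intro young_mono[OF A]) (auto intro: divide_nonneg_nonneg L2_set_nonneg)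
      also have "\<dots> \<le> (\<Sum>k<N. ennreal (w k / Wc) * A (X k))"
      proof (rule young_jensen[OF A])
        have "(\<Sum>k<N. w k) \<le> (\<Sum>k<N. wt \<sigma> (2 ^ k * d))"
          using d by (intro sum_mono) (simp add: w_def wt_nonneg)
        also have "\<dots> \<le> Wc" unfolding Wc_def by (rule wt_sum_le[OF sg d])
        finally show "(\<Sum>k<N. w k / Wc) \<le> 1" using Wc by (simp add: sum_divide_distrib[symmetric] divide_le_eq)
      qed (use w0 Wc X0 in auto)
      finally have "A (L2_set (\<lambda>\<alpha>. lacunary c N \<alpha> x - lacunary c N \<alpha> y) ?I / d powr \<sigma>) / ennreal (d ^ ?n)
          \<le> (\<Sum>k<N. ennreal (w k / Wc) * A (X k)) / ennreal (d ^ ?n)" by (rule divide_right_mono_ennreal)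
      also have "\<dots> = (\<Sum>k<N. ennreal (w k / Wc) * A (X k) * ennreal (1 / d ^ ?n))"
        using d by (simp add: divide_ennreal_def inverse_ennreal sum_distrib_right divide_inverse)
      also have "\<dots> \<le> (\<Sum>k<N. (ennreal (1 / Wc) * A (X k)) * (f k d * (indicator (B k) x + indicator (B k) y)))"
      proof (rule sum_mono)
        fix k
        show "ennreal (w k / Wc) * A (X k) * ennreal (1 / d ^ ?n)
          \<le> (ennreal (1 / Wc) * A (X k)) * (f k d * (indicator (B k) x + indicator (B k) y))"
        proof (cases "?P k")
          case True
          have "ennreal (w k / Wc) * A (X k) * ennreal (1 / d ^ ?n) = (ennreal (1 / Wc) * A (X k)) * (ennreal (w k) * ennreal (1 / d ^ ?n))"
            using w0[of k] Wc by (simp add: divide_inverse ennreal_mult' mult_ac)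
          also have "ennreal (w k) * ennreal (1 / d ^ ?n) = f k d"
            using True w0[of k] d by (simp add: f_def w_def ennreal_mult''[symmetric])
          also have "f k d \<le> f k d * (indicator (B k) x + indicator (B k) y)"
            using True by (auto simp: indicator_def mult_2_right add_increasing)
          finally show ?thesis by (simp add: mult_left_mono)
        qed (simp add: w_def)
      qed
      finally show ?thesis by (simp add: d_def)
    qed
    have "J \<sigma> A ?I (\<lambda>x \<alpha>. lacunary c N \<alpha> x)
      \<le> (\<integral>\<^sup>+x. \<integral>\<^sup>+y. (\<Sum>k<N. (ennreal (1 / Wc) * A (X k)) * (f k (norm (x - y)) * (indicator (B k) x + indicator (B k) y))) \<partial>lborel \<partial>lborel)"
      unfolding J_lborel by (intro nn_integral_mono pt)
    also have "\<dots> = (\<integral>\<^sup>+x. (\<Sum>k<N. (ennreal (1 / Wc) * A (X k)) * (\<integral>\<^sup>+y. f k (norm (x - y)) * (indicator (B k) x + indicator (B k) y) \<partial>lborel)) \<partial>lborel)"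
      by (intro nn_integral_cong, subst nn_integral_sum) (auto simp: nn_integral_cmult)
    also have "\<dots> = (\<Sum>k<N. (ennreal (1 / Wc) * A (X k)) * (\<integral>\<^sup>+x. \<integral>\<^sup>+y. f k (norm (x - y)) * (indicator (B k) x + indicator (B k) y) \<partial>lborel \<partial>lborel))"
      by (subst nn_integral_sum) (auto simp: nn_integral_cmult)
    also have "\<dots> \<le> (\<Sum>k<N. ennreal (K / (2 ^ k) ^ ?n) * A (X k))"
    proof (rule sum_mono)
      fix k
      have "(\<integral>\<^sup>+x. \<integral>\<^sup>+y. f k (norm (x - y)) * (indicator (B k) x + indicator (B k) y) \<partial>lborel \<partial>lborel)
        = 2 * (emeasure lborel (B k) * ennreal H)"
        by (subst nn_integral_pair_difference) (auto simp: f_def wt_scaled_integral H(1))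
      also have "emeasure lborel (B k) = ennreal (unit_ball_vol (real ?n) * (M / 2 ^ k) ^ ?n)"
        unfolding B_def using M by (subst emeasure_cball) auto
      finally have e: "(\<integral>\<^sup>+x. \<integral>\<^sup>+y. f k (norm (x - y)) * (indicator (B k) x + indicator (B k) y) \<partial>lborel \<partial>lborel)
        = ennreal (2 * (unit_ball_vol (real ?n) * (M / 2 ^ k) ^ ?n * H))"
        using M H(2) by (simp add: ennreal_mult' ennreal_mult'')
      have "ennreal (1 / Wc) * ennreal (2 * (unit_ball_vol (real ?n) * (M / 2 ^ k) ^ ?n * H)) \<le> ennreal (K / (2 ^ k) ^ ?n)"
      proof -
        have "1 / Wc * (2 * (unit_ball_vol (real ?n) * (M / 2 ^ k) ^ ?n * H))
           = (2 * unit_ball_vol (real ?n) * M ^ ?n * H / Wc) / (2 ^ k) ^ ?n"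
          by (simp add: power_divide mult_ac)
        also have "\<dots> \<le> K / (2 ^ k) ^ ?n" by (intro divide_right_mono) (auto simp: K_def)
        finally show ?thesis using Wc by (simp only: ennreal_mult'[symmetric] ennreal_leI divide_nonneg_pos zero_le_one)
      qed
      then have "A (X k) * (ennreal (1 / Wc) * ennreal (2 * (unit_ball_vol (real ?n) * (M / 2 ^ k) ^ ?n * H))) \<le> A (X k) * ennreal (K / (2 ^ k) ^ ?n)"
        by (rule mult_left_mono) simp
      then show "(ennreal (1 / Wc) * A (X k)) * (\<integral>\<^sup>+x. \<integral>\<^sup>+y. f k (norm (x - y)) * (indicator (B k) x + indicator (B k) y) \<partial>lborel \<partial>lborel)
        \<le> ennreal (K / (2 ^ k) ^ ?n) * A (X k)"
        unfolding e by (simp only: mult_ac)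
    qed
    finally show ?thesis unfolding X_def .
  qed
  show ?thesis by (rule that[OF K L main])
qed

section \<open>Necessity of the integral condition\<close>

lemma powr_power_swap: "(2 ^ k :: real) powr a = (2 powr a) ^ k"
  by (simp add: powr_realpow[symmetric] powr_powr mult.commute)

text \<open>If the inequality fails at t, then by \<open>young_scale\<close> it fails at all larger
  points, and the level set has length at most t.\<close>

lemma slope_level_mem:
  assumes A: "young_function A" and k: "k \<ge> 0" and t: "t > 0" "ennreal t < slope_level A k"
  shows "A t \<le> ennreal (k * t)"
proof (rule ccontr)
  assume n: "\<not> A t \<le> ennreal (k * t)"
  have "{x. 0 < x \<and> A x \<le> ennreal (k * x)} \<subseteq> {0<..<t}"
  proof safe
    fix x assume x: "0 < x" "A x \<le> ennreal (k * x)"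
    have "x < t"
    proof (rule ccontr)
      assume "\<not> x < t"
      then have "A ((t / x) * x) \<le> ennreal (t / x) * A x" using x t by (intro young_scale[OF A]) auto
      also have "\<dots> \<le> ennreal (t / x) * ennreal (k * x)" by (intro mult_left_mono x) simp
      also have "\<dots> = ennreal (k * t)" using x t k by (simp add: ennreal_mult'[symmetric])
      finally show False using n x by simp
    qed
    then show "x \<in> {0<..<t}" using x by simp
  qed
  then have "slope_level A k \<le> emeasure lborel {0<..<t}"
    unfolding slope_level_def by (intro emeasure_mono) auto
  then show False using t by simp
qed

text \<open>Take half of the slope level at slope \<kappa>_k = e 2^(k (n - s)). For large t let k be
  the first index with t in the k-th level set; then t / A(t) < 1 / \<kappa>_(k - 1), whose power s
  / (n - s) is a constant times 2^(-k s). So the divergent integral is dominated by the sum of 2^(-k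
  s) times the levels, which must diverge as well.\<close>

lemma young_selection:
  fixes s :: real and n :: nat
  assumes A: "young_function A" and fin: "\<And>t. t \<ge> 0 \<Longrightarrow> A t < \<infinity>" and s: "0 < s" "s < n"
    and nf: "\<not> finite_near_infinity A (s / (n - s))" and e: "e > 0" and B: "B > 0"
  shows "\<exists>N t. (\<forall>k. t k \<ge> 0) \<and> (\<forall>k. A (t k) \<le> ennreal (e * (2 ^ k) powr (n - s) * t k)) \<and>
    B \<le> (\<Sum>k<N. (2 ^ k) powr - s * t k)"
proof -
  let ?p = "s / (n - s)"
  define \<kappa> where "\<kappa> k = e * (2 ^ k) powr (n - s)" for k :: nat
  have \<kappa>: "\<kappa> k > 0" for k using e by (simp add: \<kappa>_def)
  define b where "b k = slope_level A (\<kappa> k)" for k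
  have mem: "A t \<le> ennreal (\<kappa> k * t)" if "t > 0" "ennreal t < b k" for t k
    by (rule slope_level_mem[OF A]) (use that \<kappa>[of k] in \<open>auto simp: b_def\<close>)
  have A0: "A 0 = 0" by (rule young_zero[OF A])
  show ?thesis
  \<comment> \<open>If A(t) <= \<kappa>_k t for all t > 0, a single term of suitable height already
    reaches \<open>B\<close>.\<close>
  proof (cases "\<exists>k. b k = top")
    case True
    then obtain k where k: "b k = top" by blast
    define t where "t j = (if j = k then (2 ^ k) powr s * B else 0)" for j
    have "A (t j) \<le> ennreal (\<kappa> j * t j)" for j
      using mem[of "(2 ^ k) powr s * B" k] k B A0 by (simp add: t_def ennreal_less_top)
    moreover have "t j \<ge> 0" for j using B by (simp add: t_def)
    moreover have "B \<le> (\<Sum>j<Suc k. (2 ^ j) powr - s * t j)"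
    proof -
      have "(\<Sum>j<Suc k. (2 ^ j) powr - s * t j) = (\<Sum>j\<in>{k}. (2 ^ j) powr - s * t j)"
        by (intro sum.mono_neutral_right) (auto simp: t_def)
      also have "\<dots> = B" by (simp add: t_def powr_minus)
      finally show ?thesis by simp
    qed
    ultimately show ?thesis unfolding \<kappa>_def by blast
  next
    case False
    define \<beta> where "\<beta> k = enn2real (b k)" for k
    have \<beta>: "b k = ennreal (\<beta> k)" "\<beta> k \<ge> 0" for k using False by (auto simp: \<beta>_def less_top)
    define S where "S k = {t. 0 < t \<and> A t \<le> ennreal (\<kappa> k * t)}" for k
    have S[measurable]: "S k \<in> sets borel" for k unfolding S_def by (rule slope_level_set_measurable[OF A])
    have eS: "emeasure lborel (S k) = b k" for k by (simp add: b_def slope_level_def S_def)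
    \<comment> \<open>The level set \<open>S 0\<close> is an interval of length
      \<open>\<beta> 0\<close>, so points beyond \<open>T\<close> lie outside it. Their first index
      is positive and has the predecessor \<open>j\<close> used below.\<close>
    define T where "T = \<beta> 0 + 1"
    have T: "T > 0" using \<beta>(2)[of 0] by (simp add: T_def)
    have nS0: "t \<notin> S 0" if t: "t > T" for t
    proof
      assume "t \<in> S 0"
      then have tS: "0 < t" "A t \<le> ennreal (\<kappa> 0 * t)" by (auto simp: S_def)
      have "{0<..t} \<subseteq> S 0"
      proof
        fix x assume x: "x \<in> {0<..t}"
        then have "A ((x / t) * t) \<le> ennreal (x / t) * A t" using tS by (intro young_scale[OF A]) auto
        also have "\<dots> \<le> ennreal (x / t) * ennreal (\<kappa> 0 * t)" by (intro mult_left_mono tS) simp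
        also have "\<dots> = ennreal (\<kappa> 0 * x)" using x tS \<kappa>[of 0] by (simp add: ennreal_mult'[symmetric])
        finally show "x \<in> S 0" using x tS by (simp add: S_def)
      qed
      then have "emeasure lborel {0<..t} \<le> b 0" unfolding eS[symmetric] by (intro emeasure_mono) auto
      then have "t \<le> \<beta> 0" using tS \<beta>[of 0] by (simp add: ennreal_le_iff)
      then show False using t by (simp add: T_def)
    qed
    define c where "c = e powr - ?p * 2 powr s"
    have c: "c > 0" using e by (simp add: c_def)
    have pt: "epowr (ennreal t / A t) ?p * indicator {T<..} t
        \<le> ennreal c * (\<Sum>k. ennreal ((2 ^ k) powr - s) * indicator (S k) t)" for t
    proof (cases "t > T")
      case t: True
      then have t0: "t > 0" using T by simp
      obtain a where a: "A t = ennreal a" "a \<ge> 0" using fin[of t] t0 by (cases "A t") auto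
      have memS: "t \<in> S k \<longleftrightarrow> a \<le> \<kappa> k * t" for k
        using t0 a \<kappa>[of k] by (simp add: S_def ennreal_le_iff)
      have ex: "\<exists>k. a \<le> \<kappa> k * t"
      proof -
        have "1 < 2 powr (n - s)" using s by simp
        then obtain k where "a / (e * t) < (2 powr (n - s)) ^ k" using real_arch_pow by blast
        then have "a < e * t * (2 ^ k) powr (n - s)" using e t0 by (simp add: powr_power_swap divide_less_eq mult.commute)
        then show ?thesis by (intro exI[of _ k]) (simp add: \<kappa>_def mult_ac)
      qed
      define k where "k = (LEAST k. a \<le> \<kappa> k * t)"
      have k: "a \<le> \<kappa> k * t" unfolding k_def by (rule LeastI_ex[OF ex])
      have "k \<noteq> 0"
      proof
        assume "k = 0"
        then have "t \<in> S 0" using k memS by simp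
        then show False using nS0[OF t] by simp
      qed
      then obtain j where j: "k = Suc j" by (cases k) auto
      have aj: "\<kappa> j * t < a" using not_less_Least[of j "\<lambda>k. a \<le> \<kappa> k * t"] j by (simp add: k_def not_le)
      then have a0: "a > 0" using \<kappa>[of j] t0 by (meson less_trans mult_pos_pos)
      have "t / a \<le> 1 / \<kappa> j" using aj a0 \<kappa>[of j] by (simp add: field_simps)
      then have "(t / a) powr ?p \<le> (1 / \<kappa> j) powr ?p" using t0 a0 s by (intro powr_mono2) auto
      also have "\<dots> = c * (2 ^ k) powr - s"
      proof -
        have "(1 / \<kappa> j) powr ?p = \<kappa> j powr - ?p" using \<kappa>[of j] by (simp add: powr_divide powr_minus_divide)
        also have "\<dots> = e powr - ?p * ((2 ^ j) powr (n - s)) powr - ?p" unfolding \<kappa>_def using e by (simp add: powr_mult)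
        also have "((2 ^ j) powr (n - s)) powr - ?p = (2 ^ j :: real) powr - s" using s by (simp add: powr_powr)
        also have "(2 ^ j :: real) powr - s = 2 powr s * (2 ^ k) powr - s"
          unfolding j by (simp add: powr_mult powr_minus)
        finally show ?thesis by (simp add: c_def)
      qed
      finally have le: "(t / a) powr ?p \<le> c * (2 ^ k) powr - s" .
      have "epowr (ennreal t / A t) ?p = ennreal ((t / a) powr ?p)"
        unfolding a(1) using a0 t0 by (simp add: divide_ennreal epowr_def)
      also have "\<dots> \<le> ennreal c * (ennreal ((2 ^ k) powr - s) * indicator (S k) t)"
        using le memS k c by (simp add: ennreal_mult'[symmetric] ennreal_leI)
      also have "\<dots> \<le> ennreal c * (\<Sum>k. ennreal ((2 ^ k) powr - s) * indicator (S k) t)"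
        by (intro mult_left_mono ennreal_le_suminf) simp
      finally show ?thesis using t by simp
    qed simp
    have "\<not> (\<integral>\<^sup>+t\<in>{T<..}. epowr (ennreal t / A t) ?p \<partial>lborel) < \<infinity>"
      using nf T unfolding finite_near_infinity_def by blast
    moreover have "(\<integral>\<^sup>+t\<in>{T<..}. epowr (ennreal t / A t) ?p \<partial>lborel)
      \<le> (\<integral>\<^sup>+t. ennreal c * (\<Sum>k. ennreal ((2 ^ k) powr - s) * indicator (S k) t) \<partial>lborel)"
      by (intro nn_integral_mono pt)
    moreover have "\<dots> = ennreal c * (\<Sum>k. ennreal ((2 ^ k) powr - s * \<beta> k))"
    proof -
      have "(\<integral>\<^sup>+t. ennreal c * (\<Sum>k. ennreal ((2 ^ k) powr - s) * indicator (S k) t) \<partial>lborel)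
        = ennreal c * (\<integral>\<^sup>+t. (\<Sum>k. ennreal ((2 ^ k) powr - s) * indicator (S k) t) \<partial>lborel)"
        by (rule nn_integral_cmult) measurable
      also have "(\<integral>\<^sup>+t. (\<Sum>k. ennreal ((2 ^ k) powr - s) * indicator (S k) t) \<partial>lborel)
        = (\<Sum>k. \<integral>\<^sup>+t. ennreal ((2 ^ k) powr - s) * indicator (S k) t \<partial>lborel)"
        by (rule nn_integral_suminf) measurable
      also have "(\<lambda>k. \<integral>\<^sup>+t. ennreal ((2 ^ k) powr - s) * indicator (S k) t \<partial>lborel) = (\<lambda>k. ennreal ((2 ^ k) powr - s * \<beta> k))"
        by (simp add: nn_integral_cmult_indicator eS \<beta> ennreal_mult')
      finally show ?thesis .
    qed
    ultimately have inf: "(\<Sum>k. ennreal ((2 ^ k) powr - s * \<beta> k)) = top"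
      by (auto simp: ennreal_mult_less_top less_top[symmetric] not_less top_unique ennreal_mult_eq_top_iff)
    \<comment> \<open>Twice \<open>B\<close>, because the heights are halved to lie strictly below
      the endpoints of the level sets.\<close>
    have "\<exists>N. 2 * B \<le> (\<Sum>k<N. (2 ^ k) powr - s * \<beta> k)"
    proof (rule ccontr)
      assume "\<not> ?thesis"
      then have "(\<Sum>k<N. ennreal ((2 ^ k) powr - s * \<beta> k)) \<le> ennreal (2 * B)" for N
        using \<beta>(2) by (subst sum_ennreal) (simp_all add: not_le ennreal_leI less_imp_le)
      then have "(\<Sum>k. ennreal ((2 ^ k) powr - s * \<beta> k)) \<le> ennreal (2 * B)"
        unfolding suminf_eq_SUP by (intro SUP_least)
      then show False using inf by (simp add: top_unique)
    qed
    then obtain N where N: "2 * B \<le> (\<Sum>k<N. (2 ^ k) powr - s * \<beta> k)" by blast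
    define t where "t k = \<beta> k / 2" for k
    have "A (t k) \<le> ennreal (\<kappa> k * t k)" for k
    proof (cases "\<beta> k = 0")
      case False
      then have "\<beta> k > 0" using \<beta>(2)[of k] by simp
      then show ?thesis using \<beta>[of k] by (intro mem) (auto simp: t_def ennreal_less_iff)
    qed (simp add: t_def A0)
    moreover have "t k \<ge> 0" for k using \<beta>(2) by (simp add: t_def)
    moreover have "B \<le> (\<Sum>k<N. (2 ^ k) powr - s * t k)"
      using N by (simp add: t_def sum_divide_distrib[symmetric])
    ultimately show ?thesis unfolding \<kappa>_def by blast
  qed
qed

text \<open>The divisor 1 is admissible in the norm. Dilation by 2^k with k >= 0 only shrinks
  supports, so one ball contains, up to null sets, the level sets of all derivatives of a given
  order.\<close>

lemma lacunary_in_V_d: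
  fixes A :: "real \<Rightarrow> ennreal"
  assumes J: "J (frac s) A (multi_indices (int_part s)) (\<lambda>(x::real^'n::finite) \<alpha>. lacunary c N \<alpha> x) \<le> 1"
  shows "(lacunary c N (\<lambda>_. 0) :: real^'n \<Rightarrow> real) \<in> V_d s A"
    and "V_norm s A (lacunary c N (\<lambda>_. 0) :: real^'n \<Rightarrow> real) \<le> 1"
proof -
  let ?u = "lacunary c N (\<lambda>_. 0) :: real^'n \<Rightarrow> real"
  have "J (frac s) A (multi_indices (int_part s)) (nabla ?u)
     = J (frac s) A (multi_indices (int_part s)) (\<lambda>(x::real^'n) \<alpha>. lacunary c N \<alpha> x)"
    unfolding nabla_def by (rule J_cong_AE[OF finite_multi_indices]) (rule lacunary_weak_deriv_AE)
  then have J': "J (frac s) A (multi_indices (int_part s)) (\<lambda>x i. nabla ?u x i / 1) \<le> 1" using J by simp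
  then have "V_norm s A ?u \<le> ennreal 1"
    unfolding V_norm_def seminorm_def by (intro INF_lower) simp
  then show norm: "V_norm s A ?u \<le> 1" by simp
  have lev: "emeasure lebesgue {x. L2_set (nabla ?u x) (multi_indices k) > t} < \<infinity>" if t: "t > 0" for t k
  proof -
    obtain L M where M: "L > 0" "M > 0"
      "\<And>x y :: real^'n. (\<Sum>\<alpha>\<in>multi_indices k. \<bar>bump_deriv_prod \<alpha> x - bump_deriv_prod \<alpha> y\<bar>) \<le> L * min 1 (norm (x - y))"
      "\<And>(\<alpha> :: 'n \<Rightarrow> nat) x. \<alpha> \<in> multi_indices k \<Longrightarrow> M < norm x \<Longrightarrow> bump_deriv_prod \<alpha> x = 0"
      by (rule bump_deriv_prod_variation[of k]) blast
    have zero: "lacunary c N \<alpha> x = 0" if \<alpha>: "\<alpha> \<in> multi_indices k" and x: "M < norm x" for \<alpha> and x :: "real^'n"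
    proof -
      have "bump_deriv_prod \<alpha> (2 ^ j *\<^sub>R x) = 0" for j :: nat
      proof (rule M(4)[OF \<alpha>])
        have "1 * norm x \<le> 2 ^ j * norm x" by (intro mult_right_mono) auto
        then show "M < norm (2 ^ j *\<^sub>R x)" using x by simp
      qed
      then show ?thesis by (simp add: lacunary_def)
    qed
    have "AE x in lborel. \<forall>\<alpha>\<in>multi_indices k. weak_deriv \<alpha> ?u x = lacunary c N \<alpha> x"
      by (rule AE_finite_allI[OF finite_multi_indices]) (rule lacunary_weak_deriv_AE)
    from AE_completion[OF this]
    have "AE x in lebesgue. x \<in> {x. L2_set (nabla ?u x) (multi_indices k) > t} \<longrightarrow> x \<in> cball 0 M"
    proof eventually_elim
      case (elim x)
      show ?case
      proof
        assume x: "x \<in> {x. L2_set (nabla ?u x) (multi_indices k) > t}"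
        show "x \<in> cball 0 M"
        proof (rule ccontr)
          assume "x \<notin> cball 0 M"
          then have "L2_set (nabla ?u x) (multi_indices k) = L2_set (\<lambda>_. 0) (multi_indices k :: ('n \<Rightarrow> nat) set)"
            using elim zero by (intro L2_set_cong refl) (auto simp: nabla_def)
          then show False using x t by (simp add: L2_set_def)
        qed
      qed
    qed
    then have "emeasure lebesgue {x. L2_set (nabla ?u x) (multi_indices k) > t} \<le> emeasure lebesgue (cball (0::real^'n) M)"
      by (rule emeasure_mono_AE) simp
    also have "\<dots> = emeasure lborel (cball (0::real^'n) M)" by (rule emeasure_lborel_eq_lebesgue[symmetric]) simp
    also have "\<dots> < \<infinity>" by (rule emeasure_lborel_cball_finite)
    finally show ?thesis .
  qed
  have "?u \<in> borel_measurable lebesgue"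
    by (rule measurable_completion) (simp add: borel_measurable_continuous_onI lacunary_continuous)
  moreover have "weakly_differentiable (int_part s) ?u"
    unfolding weakly_differentiable_def using lacunary_has_weak_deriv by blast
  ultimately show "?u \<in> V_d s A" unfolding V_d_def using norm lev by (auto intro: le_less_trans)
qed

lemma Linf_norm_ge_continuous:
  fixes w :: "real^'n::finite \<Rightarrow> real"
  assumes w: "continuous_on UNIV w" and c: "Linf_norm w \<le> ennreal c" "c \<ge> 0"
  shows "\<bar>w x\<bar> \<le> c"
proof -
  have "AE x in lebesgue. ennreal \<bar>w x\<bar> \<le> Linf_norm w" unfolding Linf_norm_def by (rule esssup_AE)
  then have "AE x in lebesgue. x \<in> {x. \<bar>w x\<bar> \<le> c}"
  proof eventually_elim
    case (elim x)
    then have "ennreal \<bar>w x\<bar> \<le> ennreal c" using c(1) by (rule order_trans)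
    then show ?case using c(2) by (simp add: ennreal_le_iff)
  qed
  moreover have "closed {x. \<bar>w x\<bar> \<le> c}" using w by (intro closed_Collect_le continuous_intros)
  ultimately show ?thesis using mem_closed_if_AE_lebesgue by blast
qed

text \<open>All bumps add up at the origin, where continuity makes the essential supremum pointwise;
  a function of norm at most 1 with value c + 1 there contradicts the embedding constant c.\<close>

lemma not_embeds_Linf:
  fixes s :: real and A :: "real \<Rightarrow> ennreal"
  assumes s: "0 < s" "s < real CARD('n::finite)" "s \<notin> \<nat>" and A: "young_function A"
    and nf: "\<not> finite_near_infinity A (s / (real CARD('n) - s))"
  shows "\<not> embeds_Linf (V_d s A :: (real^'n \<Rightarrow> real) set) (V_norm s A)"
proof
  assume emb: "embeds_Linf (V_d s A :: (real^'n \<Rightarrow> real) set) (V_norm s A)"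
  let ?n = "CARD('n)"
  define m where "m = int_part s"
  define \<sigma> where "\<sigma> = frac s"
  have ms: "real m + \<sigma> = s" using s(1) by (simp add: m_def \<sigma>_def frac_def)
  have sg: "0 < \<sigma>" "\<sigma> < 1"
  proof -
    have "\<sigma> \<noteq> 0" using ms s(3) by (metis add.right_neutral of_nat_in_Nats)
    then show "0 < \<sigma>" unfolding \<sigma>_def using frac_ge_0[of s] by simp
    show "\<sigma> < 1" by (simp add: \<sigma>_def frac_lt_1)
  qed
  \<comment> \<open>If A were infinite somewhere, t / A(t) would vanish beyond that point and the
    integral at infinity would converge.\<close>
  have fin: "A t < \<infinity>" if t: "t \<ge> 0" for t
  proof (rule ccontr)
    assume "\<not> A t < \<infinity>"
    then have At: "A t = top" by (simp add: less_top[symmetric])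
    have "t \<noteq> 0" using At young_zero[OF A] by auto
    then have t0: "t > 0" using t by simp
    have "A x = top" if "x > t" for x
      using young_mono[OF A t, of x] that At by (simp add: top_unique)
    then have "(\<integral>\<^sup>+x\<in>{t<..}. epowr (ennreal x / A x) (s / (real ?n - s)) \<partial>lborel) = (\<integral>\<^sup>+x. 0 \<partial>(lborel :: real measure))"
      by (intro nn_integral_cong) (auto simp: indicator_def epowr_def)
    then show False using nf t0 unfolding finite_near_infinity_def by auto
  qed
  obtain c where c: "c > 0" "\<And>u. u \<in> (V_d s A :: (real^'n \<Rightarrow> real) set) \<Longrightarrow> Linf_norm u \<le> ennreal c * V_norm s A u"
    using emb unfolding embeds_Linf_def by blast
  obtain K L where K: "K > 0" and L: "L > 0"
    and Jle: "\<And>c N. (\<And>k. c k \<ge> 0) \<Longrightarrow> J \<sigma> A (multi_indices m) (\<lambda>(x::real^'n) \<alpha>. lacunary c N \<alpha> x)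
      \<le> (\<Sum>k<N. ennreal (K / (2 ^ k) ^ ?n) * A (L * (c k * (2 ^ k) powr (m + \<sigma>))))"
    by (rule lacunary_J_le[OF A sg, of m]) blast
  define \<phi>0 where "\<phi>0 = prodf (\<lambda>_::'n. std_bump) 0"
  have \<phi>0: "\<phi>0 > 0" unfolding \<phi>0_def prodf_def using std_bump_0 by (intro prod_pos) simp
  \<comment> \<open>Solves (value at the origin) = B \<phi>0 / L = c + 1.\<close>
  define B where "B = L * (c + 1) / \<phi>0"
  have B: "B > 0" using L c(1) \<phi>0 by (simp add: B_def)
  \<comment> \<open>Makes the bound K e B on the modular equal to 1.\<close>
  define e where "e = 1 / (K * B)"
  have e: "e > 0" using K B by (simp add: e_def)
  obtain N t where t: "\<And>k. t k \<ge> 0" "\<And>k. A (t k) \<le> ennreal (e * (2 ^ k) powr (?n - s) * t k)"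
    and S: "B \<le> (\<Sum>k<N. (2 ^ k) powr - s * t k)"
    using young_selection[OF A fin s(1,2) nf e B] by blast
  \<comment> \<open>The selected sum may overshoot \<open>B\<close>, and the modular bound with it.
    Shrinking all heights by \<theta> makes it exactly \<open>B\<close>, and by
    \<open>young_scale\<close> the constraints on A survive.\<close>
  define \<theta> where "\<theta> = B / (\<Sum>k<N. (2 ^ k) powr - s * t k)"
  have S0: "(\<Sum>k<N. (2 ^ k) powr - s * t k) > 0" using S B by linarith
  have \<theta>: "\<theta> > 0" "\<theta> \<le> 1" using S S0 B by (auto simp: \<theta>_def divide_le_eq)
  have \<theta>S: "\<theta> * (\<Sum>k<N. (2 ^ k) powr - s * t k) = B" using S0 by (simp add: \<theta>_def)
  define a where "a k = \<theta> * t k * (2 ^ k) powr - s / L" for k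
  have a: "a k \<ge> 0" for k using \<theta> t(1) L by (simp add: a_def)
  have La: "L * (a k * (2 ^ k) powr (m + \<sigma>)) = \<theta> * t k" for k
  proof -
    have "(2 ^ k :: real) powr - s * (2 ^ k) powr s = 1" by (simp add: powr_add[symmetric])
    then have "(2 ^ k :: real) powr - s * (2 ^ k) powr (m + \<sigma>) = 1" by (simp only: ms)
    then show ?thesis using L by (simp add: a_def)
  qed
  have "J \<sigma> A (multi_indices m) (\<lambda>(x::real^'n) \<alpha>. lacunary a N \<alpha> x) \<le> (\<Sum>k<N. ennreal (K / (2 ^ k) ^ ?n) * A (\<theta> * t k))"
    using Jle[of a N, OF a] unfolding La .
  also have "\<dots> \<le> (\<Sum>k<N. ennreal (K * e * \<theta> * ((2 ^ k) powr - s * t k)))"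
  proof (rule sum_mono)
    fix k
    have "A (\<theta> * t k) \<le> ennreal \<theta> * A (t k)" using \<theta> t(1) by (intro young_scale[OF A]) auto
    also have "\<dots> \<le> ennreal \<theta> * ennreal (e * (2 ^ k) powr (?n - s) * t k)" by (intro mult_left_mono t(2)) simp
    finally have "ennreal (K / (2 ^ k) ^ ?n) * A (\<theta> * t k)
      \<le> ennreal (K / (2 ^ k) ^ ?n) * (ennreal \<theta> * ennreal (e * (2 ^ k) powr (?n - s) * t k))" by (rule mult_left_mono) simp
    also have "\<dots> = ennreal (K / (2 ^ k) ^ ?n * (\<theta> * (e * (2 ^ k) powr (?n - s) * t k)))"
      using K \<theta> by (simp only: ennreal_mult' zero_le_divide_iff less_imp_le zero_le_power zero_le_numeral simp_thms)
    also have "K / (2 ^ k) ^ ?n * (\<theta> * (e * (2 ^ k) powr (?n - s) * t k))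
      = K * e * \<theta> * ((2 ^ k) powr (?n - s) / (2 ^ k) ^ ?n * t k)" by (simp add: mult_ac)
    also have "(2 ^ k :: real) powr (?n - s) / (2 ^ k) ^ ?n = (2 ^ k) powr - s"
      by (simp add: powr_diff powr_minus powr_realpow divide_inverse)
    finally show "ennreal (K / (2 ^ k) ^ ?n) * A (\<theta> * t k) \<le> ennreal (K * e * \<theta> * ((2 ^ k) powr - s * t k))" .
  qed
  also have "\<dots> = ennreal (K * e * (\<theta> * (\<Sum>k<N. (2 ^ k) powr - s * t k)))"
    using K e \<theta> t(1) by (subst sum_ennreal) (auto simp: sum_distrib_left mult.assoc)
  also have "\<dots> = 1" unfolding \<theta>S using K B by (simp add: e_def)
  finally have J1: "J (frac s) A (multi_indices (int_part s)) (\<lambda>(x::real^'n) \<alpha>. lacunary a N \<alpha> x) \<le> 1"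
    unfolding \<sigma>_def m_def .
  let ?u = "lacunary a N (\<lambda>_. 0) :: real^'n \<Rightarrow> real"
  have "Linf_norm ?u \<le> ennreal c * V_norm s A ?u" by (rule c(2)[OF lacunary_in_V_d(1)[OF J1]])
  also have "\<dots> \<le> ennreal c * 1" by (intro mult_left_mono lacunary_in_V_d(2)[OF J1]) simp
  finally have "\<bar>?u 0\<bar> \<le> c"
    using c(1) by (intro Linf_norm_ge_continuous lacunary_continuous) auto
  moreover have "?u 0 = c + 1"
  proof -
    have "?u 0 = (\<Sum>k<N. a k * \<phi>0)" by (simp add: lacunary_def \<phi>0_def)
    also have "\<dots> = \<theta> * (\<Sum>k<N. (2 ^ k) powr - s * t k) / L * \<phi>0"
      by (simp add: a_def sum_distrib_left sum_distrib_right sum_divide_distrib mult_ac)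
    also have "\<dots> = c + 1" unfolding \<theta>S using L \<phi>0 by (simp add: B_def)
    finally show ?thesis .
  qed
  ultimately show False using c(1) by linarith
qed

theorem theorem3p2:
  fixes s :: real and A :: "real \<Rightarrow> ennreal"
  assumes "0 < s" "s < real CARD('n::finite)" "s \<notin> \<nat>"
    and "young_function A"
    and "finite_near_0 A (s / (real CARD('n) - s))"
  shows "(finite_near_infinity A (s / (real CARD('n) - s)) \<longleftrightarrow>
            embeds_Linf (V_d s A :: (real^'n \<Rightarrow> real) set) (V_norm s A)) \<and>
         (embeds_Linf (V_d s A :: (real^'n \<Rightarrow> real) set) (V_norm s A) \<longleftrightarrow>
            embeds_C0 (V_d s A :: (real^'n \<Rightarrow> real) set) (V_norm s A)) \<and>
         (finite_near_infinity A (s / (real CARD('n) - s)) \<longrightarrow>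
            (\<exists>c::real. c > 0 \<and>
              (\<forall>u\<in>(V_d s A :: (real^'n \<Rightarrow> real) set).
                 Linf_norm u \<le> ennreal c * epowr (V_modular s A u) (s / real CARD('n)))))"
proof -
  let ?fi = "finite_near_infinity A (s / (real CARD('n) - s))"
  let ?L = "embeds_Linf (V_d s A :: (real^'n \<Rightarrow> real) set) (V_norm s A)"
  let ?C = "embeds_C0 (V_d s A :: (real^'n \<Rightarrow> real) set) (V_norm s A)"
  \<comment> \<open>The equivalences are closed as a cycle (i), (iii), (ii), (i).\<close>
  have "?fi \<Longrightarrow> ?C" by (rule embeds_C0_V_d[OF assms])
  moreover have "?C \<Longrightarrow> ?L" by (rule embeds_Linf_of_embeds_C0) (auto simp: V_d_def)
  moreover have "?L \<Longrightarrow> ?fi" using not_embeds_Linf[OF assms(1-4)] by blast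
  moreover have "?fi \<Longrightarrow> \<exists>c::real. c > 0 \<and> (\<forall>u\<in>(V_d s A :: (real^'n \<Rightarrow> real) set).
    Linf_norm u \<le> ennreal c * epowr (V_modular s A u) (s / real CARD('n)))"
    by (rule modular_bound_V_d[OF assms])
  ultimately show ?thesis by blast
qed

end
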